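(* Let $K$ be a finite simplicial complex. Then the pair $(T,\tau)$ described in the context is a chain duality on the additive category $\mathbb{Z}(K^{\mathrm{op}})\text{-mod}$ (case $P=K^{\mathrm{op}}$), and the pair $(T,\tau)$ described in the context is a chain duality on the additive category $\mathbb{Z}(K)\text{-mod}$ (case $P=K$).
   Context: **Chain duality.** For an additive category $\mathbb{A}$, $\mathrm{Ch}(\mathbb{A})$ is the category of chain complexes over $\mathbb{A}$ with only finitely many nonzero terms. For $C,D\in\mathrm{Ch}(\mathbb{A})$, $\mathrm{Hom}_{\mathbb{A}}(C,D)$ is the chain complex of abelian groups with $\mathrm{Hom}_{\mathbb{A}}(C,D)_n=\bigoplus_p\mathbb{A}(C_p,D_{p+n})$ and $d(f)=d_D\circ f+(-1)^{n+1}f\circ d_C$ for $f$ of degree $n$; its $0$-cycles are the chain maps. A chain duality functor $(T,\tau)$ on $\mathbb{A}$ is an additive functor $T:\mathrm{Ch}(\mathbb{A})\to\mathrm{Ch}(\mathbb{A})^{\mathrm{op}}$ together with a natural chain map $\tau_{C,D}:\mathrm{Hom}_{\mathbb{A}}(TC,D)\to\mathrm{Hom}_{\mathbb{A}}(TD,C)$ for each $C,D\in\mathrm{Ch}(\mathbb{A})$ such that $\tau_{D,C}\circ\tau_{C,D}=\mathrm{Id}$. Put $e_C:=\tau_{C,TC}(\mathrm{Id}_{TC}):T^2C\to C$. A chain duality is a chain duality functor such that $e_C$ is a chain homotopy equivalence for every $C\in\mathrm{Ch}(\mathbb{A})$. **Categories.** A finite simplicial complex $K$ is regarded as the poset of its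 (nonempty) simplices under inclusion, and $K^{\mathrm{op}}$ is the opposite poset. A finite poset $P$ is regarded as a category with one morphism $\sigma\to\tau$ whenever $\sigma\le_P\tau$. $\mathbb{Z}[P]\text{-mod}$ is the category of functors from $P$ to abelian groups. $\mathbb{Z}(P)\text{-mod}$ has as objects the $P$-based abelian groups $M=\bigoplus_{\sigma\in P}M(\sigma)$ with each $M(\sigma)$ finitely generated free, and as morphisms $M\to N$ the homomorphisms $f$ with $f(M(\tau))\subset\bigoplus_{\sigma\le_P\tau}N(\sigma)$ for all $\tau$. The full embedding $[\ ]:\mathbb{Z}(P)\text{-mod}\to\mathbb{Z}[P]\text{-mod}$ is $[M](\sigma)=\bigoplus_{\rho\le_P\sigma}M(\rho)$, with inclusions as structure maps, and $[f](\sigma)$ the restriction of $f$. All functors on modules below are extended to chain complexes by additivity and totalization, with $d(x\otimes y)=dx\otimes y+(-1)^{|x|}x\otimes dy$. **Tensor product.** For $M\in\mathbb{Z}(P^{\mathrm{op}})\text{-mod}$ and a $\mathbb{Z}[P]$-module $N$ with $\bigoplus_\sigma N(\sigma)$ finitely generated free, $M\otimes_{\mathbb{Z}(P]}N\in\mathbb{Z}(P^{\mathrm{op}})\text{-mod}$ is $(M\otimes_{\mathbb{Z}(P]}N)(\sigma)=M(\sigma)\otimes_{\mathbb{Z}}N(\sigma)$; for morphisms $f:M\to M'$, $g:N\to N'$ and $\sigma\le_P\tau$, the component of $f\otimes g$ from the $\sigma$-summand to the $\tau$-summand is $f_{\sigma,\tau}\otimes g(\sigma\to\tau)$, where $f_{\sigma,\tau}:M(\sigma)\to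 M'(\tau)$ is the component of $f$ and $g(\sigma\to\tau)=N'(\sigma\to\tau)\circ g(\sigma)$. **Dual.** For $C\in\mathrm{Ch}(\mathbb{Z}(P)\text{-mod})$, $C^{-*}\in\mathrm{Ch}(\mathbb{Z}(P^{\mathrm{op}})\text{-mod})$ has $(C^{-*})_n(\sigma)=\mathrm{Hom}_{\mathbb{Z}}(C_{-n}(\sigma),\mathbb{Z})$ and differential $f\mapsto(-1)^{|f|+1}f\circ\partial_C$. **Simplicial chains.** Fix orientations of the simplices of $K$ ($0$-simplices positively oriented). $\Delta K\in\mathrm{Ch}(\mathbb{Z}(K)\text{-mod})$ is the simplicial chain complex, with $(\Delta K)_n(\sigma)=\mathbb{Z}$ (generated by $\sigma$) if $n=\dim\sigma$ and $0$ otherwise; $\Delta K^{-*}\in\mathrm{Ch}(\mathbb{Z}(K^{\mathrm{op}})\text{-mod})$ is its dual. **The pair $(T,\tau)$.** Let $P$ be $K^{\mathrm{op}}$ or $K$ and put $E=\Delta K$ if $P=K^{\mathrm{op}}$, $E=\Delta K^{-*}$ if $P=K$, so $E\in\mathrm{Ch}(\mathbb{Z}(P^{\mathrm{op}})\text{-mod})$. For $C\in\mathrm{Ch}(\mathbb{Z}(P)\text{-mod})$ define $TC=(E\otimes_{\mathbb{Z}(P]}[C])^{-*}$, i.e. $TC=(\Delta K\otimes_{\mathbb{Z}(K^{\mathrm{op}}]}[C])^{-*}$, respectively $TC=(\Delta K^{-*}\otimes_{\mathbb{Z}(K]}[C])^{-*}$. Since $\mathrm{Hom}_{\mathbb{Z}(P)}(TC,D)=\bigoplus_{\sigma}\mathrm{Hom}_{\mathbb{Z}}(TC(\sigma),[D](\sigma))$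 as graded groups, there is an isomorphism of chain complexes $S_{C,D}$ from the underlying complex $\bigoplus_\sigma E(\sigma)\otimes[C](\sigma)\otimes[D](\sigma)$ of $(E\otimes_{\mathbb{Z}(P]}[C])\otimes_{\mathbb{Z}(P]}[D]$ to $\mathrm{Hom}_{\mathbb{Z}(P)}(TC,D)$, sending $w\otimes z$ with $w\in E(\sigma)\otimes[C](\sigma)$, $z\in[D](\sigma)$ to $f\mapsto(-1)^{|w||z|+|w|}f(w)z$ for $f\in TC(\sigma)$ (and zero on the other summands $TC(\sigma')$). Let $\mathrm{sw}(x\otimes y\otimes z)=(-1)^{|y||z|}x\otimes z\otimes y$. Then $\tau_{C,D}=S_{D,C}\circ\mathrm{sw}\circ S_{C,D}^{-1}$. *)

theory Defs
  imports
    "HOL-Algebra.Free_Abelian_Groups"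
    "HOL-Combinatorics.Permutations"
    "HOL-Library.Infinite_Typeclass"
begin

text \<open>
  Abelian groups are the commutative groups of HOL-Algebra, hence written multiplicatively:
  \<open>\<one>\<close> is the zero element, \<open>\<otimes>\<close> the addition, and \<open>x [^] (k::int)\<close> the
  integer multiple \<open>k x\<close>.
\<close>

definition parity_sign :: "int \<Rightarrow> int" where
  "parity_sign n = (if even n then 1 else -1)"


section \<open>Additive categories, chain complexes, chain dualities\<close>

text \<open>\<open>Comp a b c g f\<close> is the composite of \<open>f : a \<rightarrow> b\<close> and \<open>g : b \<rightarrow> c\<close>.\<close>

record ('o, 'm) category_data =
  Obj :: "'o set"
  Mor :: "'o \<Rightarrow> 'o \<Rightarrow> 'm monoid"
  Ident :: "'o \<Rightarrow> 'm"
  Comp :: "'o \<Rightarrow> 'o \<Rightarrow> 'o \<Rightarrow> 'm \<Rightarrow> 'm \<Rightarrow> 'm"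

definition zero_object :: "('o, 'm) category_data \<Rightarrow> 'o \<Rightarrow> bool" where
  "zero_object A z \<longleftrightarrow> z \<in> Obj A \<and>
     (\<forall>a\<in>Obj A. carrier (Mor A a z) = {\<one>\<^bsub>Mor A a z\<^esub>} \<and> carrier (Mor A z a) = {\<one>\<^bsub>Mor A z a\<^esub>})"

locale additive_category =
  fixes A :: "('o, 'm) category_data"
  assumes Mor_comm_group: "\<lbrakk>a \<in> Obj A; b \<in> Obj A\<rbrakk> \<Longrightarrow> comm_group (Mor A a b)"
    and Ident_closed: "a \<in> Obj A \<Longrightarrow> Ident A a \<in> carrier (Mor A a a)"
    and Comp_closed: "\<lbrakk>a \<in> Obj A; b \<in> Obj A; c \<in> Obj A; f \<in> carrier (Mor A a b); g \<in> carrier (Mor A b c)\<rbrakk>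
      \<Longrightarrow> Comp A a b c g f \<in> carrier (Mor A a c)"
    and Comp_assoc: "\<lbrakk>a \<in> Obj A; b \<in> Obj A; c \<in> Obj A; d \<in> Obj A;
        f \<in> carrier (Mor A a b); g \<in> carrier (Mor A b c); h \<in> carrier (Mor A c d)\<rbrakk>
      \<Longrightarrow> Comp A a c d h (Comp A a b c g f) = Comp A a b d (Comp A b c d h g) f"
    and Comp_Ident_left: "\<lbrakk>a \<in> Obj A; b \<in> Obj A; f \<in> carrier (Mor A a b)\<rbrakk>
      \<Longrightarrow> Comp A a b b (Ident A b) f = f"
    and Comp_Ident_right: "\<lbrakk>a \<in> Obj A; b \<in> Obj A; f \<in> carrier (Mor A a b)\<rbrakk>
      \<Longrightarrow> Comp A a a b f (Ident A a) = f"
    and Comp_add_left: "\<lbrakk>a \<in> Obj A; b \<in> Obj A; c \<in> Obj A;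
        f \<in> carrier (Mor A a b); g \<in> carrier (Mor A b c); g' \<in> carrier (Mor A b c)\<rbrakk>
      \<Longrightarrow> Comp A a b c (g \<otimes>\<^bsub>Mor A b c\<^esub> g') f
        = Comp A a b c g f \<otimes>\<^bsub>Mor A a c\<^esub> Comp A a b c g' f"
    and Comp_add_right: "\<lbrakk>a \<in> Obj A; b \<in> Obj A; c \<in> Obj A;
        f \<in> carrier (Mor A a b); f' \<in> carrier (Mor A a b); g \<in> carrier (Mor A b c)\<rbrakk>
      \<Longrightarrow> Comp A a b c g (f \<otimes>\<^bsub>Mor A a b\<^esub> f')
        = Comp A a b c g f \<otimes>\<^bsub>Mor A a c\<^esub> Comp A a b c g f'"
    and ex_zero_object: "\<exists>z. zero_object A z"
    and ex_biproduct: "\<lbrakk>a \<in> Obj A; b \<in> Obj A\<rbrakk> \<Longrightarrow>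
      \<exists>s\<in>Obj A. \<exists>i\<in>carrier (Mor A a s). \<exists>j\<in>carrier (Mor A b s).
        \<exists>p\<in>carrier (Mor A s a). \<exists>q\<in>carrier (Mor A s b).
          Comp A a s a p i = Ident A a \<and> Comp A b s b q j = Ident A b \<and>
          Comp A a s b q i = \<one>\<^bsub>Mor A a b\<^esub> \<and> Comp A b s a p j = \<one>\<^bsub>Mor A b a\<^esub> \<and>
          Comp A s a s i p \<otimes>\<^bsub>Mor A s s\<^esub> Comp A s b s j q = Ident A s"

text \<open>\<open>Bd C n\<close> is the differential out of degree \<open>n\<close>, from \<open>Gr C n\<close> to \<open>Gr C (n - 1)\<close>.\<close>

record ('o, 'm) complex_data =
  Gr :: "int \<Rightarrow> 'o"
  Bd :: "int \<Rightarrow> 'm"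

definition Ch :: "('o, 'm) category_data \<Rightarrow> ('o, 'm) complex_data set" where
  "Ch A = {C. (\<forall>n. Gr C n \<in> Obj A) \<and>
      (\<forall>n. Bd C n \<in> carrier (Mor A (Gr C n) (Gr C (n - 1)))) \<and>
      (\<forall>n. Comp A (Gr C n) (Gr C (n - 1)) (Gr C (n - 2)) (Bd C (n - 1)) (Bd C n)
           = \<one>\<^bsub>Mor A (Gr C n) (Gr C (n - 2))\<^esub>) \<and>
      finite {n. \<not> zero_object A (Gr C n)}}"

definition Hom_gr ::
  "('o, 'm) category_data \<Rightarrow> ('o, 'm) complex_data \<Rightarrow> ('o, 'm) complex_data \<Rightarrow> int \<Rightarrow> (int \<Rightarrow> 'm) monoid" where
  "Hom_gr A C D n = sum_group UNIV (\<lambda>p. Mor A (Gr C p) (Gr D (p + n)))"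

definition Hom_bd ::
  "('o, 'm) category_data \<Rightarrow> ('o, 'm) complex_data \<Rightarrow> ('o, 'm) complex_data \<Rightarrow> int
     \<Rightarrow> (int \<Rightarrow> 'm) \<Rightarrow> (int \<Rightarrow> 'm)" where
  "Hom_bd A C D n f = (\<lambda>p.
     let G = Mor A (Gr C p) (Gr D (p + n - 1)) in
       Comp A (Gr C p) (Gr D (p + n)) (Gr D (p + n - 1)) (Bd D (p + n)) (f p)
       \<otimes>\<^bsub>G\<^esub>
       (Comp A (Gr C p) (Gr C (p - 1)) (Gr D (p + n - 1)) (f (p - 1)) (Bd C p)) [^]\<^bsub>G\<^esub> parity_sign (n + 1))"

definition chain_maps ::
  "('o, 'm) category_data \<Rightarrow> ('o, 'm) complex_data \<Rightarrow> ('o, 'm) complex_data \<Rightarrow> (int \<Rightarrow> 'm) set" where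
  "chain_maps A C D = {f \<in> carrier (Hom_gr A C D 0). Hom_bd A C D 0 f = \<one>\<^bsub>Hom_gr A C D (-1)\<^esub>}"

text \<open>Composite of \<open>f\<close> of degree \<open>m\<close> from \<open>C\<close> to \<open>D\<close> and \<open>g\<close> of degree \<open>n\<close> from \<open>D\<close> to \<open>E\<close>.\<close>

definition Hom_comp ::
  "('o, 'm) category_data \<Rightarrow> ('o, 'm) complex_data \<Rightarrow> ('o, 'm) complex_data \<Rightarrow> ('o, 'm) complex_data
     \<Rightarrow> int \<Rightarrow> int \<Rightarrow> (int \<Rightarrow> 'm) \<Rightarrow> (int \<Rightarrow> 'm) \<Rightarrow> (int \<Rightarrow> 'm)" where
  "Hom_comp A C D E m n g f =
     (\<lambda>p. Comp A (Gr C p) (Gr D (p + m)) (Gr E (p + m + n)) (g (p + m)) (f p))"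

definition chain_id :: "('o, 'm) category_data \<Rightarrow> ('o, 'm) complex_data \<Rightarrow> (int \<Rightarrow> 'm)" where
  "chain_id A C = (\<lambda>p. Ident A (Gr C p))"

definition chain_homotopic ::
  "('o, 'm) category_data \<Rightarrow> ('o, 'm) complex_data \<Rightarrow> ('o, 'm) complex_data
     \<Rightarrow> (int \<Rightarrow> 'm) \<Rightarrow> (int \<Rightarrow> 'm) \<Rightarrow> bool" where
  "chain_homotopic A C D f g \<longleftrightarrow>
     (\<exists>h\<in>carrier (Hom_gr A C D 1). f = Hom_bd A C D 1 h \<otimes>\<^bsub>Hom_gr A C D 0\<^esub> g)"

definition chain_homotopy_equivalence ::
  "('o, 'm) category_data \<Rightarrow> ('o, 'm) complex_data \<Rightarrow> ('o, 'm) complex_data \<Rightarrow> (int \<Rightarrow> 'm) \<Rightarrow> bool" where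
  "chain_homotopy_equivalence A C D f \<longleftrightarrow> f \<in> chain_maps A C D \<and>
     (\<exists>g\<in>chain_maps A D C.
        chain_homotopic A C C (Hom_comp A C D C 0 0 g f) (chain_id A C) \<and>
        chain_homotopic A D D (Hom_comp A D C D 0 0 f g) (chain_id A D))"

text \<open>
  \<open>TO\<close> and \<open>TM\<close> are the action of \<open>T\<close> on objects and on chain maps (\<open>TM C D f\<close> for
  \<open>f : C \<rightarrow> D\<close>), and \<open>\<tau> C D n\<close> is the degree \<open>n\<close> part of the chain map \<open>\<tau>\<close> at \<open>(C, D)\<close>.
\<close>

locale chain_duality_functor = additive_category A
  for A :: "('o, 'm) category_data" +
  fixes TO :: "('o, 'm) complex_data \<Rightarrow> ('o, 'm) complex_data"
    and TM :: "('o, 'm) complex_data \<Rightarrow> ('o, 'm) complex_data \<Rightarrow> (int \<Rightarrow> 'm) \<Rightarrow> (int \<Rightarrow> 'm)"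
    and \<tau> :: "('o, 'm) complex_data \<Rightarrow> ('o, 'm) complex_data \<Rightarrow> int \<Rightarrow> (int \<Rightarrow> 'm) \<Rightarrow> (int \<Rightarrow> 'm)"
  assumes TO_closed: "C \<in> Ch A \<Longrightarrow> TO C \<in> Ch A"
    and TM_closed: "\<lbrakk>C \<in> Ch A; D \<in> Ch A; f \<in> chain_maps A C D\<rbrakk>
      \<Longrightarrow> TM C D f \<in> chain_maps A (TO D) (TO C)"
    and TM_id: "C \<in> Ch A \<Longrightarrow> TM C C (chain_id A C) = chain_id A (TO C)"
    and TM_comp: "\<lbrakk>C \<in> Ch A; D \<in> Ch A; E \<in> Ch A; f \<in> chain_maps A C D; g \<in> chain_maps A D E\<rbrakk>
      \<Longrightarrow> TM C E (Hom_comp A C D E 0 0 g f)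
        = Hom_comp A (TO E) (TO D) (TO C) 0 0 (TM C D f) (TM D E g)"
    and TM_add: "\<lbrakk>C \<in> Ch A; D \<in> Ch A; f \<in> chain_maps A C D; g \<in> chain_maps A C D\<rbrakk>
      \<Longrightarrow> TM C D (f \<otimes>\<^bsub>Hom_gr A C D 0\<^esub> g)
        = TM C D f \<otimes>\<^bsub>Hom_gr A (TO D) (TO C) 0\<^esub> TM C D g"
    and \<tau>_hom: "\<lbrakk>C \<in> Ch A; D \<in> Ch A\<rbrakk>
      \<Longrightarrow> \<tau> C D n \<in> hom (Hom_gr A (TO C) D n) (Hom_gr A (TO D) C n)"
    and \<tau>_chain: "\<lbrakk>C \<in> Ch A; D \<in> Ch A; f \<in> carrier (Hom_gr A (TO C) D n)\<rbrakk>
      \<Longrightarrow> \<tau> C D (n - 1) (Hom_bd A (TO C) D n f) = Hom_bd A (TO D) C n (\<tau> C D n f)"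
    and \<tau>_natural: "\<lbrakk>C \<in> Ch A; C' \<in> Ch A; D \<in> Ch A; D' \<in> Ch A;
        f \<in> chain_maps A C C'; g \<in> chain_maps A D D'; h \<in> carrier (Hom_gr A (TO C) D n)\<rbrakk>
      \<Longrightarrow> \<tau> C' D' n (Hom_comp A (TO C') D D' n 0 g (Hom_comp A (TO C') (TO C) D 0 n h (TM C C' f)))
        = Hom_comp A (TO D') C C' n 0 f (Hom_comp A (TO D') (TO D) C 0 n (\<tau> C D n h) (TM D D' g))"
    and \<tau>_involution: "\<lbrakk>C \<in> Ch A; D \<in> Ch A; f \<in> carrier (Hom_gr A (TO C) D n)\<rbrakk>
      \<Longrightarrow> \<tau> D C n (\<tau> C D n f) = f"
begin

definition e :: "('o, 'm) complex_data \<Rightarrow> (int \<Rightarrow> 'm)" where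
  "e C = \<tau> C (TO C) 0 (chain_id A (TO C))"

end

locale chain_duality = chain_duality_functor +
  assumes e_equivalence: "C \<in> Ch A \<Longrightarrow> chain_homotopy_equivalence A (TO (TO C)) C (e C)"


section \<open>Modules over a finite poset\<close>

definition hom_group :: "'a monoid \<Rightarrow> 'b monoid \<Rightarrow> ('a \<Rightarrow> 'b) monoid" where
  "hom_group G H =
     \<lparr>carrier = hom G H \<inter> extensional (carrier G),
      monoid.mult = (\<lambda>f g. \<lambda>x\<in>carrier G. f x \<otimes>\<^bsub>H\<^esub> g x),
      one = (\<lambda>x\<in>carrier G. \<one>\<^bsub>H\<^esub>)\<rparr>"

definition fg_free :: "'a monoid \<Rightarrow> bool" where
  "fg_free G \<longleftrightarrow> comm_group G \<and> (\<exists>n::nat. G \<cong> free_Abelian_group {..<n})"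

text \<open>
  A finite poset is a partial order \<open>P\<close>, given as a relation, on its field; the opposite poset
  is \<open>P\<inverse>\<close>. A \<open>P\<close>-based abelian group is the family of its summands. The morphisms of
  \<open>\<int>(P)\<close>-mod are homomorphisms between the direct sums \<open>total P M\<close>.
\<close>

type_synonym ('s, 'a) based = "'s \<Rightarrow> 'a monoid"

definition total :: "'s rel \<Rightarrow> ('s, 'a) based \<Rightarrow> ('s \<Rightarrow> 'a) monoid" where
  "total P M = sum_group (Field P) M"

definition sum_incl :: "'i set \<Rightarrow> ('i \<Rightarrow> 'a monoid) \<Rightarrow> 'i \<Rightarrow> 'a \<Rightarrow> ('i \<Rightarrow> 'a)" where
  "sum_incl I G j a = (\<lambda>i\<in>I. if i = j then a else \<one>\<^bsub>G i\<^esub>)"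

definition component ::
  "'s rel \<Rightarrow> ('s, 'a) based \<Rightarrow> (('s \<Rightarrow> 'a) \<Rightarrow> ('s \<Rightarrow> 'b)) \<Rightarrow> 's \<Rightarrow> 's \<Rightarrow> ('a \<Rightarrow> 'b)" where
  "component P M f \<sigma> \<rho> = (\<lambda>x. f (sum_incl (Field P) M \<sigma> x) \<rho>)"

text \<open>The direct sum of the \<open>M \<rho>\<close> with \<open>\<rho> \<le> \<sigma>\<close>, as a subgroup of \<open>total P M\<close>.\<close>

definition below :: "'s rel \<Rightarrow> ('s, 'a) based \<Rightarrow> 's \<Rightarrow> ('s \<Rightarrow> 'a) monoid" where
  "below P M \<sigma> = (total P M)
     \<lparr>carrier := {x \<in> carrier (total P M). \<forall>\<rho>\<in>Field P. (\<rho>, \<sigma>) \<notin> P \<longrightarrow> x \<rho> = \<one>\<^bsub>M \<rho>\<^esub>}\<rparr>"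

definition based_hom ::
  "'s rel \<Rightarrow> ('s, 'a) based \<Rightarrow> ('s, 'b) based \<Rightarrow> (('s \<Rightarrow> 'a) \<Rightarrow> ('s \<Rightarrow> 'b)) monoid" where
  "based_hom P M N = (hom_group (total P M) (total P N))
     \<lparr>carrier := {f \<in> carrier (hom_group (total P M) (total P N)).
        \<forall>\<tau>\<in>Field P. f ` sum_incl (Field P) M \<tau> ` carrier (M \<tau>) \<subseteq> carrier (below P N \<tau>)}\<rparr>"

definition based_id :: "'s rel \<Rightarrow> ('s, 'a) based \<Rightarrow> (('s \<Rightarrow> 'a) \<Rightarrow> ('s \<Rightarrow> 'a))" where
  "based_id P M = (\<lambda>x\<in>carrier (total P M). x)"

text \<open>
  The category \<open>\<int>(P)\<close>-mod, the underlying sets of the groups \<open>M \<sigma>\<close> being taken in the universe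
  \<open>'u\<close>.
\<close>

definition based_category ::
  "'s rel \<Rightarrow> (('s, 'u) based, ('s \<Rightarrow> 'u) \<Rightarrow> ('s \<Rightarrow> 'u)) category_data" where
  "based_category P =
     \<lparr>Obj = {M. \<forall>\<sigma>\<in>Field P. fg_free (M \<sigma>)},
      Mor = based_hom P,
      Ident = based_id P,
      Comp = (\<lambda>L M N g f. compose (carrier (total P L)) g f)\<rparr>"

type_synonym ('s, 'a) based_complex = "(('s, 'a) based, ('s \<Rightarrow> 'a) \<Rightarrow> ('s \<Rightarrow> 'a)) complex_data"

text \<open>Objects of \<open>\<int>[P]\<close>-mod: \<open>Fun N \<sigma> \<tau>\<close> is the structure map for \<open>\<sigma> \<le> \<tau>\<close>. A morphism
  is the family of its values, of type \<open>'s \<Rightarrow> 'a \<Rightarrow> 'b\<close>.\<close>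

record ('s, 'a) functor_data =
  Val :: "'s \<Rightarrow> 'a monoid"
  Fun :: "'s \<Rightarrow> 's \<Rightarrow> 'a \<Rightarrow> 'a"

type_synonym ('s, 'a) functor_complex = "(('s, 'a) functor_data, 's \<Rightarrow> 'a \<Rightarrow> 'a) complex_data"

definition bracket :: "'s rel \<Rightarrow> ('s, 'a) based \<Rightarrow> ('s, 's \<Rightarrow> 'a) functor_data" where
  "bracket P M = \<lparr>Val = below P M, Fun = (\<lambda>\<sigma> \<tau>. \<lambda>x\<in>carrier (below P M \<sigma>). x)\<rparr>"

definition bracket_mor ::
  "'s rel \<Rightarrow> ('s, 'a) based \<Rightarrow> (('s \<Rightarrow> 'a) \<Rightarrow> ('s \<Rightarrow> 'b)) \<Rightarrow> 's \<Rightarrow> ('s \<Rightarrow> 'a) \<Rightarrow> ('s \<Rightarrow> 'b)" where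
  "bracket_mor P M f \<sigma> = restrict f (carrier (below P M \<sigma>))"

definition bracket_complex :: "'s rel \<Rightarrow> ('s, 'a) based_complex \<Rightarrow> ('s, 's \<Rightarrow> 'a) functor_complex" where
  "bracket_complex P C =
     \<lparr>Gr = (\<lambda>n. bracket P (Gr C n)), Bd = (\<lambda>n. bracket_mor P (Gr C n) (Bd C n))\<rparr>"


section \<open>Tensor products\<close>

text \<open>The tensor product of two abelian groups, as the free abelian group on the pairs modulo the
  bilinearity relations.\<close>

type_synonym ('a, 'b) tensor = "('a \<times> 'b \<Rightarrow>\<^sub>0 int) set"

definition tensor_rel :: "'a monoid \<Rightarrow> 'b monoid \<Rightarrow> ('a \<times> 'b \<Rightarrow>\<^sub>0 int) set" where
  "tensor_rel G H = generate (free_Abelian_group (carrier G \<times> carrier H))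
     ({frag_of (x \<otimes>\<^bsub>G\<^esub> x', y) - frag_of (x, y) - frag_of (x', y) | x x' y.
         x \<in> carrier G \<and> x' \<in> carrier G \<and> y \<in> carrier H} \<union>
      {frag_of (x, y \<otimes>\<^bsub>H\<^esub> y') - frag_of (x, y) - frag_of (x, y') | x y y'.
         x \<in> carrier G \<and> y \<in> carrier H \<and> y' \<in> carrier H})"

definition tensor_group :: "'a monoid \<Rightarrow> 'b monoid \<Rightarrow> ('a, 'b) tensor monoid" where
  "tensor_group G H = free_Abelian_group (carrier G \<times> carrier H) Mod tensor_rel G H"

definition tens :: "'a monoid \<Rightarrow> 'b monoid \<Rightarrow> 'a \<Rightarrow> 'b \<Rightarrow> ('a, 'b) tensor" where
  "tens G H x y = tensor_rel G H #>\<^bsub>free_Abelian_group (carrier G \<times> carrier H)\<^esub> frag_of (x, y)"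

text \<open>The homomorphism \<open>G \<otimes> H \<rightarrow> A\<close> with \<open>x \<otimes> y \<mapsto> \<beta> x y\<close>, for bilinear \<open>\<beta>\<close>: a coset is sent
  to the common value of its representatives.\<close>

definition tensor_lift ::
  "'a monoid \<Rightarrow> 'b monoid \<Rightarrow> 'c monoid \<Rightarrow> ('a \<Rightarrow> 'b \<Rightarrow> 'c) \<Rightarrow> ('a, 'b) tensor \<Rightarrow> 'c" where
  "tensor_lift G H A \<beta> = (\<lambda>X\<in>carrier (tensor_group G H).
     the_elem ((\<lambda>c. finprod A (\<lambda>(x, y). \<beta> x y [^]\<^bsub>A\<^esub> Poly_Mapping.lookup c (x, y)) (Poly_Mapping.keys c)) ` X))"

definition tensor_map ::
  "'a monoid \<Rightarrow> 'b monoid \<Rightarrow> 'c monoid \<Rightarrow> 'd monoid \<Rightarrow> ('a \<Rightarrow> 'c) \<Rightarrow> ('b \<Rightarrow> 'd)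
     \<Rightarrow> ('a, 'b) tensor \<Rightarrow> ('c, 'd) tensor" where
  "tensor_map G H G' H' f g =
     tensor_lift G H (tensor_group G' H') (\<lambda>x y. tens G' H' (f x) (g y))"

definition tensor_obj :: "('s, 'a) based \<Rightarrow> ('s, 'b) functor_data \<Rightarrow> ('s, ('a, 'b) tensor) based" where
  "tensor_obj M N = (\<lambda>\<sigma>. tensor_group (M \<sigma>) (Val N \<sigma>))"

definition tensor_mor ::
  "'s rel \<Rightarrow> ('s, 'a) based \<Rightarrow> ('s, 'b) functor_data \<Rightarrow> ('s, 'c) based \<Rightarrow> ('s, 'd) functor_data
     \<Rightarrow> (('s \<Rightarrow> 'a) \<Rightarrow> ('s \<Rightarrow> 'c)) \<Rightarrow> ('s \<Rightarrow> 'b \<Rightarrow> 'd)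
     \<Rightarrow> ('s \<Rightarrow> ('a, 'b) tensor) \<Rightarrow> ('s \<Rightarrow> ('c, 'd) tensor)" where
  "tensor_mor P M N M' N' f g = (\<lambda>u\<in>carrier (total P (tensor_obj M N)). \<lambda>\<tau>\<in>Field P.
     finprod (tensor_obj M' N' \<tau>)
       (\<lambda>\<sigma>. tensor_map (M \<sigma>) (Val N \<sigma>) (M' \<tau>) (Val N' \<tau>)
              (component P M f \<sigma> \<tau>) (Fun N' \<sigma> \<tau> \<circ> g \<sigma>) (u \<sigma>))
       {\<sigma>. (\<sigma>, \<tau>) \<in> P})"

text \<open>
  Totalization: an element of degree \<open>n\<close> at \<open>\<sigma>\<close> is a family over \<open>p\<close> of elements of
  \<open>E\<^sub>p(\<sigma>) \<otimes> N\<^sub>n\<^sub>-\<^sub>p(\<sigma>)\<close>, and \<open>slice\<close> extracts the bidegree \<open>(p, n - p)\<close> part of an element of the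
  sum over all \<open>\<sigma>\<close>.
\<close>

definition tensor_gr ::
  "('s, 'a) based_complex \<Rightarrow> ('s, 'b) functor_complex \<Rightarrow> int \<Rightarrow> ('s, int \<Rightarrow> ('a, 'b) tensor) based" where
  "tensor_gr E N n = (\<lambda>\<sigma>. sum_group UNIV (\<lambda>p. tensor_obj (Gr E p) (Gr N (n - p)) \<sigma>))"

definition slice :: "'s rel \<Rightarrow> ('s \<Rightarrow> int \<Rightarrow> 'a) \<Rightarrow> int \<Rightarrow> ('s \<Rightarrow> 'a)" where
  "slice P u p = (\<lambda>\<sigma>\<in>Field P. u \<sigma> p)"

definition tensor_complex ::
  "'s rel \<Rightarrow> ('s, 'a) based_complex \<Rightarrow> ('s, 'b) functor_complex \<Rightarrow> ('s, int \<Rightarrow> ('a, 'b) tensor) based_complex" where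
  "tensor_complex P E N =
     \<lparr>Gr = tensor_gr E N,
      Bd = (\<lambda>n. \<lambda>u\<in>carrier (total P (tensor_gr E N n)). \<lambda>\<tau>\<in>Field P. \<lambda>p.
        let G = tensor_obj (Gr E p) (Gr N (n - 1 - p)) \<tau> in
          tensor_mor P (Gr E (p + 1)) (Gr N (n - (p + 1))) (Gr E p) (Gr N (n - 1 - p))
            (Bd E (p + 1)) (\<lambda>\<sigma> y. y) (slice P u (p + 1)) \<tau>
          \<otimes>\<^bsub>G\<^esub>
          (tensor_mor P (Gr E p) (Gr N (n - p)) (Gr E p) (Gr N (n - 1 - p))
            (based_id P (Gr E p)) (Bd N (n - p)) (slice P u p) \<tau>) [^]\<^bsub>G\<^esub> parity_sign p)\<rparr>"

text \<open>The chain map \<open>Id \<otimes> g : E \<otimes> N \<rightarrow> E \<otimes> N'\<close>.\<close>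

definition tensor_chain_map ::
  "'s rel \<Rightarrow> ('s, 'a) based_complex \<Rightarrow> ('s, 'b) functor_complex \<Rightarrow> ('s, 'b) functor_complex
     \<Rightarrow> (int \<Rightarrow> 's \<Rightarrow> 'b \<Rightarrow> 'b)
     \<Rightarrow> int \<Rightarrow> ('s \<Rightarrow> int \<Rightarrow> ('a, 'b) tensor) \<Rightarrow> ('s \<Rightarrow> int \<Rightarrow> ('a, 'b) tensor)" where
  "tensor_chain_map P E N N' g n =
     (\<lambda>u\<in>carrier (total P (tensor_gr E N n)). \<lambda>\<tau>\<in>Field P. \<lambda>p.
        tensor_mor P (Gr E p) (Gr N (n - p)) (Gr E p) (Gr N' (n - p))
          (based_id P (Gr E p)) (g (n - p)) (slice P u p) \<tau>)"


section \<open>Duals\<close>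

definition dual_obj :: "('s, 'a) based \<Rightarrow> ('s, 'a \<Rightarrow> int) based" where
  "dual_obj M = (\<lambda>\<sigma>. hom_group (M \<sigma>) integer_group)"

text \<open>Precomposition with \<open>f : M \<rightarrow> N\<close>, under the identification of the elements of
  \<open>total P (dual_obj N)\<close> with the homomorphisms from \<open>total P N\<close> to the integers.\<close>

definition dual_mor ::
  "'s rel \<Rightarrow> ('s, 'a) based \<Rightarrow> ('s, 'b) based \<Rightarrow> (('s \<Rightarrow> 'a) \<Rightarrow> ('s \<Rightarrow> 'b))
     \<Rightarrow> ('s \<Rightarrow> 'b \<Rightarrow> int) \<Rightarrow> ('s \<Rightarrow> 'a \<Rightarrow> int)" where
  "dual_mor P M N f = (\<lambda>\<phi>\<in>carrier (total P (dual_obj N)). \<lambda>\<tau>\<in>Field P. \<lambda>x\<in>carrier (M \<tau>).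
     \<Sum>\<sigma>\<in>Field P. \<phi> \<sigma> (component P M f \<tau> \<sigma> x))"

definition dual_complex :: "'s rel \<Rightarrow> ('s, 'a) based_complex \<Rightarrow> ('s, 'a \<Rightarrow> int) based_complex" where
  "dual_complex P C =
     \<lparr>Gr = (\<lambda>n. dual_obj (Gr C (- n))),
      Bd = (\<lambda>n. \<lambda>\<phi>\<in>carrier (total P (dual_obj (Gr C (- n)))).
        dual_mor P (Gr C (1 - n)) (Gr C (- n)) (Bd C (1 - n)) \<phi>
          [^]\<^bsub>total P (dual_obj (Gr C (1 - n)))\<^esub> parity_sign (n + 1))\<rparr>"

definition dual_chain_map ::
  "'s rel \<Rightarrow> ('s, 'a) based_complex \<Rightarrow> ('s, 'b) based_complex \<Rightarrow> (int \<Rightarrow> ('s \<Rightarrow> 'a) \<Rightarrow> ('s \<Rightarrow> 'b))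
     \<Rightarrow> int \<Rightarrow> ('s \<Rightarrow> 'b \<Rightarrow> int) \<Rightarrow> ('s \<Rightarrow> 'a \<Rightarrow> int)" where
  "dual_chain_map P C D f n = dual_mor P (Gr C (- n)) (Gr D (- n)) (f (- n))"


section \<open>Simplicial chains\<close>

text \<open>An abstract finite simplicial complex, given by the set of its (nonempty) simplices.\<close>

definition finite_simplicial_complex :: "'v set set \<Rightarrow> bool" where
  "finite_simplicial_complex K \<longleftrightarrow> finite K \<and>
     (\<forall>\<sigma>\<in>K. finite \<sigma> \<and> \<sigma> \<noteq> {}) \<and> (\<forall>\<sigma>\<in>K. \<forall>\<rho>. \<rho> \<subseteq> \<sigma> \<and> \<rho> \<noteq> {} \<longrightarrow> \<rho> \<in> K)"

definition face_poset :: "'v set set \<Rightarrow> 'v set rel" where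
  "face_poset K = {(\<rho>, \<sigma>). \<rho> \<in> K \<and> \<sigma> \<in> K \<and> \<rho> \<subseteq> \<sigma>}"

text \<open>
  An orientation of a simplex is represented by an ordering of its vertices; two orderings
  represent orientations that agree up to the sign \<open>list_sign\<close> of the permutation between them.
  A vertex has a single ordering, hence is positively oriented.
\<close>

definition orientation :: "'v set set \<Rightarrow> ('v set \<Rightarrow> 'v list) \<Rightarrow> bool" where
  "orientation K orient \<longleftrightarrow> (\<forall>\<sigma>\<in>K. distinct (orient \<sigma>) \<and> set (orient \<sigma>) = \<sigma>)"

definition list_sign :: "'v list \<Rightarrow> 'v list \<Rightarrow> int" where
  "list_sign xs ys = sign (THE p. p permutes set xs \<and> map p xs = ys)"

text \<open>The coefficient of \<open>\<rho>\<close> in \<open>\<partial>[v\<^sub>0, \<dots>, v\<^sub>n] = (\<Sum>i\<le>n. (-1)^i [v\<^sub>0, \<dots>, v\<^sub>i\<^sub>-\<^sub>1, v\<^sub>i\<^sub>+\<^sub>1, \<dots>, v\<^sub>n])\<close>,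
  where \<open>orient \<sigma> = [v\<^sub>0, \<dots>, v\<^sub>n]\<close>.\<close>

definition incidence :: "('v set \<Rightarrow> 'v list) \<Rightarrow> 'v set \<Rightarrow> 'v set \<Rightarrow> int" where
  "incidence orient \<sigma> \<rho> =
     (\<Sum>i<length (orient \<sigma>).
        let face = take i (orient \<sigma>) @ drop (Suc i) (orient \<sigma>)
        in if set face = \<rho> then (-1) ^ i * list_sign (orient \<rho>) face else 0)"

definition simplicial_gr :: "int \<Rightarrow> ('v set, int) based" where
  "simplicial_gr n = (\<lambda>\<sigma>. if n = int (card \<sigma>) - 1 then integer_group else singleton_group 0)"

definition simplicial_chains :: "'v set set \<Rightarrow> ('v set \<Rightarrow> 'v list) \<Rightarrow> ('v set, int) based_complex" where
  "simplicial_chains K orient =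
     \<lparr>Gr = simplicial_gr,
      Bd = (\<lambda>n. \<lambda>x\<in>carrier (total (face_poset K) (simplicial_gr n)). \<lambda>\<rho>\<in>K.
        \<Sum>\<sigma>\<in>K. x \<sigma> * incidence orient \<sigma> \<rho>)\<rparr>"


section \<open>The pair \<open>(T, \<tau>)\<close>\<close>

text \<open>
  The groups of \<open>(E \<otimes> [C])\<^sup>-\<^sup>*\<close> are countable but do not have their underlying sets in the universe
  \<open>'u\<close>. As \<open>'u\<close> is infinite, each of them may be replaced by its isomorphic image under a chosen
  injection.
\<close>

definition copy_map :: "'a monoid \<Rightarrow> 'a \<Rightarrow> 'u::infinite" where
  "copy_map G = (SOME h. inj_on h (carrier G))"

definition uncopy_map :: "'a monoid \<Rightarrow> 'u::infinite \<Rightarrow> 'a" where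
  "uncopy_map G = inv_into (carrier G) (copy_map G)"

definition copy_group :: "'a monoid \<Rightarrow> 'u::infinite monoid" where
  "copy_group G =
     \<lparr>carrier = copy_map G ` carrier G,
      monoid.mult = (\<lambda>x y. copy_map G (uncopy_map G x \<otimes>\<^bsub>G\<^esub> uncopy_map G y)),
      one = copy_map G \<one>\<^bsub>G\<^esub>\<rparr>"

definition copy_obj :: "('s, 'a) based \<Rightarrow> ('s, 'u::infinite) based" where
  "copy_obj M = (\<lambda>\<sigma>. copy_group (M \<sigma>))"

definition copy_mor ::
  "'s rel \<Rightarrow> ('s, 'a) based \<Rightarrow> ('s, 'b) based \<Rightarrow> (('s \<Rightarrow> 'a) \<Rightarrow> ('s \<Rightarrow> 'b))
     \<Rightarrow> ('s \<Rightarrow> 'u::infinite) \<Rightarrow> ('s \<Rightarrow> 'u)" where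
  "copy_mor P M N f = (\<lambda>x\<in>carrier (total P (copy_obj M)). \<lambda>\<tau>\<in>Field P.
     copy_map (N \<tau>) (f (\<lambda>\<sigma>\<in>Field P. uncopy_map (M \<sigma>) (x \<sigma>)) \<tau>))"

text \<open>\<open>E \<otimes> [C]\<close> and \<open>(E \<otimes> [C])\<^sup>-\<^sup>*\<close>. The former is a complex over \<open>\<int>(P\<^sup>o\<^sup>p)\<close>-mod,
  whence the dual is taken over \<open>P\<inverse>\<close>.\<close>

definition T_tensor ::
  "'s rel \<Rightarrow> ('s, 'e) based_complex \<Rightarrow> ('s, 'u) based_complex
     \<Rightarrow> ('s, int \<Rightarrow> ('e, 's \<Rightarrow> 'u) tensor) based_complex" where
  "T_tensor P E C = tensor_complex P E (bracket_complex P C)"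

definition T_dual ::
  "'s rel \<Rightarrow> ('s, 'e) based_complex \<Rightarrow> ('s, 'u) based_complex
     \<Rightarrow> ('s, (int \<Rightarrow> ('e, 's \<Rightarrow> 'u) tensor) \<Rightarrow> int) based_complex" where
  "T_dual P E C = dual_complex (P\<inverse>) (T_tensor P E C)"

definition T_obj ::
  "'s rel \<Rightarrow> ('s, 'e) based_complex \<Rightarrow> ('s, 'u::infinite) based_complex \<Rightarrow> ('s, 'u) based_complex" where
  "T_obj P E C =
     \<lparr>Gr = (\<lambda>n. copy_obj (Gr (T_dual P E C) n)),
      Bd = (\<lambda>n. copy_mor P (Gr (T_dual P E C) n) (Gr (T_dual P E C) (n - 1)) (Bd (T_dual P E C) n))\<rparr>"

definition T_mor ::
  "'s rel \<Rightarrow> ('s, 'e) based_complex \<Rightarrow> ('s, 'u::infinite) based_complex \<Rightarrow> ('s, 'u) based_complex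
     \<Rightarrow> (int \<Rightarrow> ('s \<Rightarrow> 'u) \<Rightarrow> ('s \<Rightarrow> 'u)) \<Rightarrow> (int \<Rightarrow> ('s \<Rightarrow> 'u) \<Rightarrow> ('s \<Rightarrow> 'u))" where
  "T_mor P E C D f = (\<lambda>n.
     copy_mor P (Gr (T_dual P E D) n) (Gr (T_dual P E C) n)
       (dual_chain_map (P\<inverse>) (T_tensor P E C) (T_tensor P E D)
         (tensor_chain_map P E (bracket_complex P C) (bracket_complex P D)
           (\<lambda>q. bracket_mor P (Gr C q) (f q)))
         n))"

text \<open>The complex \<open>(E \<otimes> [C]) \<otimes> [D]\<close>; its underlying group in degree \<open>n\<close> is the domain of
  \<open>S_map P E C D n\<close> below.\<close>

definition T_tensor2 ::
  "'s rel \<Rightarrow> ('s, 'e) based_complex \<Rightarrow> ('s, 'u) based_complex \<Rightarrow> ('s, 'u) based_complex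
     \<Rightarrow> ('s, int \<Rightarrow> (int \<Rightarrow> ('e, 's \<Rightarrow> 'u) tensor, 's \<Rightarrow> 'u) tensor) based_complex" where
  "T_tensor2 P E C D = tensor_complex P (T_tensor P E C) (bracket_complex P D)"

text \<open>
  On elements of \<open>TC\<close> of degree \<open>q\<close>, only the summands \<open>w \<otimes> z\<close> with \<open>|w| = -q\<close> and
  \<open>|z| = n + q\<close> matter.
\<close>

definition S_map ::
  "'s rel \<Rightarrow> ('s, 'e) based_complex \<Rightarrow> ('s, 'u::infinite) based_complex \<Rightarrow> ('s, 'u) based_complex \<Rightarrow> int
     \<Rightarrow> ('s \<Rightarrow> int \<Rightarrow> (int \<Rightarrow> ('e, 's \<Rightarrow> 'u) tensor, 's \<Rightarrow> 'u) tensor)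
     \<Rightarrow> (int \<Rightarrow> ('s \<Rightarrow> 'u) \<Rightarrow> ('s \<Rightarrow> 'u))" where
  "S_map P E C D n u = (\<lambda>q. \<lambda>\<phi>\<in>carrier (total P (Gr (T_obj P E C) q)).
     let G = total P (Gr D (q + n)) in
       finprod G
         (\<lambda>\<sigma>. tensor_lift (Gr (T_tensor P E C) (- q) \<sigma>) (below P (Gr D (q + n)) \<sigma>) G
            (\<lambda>w z. z [^]\<^bsub>G\<^esub> (parity_sign ((- q) * (q + n) + (- q))
                            * uncopy_map (Gr (T_dual P E C) q \<sigma>) (\<phi> \<sigma>) w))
            (u \<sigma> (- q)))
         (Field P))"

text \<open>
  For homogeneous \<open>x, y, z\<close> of degrees \<open>p\<close>, \<open>m - p\<close> and \<open>n - m\<close>, the element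
  \<open>(x \<otimes> y) \<otimes> z\<close> is sent to \<open>(-1)^((m - p)(n - m)) (x \<otimes> z) \<otimes> y\<close>, where \<open>x \<otimes> z\<close> has degree
  \<open>p + (n - m)\<close>.
\<close>

definition swap_map ::
  "'s rel \<Rightarrow> ('s, 'e) based_complex \<Rightarrow> ('s, 'u) based_complex \<Rightarrow> ('s, 'u) based_complex \<Rightarrow> int
     \<Rightarrow> ('s \<Rightarrow> int \<Rightarrow> (int \<Rightarrow> ('e, 's \<Rightarrow> 'u) tensor, 's \<Rightarrow> 'u) tensor)
     \<Rightarrow> ('s \<Rightarrow> int \<Rightarrow> (int \<Rightarrow> ('e, 's \<Rightarrow> 'u) tensor, 's \<Rightarrow> 'u) tensor)" where
  "swap_map P E C D n u = (\<lambda>\<sigma>\<in>Field P.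
     let G = Gr (T_tensor2 P E D C) n \<sigma>;
         XC = (\<lambda>q. below P (Gr C q) \<sigma>);
         XD = (\<lambda>q. below P (Gr D q) \<sigma>);
         WC = (\<lambda>m. Gr (T_tensor P E C) m \<sigma>);
         WD = (\<lambda>m. Gr (T_tensor P E D) m \<sigma>)
     in gfinprod G
          (\<lambda>m. tensor_lift (WC m) (XD (n - m)) G
             (\<lambda>w z. gfinprod G
                (\<lambda>p. tensor_lift (Gr E p \<sigma>) (XC (m - p)) G
                   (\<lambda>x y.
                      sum_incl UNIV (\<lambda>k. tensor_group (WD k) (XC (n - k))) (p + (n - m))
                        (tens (WD (p + (n - m))) (XC (m - p))
                          (sum_incl UNIV (\<lambda>k. tensor_group (Gr E k \<sigma>) (XD (p + (n - m) - k))) p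
                            (tens (Gr E p \<sigma>) (XD (n - m)) x z))
                          y)
                      [^]\<^bsub>G\<^esub> parity_sign ((m - p) * (n - m)))
                   (w p))
                UNIV)
             (u \<sigma> m))
          UNIV)"

definition tau ::
  "'s rel \<Rightarrow> ('s, 'e) based_complex \<Rightarrow> ('s, 'u::infinite) based_complex \<Rightarrow> ('s, 'u) based_complex \<Rightarrow> int
     \<Rightarrow> (int \<Rightarrow> ('s \<Rightarrow> 'u) \<Rightarrow> ('s \<Rightarrow> 'u)) \<Rightarrow> (int \<Rightarrow> ('s \<Rightarrow> 'u) \<Rightarrow> ('s \<Rightarrow> 'u))" where
  "tau P E C D n f =
     S_map P E D C n (swap_map P E C D n
       (inv_into (carrier (total P (Gr (T_tensor2 P E C D) n))) (S_map P E C D n) f))"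

end

theory Submission
  imports Defs "HOL-Library.Function_Algebras"
begin

text \<open>The statement is reduced to integer matrices. A based module has a basis in which every element
  has a position in the poset \<open>P\<close>, and a homomorphism is a morphism of \<open>\<int>(P)\<close>-mod exactly if the entries
  of its matrix vanish unless the position of the target element is below that of the source
  element. A framing of a complex is a finite set of indices, each with a degree and a position,
  together with coordinates that identify the complex with the integer vectors on that set. Every
  object of \<open>Ch\<close> has a framing (\<open>Ch_framed\<close>), framings are inherited by \<open>E \<otimes> [C]\<close>, by duals and by \<open>TC\<close>,
  and the group \<open>Hom(C, D)\<^sub>n\<close> becomes the group of matrices \<open>mats P I J n\<close>.

  The basis of \<open>TC\<close> consists of the pairs \<open>(x, c)\<close> with \<open>x\<close> a basis element of \<open>E\<close> whose position is above
  that of \<open>c\<close>. The maps \<open>S\<close> and \<open>sw\<close> are signed permutations of such bases, whence \<open>\<tau>\<close> is a signed partial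
  transposition: the entry of \<open>\<tau> f\<close> from \<open>(x, d)\<close> to \<open>c\<close> is, up to sign, the entry of \<open>f\<close> from \<open>(x, c)\<close>
  to \<open>d\<close> (\<open>tau_mat\<close>, \<open>tau_represents\<close>). After this translation, functoriality of \<open>T\<close> and the properties
  of \<open>\<tau>\<close> are computations with signs, valid for every bounded complex \<open>E\<close> of based modules
  (\<open>T_chain_duality_functor\<close>).

  That \<open>e : T\<^sup>2C \<rightarrow> C\<close> is an equivalence uses the geometry of \<open>E\<close>. The basis of \<open>T\<^sup>2C\<close> consists of the
  triples \<open>(x, y, c)\<close> with \<open>c \<le> y \<le> x\<close>, and \<open>e\<close> sends \<open>(x, x, c)\<close> to \<open>\<plusminus> c\<close> and the other triples to \<open>0\<close>.
  The differential moves \<open>y\<close>, or lowers \<open>x\<close>, or changes \<open>c\<close>. For fixed \<open>x\<close> and \<open>c\<close> the part that moves \<open>y\<close>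
  is the simplicial (co)chain complex of the simplices \<open>y\<close> in the interval between \<open>c\<close> and \<open>x\<close>. If this
  interval is not a single point, then choosing a vertex \<open>v\<close> that one end of the interval has and the other lacks
  pairs the simplices with \<open>v\<close> and those without, along incidence numbers \<open>\<plusminus> 1\<close>
  (\<open>interval_matching\<close>), so the complex is contractible; if it is a point, \<open>e\<close> is bijective on it. Hence
  there are maps \<open>s : C \<rightarrow> T\<^sup>2C\<close> and \<open>h\<close> with \<open>e s = 1\<close>, \<open>e h = 0\<close> and \<open>h s = 0\<close> for which
  \<open>d h + h d (1 - s e) + s e\<close> differs from the identity only by terms that strictly lower a rank
  (\<open>rank_drops\<close>). Such a map is invertible, and homological perturbation turns \<open>s\<close> and \<open>h\<close> into a chain
  homotopy inverse of \<open>e\<close> and a homotopy (\<open>equivalence_of_unipotent\<close>).\<close>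

section \<open>Finitely generated free abelian groups and their coordinates\<close>

lemma hom_finprod:
  assumes "comm_group G" "comm_group H" "h \<in> hom G H" "f \<in> I \<rightarrow> carrier G"
  shows "h (finprod G f I) = finprod H (\<lambda>i. h (f i)) I"
proof -
  interpret G: comm_group G by fact
  interpret H: comm_group H by fact
  interpret group_hom G H h using assms(3) by unfold_locales
  show ?thesis using assms(4)
    by (induction I rule: infinite_finite_induct) (auto simp: Pi_iff)
qed

lemma int_hom_finprod:
  assumes "comm_group G" "\<chi> \<in> hom G integer_group" "f \<in> I \<rightarrow> carrier G"
  shows "\<chi> (finprod G f I) = (\<Sum>i\<in>I. \<chi> (f i))"
proof -
  interpret G: comm_group G by fact
  interpret group_hom G integer_group \<chi> using assms(2)
    by (simp add: G.group_axioms group_hom_axioms_def group_hom_def)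
  show ?thesis using assms(3)
    by (induction I rule: infinite_finite_induct) (auto simp: Pi_iff)
qed

lemma int_hom_int_pow:
  assumes "group G" "\<chi> \<in> hom G integer_group" "x \<in> carrier G"
  shows "\<chi> (x [^]\<^bsub>G\<^esub> (k::int)) = k * \<chi> x"
  using hom_int_pow[OF assms(2,3,1)] by simp

lemma int_hom_one: "\<lbrakk>group G; \<chi> \<in> hom G integer_group\<rbrakk> \<Longrightarrow> \<chi> \<one>\<^bsub>G\<^esub> = 0"
  using hom_one[of \<chi> G integer_group] by simp

text \<open>
  A coordinate system: \<open>\<kappa>\<close> identifies \<open>G\<close> with the integer vectors indexed by the finite set \<open>W\<close>.
  Vectors are functions on the whole type that vanish off \<open>W\<close>, so that coordinates with respect
  to different index sets can be summed over any common finite superset.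
\<close>

definition framed :: "'a monoid \<Rightarrow> 'w set \<Rightarrow> ('a \<Rightarrow> 'w \<Rightarrow> int) \<Rightarrow> bool" where
  "framed G W \<kappa> \<longleftrightarrow> comm_group G \<and> finite W \<and>
     bij_betw \<kappa> (carrier G) {v. \<forall>w. w \<notin> W \<longrightarrow> v w = 0} \<and>
     (\<forall>x\<in>carrier G. \<forall>y\<in>carrier G. \<forall>w. \<kappa> (x \<otimes>\<^bsub>G\<^esub> y) w = \<kappa> x w + \<kappa> y w)"

definition basis_elt :: "'a monoid \<Rightarrow> ('a \<Rightarrow> 'w \<Rightarrow> int) \<Rightarrow> 'w \<Rightarrow> 'a" where
  "basis_elt G \<kappa> w = inv_into (carrier G) \<kappa> (\<lambda>w'. of_bool (w' = w))"

locale framed_group =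
  fixes G :: "'a monoid" (structure) and W :: "'w set" and \<kappa> :: "'a \<Rightarrow> 'w \<Rightarrow> int"
  assumes framed: "framed G W \<kappa>"
begin

lemma comm: "comm_group G" and fin: "finite W"
  and bij: "bij_betw \<kappa> (carrier G) {v. \<forall>w. w \<notin> W \<longrightarrow> v w = 0}"
  and coord_mult: "\<lbrakk>x \<in> carrier G; y \<in> carrier G\<rbrakk> \<Longrightarrow> \<kappa> (x \<otimes> y) w = \<kappa> x w + \<kappa> y w"
  using framed by (auto simp: framed_def)

sublocale comm_group G by (rule comm)

lemma coord_hom: "(\<lambda>x. \<kappa> x w) \<in> hom G integer_group"
  by (rule homI) (auto simp: coord_mult)

lemma coord_outside: "x \<in> carrier G \<Longrightarrow> w \<notin> W \<Longrightarrow> \<kappa> x w = 0"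
  using bij by (auto simp: bij_betw_def)

lemma coord_eq: 
  assumes "x \<in> carrier G" "y \<in> carrier G" "\<And>w. w \<in> W \<Longrightarrow> \<kappa> x w = \<kappa> y w"
  shows "x = y"
proof -
  have "\<kappa> x = \<kappa> y" using assms coord_outside by (metis ext)
  thus ?thesis using bij assms by (auto simp: bij_betw_def inj_on_def)
qed

lemma coord_ex: "\<exists>x\<in>carrier G. \<forall>w\<in>W. \<kappa> x w = v w"
proof -
  have "(\<lambda>w. if w \<in> W then v w else 0) \<in> \<kappa> ` carrier G"
    using bij by (auto simp: bij_betw_def)
  then obtain x where x: "x \<in> carrier G" "(\<lambda>w. if w \<in> W then v w else 0) = \<kappa> x" by auto
  have "\<kappa> x w = v w" if "w \<in> W" for w using fun_cong[OF x(2), of w] that by simp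
  thus ?thesis using x(1) by blast
qed

lemma basis:
  assumes "w \<in> W"
  shows basis_closed: "basis_elt G \<kappa> w \<in> carrier G" and coord_basis: "\<kappa> (basis_elt G \<kappa> w) w' = of_bool (w' = w)"
proof -
  have "(\<lambda>w'. of_bool (w' = w)) \<in> \<kappa> ` carrier G"
    using bij assms by (auto simp: bij_betw_def)
  then show "basis_elt G \<kappa> w \<in> carrier G" "\<kappa> (basis_elt G \<kappa> w) w' = of_bool (w' = w)"
    unfolding basis_elt_def by (auto simp: inv_into_into f_inv_into_f)
qed

lemma coord_one: "\<kappa> \<one> w = 0"
  using int_hom_one[OF group_axioms coord_hom] .

lemma coord_int_pow: "x \<in> carrier G \<Longrightarrow> \<kappa> (x [^] (k::int)) w = k * \<kappa> x w"
  using int_hom_int_pow[OF group_axioms coord_hom] .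

lemma coord_finprod: "f \<in> I \<rightarrow> carrier G \<Longrightarrow> \<kappa> (finprod G f I) w = (\<Sum>i\<in>I. \<kappa> (f i) w)"
  using int_hom_finprod[OF comm coord_hom] .

lemma expansion: 
  assumes "x \<in> carrier G" shows "x = (\<Otimes>w\<in>W. basis_elt G \<kappa> w [^] \<kappa> x w)"
proof (rule coord_eq)
  have *: "(\<lambda>w. basis_elt G \<kappa> w [^] \<kappa> x w) \<in> W \<rightarrow> carrier G" using basis_closed by auto
  then show "(\<Otimes>w\<in>W. basis_elt G \<kappa> w [^] \<kappa> x w) \<in> carrier G" by simp
  fix w assume w: "w \<in> W"
  have "\<kappa> (\<Otimes>w\<in>W. basis_elt G \<kappa> w [^] \<kappa> x w) w = (\<Sum>i\<in>W. \<kappa> x i * of_bool (w = i))"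
    unfolding coord_finprod[OF *]
    by (intro sum.cong) (auto simp: coord_int_pow basis_closed coord_basis)
  also have "\<dots> = \<kappa> x w" using w fin by (simp add: of_bool_def if_distrib cong: if_cong)
  finally show "\<kappa> x w = \<kappa> (\<Otimes>w\<in>W. basis_elt G \<kappa> w [^] \<kappa> x w) w" ..
qed (rule assms)

lemma hom_expansion:
  assumes "comm_group H" "h \<in> hom G H" "x \<in> carrier G"
  shows "h x = finprod H (\<lambda>w. h (basis_elt G \<kappa> w) [^]\<^bsub>H\<^esub> \<kappa> x w) W"
proof -
  interpret H: comm_group H by fact
  have *: "(\<lambda>w. basis_elt G \<kappa> w [^] \<kappa> x w) \<in> W \<rightarrow> carrier G" using basis_closed by auto
  have "h x = h (\<Otimes>w\<in>W. basis_elt G \<kappa> w [^] \<kappa> x w)" using expansion assms(3) by simp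
  also have "\<dots> = finprod H (\<lambda>w. h (basis_elt G \<kappa> w [^] \<kappa> x w)) W"
    by (rule hom_finprod[OF comm assms(1,2) *])
  also have "\<dots> = finprod H (\<lambda>w. h (basis_elt G \<kappa> w) [^]\<^bsub>H\<^esub> \<kappa> x w) W"
    by (rule H.finprod_cong') 
      (use basis_closed assms(2) in \<open>auto simp: hom_int_pow[OF assms(2) _ group_axioms H.group_axioms] hom_in_carrier\<close>)
  finally show ?thesis .
qed

lemma int_hom_expansion:
  assumes "\<chi> \<in> hom G integer_group" "x \<in> carrier G"
  shows "\<chi> x = (\<Sum>w\<in>W. \<kappa> x w * \<chi> (basis_elt G \<kappa> w))"
proof -
  have *: "(\<lambda>w. basis_elt G \<kappa> w [^] \<kappa> x w) \<in> W \<rightarrow> carrier G" using basis_closed by auto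
  have "\<chi> x = \<chi> (\<Otimes>w\<in>W. basis_elt G \<kappa> w [^] \<kappa> x w)" using expansion assms(2) by simp
  also have "\<dots> = (\<Sum>w\<in>W. \<kappa> x w * \<chi> (basis_elt G \<kappa> w))"
    by (auto simp: int_hom_finprod[OF comm assms(1) *] int_hom_int_pow[OF group_axioms assms(1)] basis_closed)
  finally show ?thesis .
qed

lemma hom_eqI:
  assumes "comm_group H" "h \<in> hom G H" "h' \<in> hom G H" "\<And>w. w \<in> W \<Longrightarrow> h (basis_elt G \<kappa> w) = h' (basis_elt G \<kappa> w)" "x \<in> carrier G"
  shows "h x = h' x"
proof -
  interpret H: comm_group H by fact
  show ?thesis
  unfolding hom_expansion[OF assms(1,2,5)] hom_expansion[OF assms(1,3,5)]
    by (rule H.finprod_cong') (use basis_closed assms in \<open>auto simp: hom_in_carrier\<close>)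
qed

end

text \<open>An additive \<open>\<kappa>\<close> with trivial kernel is injective, and it is onto because it hits the standard basis
  vectors.\<close>

lemma framedI:
  assumes "comm_group G" "finite W"
    and mult: "\<And>x y w. \<lbrakk>x \<in> carrier G; y \<in> carrier G; w \<in> W\<rbrakk> \<Longrightarrow> \<kappa> (x \<otimes>\<^bsub>G\<^esub> y) w = \<kappa> x w + \<kappa> y w"
    and out: "\<And>x w. \<lbrakk>x \<in> carrier G; w \<notin> W\<rbrakk> \<Longrightarrow> \<kappa> x w = 0"
    and ker: "\<And>x. \<lbrakk>x \<in> carrier G; \<And>w. w \<in> W \<Longrightarrow> \<kappa> x w = 0\<rbrakk> \<Longrightarrow> x = \<one>\<^bsub>G\<^esub>"
    and b: "\<And>w. w \<in> W \<Longrightarrow> c w \<in> carrier G"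
    and kb: "\<And>w w'. \<lbrakk>w \<in> W; w' \<in> W\<rbrakk> \<Longrightarrow> \<kappa> (c w) w' = of_bool (w' = w)"
  shows "framed G W \<kappa>"
proof -
  interpret comm_group G by fact
  have mult': "\<kappa> (x \<otimes>\<^bsub>G\<^esub> y) w = \<kappa> x w + \<kappa> y w" if "x \<in> carrier G" "y \<in> carrier G" for x y w
    using mult[OF that, of w] out[of _ w] that by (cases "w \<in> W") auto
  have h: "(\<lambda>x. \<kappa> x w) \<in> hom G integer_group" for w
    by (rule homI) (auto simp: mult')
  have inj: "inj_on \<kappa> (carrier G)"
  proof (rule inj_onI)
    fix x y assume xy: "x \<in> carrier G" "y \<in> carrier G" "\<kappa> x = \<kappa> y"
    have "\<kappa> (inv\<^bsub>G\<^esub> y) w = - \<kappa> y w" for w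
      using hom_mult[OF h xy(2) inv_closed[OF xy(2)], of w] int_hom_one[OF group_axioms h, of w] xy
      by (simp add: r_inv)
    then have "x \<otimes>\<^bsub>G\<^esub> inv\<^bsub>G\<^esub> y = \<one>\<^bsub>G\<^esub>"
      using xy by (intro ker) (auto simp: mult')
    then show "x = y" using xy by (metis inv_closed inv_inv inv_equality)
  qed
  have surj: "v \<in> \<kappa> ` carrier G" if v: "\<forall>w. w \<notin> W \<longrightarrow> v w = 0" for v
  proof -
    have *: "(\<lambda>w. c w [^]\<^bsub>G\<^esub> v w) \<in> W \<rightarrow> carrier G" using b by auto
    have "\<kappa> (\<Otimes>\<^bsub>G\<^esub>w\<in>W. c w [^]\<^bsub>G\<^esub> v w) w = v w" for w
    proof (cases "w \<in> W")
      case True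
      have "\<kappa> (\<Otimes>\<^bsub>G\<^esub>w\<in>W. c w [^]\<^bsub>G\<^esub> v w) w = (\<Sum>i\<in>W. v i * of_bool (w = i))"
        unfolding int_hom_finprod[OF comm_group_axioms h *] using True
        by (intro sum.cong) (auto simp: int_hom_int_pow[OF group_axioms h] b kb)
      also have "\<dots> = v w" using True assms(2) by (simp add: of_bool_def if_distrib cong: if_cong)
      finally show ?thesis .
    next
      case False
      then show ?thesis using v out * by simp
    qed
    then have "v = \<kappa> (\<Otimes>\<^bsub>G\<^esub>w\<in>W. c w [^]\<^bsub>G\<^esub> v w)" by auto
    then show ?thesis using * by simp
  qed
  show ?thesis unfolding framed_def bij_betw_def
    using inj surj out mult' assms(1,2) by auto
qed

text \<open>Framings are the same thing as isomorphisms with a standard free abelian group; only the indexing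
  of the basis differs.\<close>

lemma framed_fg_free:
  assumes "framed G W \<kappa>" shows "fg_free G"
proof -
  interpret framed_group G W \<kappa> by unfold_locales fact
  have "(\<lambda>x. Abs_poly_mapping (\<kappa> x)) \<in> iso G (free_Abelian_group W)"
  proof (rule isoI)
    have f: "finite {w. \<kappa> x w \<noteq> 0}" if "x \<in> carrier G" for x
      by (rule finite_subset[OF _ fin]) (use coord_outside that in auto)
    have l: "Poly_Mapping.lookup (Abs_poly_mapping (\<kappa> x)) = \<kappa> x" if "x \<in> carrier G" for x
      using f[OF that] by simp
    have k: "Poly_Mapping.keys (Abs_poly_mapping (\<kappa> x)) \<subseteq> W" if "x \<in> carrier G" for x
      using coord_outside[OF that] l[OF that] by (force simp: in_keys_iff)
    show "(\<lambda>x. Abs_poly_mapping (\<kappa> x)) \<in> hom G (free_Abelian_group W)"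
      by (rule homI) (use k in \<open>auto intro!: poly_mapping_eqI simp: l lookup_add coord_mult\<close>)
    show "bij_betw (\<lambda>x. Abs_poly_mapping (\<kappa> x)) (carrier G) (carrier (free_Abelian_group W))"
      unfolding bij_betw_def
    proof
      show "inj_on (\<lambda>x. Abs_poly_mapping (\<kappa> x)) (carrier G)"
        by (rule inj_onI) (metis l coord_eq)
      show "(\<lambda>x. Abs_poly_mapping (\<kappa> x)) ` carrier G = carrier (free_Abelian_group W)"
      proof (intro equalityI subsetI)
        fix c assume "c \<in> carrier (free_Abelian_group W)"
        then have c: "Poly_Mapping.keys c \<subseteq> W" by simp
        obtain x where x: "x \<in> carrier G" "\<forall>w\<in>W. \<kappa> x w = Poly_Mapping.lookup c w" using coord_ex by blast
        have "\<kappa> x w = Poly_Mapping.lookup c w" for w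
          using x coord_outside[OF x(1), of w] c by (cases "w \<in> W") (auto simp: in_keys_iff)
        then have "Abs_poly_mapping (\<kappa> x) = c" by (intro poly_mapping_eqI) (simp add: l x)
        with x show "c \<in> (\<lambda>x. Abs_poly_mapping (\<kappa> x)) ` carrier G" by auto
      qed (use k in auto)
    qed
  qed
  then have "G \<cong> free_Abelian_group W" by (auto simp: is_iso_def)
  moreover have "free_Abelian_group W \<cong> free_Abelian_group {..<card W}"
    unfolding isomorphic_free_Abelian_groups by (simp add: fin eqpoll_iff_card)
  ultimately show ?thesis unfolding fg_free_def using comm iso_trans by blast
qed

lemma fg_free_framed:
  assumes "fg_free G" shows "\<exists>W \<kappa>. framed G (W :: nat set) \<kappa>"
proof -
  obtain n h where h: "h \<in> iso G (free_Abelian_group {..<n::nat})" and G: "comm_group G"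
    using assms by (auto simp: fg_free_def is_iso_def)
  have hm: "h \<in> hom G (free_Abelian_group {..<n})"
    and bj: "bij_betw h (carrier G) (carrier (free_Abelian_group {..<n}))"
    using h by (auto simp: iso_def)
  interpret comm_group G by (fact G)
  have "framed G {..<n} (\<lambda>x. Poly_Mapping.lookup (h x))"
  proof (rule framedI[OF G, where c = "\<lambda>w. inv_into (carrier G) h (frag_of w)"])
    fix x y :: 'a and w :: nat assume xy: "x \<in> carrier G" "y \<in> carrier G"
    then show "Poly_Mapping.lookup (h (x \<otimes>\<^bsub>G\<^esub> y)) w = Poly_Mapping.lookup (h x) w + Poly_Mapping.lookup (h y) w"
      using hom_mult[OF hm xy] by (simp add: lookup_add)
  next
    fix x and w :: nat assume "x \<in> carrier G" "w \<notin> {..<n}"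
    then have "Poly_Mapping.keys (h x) \<subseteq> {..<n}" "w \<notin> {..<n}"
      using hom_in_carrier[OF hm] by auto
    then show "Poly_Mapping.lookup (h x) w = 0" by (auto simp: in_keys_iff)
  next
    fix x assume x: "x \<in> carrier G" and z: "\<And>w. w \<in> {..<n} \<Longrightarrow> Poly_Mapping.lookup (h x) w = 0"
    have "Poly_Mapping.keys (h x) \<subseteq> {..<n}" using hom_in_carrier[OF hm x] by simp
    then have "h x = 0" using z by (auto intro!: poly_mapping_eqI simp: in_keys_iff)
    moreover have "h \<one>\<^bsub>G\<^esub> = 0" using hom_one[OF hm group_axioms group_free_Abelian_group] by simp
    ultimately show "x = \<one>\<^bsub>G\<^esub>" using bj x by (auto simp: bij_betw_def inj_on_def)
  next
    fix w assume "w \<in> {..<n}"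
    then have "frag_of w \<in> h ` carrier G" using bj by (auto simp: bij_betw_def)
    then show "inv_into (carrier G) h (frag_of w) \<in> carrier G"
       by (simp add: inv_into_into)
    fix w'
    show "Poly_Mapping.lookup (h (inv_into (carrier G) h (frag_of w))) w' = of_bool (w' = w)"
      using \<open>frag_of w \<in> h ` carrier G\<close> by (simp add: f_inv_into_f lookup_single when_def)
  qed auto
  then show ?thesis by blast
qed

text \<open>Countability ensures that the group embeds into every infinite type, so that \<open>copy_map\<close> is injective.\<close>

lemma framed_countable:
  assumes "framed G W \<kappa>" shows "countable (carrier G)"
proof -
  interpret framed_group G W \<kappa> by unfold_locales fact
  obtain ws where ws: "set ws = W" using fin finite_list by blast
  have "inj_on (\<lambda>x. map (\<kappa> x) ws) (carrier G)"
    by (rule inj_onI) (use ws in \<open>auto intro: coord_eq simp: map_eq_conv\<close>)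
  then show ?thesis by (meson countableI_type countable_image_inj_on)
qed

lemma (in framed_group) basis_eqI:
  assumes "x \<in> carrier G" "w \<in> W" "\<And>w'. w' \<in> W \<Longrightarrow> \<kappa> x w' = of_bool (w' = w)"
  shows "basis_elt G \<kappa> w = x"
  by (rule coord_eq) (use assms in \<open>auto simp: basis_closed coord_basis\<close>)

section \<open>Groups of homomorphisms\<close>

lemma carrier_hom_group: "carrier (hom_group G H) = hom G H \<inter> extensional (carrier G)"
  and mult_hom_group: "f \<otimes>\<^bsub>hom_group G H\<^esub> g = (\<lambda>x\<in>carrier G. f x \<otimes>\<^bsub>H\<^esub> g x)"
  and one_hom_group: "\<one>\<^bsub>hom_group G H\<^esub> = (\<lambda>x\<in>carrier G. \<one>\<^bsub>H\<^esub>)"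
  by (simp_all add: hom_group_def)

lemma restrict_hom_group:
  assumes "group G" "f \<in> hom G H" shows "restrict f (carrier G) \<in> carrier (hom_group G H)"
  using assms group.hom_restrict[OF assms(1,2), of "restrict f (carrier G)"]
  by (simp add: carrier_hom_group)

lemma comm_group_hom_group:
  assumes "group G" "comm_group H" shows "comm_group (hom_group G H)"
proof -
  interpret G: group G by fact
  interpret H: comm_group H by fact
  have inv: "(\<lambda>x\<in>carrier G. inv\<^bsub>H\<^esub> f x) \<in> carrier (hom_group G H)" if "f \<in> carrier (hom_group G H)" for f
    using that by (intro restrict_hom_group assms homI)
     (auto simp: carrier_hom_group hom_mult hom_in_carrier H.inv_mult)
  have m: "f \<otimes>\<^bsub>hom_group G H\<^esub> g \<in> carrier (hom_group G H)"
    if "f \<in> carrier (hom_group G H)" "g \<in> carrier (hom_group G H)" for f g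
  proof -
    have "f x \<in> carrier H" "g x \<in> carrier H" if "x \<in> carrier G" for x
      using that \<open>f \<in> _\<close> \<open>g \<in> _\<close> by (auto simp: carrier_hom_group hom_in_carrier)
    then show ?thesis unfolding mult_hom_group
      using that by (intro restrict_hom_group assms homI)
        (auto simp: carrier_hom_group hom_mult[of f G H] hom_mult[of g G H] H.m_ac)
  qed
  show ?thesis
  proof (rule comm_groupI)
    show "\<one>\<^bsub>hom_group G H\<^esub> \<in> carrier (hom_group G H)"
      unfolding one_hom_group by (intro restrict_hom_group assms homI) auto
    show "\<exists>g\<in>carrier (hom_group G H). g \<otimes>\<^bsub>hom_group G H\<^esub> f = \<one>\<^bsub>hom_group G H\<^esub>"
      if f: "f \<in> carrier (hom_group G H)" for f
      using inv[OF f] f by (intro bexI[of _ "\<lambda>x\<in>carrier G. inv\<^bsub>H\<^esub> f x"])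
        (auto simp: mult_hom_group one_hom_group carrier_hom_group hom_in_carrier intro!: restrict_ext)
  next
    fix f g assume fg: "f \<in> carrier (hom_group G H)" "g \<in> carrier (hom_group G H)"
    then have c: "f x \<in> carrier H" "g x \<in> carrier H" if "x \<in> carrier G" for x
      using that by (auto simp: carrier_hom_group hom_in_carrier)
    show "f \<otimes>\<^bsub>hom_group G H\<^esub> g = g \<otimes>\<^bsub>hom_group G H\<^esub> f"
      unfolding mult_hom_group by (rule restrict_ext) (use c in \<open>simp add: H.m_comm\<close>)
    show "\<one>\<^bsub>hom_group G H\<^esub> \<otimes>\<^bsub>hom_group G H\<^esub> f = f"
      unfolding mult_hom_group one_hom_group
      by (rule extensionalityI[of _ "carrier G"]) (use c fg in \<open>auto simp: carrier_hom_group\<close>)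
    fix h assume h: "h \<in> carrier (hom_group G H)"
    then have "h x \<in> carrier H" if "x \<in> carrier G" for x
      using that by (auto simp: carrier_hom_group hom_in_carrier)
    then show "f \<otimes>\<^bsub>hom_group G H\<^esub> g \<otimes>\<^bsub>hom_group G H\<^esub> h = f \<otimes>\<^bsub>hom_group G H\<^esub> (g \<otimes>\<^bsub>hom_group G H\<^esub> h)"
      unfolding mult_hom_group by (intro restrict_ext) (use c in \<open>simp add: H.m_assoc\<close>)
  qed (rule m)
qed

text \<open>The dual basis: a homomorphism to the integers has its values on the basis as coordinates.\<close>

lemma framed_hom_group:
  assumes "framed G W \<kappa>"
  shows "framed (hom_group G integer_group) W (\<lambda>\<phi> w. if w \<in> W then \<phi> (basis_elt G \<kappa> w) else 0)"
proof -
  interpret framed_group G W \<kappa> by unfold_locales fact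
  show ?thesis
  proof (rule framedI[where c = "\<lambda>w. \<lambda>x\<in>carrier G. \<kappa> x w"])
    show "comm_group (hom_group G integer_group)"
      by (rule comm_group_hom_group[OF group_axioms abelian_integer_group])
  next
    fix \<phi> assume \<phi>: "\<phi> \<in> carrier (hom_group G integer_group)"
      and z: "\<And>w. w \<in> W \<Longrightarrow> (if w \<in> W then \<phi> (basis_elt G \<kappa> w) else 0) = 0"
    have "\<phi> x = 0" if "x \<in> carrier G" for x
      using int_hom_expansion[of \<phi> x] that \<phi> z by (simp add: carrier_hom_group)
    then show "\<phi> = \<one>\<^bsub>hom_group G integer_group\<^esub>"
      using \<phi> by (auto simp: carrier_hom_group one_hom_group extensional_def)
  qed (auto simp: fin mult_hom_group basis_closed coord_basis intro!: restrict_hom_group group_axioms coord_hom)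
qed

section \<open>Isomorphic copies in an infinite type\<close>

lemma copy_map_inj:
  assumes "countable (carrier G)"
  shows "inj_on (copy_map G :: 'a \<Rightarrow> 'u::infinite) (carrier G)"
proof -
  have "\<exists>h :: 'a \<Rightarrow> 'u. inj_on h (carrier G)"
  proof -
    obtain f :: "'a \<Rightarrow> nat" where f: "inj_on f (carrier G)" using assms by (auto simp: countable_def)
    obtain g :: "nat \<Rightarrow> 'u" where g: "inj g" using infinite_countable_subset[OF infinite_UNIV] by auto
    have "inj_on (g \<circ> f) (carrier G)" using f g by (auto simp: inj_on_def)
    then show ?thesis by blast
  qed
  then show ?thesis unfolding copy_map_def by (rule someI_ex)
qed

lemma carrier_copy_group: "carrier (copy_group G) = copy_map G ` carrier G"
  and mult_copy_group: "x \<otimes>\<^bsub>copy_group G\<^esub> y = copy_map G (uncopy_map G x \<otimes>\<^bsub>G\<^esub> uncopy_map G y)"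
  and one_copy_group: "\<one>\<^bsub>copy_group G\<^esub> = copy_map G \<one>\<^bsub>G\<^esub>"
  by (simp_all add: copy_group_def)

lemma uncopy_copy:
  assumes "countable (carrier G)" "x \<in> carrier G"
  shows "uncopy_map G (copy_map G x :: 'u::infinite) = x"
  unfolding uncopy_map_def using inv_into_f_f[OF copy_map_inj[OF assms(1)] assms(2)] .

lemma copy_uncopy: "y \<in> carrier (copy_group G) \<Longrightarrow> copy_map G (uncopy_map G y) = y"
  and uncopy_closed: "y \<in> carrier (copy_group G) \<Longrightarrow> uncopy_map G y \<in> carrier G"
  and copy_closed: "x \<in> carrier G \<Longrightarrow> copy_map G x \<in> carrier (copy_group G)"
  unfolding uncopy_map_def carrier_copy_group by (auto simp: f_inv_into_f inv_into_into)

lemma comm_group_copy: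
  assumes "countable (carrier G)" "comm_group G"
  shows "comm_group (copy_group G :: 'u::infinite monoid)"
proof -
  interpret comm_group G by fact
  note u = uncopy_copy[OF assms(1)]
  show ?thesis
  proof (rule comm_groupI)
    show "\<exists>y\<in>carrier (copy_group G). y \<otimes>\<^bsub>copy_group G\<^esub> x = \<one>\<^bsub>copy_group G\<^esub>"
      if "x \<in> carrier (copy_group G :: 'u monoid)" for x
      using that by (intro bexI[of _ "copy_map G (inv\<^bsub>G\<^esub> uncopy_map G x)"])
       (auto simp: carrier_copy_group mult_copy_group one_copy_group u)
  qed (auto simp: carrier_copy_group mult_copy_group one_copy_group u m_ac)
qed

lemma framed_copy:
  assumes "framed G W \<kappa>"
  shows "framed (copy_group G :: 'u::infinite monoid) W (\<lambda>y. \<kappa> (uncopy_map G y))"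
proof -
  interpret framed_group G W \<kappa> by unfold_locales fact
  note c = framed_countable[OF assms]
  note [simp] = uncopy_copy[OF c] uncopy_closed copy_closed
  show ?thesis
  proof (rule framedI[where c = "\<lambda>w. copy_map G (basis_elt G \<kappa> w)"])
    fix y :: 'u assume y: "y \<in> carrier (copy_group G)" and z: "\<And>w. w \<in> W \<Longrightarrow> \<kappa> (uncopy_map G y) w = 0"
    have "uncopy_map G y = \<one>\<^bsub>G\<^esub>" by (rule coord_eq) (use y z in \<open>auto simp: coord_one\<close>)
    then show "y = \<one>\<^bsub>copy_group G\<^esub>" using copy_uncopy[OF y] by (simp add: one_copy_group)
  qed (auto simp: comm_group_copy[OF c comm] fin mult_copy_group coord_mult coord_outside basis_closed coord_basis)
qed

section \<open>Tensor products\<close>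

text \<open>The extension of \<open>f\<close> to the free abelian group, in the form in which it occurs in \<open>tensor_lift\<close>.\<close>

lemma lookup_product_hom:
  assumes "comm_group A" and f: "\<And>s. s \<in> S \<Longrightarrow> f s \<in> carrier A"
  shows "(\<lambda>c. finprod A (\<lambda>s. f s [^]\<^bsub>A\<^esub> Poly_Mapping.lookup c s) (Poly_Mapping.keys c))
    \<in> hom (free_Abelian_group S) A" (is "?\<phi> \<in> _")
proof -
  interpret comm_group A by fact
  have ext: "?\<phi> c = finprod A (\<lambda>s. f s [^]\<^bsub>A\<^esub> Poly_Mapping.lookup c s) T"
    if "Poly_Mapping.keys c \<subseteq> T" "finite T" "T \<subseteq> S" for c T
    by (rule finprod_mono_neutral_cong_left) (use that f in \<open>auto simp: in_keys_iff\<close>)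
  show ?thesis
  proof (rule homI)
    fix c assume "c \<in> carrier (free_Abelian_group S)"
    then show "?\<phi> c \<in> carrier A" using f by (auto intro!: finprod_closed)
  next
    fix c d assume "c \<in> carrier (free_Abelian_group S)" "d \<in> carrier (free_Abelian_group S)"
    then have cd: "Poly_Mapping.keys c \<subseteq> S" "Poly_Mapping.keys d \<subseteq> S" by auto
    define T where "T = Poly_Mapping.keys c \<union> Poly_Mapping.keys d"
    have T: "finite T" "T \<subseteq> S" using cd by (auto simp: T_def)
    have "?\<phi> (c + d) = finprod A (\<lambda>s. f s [^]\<^bsub>A\<^esub> Poly_Mapping.lookup (c + d) s) T"
      by (rule ext) (use T keys_add[of c d] in \<open>auto simp: T_def\<close>)
    also have "\<dots> = finprod A (\<lambda>s. f s [^]\<^bsub>A\<^esub> Poly_Mapping.lookup c s \<otimes>\<^bsub>A\<^esub> f s [^]\<^bsub>A\<^esub> Poly_Mapping.lookup d s) T"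
      by (rule finprod_cong') (use T f in \<open>auto simp: lookup_add int_pow_mult\<close>)
    also have "\<dots> = ?\<phi> c \<otimes>\<^bsub>A\<^esub> ?\<phi> d"
    proof -
      have c: "Poly_Mapping.keys c \<subseteq> T" and d: "Poly_Mapping.keys d \<subseteq> T" by (auto simp: T_def)
      show ?thesis unfolding ext[OF c T] ext[OF d T]
        by (intro finprod_multf) (use T f in auto)
    qed
    finally show "?\<phi> (c \<otimes>\<^bsub>free_Abelian_group S\<^esub> d) = ?\<phi> c \<otimes>\<^bsub>A\<^esub> ?\<phi> d" by simp
  qed
qed

definition bilinear :: "'a monoid \<Rightarrow> 'b monoid \<Rightarrow> 'c monoid \<Rightarrow> ('a \<Rightarrow> 'b \<Rightarrow> 'c) \<Rightarrow> bool" where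
  "bilinear G H A \<beta> \<longleftrightarrow>
     (\<forall>y\<in>carrier H. (\<lambda>x. \<beta> x y) \<in> hom G A) \<and> (\<forall>x\<in>carrier G. \<beta> x \<in> hom H A)"

lemma (in comm_group) eq_mult_of_diff:
  assumes "x \<otimes> inv y \<otimes> inv z = \<one>" "x \<in> carrier G" "y \<in> carrier G" "z \<in> carrier G"
  shows "x = y \<otimes> z"
proof -
  have "x \<otimes> inv (y \<otimes> z) = \<one>" using assms by (simp add: inv_mult m_assoc)
  then have "inv (inv (y \<otimes> z)) = x" by (rule inv_equality) (use assms in auto)
  then show ?thesis using assms by simp
qed

locale tensor_product = G: comm_group G + H: comm_group H
  for G :: "'a monoid" and H :: "'b monoid"
begin

abbreviation F where "F \<equiv> free_Abelian_group (carrier G \<times> carrier H)"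
abbreviation N where "N \<equiv> tensor_rel G H"
abbreviation T where "T \<equiv> tensor_group G H"

sublocale F: comm_group F by (rule abelian_free_Abelian_group)

lemma subgroup_N: "subgroup N F"
  unfolding tensor_rel_def
  by (rule F.generate_is_subgroup) (auto dest!: subsetD[OF keys_diff] simp: keys_frag_of)

sublocale T: comm_group T
  unfolding tensor_group_def by (rule F.abelian_FactGroup[OF subgroup_N])

lemma quotient_hom: "(\<lambda>c. N #>\<^bsub>F\<^esub> c) \<in> hom F T"
proof -
  have "N \<lhd> F" using subgroup_N by (simp add: F.normal_iff_subgroup)
  then show ?thesis unfolding tensor_group_def by (rule normal.r_coset_hom_Mod)
qed

lemma carrier_T: "carrier T = (\<lambda>c. N #>\<^bsub>F\<^esub> c) ` carrier F"
  by (auto simp: tensor_group_def FactGroup_def RCOSETS_def)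

lemma coset_eq_one: "c \<in> N \<Longrightarrow> N #>\<^bsub>F\<^esub> c = \<one>\<^bsub>T\<^esub>"
  using F.coset_join2[OF _ subgroup_N] subgroup.subset[OF subgroup_N]
  by (auto simp: tensor_group_def FactGroup_def)

lemma hom_diff:
  assumes "group A" "h \<in> hom F A" "c \<in> carrier F" "d \<in> carrier F"
  shows "h (c - d) = h c \<otimes>\<^bsub>A\<^esub> inv\<^bsub>A\<^esub> h d"
proof -
  interpret group_hom F A h using assms by (simp add: group_hom_def group_hom_axioms_def F.group_axioms)
  have "c - d = c \<otimes>\<^bsub>F\<^esub> inv\<^bsub>F\<^esub> d" using assms(4) by simp
  then show ?thesis using assms(3,4) by (metis hom_mult hom_inv F.inv_closed)
qed

lemma tens_closed: "\<lbrakk>x \<in> carrier G; y \<in> carrier H\<rbrakk> \<Longrightarrow> tens G H x y \<in> carrier T"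
  unfolding tens_def carrier_T by simp

lemma bilinear_tens: "bilinear G H T (tens G H)"
proof -
  have *: "N #>\<^bsub>F\<^esub> c = (N #>\<^bsub>F\<^esub> d) \<otimes>\<^bsub>T\<^esub> (N #>\<^bsub>F\<^esub> d')"
    if "c - d - d' \<in> N" "c \<in> carrier F" "d \<in> carrier F" "d' \<in> carrier F" for c d d'
  proof -
    let ?q = "\<lambda>c. N #>\<^bsub>F\<^esub> c"
    have "c - d \<in> carrier F" using that(2,3) keys_diff[of c d] by auto
    then have "?q c \<otimes>\<^bsub>T\<^esub> inv\<^bsub>T\<^esub> ?q d \<otimes>\<^bsub>T\<^esub> inv\<^bsub>T\<^esub> ?q d' = \<one>\<^bsub>T\<^esub>"
      using hom_diff[OF T.group_axioms quotient_hom] coset_eq_one[OF that(1)] that by simp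
    moreover have "?q c \<in> carrier T" "?q d \<in> carrier T" "?q d' \<in> carrier T"
      unfolding carrier_T using that by blast+
    ultimately show ?thesis by (rule T.eq_mult_of_diff)
  qed
  show ?thesis unfolding bilinear_def
  proof (intro conjI ballI homI)
    fix x x' y assume "x \<in> carrier G" "x' \<in> carrier G" "y \<in> carrier H"
    then show "tens G H (x \<otimes>\<^bsub>G\<^esub> x') y = tens G H x y \<otimes>\<^bsub>T\<^esub> tens G H x' y"
      unfolding tens_def
      by (intro *) (auto simp: tensor_rel_def intro!: generate.incl)
  next
    fix x y y' assume "x \<in> carrier G" "y \<in> carrier H" "y' \<in> carrier H"
    then show "tens G H x (y \<otimes>\<^bsub>H\<^esub> y') = tens G H x y \<otimes>\<^bsub>T\<^esub> tens G H x y'"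
      unfolding tens_def
      by (intro *) (auto simp: tensor_rel_def intro!: generate.incl)
  qed (rule tens_closed; assumption)+
qed

lemma tens_mult_left: "\<lbrakk>x \<in> carrier G; x' \<in> carrier G; y \<in> carrier H\<rbrakk>
    \<Longrightarrow> tens G H (x \<otimes>\<^bsub>G\<^esub> x') y = tens G H x y \<otimes>\<^bsub>T\<^esub> tens G H x' y"
  and tens_mult_right: "\<lbrakk>x \<in> carrier G; y \<in> carrier H; y' \<in> carrier H\<rbrakk>
    \<Longrightarrow> tens G H x (y \<otimes>\<^bsub>H\<^esub> y') = tens G H x y \<otimes>\<^bsub>T\<^esub> tens G H x y'"
  using bilinear_tens by (auto simp: bilinear_def hom_def)

lemma hom_eqI:
  assumes "group A" "f \<in> hom T A" "g \<in> hom T A"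
    and eq: "\<And>x y. \<lbrakk>x \<in> carrier G; y \<in> carrier H\<rbrakk> \<Longrightarrow> f (tens G H x y) = g (tens G H x y)"
    and X: "X \<in> carrier T"
  shows "f X = g X"
proof -
  obtain c where c: "c \<in> carrier F" "X = N #>\<^bsub>F\<^esub> c" using X by (auto simp: carrier_T)
  have f: "(\<lambda>c. f (N #>\<^bsub>F\<^esub> c)) \<in> hom F A" and g: "(\<lambda>c. g (N #>\<^bsub>F\<^esub> c)) \<in> hom F A"
    using hom_compose[OF quotient_hom assms(2)] hom_compose[OF quotient_hom assms(3)] by (auto simp: o_def)
  have "f (N #>\<^bsub>F\<^esub> c) = g (N #>\<^bsub>F\<^esub> c)"
  proof (rule free_Abelian_group_induct[of c "carrier G \<times> carrier H"])
    show "Poly_Mapping.keys c \<subseteq> carrier G \<times> carrier H" using c by simp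
    show "f (N #>\<^bsub>F\<^esub> 0) = g (N #>\<^bsub>F\<^esub> 0)"
      using hom_one[OF f F.group_axioms assms(1)] hom_one[OF g F.group_axioms assms(1)] by simp
    show "f (N #>\<^bsub>F\<^esub> frag_of a) = g (N #>\<^bsub>F\<^esub> frag_of a)" if "a \<in> carrier G \<times> carrier H" for a
      using eq[of "fst a" "snd a"] that by (auto simp: tens_def)
  qed (simp add: hom_diff[OF assms(1) f] hom_diff[OF assms(1) g])
  then show ?thesis by (simp add: c)
qed

text \<open>The universal property. The extension of \<open>\<beta>\<close> to the free abelian group on the pairs kills the
  bilinearity relations, so that all representatives of a coset have the same value.\<close>

lemma
  assumes A: "comm_group A" and \<beta>: "bilinear G H A \<beta>"
  shows tensor_lift_hom: "tensor_lift G H A \<beta> \<in> hom T A"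
    and tensor_lift_tens: "\<lbrakk>x \<in> carrier G; y \<in> carrier H\<rbrakk> \<Longrightarrow> tensor_lift G H A \<beta> (tens G H x y) = \<beta> x y"
proof -
  interpret A: comm_group A by fact
  let ?\<phi> = "\<lambda>c. finprod A (\<lambda>(x, y). \<beta> x y [^]\<^bsub>A\<^esub> Poly_Mapping.lookup c (x, y)) (Poly_Mapping.keys c)"
  have \<beta>c: "\<beta> x y \<in> carrier A" if "x \<in> carrier G" "y \<in> carrier H" for x y
    using \<beta> that by (auto simp: bilinear_def hom_def)
  have \<beta>l: "\<beta> (x \<otimes>\<^bsub>G\<^esub> x') y = \<beta> x y \<otimes>\<^bsub>A\<^esub> \<beta> x' y" if "x \<in> carrier G" "x' \<in> carrier G" "y \<in> carrier H" for x x' y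
    using \<beta> that by (auto simp: bilinear_def hom_def)
  have \<beta>r: "\<beta> x (y \<otimes>\<^bsub>H\<^esub> y') = \<beta> x y \<otimes>\<^bsub>A\<^esub> \<beta> x y'" if "x \<in> carrier G" "y \<in> carrier H" "y' \<in> carrier H" for x y y'
    using \<beta> that by (auto simp: bilinear_def hom_def)
  have \<phi>: "?\<phi> \<in> hom F A"
  proof -
    have "?\<phi> = (\<lambda>c. finprod A (\<lambda>s. (\<lambda>(x, y). \<beta> x y) s [^]\<^bsub>A\<^esub> Poly_Mapping.lookup c s) (Poly_Mapping.keys c))"
      by (intro ext arg_cong2[where f = "finprod A"]) auto
    also have "\<dots> \<in> hom F A" by (rule lookup_product_hom[OF A]) (use \<beta>c in auto)
    finally show ?thesis .
  qed
  have frag: "?\<phi> (frag_of (x, y)) = \<beta> x y" if "x \<in> carrier G" "y \<in> carrier H" for x y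
    using \<beta>c[OF that] by (simp add: keys_frag_of A.finprod_singleton)
  interpret \<phi>: group_hom F A ?\<phi> using \<phi> by unfold_locales
  have z: "?\<phi> c = \<one>\<^bsub>A\<^esub>" if "c \<in> N" for c
  proof -
    have "N \<subseteq> kernel F A ?\<phi>"
      unfolding tensor_rel_def
    proof (rule F.generate_subgroup_incl[OF _ \<phi>.subgroup_kernel], rule subsetI)
      have rel: "c - d - d' \<in> kernel F A ?\<phi>" if "c \<in> carrier F" "d \<in> carrier F" "d' \<in> carrier F"
        "?\<phi> c = ?\<phi> d \<otimes>\<^bsub>A\<^esub> ?\<phi> d'" for c d d'
      proof -
        have cd: "c - d \<in> carrier F" using that(1,2) keys_diff[of c d] by auto
        then have "c - d - d' \<in> carrier F" using that(3) keys_diff[of "c - d" d'] by auto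
        moreover have "?\<phi> (c - d - d') = ?\<phi> c \<otimes>\<^bsub>A\<^esub> inv\<^bsub>A\<^esub> ?\<phi> d \<otimes>\<^bsub>A\<^esub> inv\<^bsub>A\<^esub> ?\<phi> d'"
          using cd that hom_diff[OF A.group_axioms \<phi>] by simp
        moreover have "?\<phi> d \<in> carrier A" "?\<phi> d' \<in> carrier A" using that by (auto intro!: \<phi>.hom_closed)
        then have "?\<phi> c \<otimes>\<^bsub>A\<^esub> inv\<^bsub>A\<^esub> ?\<phi> d \<otimes>\<^bsub>A\<^esub> inv\<^bsub>A\<^esub> ?\<phi> d' = \<one>\<^bsub>A\<^esub>"
          unfolding that(4) by (simp add: A.m_ac) 
        ultimately show ?thesis unfolding kernel_def by simp
      qed
      fix c assume "c \<in> {frag_of (x \<otimes>\<^bsub>G\<^esub> x', y) - frag_of (x, y) - frag_of (x', y) | x x' y.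
         x \<in> carrier G \<and> x' \<in> carrier G \<and> y \<in> carrier H} \<union>
      {frag_of (x, y \<otimes>\<^bsub>H\<^esub> y') - frag_of (x, y) - frag_of (x, y') | x y y'.
         x \<in> carrier G \<and> y \<in> carrier H \<and> y' \<in> carrier H}"
      then consider (l) x x' y where "c = frag_of (x \<otimes>\<^bsub>G\<^esub> x', y) - frag_of (x, y) - frag_of (x', y)"
          "x \<in> carrier G" "x' \<in> carrier G" "y \<in> carrier H"
        | (r) x y y' where "c = frag_of (x, y \<otimes>\<^bsub>H\<^esub> y') - frag_of (x, y) - frag_of (x, y')"
          "x \<in> carrier G" "y \<in> carrier H" "y' \<in> carrier H"
        by blast
      then show "c \<in> kernel F A ?\<phi>"
      proof cases
        case l
        show ?thesis unfolding l(1)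
          by (rule rel) (use l in \<open>simp_all only: frag \<beta>l G.m_closed frag_of_in_free_Abelian_group mem_Times_iff fst_conv snd_conv\<close>)
      next
        case r
        show ?thesis unfolding r(1)
          by (rule rel) (use r in \<open>simp_all only: frag \<beta>r H.m_closed frag_of_in_free_Abelian_group mem_Times_iff fst_conv snd_conv\<close>)
      qed
    qed
    then show ?thesis using that by (auto simp: kernel_def)
  qed
  have eq: "tensor_lift G H A \<beta> (N #>\<^bsub>F\<^esub> c) = ?\<phi> c" if c: "c \<in> carrier F" for c
  proof -
    have "?\<phi> ` (N #>\<^bsub>F\<^esub> c) = {?\<phi> c}"
    proof -
      have "?\<phi> (d \<otimes>\<^bsub>F\<^esub> c) = ?\<phi> c" if "d \<in> N" for d
      proof -
        have "d \<in> carrier F" using subsetD[OF subgroup.subset[OF subgroup_N] that] .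
        from \<phi>.hom_mult[OF this c] have "?\<phi> (d \<otimes>\<^bsub>F\<^esub> c) = \<one>\<^bsub>A\<^esub> \<otimes>\<^bsub>A\<^esub> ?\<phi> c"
          unfolding z[OF that] .
        then show ?thesis unfolding A.l_one[OF \<phi>.hom_closed[OF c]] .
      qed
      then have sub: "?\<phi> e = ?\<phi> c" if "e \<in> N #>\<^bsub>F\<^esub> c" for e
        using that unfolding r_coset_def by (elim UN_E singletonE) (simp only:)
      have "c \<in> N #>\<^bsub>F\<^esub> c" by (rule F.rcos_self[OF c subgroup_N])
      show ?thesis
      proof (rule equalityI)
        show "?\<phi> ` (N #>\<^bsub>F\<^esub> c) \<subseteq> {?\<phi> c}"
          by (rule image_subsetI) (simp only: sub singleton_iff)
        show "{?\<phi> c} \<subseteq> ?\<phi> ` (N #>\<^bsub>F\<^esub> c)"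
          using imageI[OF \<open>c \<in> N #>\<^bsub>F\<^esub> c\<close>, of ?\<phi>] by (simp only: insert_subset empty_subsetI simp_thms)
      qed
    qed
    then have "the_elem (?\<phi> ` (N #>\<^bsub>F\<^esub> c)) = ?\<phi> c" by (simp only: the_elem_eq)
    moreover have "N #>\<^bsub>F\<^esub> c \<in> carrier T" unfolding carrier_T using c by (rule imageI)
    ultimately show ?thesis unfolding tensor_lift_def by (simp only: restrict_apply' simp_thms)
  qed
  show "tensor_lift G H A \<beta> (tens G H x y) = \<beta> x y" if "x \<in> carrier G" "y \<in> carrier H"
    unfolding tens_def using eq[of "frag_of (x, y)"] frag[OF that] that
    by (simp only: frag_of_in_free_Abelian_group mem_Times_iff fst_conv snd_conv simp_thms)
  show "tensor_lift G H A \<beta> \<in> hom T A"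
  proof (rule homI)
    fix X assume "X \<in> carrier T"
    then show "tensor_lift G H A \<beta> X \<in> carrier A" by (auto simp: carrier_T eq intro!: \<phi>.hom_closed)
  next
    fix X Y assume "X \<in> carrier T" "Y \<in> carrier T"
    then obtain c d where c: "c \<in> carrier F" "X = N #>\<^bsub>F\<^esub> c" and d: "d \<in> carrier F" "Y = N #>\<^bsub>F\<^esub> d"
      by (auto simp: carrier_T)
    have "X \<otimes>\<^bsub>T\<^esub> Y = N #>\<^bsub>F\<^esub> (c \<otimes>\<^bsub>F\<^esub> d)" using hom_mult[OF quotient_hom c(1) d(1)] c d by simp
    then show "tensor_lift G H A \<beta> (X \<otimes>\<^bsub>T\<^esub> Y) = tensor_lift G H A \<beta> X \<otimes>\<^bsub>A\<^esub> tensor_lift G H A \<beta> Y"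
      using eq[OF F.m_closed[OF c(1) d(1)]] eq[OF c(1)] eq[OF d(1)] c d \<phi>.hom_mult[OF c(1) d(1)] by simp
  qed
qed

end

text \<open>The coordinate functionals of \<open>G \<otimes> H\<close> are induced by the bilinear products of coordinates.\<close>

definition tensor_coord :: "'a monoid \<Rightarrow> 'b monoid \<Rightarrow> ('a \<Rightarrow> 'v \<Rightarrow> int) \<Rightarrow> ('b \<Rightarrow> 'w \<Rightarrow> int)
    \<Rightarrow> ('a, 'b) tensor \<Rightarrow> 'v \<times> 'w \<Rightarrow> int" where
  "tensor_coord G H \<kappa> \<mu> X = (\<lambda>(v, w). tensor_lift G H integer_group (\<lambda>x y. \<kappa> x v * \<mu> y w) X)"

lemma (in comm_group) finprod_int_pow:
  assumes "f \<in> I \<rightarrow> carrier G"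
  shows "(\<Otimes>i\<in>I. f i) [^] (k::int) = (\<Otimes>i\<in>I. f i [^] k)"
proof -
  have "(\<lambda>x. x [^] k) \<in> hom G G" by (rule homI) (auto simp: int_pow_distrib)
  from hom_finprod[OF comm_group_axioms comm_group_axioms this assms] show ?thesis .
qed

locale framed_tensor = G: framed_group G V \<kappa> + H: framed_group H W \<mu>
  for G :: "'a monoid" and V :: "'v set" and \<kappa> and H :: "'b monoid" and W :: "'w set" and \<mu>
begin

sublocale tensor_product G H ..

abbreviation tc where "tc \<equiv> tensor_coord G H \<kappa> \<mu>"

lemma bilinear_coord: "bilinear G H integer_group (\<lambda>x y. \<kappa> x v * \<mu> y w)"
  unfolding bilinear_def by (intro conjI ballI homI) (auto simp: G.coord_mult H.coord_mult algebra_simps)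

lemma tensor_coord_hom: "(\<lambda>X. tc X p) \<in> hom T integer_group"
  using tensor_lift_hom[OF abelian_integer_group bilinear_coord] by (cases p) (simp add: tensor_coord_def)

lemma tensor_coord_tens:
  "\<lbrakk>x \<in> carrier G; y \<in> carrier H\<rbrakk> \<Longrightarrow> tc (tens G H x y) (v, w) = \<kappa> x v * \<mu> y w"
  using tensor_lift_tens[OF abelian_integer_group bilinear_coord] by (simp add: tensor_coord_def)

lemma tens_hom_left: "y \<in> carrier H \<Longrightarrow> (\<lambda>x. tens G H x y) \<in> hom G T"
  and tens_hom_right: "x \<in> carrier G \<Longrightarrow> tens G H x \<in> hom H T"
  using bilinear_tens by (auto simp: bilinear_def)

abbreviation bb where "bb v w \<equiv> tens G H (basis_elt G \<kappa> v) (basis_elt H \<mu> w)"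

lemma bb_closed: "v \<in> V \<Longrightarrow> w \<in> W \<Longrightarrow> bb v w \<in> carrier T"
  by (intro tens_closed G.basis_closed H.basis_closed)

lemma tensor_expansion:
  assumes "X \<in> carrier T"
  shows "X = finprod T (\<lambda>v. finprod T (\<lambda>w. bb v w [^]\<^bsub>T\<^esub> tc X (v, w)) W) V" (is "_ = ?R X")
proof (rule hom_eqI[OF T.group_axioms _ _ _ assms])
  have cl: "(\<lambda>w. bb v w [^]\<^bsub>T\<^esub> k w) \<in> W \<rightarrow> carrier T" if "v \<in> V" for v and k :: "'w \<Rightarrow> int"
    using bb_closed that by auto
  have cl2: "(\<lambda>v. finprod T (\<lambda>w. bb v w [^]\<^bsub>T\<^esub> k v w) W) \<in> V \<rightarrow> carrier T" for k :: "'v \<Rightarrow> 'w \<Rightarrow> int"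
    using cl by auto
  show "(\<lambda>x. x) \<in> hom T T" by (auto simp: hom_def)
  show "?R \<in> hom T T"
  proof (rule homI)
    fix X Y assume XY: "X \<in> carrier T" "Y \<in> carrier T"
    have "?R (X \<otimes>\<^bsub>T\<^esub> Y) = finprod T (\<lambda>v. finprod T (\<lambda>w. bb v w [^]\<^bsub>T\<^esub> tc X (v, w)) W \<otimes>\<^bsub>T\<^esub>
         finprod T (\<lambda>w. bb v w [^]\<^bsub>T\<^esub> tc Y (v, w)) W) V"
    proof (rule T.finprod_cong')
      fix v assume v: "v \<in> V"
      have "finprod T (\<lambda>w. bb v w [^]\<^bsub>T\<^esub> tc (X \<otimes>\<^bsub>T\<^esub> Y) (v, w)) W
        = finprod T (\<lambda>w. bb v w [^]\<^bsub>T\<^esub> tc X (v, w) \<otimes>\<^bsub>T\<^esub> bb v w [^]\<^bsub>T\<^esub> tc Y (v, w)) W"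
        by (rule T.finprod_cong')
          (use bb_closed v hom_mult[OF tensor_coord_hom XY] in \<open>auto simp: T.int_pow_mult\<close>)
      also have "\<dots> = finprod T (\<lambda>w. bb v w [^]\<^bsub>T\<^esub> tc X (v, w)) W \<otimes>\<^bsub>T\<^esub>
         finprod T (\<lambda>w. bb v w [^]\<^bsub>T\<^esub> tc Y (v, w)) W"
        by (rule T.finprod_multf[OF cl[OF v] cl[OF v]])
      finally show "finprod T (\<lambda>w. bb v w [^]\<^bsub>T\<^esub> tc (X \<otimes>\<^bsub>T\<^esub> Y) (v, w)) W = \<dots>" .
    qed (use cl in auto)
    also have "\<dots> = ?R X \<otimes>\<^bsub>T\<^esub> ?R Y"
      by (rule T.finprod_multf[OF cl2 cl2])
    finally show "?R (X \<otimes>\<^bsub>T\<^esub> Y) = ?R X \<otimes>\<^bsub>T\<^esub> ?R Y" .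
  qed (use cl2 in simp)
  fix x y assume xy: "x \<in> carrier G" "y \<in> carrier H"
  have "tens G H x y = finprod T (\<lambda>v. tens G H (basis_elt G \<kappa> v) y [^]\<^bsub>T\<^esub> \<kappa> x v) V"
    by (rule G.hom_expansion[OF T.comm_group_axioms tens_hom_left[OF xy(2)] xy(1)])
  also have "\<dots> = finprod T (\<lambda>v. finprod T (\<lambda>w. bb v w [^]\<^bsub>T\<^esub> (\<kappa> x v * \<mu> y w)) W) V"
  proof (rule T.finprod_cong')
    fix v assume v: "v \<in> V"
    have "tens G H (basis_elt G \<kappa> v) y = finprod T (\<lambda>w. bb v w [^]\<^bsub>T\<^esub> \<mu> y w) W"
      by (rule H.hom_expansion[OF T.comm_group_axioms tens_hom_right[OF G.basis_closed[OF v]] xy(2)])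
    then have "tens G H (basis_elt G \<kappa> v) y [^]\<^bsub>T\<^esub> \<kappa> x v = finprod T (\<lambda>w. (bb v w [^]\<^bsub>T\<^esub> \<mu> y w) [^]\<^bsub>T\<^esub> \<kappa> x v) W"
      using T.finprod_int_pow[OF cl[OF v]] by simp
    also have "\<dots> = finprod T (\<lambda>w. bb v w [^]\<^bsub>T\<^esub> (\<kappa> x v * \<mu> y w)) W"
      by (rule T.finprod_cong') (use bb_closed v in \<open>auto simp: T.int_pow_pow mult.commute\<close>)
    finally show "tens G H (basis_elt G \<kappa> v) y [^]\<^bsub>T\<^esub> \<kappa> x v = \<dots>" .
  qed (use cl2 in auto)
  finally show "tens G H x y = ?R (tens G H x y)" unfolding tensor_coord_tens[OF xy] .
qed

text \<open>The tensors of basis elements generate \<open>G \<otimes> H\<close> by bilinearity, and the induced functionals take the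
  values \<open>0\<close> and \<open>1\<close> on them, so there is no relation between them.\<close>

lemma framed_T: "framed T (V \<times> W) tc"
proof (rule framedI[OF T.comm_group_axioms, where c = "\<lambda>(v, w). bb v w"])
  show "finite (V \<times> W)" by (simp add: G.fin H.fin)
  show "tc (X \<otimes>\<^bsub>T\<^esub> Y) p = tc X p + tc Y p" if "X \<in> carrier T" "Y \<in> carrier T" for X Y p
    using hom_mult[OF tensor_coord_hom that] by simp
  show "tc X p = 0" if X: "X \<in> carrier T" and p: "p \<notin> V \<times> W" for X p
  proof -
    obtain v w where vw: "p = (v, w)" by (cases p)
    have z: "(\<lambda>X. 0) \<in> hom T integer_group" by (auto simp: hom_def)
    show ?thesis
      by (rule hom_eqI[OF group_integer_group tensor_coord_hom z _ X])
       (use p vw in \<open>auto simp: tensor_coord_tens G.coord_outside H.coord_outside\<close>)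
  qed
  show "X = \<one>\<^bsub>T\<^esub>" if X: "X \<in> carrier T" and z: "\<And>p. p \<in> V \<times> W \<Longrightarrow> tc X p = 0" for X
  proof -
    have "finprod T (\<lambda>w. bb v w [^]\<^bsub>T\<^esub> tc X (v, w)) W = \<one>\<^bsub>T\<^esub>" if "v \<in> V" for v
      by (rule T.finprod_one_eqI) (use z that in simp)
    then show ?thesis by (subst tensor_expansion[OF X]) (rule T.finprod_one_eqI)
  qed
  show "(case p of (v, w) \<Rightarrow> bb v w) \<in> carrier T" if "p \<in> V \<times> W" for p
    using that bb_closed by auto
  show "tc (case p of (v, w) \<Rightarrow> bb v w) p' = of_bool (p' = p)" if "p \<in> V \<times> W" "p' \<in> V \<times> W" for p p'
    using that by (cases p; cases p')
      (auto simp: tensor_coord_tens G.basis_closed H.basis_closed G.coord_basis H.coord_basis)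
qed

sublocale T: framed_group T "V \<times> W" tc
  by unfold_locales (rule framed_T)

lemma basis_tensor: "\<lbrakk>v \<in> V; w \<in> W\<rbrakk> \<Longrightarrow> basis_elt T tc (v, w) = bb v w"
  by (rule T.basis_eqI)
    (auto simp: bb_closed tensor_coord_tens G.basis_closed H.basis_closed G.coord_basis H.coord_basis)

lemma int_hom_tensor_lift:
  assumes "comm_group A" "bilinear G H A \<beta>" "\<chi> \<in> hom A integer_group" "X \<in> carrier T"
  shows "\<chi> (tensor_lift G H A \<beta> X) =
    (\<Sum>(v, w)\<in>V \<times> W. tc X (v, w) * \<chi> (\<beta> (basis_elt G \<kappa> v) (basis_elt H \<mu> w)))"
proof -
  have h: "\<chi> \<circ> tensor_lift G H A \<beta> \<in> hom T integer_group"
    by (rule hom_compose[OF tensor_lift_hom[OF assms(1,2)] assms(3)])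
  have "(\<chi> \<circ> tensor_lift G H A \<beta>) X = (\<Sum>p\<in>V \<times> W. tc X p * (\<chi> \<circ> tensor_lift G H A \<beta>) (basis_elt T tc p))"
    by (rule T.int_hom_expansion[OF h assms(4)])
  also have "\<dots> = (\<Sum>(v, w)\<in>V \<times> W. tc X (v, w) * \<chi> (\<beta> (basis_elt G \<kappa> v) (basis_elt H \<mu> w)))"
    by (intro sum.cong) (auto simp: basis_tensor tensor_lift_tens[OF assms(1,2)] G.basis_closed H.basis_closed)
  finally show ?thesis by simp
qed

end

section \<open>Direct sums\<close>

text \<open>A direct sum of framed groups is framed by the disjoint union of the index sets, presented as
  a single set \<open>W\<close> with a function \<open>\<pi>\<close> telling the summand to which an index belongs.\<close>

definition sum_coord :: "'w set \<Rightarrow> ('w \<Rightarrow> 'i) \<Rightarrow> ('i \<Rightarrow> 'a \<Rightarrow> 'w \<Rightarrow> int) \<Rightarrow> ('i \<Rightarrow> 'a) \<Rightarrow> 'w \<Rightarrow> int" where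
  "sum_coord W \<pi> \<kappa> x w = (if w \<in> W then \<kappa> (\<pi> w) (x (\<pi> w)) w else 0)"

locale framed_sum =
  fixes I :: "'i set" and G :: "'i \<Rightarrow> 'a monoid" and W :: "'w set" and \<pi> :: "'w \<Rightarrow> 'i"
    and \<kappa> :: "'i \<Rightarrow> 'a \<Rightarrow> 'w \<Rightarrow> int"
  assumes summand: "i \<in> I \<Longrightarrow> framed (G i) {w \<in> W. \<pi> w = i} (\<kappa> i)"
    and finite_index: "finite W" and index_in: "w \<in> W \<Longrightarrow> \<pi> w \<in> I"
begin

lemma fr: "i \<in> I \<Longrightarrow> framed_group (G i) {w \<in> W. \<pi> w = i} (\<kappa> i)"
  by unfold_locales (rule summand)

lemma comm_group_summand: "i \<in> I \<Longrightarrow> comm_group (G i)"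
  using framed_group.comm[OF fr] .

lemma group_summand: "i \<in> I \<Longrightarrow> group (G i)"
  using comm_group_summand comm_group.axioms(2) by blast

lemma carrier_sum: "carrier (sum_group I G) = (\<Pi>\<^sub>E i\<in>I. carrier (G i))"
proof -
  have "finite {i \<in> I. x i \<noteq> \<one>\<^bsub>G i\<^esub>}" if x: "x \<in> (\<Pi>\<^sub>E i\<in>I. carrier (G i))" for x
  proof (rule finite_subset)
    show "{i \<in> I. x i \<noteq> \<one>\<^bsub>G i\<^esub>} \<subseteq> \<pi> ` W"
    proof (rule ccontr)
      assume "\<not> {i \<in> I. x i \<noteq> \<one>\<^bsub>G i\<^esub>} \<subseteq> \<pi> ` W"
      then obtain i where i: "i \<in> I" "x i \<noteq> \<one>\<^bsub>G i\<^esub>" "i \<notin> \<pi> ` W" by blast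
      interpret framed_group "G i" "{w \<in> W. \<pi> w = i}" "\<kappa> i" by (rule fr[OF i(1)])
      have "x i = \<one>\<^bsub>G i\<^esub>" by (rule coord_eq) (use i x in auto)
      with i show False by simp
    qed
  qed (simp add: finite_index)
  then show ?thesis using group_summand by (auto simp: carrier_sum_group)
qed

lemma comm_group_sum: "comm_group (sum_group I G)"
proof (rule group.group_comm_groupI)
  show "group (sum_group I G)" using group_summand by simp
  fix x y assume "x \<in> carrier (sum_group I G)" "y \<in> carrier (sum_group I G)"
  then show "x \<otimes>\<^bsub>sum_group I G\<^esub> y = y \<otimes>\<^bsub>sum_group I G\<^esub> x"
    unfolding carrier_sum mult_sum_group
    by (intro restrict_ext) (auto intro!: comm_monoid.m_comm[OF comm_group.axioms(1)[OF comm_group_summand]])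
qed

lemma sum_incl_closed: "i \<in> I \<Longrightarrow> a \<in> carrier (G i) \<Longrightarrow> sum_incl I G i a \<in> carrier (sum_group I G)"
  unfolding carrier_sum sum_incl_def using group_summand by (auto simp: group.is_monoid)

lemma sum_incl_hom: "i \<in> I \<Longrightarrow> sum_incl I G i \<in> hom (G i) (sum_group I G)"
proof (rule homI)
  fix a b assume "i \<in> I" "a \<in> carrier (G i)" "b \<in> carrier (G i)"
  then show "sum_incl I G i (a \<otimes>\<^bsub>G i\<^esub> b) = sum_incl I G i a \<otimes>\<^bsub>sum_group I G\<^esub> sum_incl I G i b"
    unfolding mult_sum_group sum_incl_def using group_summand
    by (intro restrict_ext) (auto simp: group.is_monoid)
qed (rule sum_incl_closed)

lemma coord_sum_incl:
  assumes "\<tau> \<in> I" "a \<in> carrier (G \<tau>)"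
  shows "sum_coord W \<pi> \<kappa> (sum_incl I G \<tau> a) w = (if w \<in> W \<and> \<pi> w = \<tau> then \<kappa> \<tau> a w else 0)"
proof (cases "w \<in> W")
  case True
  interpret w: framed_group "G (\<pi> w)" "{w' \<in> W. \<pi> w' = \<pi> w}" "\<kappa> (\<pi> w)" by (rule fr[OF index_in[OF True]])
  show ?thesis using True w.coord_one index_in[OF True] by (auto simp: sum_coord_def sum_incl_def)
qed (simp add: sum_coord_def)

lemma framed_sum_group: "framed (sum_group I G) W (sum_coord W \<pi> \<kappa>)"
proof (rule framedI[OF comm_group_sum finite_index,
      where c = "\<lambda>w. sum_incl I G (\<pi> w) (basis_elt (G (\<pi> w)) (\<kappa> (\<pi> w)) w)"])
  fix x y w assume xy: "x \<in> carrier (sum_group I G)" "y \<in> carrier (sum_group I G)" and w: "w \<in> W"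
  interpret framed_group "G (\<pi> w)" "{w' \<in> W. \<pi> w' = \<pi> w}" "\<kappa> (\<pi> w)" by (rule fr[OF index_in[OF w]])
  show "sum_coord W \<pi> \<kappa> (x \<otimes>\<^bsub>sum_group I G\<^esub> y) w = sum_coord W \<pi> \<kappa> x w + sum_coord W \<pi> \<kappa> y w"
    using xy w index_in[OF w] by (auto simp: sum_coord_def carrier_sum intro!: coord_mult)
next
  fix x assume x: "x \<in> carrier (sum_group I G)" and z: "\<And>w. w \<in> W \<Longrightarrow> sum_coord W \<pi> \<kappa> x w = 0"
  have "x i = \<one>\<^bsub>G i\<^esub>" if i: "i \<in> I" for i
  proof -
    interpret framed_group "G i" "{w \<in> W. \<pi> w = i}" "\<kappa> i" by (rule fr[OF i])
    show ?thesis by (rule coord_eq) (use x z i in \<open>auto simp: sum_coord_def coord_one carrier_sum\<close>)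
  qed
  then show "x = \<one>\<^bsub>sum_group I G\<^esub>" using x by (auto simp: carrier_sum PiE_def extensional_def fun_eq_iff)
next
  fix w assume w: "w \<in> W"
  interpret framed_group "G (\<pi> w)" "{w' \<in> W. \<pi> w' = \<pi> w}" "\<kappa> (\<pi> w)" by (rule fr[OF index_in[OF w]])
  have b: "basis_elt (G (\<pi> w)) (\<kappa> (\<pi> w)) w \<in> carrier (G (\<pi> w))" using w by (auto intro!: basis_closed)
  then show "sum_incl I G (\<pi> w) (basis_elt (G (\<pi> w)) (\<kappa> (\<pi> w)) w) \<in> carrier (sum_group I G)"
    by (intro sum_incl_closed index_in w)
  fix w' assume w': "w' \<in> W"
  interpret w': framed_group "G (\<pi> w')" "{w'' \<in> W. \<pi> w'' = \<pi> w'}" "\<kappa> (\<pi> w')" by (rule fr[OF index_in[OF w']])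
  show "sum_coord W \<pi> \<kappa> (sum_incl I G (\<pi> w) (basis_elt (G (\<pi> w)) (\<kappa> (\<pi> w)) w)) w' = of_bool (w' = w)"
    using w w' coord_basis[of w w'] w'.coord_one by (auto simp: sum_coord_def sum_incl_def index_in)
qed (simp add: sum_coord_def)

sublocale framed_group "sum_group I G" W "sum_coord W \<pi> \<kappa>"
  by unfold_locales (rule framed_sum_group)

lemma basis_sum: "w \<in> W \<Longrightarrow>
  basis_elt (sum_group I G) (sum_coord W \<pi> \<kappa>) w = sum_incl I G (\<pi> w) (basis_elt (G (\<pi> w)) (\<kappa> (\<pi> w)) w)"
proof (rule basis_eqI)
  assume w: "w \<in> W"
  interpret framed_group "G (\<pi> w)" "{w' \<in> W. \<pi> w' = \<pi> w}" "\<kappa> (\<pi> w)" by (rule fr[OF index_in[OF w]])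
  have b: "basis_elt (G (\<pi> w)) (\<kappa> (\<pi> w)) w \<in> carrier (G (\<pi> w))" using w by (auto intro!: basis_closed)
  then show "sum_incl I G (\<pi> w) (basis_elt (G (\<pi> w)) (\<kappa> (\<pi> w)) w) \<in> carrier (sum_group I G)"
    by (intro sum_incl_closed index_in w)
  fix w' assume w': "w' \<in> W"
  interpret w': framed_group "G (\<pi> w')" "{w'' \<in> W. \<pi> w'' = \<pi> w'}" "\<kappa> (\<pi> w')" by (rule fr[OF index_in[OF w']])
  show "sum_coord W \<pi> \<kappa> (sum_incl I G (\<pi> w) (basis_elt (G (\<pi> w)) (\<kappa> (\<pi> w)) w)) w' = of_bool (w' = w)"
    using w w' coord_basis[of w w'] w'.coord_one by (auto simp: sum_coord_def sum_incl_def index_in)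
qed

end

section \<open>Based modules and their matrices\<close>

locale finite_poset =
  fixes P :: "'s rel"
  assumes finite_poset: "finite (Field P)" and poset_refl: "\<sigma> \<in> Field P \<Longrightarrow> (\<sigma>, \<sigma>) \<in> P"
    and poset_trans: "\<lbrakk>(\<rho>, \<sigma>) \<in> P; (\<sigma>, \<tau>) \<in> P\<rbrakk> \<Longrightarrow> (\<rho>, \<tau>) \<in> P"
    and poset_antisym: "\<lbrakk>(\<rho>, \<sigma>) \<in> P; (\<sigma>, \<rho>) \<in> P\<rbrakk> \<Longrightarrow> \<rho> = \<sigma>"

lemma (in finite_poset) finite_poset_converse: "finite_poset (P\<inverse>)"
  by unfold_locales (auto simp: finite_poset poset_refl intro: poset_trans poset_antisym)

locale framed_based = finite_poset P + framed_sum "Field P" M W ps \<kappa>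
  for P :: "'s rel" and M :: "('s, 'a) based" and W :: "'w set" and ps :: "'w \<Rightarrow> 's" and \<kappa>
begin

abbreviation crd where "crd \<equiv> sum_coord W ps \<kappa>"

lemma comm_total: "comm_group (total P M)"
  unfolding total_def by (rule comm_group_sum)

lemma total_frame: "framed_group (total P M) W crd"
  unfolding total_def by (rule framed_group_axioms)

lemma carrier_total: "carrier (total P M) = (\<Pi>\<^sub>E \<sigma>\<in>Field P. carrier (M \<sigma>))"
  unfolding total_def by (rule carrier_sum)

lemma one_total: "\<one>\<^bsub>total P M\<^esub> = (\<lambda>\<sigma>\<in>Field P. \<one>\<^bsub>M \<sigma>\<^esub>)"
  and mult_total: "x \<otimes>\<^bsub>total P M\<^esub> y = (\<lambda>\<sigma>\<in>Field P. x \<sigma> \<otimes>\<^bsub>M \<sigma>\<^esub> y \<sigma>)"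
  by (simp_all add: total_def)

lemma sum_incl_total: "\<tau> \<in> Field P \<Longrightarrow> a \<in> carrier (M \<tau>) \<Longrightarrow> sum_incl (Field P) M \<tau> a \<in> carrier (total P M)"
  unfolding total_def by (rule sum_incl_closed)

lemma carrier_below:
  "x \<in> carrier (below P M \<sigma>) \<longleftrightarrow> x \<in> carrier (total P M) \<and> (\<forall>w\<in>W. crd x w \<noteq> 0 \<longrightarrow> (ps w, \<sigma>) \<in> P)"
proof -
  have "(\<forall>\<rho>\<in>Field P. (\<rho>, \<sigma>) \<notin> P \<longrightarrow> x \<rho> = \<one>\<^bsub>M \<rho>\<^esub>) \<longleftrightarrow> (\<forall>w\<in>W. crd x w \<noteq> 0 \<longrightarrow> (ps w, \<sigma>) \<in> P)"
    if x: "x \<in> carrier (total P M)"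
  proof (intro iffI ballI impI)
    fix w assume *: "\<forall>\<rho>\<in>Field P. (\<rho>, \<sigma>) \<notin> P \<longrightarrow> x \<rho> = \<one>\<^bsub>M \<rho>\<^esub>" and w: "w \<in> W" "crd x w \<noteq> 0"
    interpret w: framed_group "M (ps w)" "{w' \<in> W. ps w' = ps w}" "\<kappa> (ps w)" by (rule fr[OF index_in[OF w(1)]])
    show "(ps w, \<sigma>) \<in> P" using * w w.coord_one index_in[OF w(1)] by (auto simp: sum_coord_def)
  next
    fix \<rho> assume *: "\<forall>w\<in>W. crd x w \<noteq> 0 \<longrightarrow> (ps w, \<sigma>) \<in> P" and \<rho>: "\<rho> \<in> Field P" "(\<rho>, \<sigma>) \<notin> P"
    interpret \<rho>: framed_group "M \<rho>" "{w' \<in> W. ps w' = \<rho>}" "\<kappa> \<rho>" by (rule fr[OF \<rho>(1)])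
    show "x \<rho> = \<one>\<^bsub>M \<rho>\<^esub>"
      by (rule \<rho>.coord_eq) (use x * \<rho> in \<open>auto simp: carrier_total \<rho>.coord_one sum_coord_def\<close>)
  qed
  then show ?thesis by (auto simp: below_def)
qed

lemma mult_below: "x \<otimes>\<^bsub>below P M \<sigma>\<^esub> y = x \<otimes>\<^bsub>total P M\<^esub> y" and one_below: "\<one>\<^bsub>below P M \<sigma>\<^esub> = \<one>\<^bsub>total P M\<^esub>"
  by (simp_all add: below_def)

lemma subgroup_below: "subgroup (carrier (below P M \<sigma>)) (total P M)"
proof -
  interpret T: framed_group "total P M" W crd by (rule total_frame)
  show ?thesis
  proof (rule T.subgroupI)
    show "carrier (below P M \<sigma>) \<noteq> {}" using carrier_below[of "\<one>\<^bsub>total P M\<^esub>"] T.coord_one by auto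
    fix a assume a: "a \<in> carrier (below P M \<sigma>)"
    have "crd (inv\<^bsub>total P M\<^esub> a) w = - crd a w" for w
      using T.coord_mult[of a "inv\<^bsub>total P M\<^esub> a" w] a T.coord_one[of w] by (simp add: carrier_below)
    then show "inv\<^bsub>total P M\<^esub> a \<in> carrier (below P M \<sigma>)" using a by (simp add: carrier_below)
    fix b assume b: "b \<in> carrier (below P M \<sigma>)"
    show "a \<otimes>\<^bsub>total P M\<^esub> b \<in> carrier (below P M \<sigma>)"
      using a b by (auto simp: carrier_below T.coord_mult)
  qed (auto simp: carrier_below)
qed

lemma comm_below: "comm_group (below P M \<sigma>)"
proof -
  interpret T: comm_group "total P M" by (rule comm_total)
  have "group ((total P M)\<lparr>carrier := carrier (below P M \<sigma>)\<rparr>)"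
    by (rule T.subgroup_imp_group[OF subgroup_below])
  moreover have "(total P M)\<lparr>carrier := carrier (below P M \<sigma>)\<rparr> = below P M \<sigma>" by (simp add: below_def)
  ultimately show ?thesis
    by (intro group.group_comm_groupI) (auto simp: mult_below carrier_below intro: T.m_comm)
qed

text \<open>A basis adapted to the direct sum decomposition contains bases of all \<open>[M](\<sigma>)\<close>; this makes the tensor
  products \<open>E(\<sigma>) \<otimes> [M](\<sigma>)\<close> accessible by coordinates.\<close>

lemma framed_below: "framed (below P M \<sigma>) {w \<in> W. (ps w, \<sigma>) \<in> P} crd"
proof -
  interpret T: framed_group "total P M" W crd by (rule total_frame)
  show ?thesis
  proof (rule framedI[OF comm_below, where c = "basis_elt (total P M) crd"])
    fix x assume x: "x \<in> carrier (below P M \<sigma>)" and z: "\<And>w. w \<in> {w \<in> W. (ps w, \<sigma>) \<in> P} \<Longrightarrow> crd x w = 0"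
    have "x = \<one>\<^bsub>total P M\<^esub>" by (rule T.coord_eq) (use x z T.coord_one in \<open>auto simp: carrier_below\<close>)
    then show "x = \<one>\<^bsub>below P M \<sigma>\<^esub>" by (simp add: one_below)
  next
    fix x w assume "x \<in> carrier (below P M \<sigma>)" "w \<notin> {w \<in> W. (ps w, \<sigma>) \<in> P}"
    then show "crd x w = 0" by (cases "w \<in> W") (auto simp: carrier_below T.coord_outside)
  qed (auto simp: T.fin mult_below carrier_below T.coord_mult T.basis_closed T.coord_basis)
qed

lemma basis_below:
  assumes "w \<in> W" "(ps w, \<sigma>) \<in> P"
  shows "basis_elt (below P M \<sigma>) crd w = basis_elt (total P M) crd w"
proof -
  interpret T: framed_group "total P M" W crd by (rule total_frame)
  interpret B: framed_group "below P M \<sigma>" "{w \<in> W. (ps w, \<sigma>) \<in> P}" crd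
    by unfold_locales (rule framed_below)
  show ?thesis
    by (rule B.basis_eqI) (use assms in \<open>auto simp: carrier_below T.basis_closed T.coord_basis\<close>)
qed

lemma basis_total: "w \<in> W \<Longrightarrow> basis_elt (total P M) crd w = sum_incl (Field P) M (ps w) (basis_elt (M (ps w)) (\<kappa> (ps w)) w)"
  unfolding total_def by (rule basis_sum)

lemma basis_summand: "w \<in> W \<Longrightarrow> basis_elt (M (ps w)) (\<kappa> (ps w)) w \<in> carrier (M (ps w))"
  using framed_group.basis_closed[OF fr[OF index_in]] by fastforce

lemma fg_free_summand: "\<sigma> \<in> Field P \<Longrightarrow> fg_free (M \<sigma>)"
  using framed_fg_free[OF summand] .

end

text \<open>The bases of the finitely many summands, made disjoint by tagging with the position.\<close>

lemma (in finite_poset) based_frame_ex: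
  assumes "\<forall>\<sigma>\<in>Field P. fg_free (M \<sigma>)"
  shows "\<exists>W \<kappa>. framed_based P M (W :: ('s \<times> nat) set) fst \<kappa>"
proof -
  obtain V \<kappa> where V: "\<And>\<sigma>. \<sigma> \<in> Field P \<Longrightarrow> framed (M \<sigma>) (V \<sigma> :: nat set) (\<kappa> \<sigma>)"
  proof -
    have "\<forall>\<sigma>\<in>Field P. \<exists>p. framed (M \<sigma>) (fst p :: nat set) (snd p)"
      using assms fg_free_framed by (metis fst_conv snd_conv)
    then obtain p where "\<forall>\<sigma>\<in>Field P. framed (M \<sigma>) (fst (p \<sigma>) :: nat set) (snd (p \<sigma>))" by metis
    then show ?thesis by (intro that[of "\<lambda>\<sigma>. fst (p \<sigma>)" "\<lambda>\<sigma>. snd (p \<sigma>)"]) auto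
  qed
  define W where "W = (SIGMA \<sigma>:Field P. V \<sigma>)"
  define \<kappa>' where "\<kappa>' = (\<lambda>\<sigma> x w. if fst w = \<sigma> then \<kappa> \<sigma> x (snd w) else (0::int))"
  have "framed_based P M W fst \<kappa>'"
  proof unfold_locales
    fix \<sigma> assume \<sigma>: "\<sigma> \<in> Field P"
    interpret framed_group "M \<sigma>" "V \<sigma>" "\<kappa> \<sigma>" by unfold_locales (rule V[OF \<sigma>])
    show "framed (M \<sigma>) {w \<in> W. fst w = \<sigma>} (\<kappa>' \<sigma>)"
    proof (rule framedI[OF comm, where c = "\<lambda>w. basis_elt (M \<sigma>) (\<kappa> \<sigma>) (snd w)"])
      have "{w \<in> W. fst w = \<sigma>} \<subseteq> {\<sigma>} \<times> V \<sigma>" by (auto simp: W_def)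
      then show "finite {w \<in> W. fst w = \<sigma>}" using fin finite_subset by blast
      show "x = \<one>\<^bsub>M \<sigma>\<^esub>" if x: "x \<in> carrier (M \<sigma>)" and z: "\<And>w. w \<in> {w \<in> W. fst w = \<sigma>} \<Longrightarrow> \<kappa>' \<sigma> x w = 0" for x
      proof (rule coord_eq[OF x])
        fix v assume "v \<in> V \<sigma>"
        then show "\<kappa> \<sigma> x v = \<kappa> \<sigma> \<one>\<^bsub>M \<sigma>\<^esub> v"
          using z[of "(\<sigma>, v)"] \<sigma> by (auto simp: W_def \<kappa>'_def coord_one)
      qed simp
    next
      fix x w assume x: "x \<in> carrier (M \<sigma>)" and w: "w \<notin> {w \<in> W. fst w = \<sigma>}"
      show "\<kappa>' \<sigma> x w = 0"
        using w \<sigma> coord_outside[OF x, of "snd w"] by (cases w) (auto simp: W_def \<kappa>'_def)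
    qed (auto simp: \<kappa>'_def W_def coord_mult coord_basis basis_closed)
  qed (use V finite_poset in \<open>auto simp: W_def framed_def\<close>)
  then show ?thesis by blast
qed

locale framed_based_pair = M: framed_based P M W ps \<kappa> + N: framed_based P N W' ps' \<kappa>'
  for P :: "'s rel" and M :: "('s, 'a) based" and W :: "'w set" and ps \<kappa>
    and N :: "('s, 'b) based" and W' :: "'v set" and ps' \<kappa>'
begin

sublocale TM: framed_group "total P M" W M.crd by (rule M.total_frame)
sublocale TN: framed_group "total P N" W' N.crd by (rule N.total_frame)

text \<open>It suffices to test the morphism condition on basis elements, where it says that the matrix is supported
  on the order relation.\<close>

lemma based_hom_iff:
  "f \<in> carrier (based_hom P M N) \<longleftrightarrow> f \<in> carrier (hom_group (total P M) (total P N)) \<and>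
    (\<forall>w\<in>W. \<forall>w'\<in>W'. N.crd (f (basis_elt (total P M) M.crd w)) w' \<noteq> 0 \<longrightarrow> (ps' w', ps w) \<in> P)"
proof -
  have "(\<forall>\<tau>\<in>Field P. f ` sum_incl (Field P) M \<tau> ` carrier (M \<tau>) \<subseteq> carrier (below P N \<tau>))
    \<longleftrightarrow> (\<forall>w\<in>W. \<forall>w'\<in>W'. N.crd (f (basis_elt (total P M) M.crd w)) w' \<noteq> 0 \<longrightarrow> (ps' w', ps w) \<in> P)"
    if f: "f \<in> carrier (hom_group (total P M) (total P N))"
  proof (intro iffI ballI impI subsetI)
    fix w w' assume *: "\<forall>\<tau>\<in>Field P. f ` sum_incl (Field P) M \<tau> ` carrier (M \<tau>) \<subseteq> carrier (below P N \<tau>)"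
      and w: "w \<in> W" "w' \<in> W'" "N.crd (f (basis_elt (total P M) M.crd w)) w' \<noteq> 0"
    have "f (basis_elt (total P M) M.crd w) \<in> carrier (below P N (ps w))"
      using * M.index_in[OF w(1)] M.basis_summand[OF w(1)] by (auto simp: M.basis_total[OF w(1)])
    with w show "(ps' w', ps w) \<in> P" by (simp add: N.carrier_below)
  next
    fix \<tau> y assume *: "\<forall>w\<in>W. \<forall>w'\<in>W'. N.crd (f (basis_elt (total P M) M.crd w)) w' \<noteq> 0 \<longrightarrow> (ps' w', ps w) \<in> P"
      and \<tau>: "\<tau> \<in> Field P" and "y \<in> f ` sum_incl (Field P) M \<tau> ` carrier (M \<tau>)"
    then obtain a where a: "a \<in> carrier (M \<tau>)" and y: "y = f (sum_incl (Field P) M \<tau> a)" by auto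
    let ?x = "sum_incl (Field P) M \<tau> a"
    have x: "?x \<in> carrier (total P M)" by (rule M.sum_incl_total[OF \<tau> a])
    have fh: "f \<in> hom (total P M) (total P N)" using f by (simp add: carrier_hom_group)
    show "y \<in> carrier (below P N \<tau>)"
      unfolding N.carrier_below y
    proof (intro conjI ballI impI)
      show "f ?x \<in> carrier (total P N)" using hom_in_carrier[OF fh x] .
      fix w' assume w': "w' \<in> W'" and ne: "N.crd (f ?x) w' \<noteq> 0"
      have "(\<lambda>x. N.crd (f x) w') \<in> hom (total P M) integer_group"
        using hom_compose[OF fh TN.coord_hom[of w']] by (simp add: o_def)
      from TM.int_hom_expansion[OF this x]
      have "N.crd (f ?x) w' = (\<Sum>w\<in>W. M.crd ?x w * N.crd (f (basis_elt (total P M) M.crd w)) w')" .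
      with ne obtain w where w: "w \<in> W" "M.crd ?x w * N.crd (f (basis_elt (total P M) M.crd w)) w' \<noteq> 0"
        by (metis (no_types, lifting) sum.neutral)
      then have "ps w = \<tau>" by (auto simp: M.coord_sum_incl[OF \<tau> a] split: if_splits)
      with * w w' show "(ps' w', \<tau>) \<in> P" by auto
    qed
  qed
  then show ?thesis by (auto simp: based_hom_def)
qed

lemma based_hom_hom: "f \<in> carrier (based_hom P M N) \<Longrightarrow> f \<in> hom (total P M) (total P N)"
  and based_hom_ext: "f \<in> carrier (based_hom P M N) \<Longrightarrow> f \<in> extensional (carrier (total P M))"
  and mult_based_hom: "f \<otimes>\<^bsub>based_hom P M N\<^esub> g = (\<lambda>x\<in>carrier (total P M). f x \<otimes>\<^bsub>total P N\<^esub> g x)"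
  and one_based_hom: "\<one>\<^bsub>based_hom P M N\<^esub> = (\<lambda>x\<in>carrier (total P M). \<one>\<^bsub>total P N\<^esub>)"
  by (auto simp: based_hom_def hom_group_def)

lemma based_hom_in: "f \<in> carrier (based_hom P M N) \<Longrightarrow> x \<in> carrier (total P M) \<Longrightarrow> f x \<in> carrier (total P N)"
  using hom_in_carrier[OF based_hom_hom] .

lemma based_hom_matrix:
  assumes "f \<in> carrier (based_hom P M N)" "x \<in> carrier (total P M)"
  shows "N.crd (f x) w' = (\<Sum>w\<in>W. M.crd x w * N.crd (f (basis_elt (total P M) M.crd w)) w')"
proof (rule TM.int_hom_expansion[OF _ assms(2)])
  show "(\<lambda>x. N.crd (f x) w') \<in> hom (total P M) integer_group"
    using hom_compose[OF based_hom_hom[OF assms(1)] TN.coord_hom[of w']] by (simp add: o_def)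
qed

text \<open>A function given in coordinates by a matrix is automatically a homomorphism, and it is a
  morphism of based modules as soon as the matrix respects the order.\<close>

lemma based_homI:
  assumes f: "f \<in> carrier (total P M) \<rightarrow> carrier (total P N)" and ext: "f \<in> extensional (carrier (total P M))"
    and A: "\<And>x w'. \<lbrakk>x \<in> carrier (total P M); w' \<in> W'\<rbrakk> \<Longrightarrow> N.crd (f x) w' = (\<Sum>w\<in>W. M.crd x w * A w w')"
    and P: "\<And>w w'. \<lbrakk>w \<in> W; w' \<in> W'; A w w' \<noteq> 0\<rbrakk> \<Longrightarrow> (ps' w', ps w) \<in> P"
  shows "f \<in> carrier (based_hom P M N)"
proof -
  have h: "f \<in> hom (total P M) (total P N)"
  proof (rule homI)
    fix x y assume xy: "x \<in> carrier (total P M)" "y \<in> carrier (total P M)"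
    show "f (x \<otimes>\<^bsub>total P M\<^esub> y) = f x \<otimes>\<^bsub>total P N\<^esub> f y"
      by (rule TN.coord_eq)
       (use funcset_mem[OF f] xy in \<open>simp_all add: A TN.coord_mult TM.coord_mult sum.distrib distrib_right\<close>)
  qed (use f in auto)
  have "N.crd (f (basis_elt (total P M) M.crd w)) w' = A w w'" if "w \<in> W" "w' \<in> W'" for w w'
    using that TM.fin by (simp add: A TM.basis_closed TM.coord_basis of_bool_def if_distrib[of "\<lambda>x. x * _"] cong: if_cong)
  then show ?thesis
    unfolding based_hom_iff using h ext P by (simp add: carrier_hom_group)
qed

lemma comm_group_based_hom: "comm_group (based_hom P M N)"
proof -
  let ?H = "hom_group (total P M) (total P N)" and ?b = "basis_elt (total P M) M.crd"
  interpret H: comm_group ?H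
    by (rule comm_group_hom_group[OF TM.group_axioms TN.comm])
  have H_in: "f (?b w) \<in> carrier (total P N)" if "f \<in> carrier ?H" "w \<in> W" for f w
    using that TM.basis_closed by (auto simp: carrier_hom_group hom_in_carrier)
  have m: "N.crd ((f \<otimes>\<^bsub>?H\<^esub> g) (?b w)) w' = N.crd (f (?b w)) w' + N.crd (g (?b w)) w'"
    if "f \<in> carrier ?H" "g \<in> carrier ?H" "w \<in> W" for f g w w'
    using that H_in TM.basis_closed by (simp add: mult_hom_group TN.coord_mult)
  have o: "N.crd (\<one>\<^bsub>?H\<^esub> (?b w)) w' = 0" if "w \<in> W" for w w'
    using that TM.basis_closed by (simp add: one_hom_group TN.coord_one)
  have i: "N.crd ((inv\<^bsub>?H\<^esub> f) (?b w)) w' = - N.crd (f (?b w)) w'" if "f \<in> carrier ?H" "w \<in> W" for f w w'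
    using m[OF that(1) H.inv_closed[OF that(1)] that(2), of w'] o[OF that(2), of w'] that by (simp add: eq_neg_iff_add_eq_0 add.commute)
  have sg: "subgroup (carrier (based_hom P M N)) ?H"
  proof (rule H.subgroupI)
    show "carrier (based_hom P M N) \<noteq> {}" using based_hom_iff[of "\<one>\<^bsub>?H\<^esub>"] o by auto
    fix f g assume fg: "f \<in> carrier (based_hom P M N)" "g \<in> carrier (based_hom P M N)"
    show "f \<otimes>\<^bsub>?H\<^esub> g \<in> carrier (based_hom P M N)"
      unfolding based_hom_iff
    proof (intro conjI ballI impI)
      show "f \<otimes>\<^bsub>?H\<^esub> g \<in> carrier ?H" using fg by (auto simp: based_hom_iff)
      fix w w' assume w: "w \<in> W" "w' \<in> W'" and ne: "N.crd ((f \<otimes>\<^bsub>?H\<^esub> g) (?b w)) w' \<noteq> 0"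
      then have "N.crd (f (?b w)) w' \<noteq> 0 \<or> N.crd (g (?b w)) w' \<noteq> 0"
        using fg m[of f g w w'] by (auto simp: based_hom_iff)
      then show "(ps' w', ps w) \<in> P" using fg w by (auto simp: based_hom_iff)
    qed
  qed (auto simp: based_hom_iff i)
  have eq: "?H\<lparr>carrier := carrier (based_hom P M N)\<rparr> = based_hom P M N"
    by (simp add: based_hom_def)
  have "group (based_hom P M N)" using H.subgroup_imp_group[OF sg] by (simp add: eq)
  then show ?thesis
  proof (rule group.group_comm_groupI)
    fix f g assume "f \<in> carrier (based_hom P M N)" "g \<in> carrier (based_hom P M N)"
    then show "f \<otimes>\<^bsub>based_hom P M N\<^esub> g = g \<otimes>\<^bsub>based_hom P M N\<^esub> f"
      unfolding mult_based_hom by (intro restrict_ext TN.m_comm based_hom_in)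
  qed
qed

lemma based_hom_int_pow:
  assumes "f \<in> carrier (based_hom P M N)" "x \<in> carrier (total P M)"
  shows "(f [^]\<^bsub>based_hom P M N\<^esub> (k::int)) x = f x [^]\<^bsub>total P N\<^esub> k"
proof -
  interpret B: comm_group "based_hom P M N" by (rule comm_group_based_hom)
  have "(\<lambda>f. f x) \<in> hom (based_hom P M N) (total P N)"
    by (rule homI) (use assms based_hom_in in \<open>auto simp: mult_based_hom\<close>)
  from hom_int_pow[OF this assms(1) B.group_axioms TN.group_axioms] show ?thesis .
qed

lemma based_hom_of_matrix:
  assumes "\<And>w w'. \<lbrakk>w \<in> W; w' \<in> W'; A w w' \<noteq> 0\<rbrakk> \<Longrightarrow> (ps' w', ps w) \<in> P"
  obtains f where "f \<in> carrier (based_hom P M N)"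
    "\<And>x w'. \<lbrakk>x \<in> carrier (total P M); w' \<in> W'\<rbrakk> \<Longrightarrow> N.crd (f x) w' = (\<Sum>w\<in>W. M.crd x w * A w w')"
proof -
  have "\<exists>y\<in>carrier (total P N). \<forall>w'\<in>W'. N.crd y w' = (\<Sum>w\<in>W. M.crd x w * A w w')" for x
    by (rule TN.coord_ex)
  then obtain g where g: "\<And>x. g x \<in> carrier (total P N)"
    "\<And>x w'. w' \<in> W' \<Longrightarrow> N.crd (g x) w' = (\<Sum>w\<in>W. M.crd x w * A w w')" by metis
  show ?thesis
    by (rule that[of "restrict g (carrier (total P M))"], rule based_homI[where A = A])
      (use g assms in auto)
qed

end

section \<open>Matrices over a poset\<close>

text \<open>The basis elements of a complex with their degrees and positions. The rows of a matrix belong to the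
  source: \<open>A v w\<close> is the coefficient of \<open>w\<close> in the image of \<open>v\<close>. Accordingly \<open>mmul J B A\<close> is the matrix of
  the composite of \<open>A\<close> followed by \<open>B\<close>, through the complex with basis \<open>J\<close>.\<close>

record ('w, 's) index =
  Ix :: "'w set"
  Dg :: "'w \<Rightarrow> int"
  Ps :: "'w \<Rightarrow> 's"

definition mats :: "'s rel \<Rightarrow> ('v, 's) index \<Rightarrow> ('w, 's) index \<Rightarrow> int \<Rightarrow> ('v \<Rightarrow> 'w \<Rightarrow> int) set" where
  "mats P I J n = {A. \<forall>v w. A v w \<noteq> 0 \<longrightarrow>
     v \<in> Ix I \<and> w \<in> Ix J \<and> Dg J w = Dg I v + n \<and> (Ps J w, Ps I v) \<in> P}"

definition mmul :: "('w, 's) index \<Rightarrow> ('w \<Rightarrow> 'x \<Rightarrow> int) \<Rightarrow> ('v \<Rightarrow> 'w \<Rightarrow> int) \<Rightarrow> ('v \<Rightarrow> 'x \<Rightarrow> int)" where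
  "mmul J B A = (\<lambda>v x. \<Sum>w\<in>Ix J. A v w * B w x)"

definition mone :: "('w, 's) index \<Rightarrow> ('w \<Rightarrow> 'w \<Rightarrow> int)" where
  "mone I = (\<lambda>v w. of_bool (v = w \<and> v \<in> Ix I))"

text \<open>The differential of the complex \<open>Hom(C, D)\<close>.\<close>

definition mbd :: "('v, 's) index \<Rightarrow> ('w, 's) index \<Rightarrow> int \<Rightarrow> ('v \<Rightarrow> 'v \<Rightarrow> int) \<Rightarrow> ('w \<Rightarrow> 'w \<Rightarrow> int)
    \<Rightarrow> ('v \<Rightarrow> 'w \<Rightarrow> int) \<Rightarrow> ('v \<Rightarrow> 'w \<Rightarrow> int)" where
  "mbd I J n dI dJ A = (\<lambda>v w. mmul J dJ A v w + parity_sign (n + 1) * mmul I A dI v w)"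

lemma matsD: "\<lbrakk>A \<in> mats P I J n; A v w \<noteq> 0\<rbrakk>
    \<Longrightarrow> v \<in> Ix I \<and> w \<in> Ix J \<and> Dg J w = Dg I v + n \<and> (Ps J w, Ps I v) \<in> P"
  by (auto simp: mats_def)

lemma matsI: "(\<And>v w. A v w \<noteq> 0 \<Longrightarrow> v \<in> Ix I \<and> w \<in> Ix J \<and> Dg J w = Dg I v + n \<and> (Ps J w, Ps I v) \<in> P)
    \<Longrightarrow> A \<in> mats P I J n"
  by (auto simp: mats_def)

lemma mats_out: "A \<in> mats P I J n \<Longrightarrow> v \<notin> Ix I \<Longrightarrow> A v w = 0" "A \<in> mats P I J n \<Longrightarrow> w \<notin> Ix J \<Longrightarrow> A v w = 0"
  by (auto simp: mats_def)

lemma mats_add: "\<lbrakk>A \<in> mats P I J n; B \<in> mats P I J n\<rbrakk> \<Longrightarrow> (\<lambda>v w. A v w + B v w) \<in> mats P I J n"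
  unfolding mats_def by (auto simp: add_nonneg_eq_0_iff) (metis add_0)+

lemma mats_scale: "A \<in> mats P I J n \<Longrightarrow> (\<lambda>v w. k v w * A v w) \<in> mats P I J n"
  by (auto simp: mats_def)

lemma mats_zero: "(\<lambda>v w. 0) \<in> mats P I J n"
  by (rule matsI) auto

lemma mats_mmul:
  assumes "trans P" "A \<in> mats P I J m" "B \<in> mats P J K n"
  shows "mmul J B A \<in> mats P I K (m + n)"
proof (rule matsI)
  fix v x assume "mmul J B A v x \<noteq> 0"
  then obtain w where "A v w * B w x \<noteq> 0" unfolding mmul_def by (meson sum.neutral)
  then have "A v w \<noteq> 0" "B w x \<noteq> 0" by auto
  from matsD[OF assms(2) this(1)] matsD[OF assms(3) this(2)] transD[OF assms(1)]
  show "v \<in> Ix I \<and> x \<in> Ix K \<and> Dg K x = Dg I v + (m + n) \<and> (Ps K x, Ps I v) \<in> P"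
    by auto
qed

lemma mats_mone: "(\<And>v. v \<in> Ix I \<Longrightarrow> (Ps I v, Ps I v) \<in> P) \<Longrightarrow> mone I \<in> mats P I I 0"
  by (rule matsI) (auto simp: mone_def)

lemma mmul_assoc: "mmul J (mmul K C B) A = mmul K C (mmul J B A)"
  unfolding mmul_def sum_distrib_left sum_distrib_right
  by (subst sum.swap) (simp add: mult.assoc)

lemma mmul_mone_left: "\<lbrakk>A \<in> mats P I J n; finite (Ix J)\<rbrakk> \<Longrightarrow> mmul J (mone J) A = A"
  proof (intro ext)
  fix v x assume A: "A \<in> mats P I J n" and J: "finite (Ix J)"
  have "mmul J (mone J) A v x = (\<Sum>w\<in>Ix J. if w = x then A v x else 0)"
    unfolding mmul_def mone_def by (rule sum.cong) auto
  also have "\<dots> = A v x" using J mats_out(2)[OF A] by simp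
  finally show "mmul J (mone J) A v x = A v x" .
qed

lemma mmul_mone_right: "\<lbrakk>A \<in> mats P I J n; finite (Ix I)\<rbrakk> \<Longrightarrow> mmul I A (mone I) = A"
proof (intro ext)
  fix v x assume A: "A \<in> mats P I J n" and I: "finite (Ix I)"
  have "mmul I A (mone I) v x = (\<Sum>w\<in>Ix I. if w = v then A v x else 0)"
    unfolding mmul_def mone_def by (rule sum.cong) auto
  also have "\<dots> = A v x" using I mats_out(1)[OF A] by simp
  finally show "mmul I A (mone I) v x = A v x" .
qed

lemma mats_mbd:
  assumes "trans P" "A \<in> mats P I J n" "dI \<in> mats P I I (-1)" "dJ \<in> mats P J J (-1)"
  shows "mbd I J n dI dJ A \<in> mats P I J (n - 1)"
  unfolding mbd_def using mats_mmul[OF assms(1,2,4)] mats_mmul[OF assms(1,3,2)]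
  by (intro mats_add mats_scale) (simp_all add: add.commute)

lemma parity_sign_square [simp]: "parity_sign n * parity_sign n = 1"
  by (simp add: parity_sign_def)

lemma parity_sign_square' [simp]: "parity_sign n * (parity_sign n * k) = k"
  by (simp add: parity_sign_def)

section \<open>The matrices of the tensor product, of the dual and of \<open>\<tau>\<close>\<close>

text \<open>The basis elements \<open>x \<otimes> c\<close> of \<open>E \<otimes> [C]\<close>: the element \<open>c\<close> occurs in \<open>[C](\<sigma>)\<close> exactly for the \<open>\<sigma>\<close> above its
  position.\<close>

definition tensor_index :: "'s rel \<Rightarrow> ('x, 's) index \<Rightarrow> ('w, 's) index \<Rightarrow> ('x \<times> 'w, 's) index" where
  "tensor_index P E I = \<lparr>Ix = {(x, c). x \<in> Ix E \<and> c \<in> Ix I \<and> (Ps I c, Ps E x) \<in> P},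
     Dg = (\<lambda>(x, c). Dg E x + Dg I c), Ps = (\<lambda>(x, c). Ps E x)\<rparr>"

definition dual_index :: "('w, 's) index \<Rightarrow> ('w, 's) index" where
  "dual_index I = \<lparr>Ix = Ix I, Dg = (\<lambda>w. - Dg I w), Ps = Ps I\<rparr>"

abbreviation T_index where "T_index P E I \<equiv> dual_index (tensor_index P E I)"

definition tensor_bd :: "'s rel \<Rightarrow> ('x, 's) index \<Rightarrow> ('w, 's) index \<Rightarrow> ('x \<Rightarrow> 'x \<Rightarrow> int) \<Rightarrow> ('w \<Rightarrow> 'w \<Rightarrow> int)
    \<Rightarrow> ('x \<times> 'w \<Rightarrow> 'x \<times> 'w \<Rightarrow> int)" where
  "tensor_bd P E I dE dI = (\<lambda>(x, c) (x', c'). of_bool ((x, c) \<in> Ix (tensor_index P E I)) *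
     (of_bool (c = c') * dE x x' + of_bool (x = x') * (parity_sign (Dg E x) * dI c c')))"

definition T_bd where
  "T_bd P E I dE dI = (\<lambda>a b. parity_sign (Dg (T_index P E I) a + 1) * tensor_bd P E I dE dI b a)"

definition tensor_mat :: "'s rel \<Rightarrow> ('x, 's) index \<Rightarrow> ('w, 's) index \<Rightarrow> ('w \<Rightarrow> 'v \<Rightarrow> int)
    \<Rightarrow> ('x \<times> 'w \<Rightarrow> 'x \<times> 'v \<Rightarrow> int)" where
  "tensor_mat P E I A = (\<lambda>(x, c) (x', c'). of_bool ((x, c) \<in> Ix (tensor_index P E I) \<and> x = x') * A c c')"

definition T_mat where
  "T_mat P E I A = (\<lambda>a b. tensor_mat P E I A b a)"

text \<open>For \<open>x\<close>, \<open>c\<close> and \<open>c'\<close> of degrees \<open>d\<close>, \<open>y\<close> and \<open>z\<close>, the maps \<open>S\<close>, \<open>sw\<close> and \<open>S\<close> contribute the exponents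
  \<open>(d + y) z + d + y\<close>, \<open>y z\<close> and \<open>(d + z) y + d + z\<close>; this is their sum modulo \<open>2\<close>.\<close>

definition tau_sign :: "int \<Rightarrow> int \<Rightarrow> int \<Rightarrow> int" where
  "tau_sign d y z = parity_sign (d * (y + z) + y * z + y + z)"

definition tau_mat :: "('x, 's) index \<Rightarrow> ('v, 's) index \<Rightarrow> ('w, 's) index
    \<Rightarrow> ('x \<times> 'v \<Rightarrow> 'w \<Rightarrow> int) \<Rightarrow> ('x \<times> 'w \<Rightarrow> 'v \<Rightarrow> int)" where
  "tau_mat E I J A = (\<lambda>(x, c') c. tau_sign (Dg E x) (Dg I c) (Dg J c') * A (x, c) c')"

lemma index_simps [simp]:
  "Ix (dual_index I) = Ix I" "Dg (dual_index I) w = - Dg I w" "Ps (dual_index I) = Ps I"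
  "(x, c) \<in> Ix (tensor_index P E I) \<longleftrightarrow> x \<in> Ix E \<and> c \<in> Ix I \<and> (Ps I c, Ps E x) \<in> P"
  "Dg (tensor_index P E I) (x, c) = Dg E x + Dg I c" "Ps (tensor_index P E I) (x, c) = Ps E x"
  by (simp_all add: dual_index_def tensor_index_def)

lemma Ix_tensor_subset: "Ix (tensor_index P E I) \<subseteq> Ix E \<times> Ix I"
  by (auto simp: tensor_index_def)

lemma finite_tensor_index: "finite (Ix E) \<Longrightarrow> finite (Ix I) \<Longrightarrow> finite (Ix (tensor_index P E I))"
  using Ix_tensor_subset finite_subset by (metis finite_SigmaI)

text \<open>The differential of \<open>E\<close> is supported on the opposite order, because \<open>E\<close> is a complex over
  \<open>\<int>(P\<^sup>o\<^sup>p)\<close>-mod.\<close>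

locale tensor_matrices =
  fixes P :: "'s rel" and E :: "('x, 's) index" and dE :: "'x \<Rightarrow> 'x \<Rightarrow> int"
  assumes trans_P: "trans P" and refl_E: "x \<in> Ix E \<Longrightarrow> (Ps E x, Ps E x) \<in> P" and finite_E: "finite (Ix E)"
    and dE: "dE \<in> mats (P\<inverse>) E E (-1)" and dE_dE: "mmul E dE dE = (\<lambda>_ _. 0)"
begin

abbreviation W where "W I \<equiv> tensor_index P E I"
abbreviation T where "T I \<equiv> T_index P E I"
abbreviation bdW where "bdW I dI \<equiv> tensor_bd P E I dE dI"
abbreviation bdT where "bdT I dI \<equiv> T_bd P E I dE dI"

lemma tensor_bd_mats:
  assumes "dI \<in> mats P I I (-1)"
  shows "bdW I dI \<in> mats (P\<inverse>) (W I) (W I) (-1)"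
proof (rule matsI)
  fix a b assume ne: "bdW I dI a b \<noteq> 0"
  obtain x c x' c' where ab: "a = (x, c)" "b = (x', c')" by (cases a; cases b)
  have m: "x \<in> Ix E" "c \<in> Ix I" "(Ps I c, Ps E x) \<in> P"
    and "(c = c' \<and> dE x x' \<noteq> 0) \<or> (x = x' \<and> dI c c' \<noteq> 0)"
    using ne by (auto simp: ab tensor_bd_def split: if_splits)
  then show "a \<in> Ix (W I) \<and> b \<in> Ix (W I) \<and> Dg (W I) b = Dg (W I) a + - 1 \<and> (Ps (W I) b, Ps (W I) a) \<in> P\<inverse>"
    using matsD[OF dE, of x x'] matsD[OF assms, of c c'] transD[OF trans_P] refl_E by (auto simp: ab)
qed

lemma tensor_bd_sum_left:
  assumes "finite (Ix I)" "\<And>a. a \<notin> Ix (W I) \<Longrightarrow> g a = 0"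
  shows "(\<Sum>a\<in>Ix (W I). g a * bdW I dI a (x', c')) =
    (\<Sum>x\<in>Ix E. g (x, c') * dE x x') + parity_sign (Dg E x') * (\<Sum>c\<in>Ix I. g (x', c) * dI c c')"
proof -
  have o: "g (x, c) = 0" if "x \<notin> Ix E \<or> c \<notin> Ix I" for x c using assms(2)[of "(x, c)"] that by auto
  have "(\<Sum>a\<in>Ix (W I). g a * bdW I dI a (x', c')) = (\<Sum>a\<in>Ix E \<times> Ix I. g a * bdW I dI a (x', c'))"
    by (rule sum.mono_neutral_left) (use assms finite_E Ix_tensor_subset in auto)
  also have "\<dots> = (\<Sum>(x, c)\<in>Ix E \<times> Ix I. of_bool (c = c') * (g (x, c) * dE x x')
      + of_bool (x = x') * (parity_sign (Dg E x') * (g (x, c) * dI c c')))"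
    by (rule sum.cong) (use assms(2) in \<open>auto simp: tensor_bd_def algebra_simps\<close>)
  also have "\<dots> = (\<Sum>x\<in>Ix E. \<Sum>c\<in>Ix I. of_bool (c = c') * (g (x, c) * dE x x'))
      + (\<Sum>x\<in>Ix E. \<Sum>c\<in>Ix I. of_bool (x = x') * (parity_sign (Dg E x') * (g (x, c) * dI c c')))"
    by (simp add: sum.cartesian_product[symmetric] sum.distrib)
  also have "(\<Sum>x\<in>Ix E. \<Sum>c\<in>Ix I. of_bool (c = c') * (g (x, c) * dE x x')) = (\<Sum>x\<in>Ix E. g (x, c') * dE x x')"
    using assms(1) by (intro sum.cong) (auto simp: of_bool_def if_distrib[of "\<lambda>x. x * _"] o cong: if_cong)
  also have "(\<Sum>x\<in>Ix E. \<Sum>c\<in>Ix I. of_bool (x = x') * (parity_sign (Dg E x') * (g (x, c) * dI c c')))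
     = parity_sign (Dg E x') * (\<Sum>c\<in>Ix I. g (x', c) * dI c c')"
    using finite_E
    by (subst sum.swap, unfold sum_distrib_left, intro sum.cong)
      (auto simp: of_bool_def if_distrib[of "\<lambda>x. x * _"] o cong: if_cong)
  finally show ?thesis .
qed

lemma T_bd_mats: "dI \<in> mats P I I (-1) \<Longrightarrow> bdT I dI \<in> mats P (T I) (T I) (-1)"
  by (rule matsI) (use matsD[OF tensor_bd_mats] in \<open>fastforce simp: T_bd_def\<close>)

text \<open>The sign \<open>(-1)^|x|\<close> in front of the second differential makes the two mixed terms cancel. Transitivity
  enters because a step of \<open>dE\<close> or \<open>dI\<close> must not leave the set of pairs \<open>(x, c)\<close> with \<open>c\<close> below \<open>x\<close>.\<close>

lemma tensor_bd_squared:
  assumes "finite (Ix I)" "dI \<in> mats P I I (-1)" "mmul I dI dI = (\<lambda>_ _. 0)"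
  shows "mmul (W I) (bdW I dI) (bdW I dI) = (\<lambda>_ _. 0)"
proof (intro ext, clarify)
  fix x c x'' c''
  note mW = tensor_bd_mats[OF assms(2)]
  show "mmul (W I) (bdW I dI) (bdW I dI) (x, c) (x'', c'') = 0"
  proof (cases "(x, c) \<in> Ix (W I)")
    case False
    then show ?thesis by (simp add: mmul_def mats_out(1)[OF mW] del: index_simps)
  next
    case True
    have e: "(\<Sum>y\<in>Ix E. dE x y * dE y x'') = 0" using fun_cong[OF fun_cong[OF dE_dE, of x], of x''] by (simp add: mmul_def)
    have i: "(\<Sum>b\<in>Ix I. dI c b * dI b c'') = 0" using fun_cong[OF fun_cong[OF assms(3), of c], of c''] by (simp add: mmul_def)
    have s: "dE x x'' * dI c c'' * parity_sign (Dg E x'') = - (dE x x'' * dI c c'' * parity_sign (Dg E x))"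
      using matsD[OF dE, of x x''] by (cases "dE x x'' = 0") (auto simp: parity_sign_def)
    have x: "x \<in> Ix E" "c \<in> Ix I" using True by auto
    have E0: "dE x y = 0" if "y \<notin> Ix E" for y using mats_out(2)[OF dE that] .
    have I0: "dI c y = 0" if "y \<notin> Ix I" for y using mats_out(2)[OF assms(2) that] .
    have "mmul (W I) (bdW I dI) (bdW I dI) (x, c) (x'', c'') =
       (\<Sum>y\<in>Ix E. bdW I dI (x, c) (y, c'') * dE y x'') + parity_sign (Dg E x'') * (\<Sum>b\<in>Ix I. bdW I dI (x, c) (x'', b) * dI b c'')"
      unfolding mmul_def
      by (rule tensor_bd_sum_left[OF assms(1)]) (rule mats_out(2)[OF mW])
    also have "\<dots> = (\<Sum>y\<in>Ix E. of_bool (c = c'') * (dE x y * dE y x'') + of_bool (x = y) * (parity_sign (Dg E x) * dI c c'' * dE y x''))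
      + parity_sign (Dg E x'') * (\<Sum>b\<in>Ix I. of_bool (c = b) * (dE x x'' * dI b c'') + of_bool (x = x'') * (parity_sign (Dg E x) * (dI c b * dI b c'')))"
      using True by (simp add: tensor_bd_def algebra_simps del: index_simps)
    also have "\<dots> = of_bool (c = c'') * (\<Sum>y\<in>Ix E. dE x y * dE y x'')
        + (\<Sum>y\<in>Ix E. of_bool (x = y) * (parity_sign (Dg E x) * dI c c'' * dE y x''))
      + parity_sign (Dg E x'') * ((\<Sum>b\<in>Ix I. of_bool (c = b) * (dE x x'' * dI b c''))
        + of_bool (x = x'') * (parity_sign (Dg E x) * (\<Sum>b\<in>Ix I. dI c b * dI b c'')))"
      by (simp only: sum.distrib sum_distrib_left[symmetric])
    also have "\<dots> = parity_sign (Dg E x) * dI c c'' * dE x x'' + parity_sign (Dg E x'') * (dE x x'' * dI c c'')"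
      using x finite_E assms(1) unfolding e i
      by (simp add: of_bool_def if_distrib[of "\<lambda>x. x * _"] cong: if_cong)
    also have "\<dots> = 0" using s by (simp add: algebra_simps)
    finally show ?thesis .
  qed
qed

lemma T_bd_squared:
  assumes "finite (Ix I)" "dI \<in> mats P I I (-1)" "mmul I dI dI = (\<lambda>_ _. 0)"
  shows "mmul (T I) (bdT I dI) (bdT I dI) = (\<lambda>_ _. 0)"
proof (intro ext)
  fix a b
  have "mmul (T I) (bdT I dI) (bdT I dI) a b =
    (\<Sum>w\<in>Ix (W I). - (bdW I dI b w * bdW I dI w a))"
    unfolding mmul_def
  proof (rule sum.cong)
    fix w
    show "bdT I dI a w * bdT I dI w b = - (bdW I dI b w * bdW I dI w a)"
      using matsD[OF tensor_bd_mats[OF assms(2)], of w a]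
      by (cases "bdW I dI w a = 0") (auto simp: T_bd_def parity_sign_def)
  qed simp
  also have "\<dots> = - mmul (W I) (bdW I dI) (bdW I dI) b a" by (simp add: mmul_def sum_negf)
  finally show "mmul (T I) (bdT I dI) (bdT I dI) a b = 0" by (simp add: tensor_bd_squared[OF assms])
qed

lemma T_bd_sum:
  assumes "finite (Ix I)" "\<And>a. a \<notin> Ix (W I) \<Longrightarrow> g a = 0"
  shows "(\<Sum>a\<in>Ix (T I). bdT I dI (x, c) a * g a) = parity_sign (Dg E x + Dg I c + 1) *
    ((\<Sum>y\<in>Ix E. g (y, c) * dE y x) + parity_sign (Dg E x) * (\<Sum>b\<in>Ix I. g (x, b) * dI b c))"
proof -
  have "(\<Sum>a\<in>Ix (T I). bdT I dI (x, c) a * g a)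
    = parity_sign (Dg E x + Dg I c + 1) * (\<Sum>a\<in>Ix (W I). g a * bdW I dI a (x, c))"
    unfolding sum_distrib_left by (rule sum.cong) (auto simp: T_bd_def parity_sign_def)
  also have "(\<Sum>a\<in>Ix (W I). g a * bdW I dI a (x, c)) =
      (\<Sum>y\<in>Ix E. g (y, c) * dE y x) + parity_sign (Dg E x) * (\<Sum>b\<in>Ix I. g (x, b) * dI b c)"
    by (rule tensor_bd_sum_left) (use assms in auto)
  finally show ?thesis .
qed

lemma tau_mat_mats: "A \<in> mats P (T I) J n \<Longrightarrow> tau_mat E I J A \<in> mats P (T J) I n"
  by (rule matsI) (auto simp: tau_mat_def dest!: matsD)

lemma tau_mat_involution: "tau_mat E J I (tau_mat E I J A) = A"
  by (intro ext) (auto simp: tau_mat_def tau_sign_def add.commute mult.commute add.left_commute)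

text \<open>Both sides consist of a term with \<open>dE\<close>, a term with \<open>dI\<close> and a term with \<open>dJ\<close>; the last two exchange
  their roles as differential of the source and of the target. What has to be checked is that \<open>tau_sign\<close>
  compensates the signs in the differentials of \<open>T\<close> and \<open>Hom\<close>.\<close>

lemma tau_mat_chain:
  assumes "finite (Ix I)" "finite (Ix J)" "dI \<in> mats P I I (-1)" "dJ \<in> mats P J J (-1)"
    and F: "F \<in> mats P (T I) J n"
  shows "tau_mat E I J (mbd (T I) J n (bdT I dI) dJ F) = mbd (T J) I n (bdT J dJ) dI (tau_mat E I J F)"
proof (intro ext, clarify)
  fix x c' c
  note F' = tau_mat_mats[OF F]
  let ?s = "tau_sign (Dg E x) (Dg I c) (Dg J c')"
  have F0: "F (x, b) y \<noteq> 0 \<Longrightarrow> Dg J y = n - Dg E x - Dg I b" for x b y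
    using matsD[OF F, of "(x, b)" y] by auto
  have 1: "mbd (T I) J n (bdT I dI) dJ F (x, c) c' = (\<Sum>y\<in>Ix J. F (x, c) y * dJ y c') +
     parity_sign (n + 1) * (parity_sign (Dg E x + Dg I c + 1) *
     ((\<Sum>y\<in>Ix E. F (y, c) c' * dE y x) + parity_sign (Dg E x) * (\<Sum>b\<in>Ix I. F (x, b) c' * dI b c)))"
    unfolding mbd_def mmul_def
    by (subst T_bd_sum[OF assms(1)]) (use mats_out(1)[OF F] in auto)
  have 2: "mbd (T J) I n (bdT J dJ) dI (tau_mat E I J F) (x, c') c = (\<Sum>b\<in>Ix I. tau_mat E I J F (x, c') b * dI b c) +
     parity_sign (n + 1) * (parity_sign (Dg E x + Dg J c' + 1) *
     ((\<Sum>y\<in>Ix E. tau_mat E I J F (y, c') c * dE y x) + parity_sign (Dg E x) * (\<Sum>y\<in>Ix J. tau_mat E I J F (x, y) c * dJ y c')))"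
    unfolding mbd_def mmul_def
    by (subst T_bd_sum[OF assms(2)]) (use mats_out(1)[OF F'] in auto)
  have a: "?s * (F (x, c) y * dJ y c') = parity_sign (n + 1) * (parity_sign (Dg E x + Dg J c' + 1) *
       (parity_sign (Dg E x) * (tau_mat E I J F (x, y) c * dJ y c')))" for y
    using F0[of x c y] matsD[OF assms(4), of y c']
    by (cases "F (x, c) y = 0 \<or> dJ y c' = 0") (auto simp: tau_mat_def tau_sign_def parity_sign_def)
  have b: "?s * (parity_sign (n + 1) * (parity_sign (Dg E x + Dg I c + 1) * (F (y, c) c' * dE y x)))
     = parity_sign (n + 1) * (parity_sign (Dg E x + Dg J c' + 1) * (tau_mat E I J F (y, c') c * dE y x))" for y
    using F0[of y c c'] matsD[OF dE, of y x]
    by (cases "F (y, c) c' = 0 \<or> dE y x = 0") (auto simp: tau_mat_def tau_sign_def parity_sign_def)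
  have c: "?s * (parity_sign (n + 1) * (parity_sign (Dg E x + Dg I c + 1) * (parity_sign (Dg E x) * (F (x, b) c' * dI b c))))
     = tau_mat E I J F (x, c') b * dI b c" for b
    using F0[of x b c'] matsD[OF assms(3), of b c]
    by (cases "F (x, b) c' = 0 \<or> dI b c = 0") (auto simp: tau_mat_def tau_sign_def parity_sign_def)
  note sums = sum_distrib_left a b c
  have "tau_mat E I J (mbd (T I) J n (bdT I dI) dJ F) (x, c') c = ?s * mbd (T I) J n (bdT I dI) dJ F (x, c) c'"
    by (simp add: tau_mat_def)
  also have "\<dots> = ?s * (\<Sum>y\<in>Ix J. F (x, c) y * dJ y c')
      + (?s * (parity_sign (n + 1) * (parity_sign (Dg E x + Dg I c + 1) * (\<Sum>y\<in>Ix E. F (y, c) c' * dE y x)))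
      + ?s * (parity_sign (n + 1) * (parity_sign (Dg E x + Dg I c + 1) * (parity_sign (Dg E x) * (\<Sum>b\<in>Ix I. F (x, b) c' * dI b c)))))"
    unfolding 1 by (simp only: distrib_left)
  also have "\<dots> = mbd (T J) I n (bdT J dJ) dI (tau_mat E I J F) (x, c') c"
    unfolding 2 sum_distrib_left a b c distrib_left by (simp only: add_ac)
  finally show "tau_mat E I J (mbd (T I) J n (bdT I dI) dJ F) (x, c') c = \<dots>" .
qed

lemma tensor_mat_mats: "A \<in> mats P I J 0 \<Longrightarrow> tensor_mat P E I A \<in> mats (P\<inverse>) (W I) (W J) 0"
  by (rule matsI) (use trans_P refl_E in \<open>auto simp: tensor_mat_def dest!: matsD intro: transD\<close>)

lemma T_mat_mats: "A \<in> mats P I J 0 \<Longrightarrow> T_mat P E I A \<in> mats P (T J) (T I) 0"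
  by (rule matsI) (use matsD[OF tensor_mat_mats] in \<open>fastforce simp: T_mat_def\<close>)

text \<open>Multiplication by the matrix of \<open>T f\<close> leaves \<open>x\<close> alone. The entries of \<open>A\<close> only lead to elements
  \<open>c'\<close> below \<open>c\<close>, so the sum may be extended from the pairs \<open>(x, c')\<close> to all \<open>c'\<close>.\<close>

lemma T_mat_sum_left:
  assumes "finite (Ix J)" "A \<in> mats P I J 0" "\<And>a. a \<notin> Ix (W J) \<Longrightarrow> g a = 0"
  shows "(\<Sum>a\<in>Ix (T J). g a * T_mat P E I A a (x, c)) = of_bool ((x, c) \<in> Ix (W I)) * (\<Sum>c'\<in>Ix J. g (x, c') * A c c')"
proof -
  have "(\<Sum>a\<in>Ix (T J). g a * T_mat P E I A a (x, c)) = (\<Sum>a\<in>Ix E \<times> Ix J. g a * T_mat P E I A a (x, c))"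
    by (rule sum.mono_neutral_left) (use assms finite_E Ix_tensor_subset in auto)
  also have "\<dots> = (\<Sum>c'\<in>Ix J. \<Sum>x'\<in>Ix E. of_bool (x' = x) * (of_bool ((x, c) \<in> Ix (W I)) * (g (x, c') * A c c')))"
    by (subst sum.swap, unfold sum.cartesian_product, rule sum.cong) (auto simp: T_mat_def tensor_mat_def)
  also have "\<dots> = of_bool ((x, c) \<in> Ix (W I)) * (\<Sum>c'\<in>Ix J. g (x, c') * A c c')"
    using finite_E unfolding sum_distrib_left
    by (intro sum.cong) (auto simp: of_bool_def if_distrib[of "\<lambda>x. x * _"] cong: if_cong)
  finally show ?thesis .
qed

lemma T_mat_sum_right:
  assumes "finite (Ix I)" "A \<in> mats P I J 0" "\<And>a. a \<notin> Ix (W I) \<Longrightarrow> g a = 0"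
  shows "(\<Sum>a\<in>Ix (T I). T_mat P E I A (x, c') a * g a) = (\<Sum>c\<in>Ix I. A c c' * g (x, c))"
proof -
  have o: "g (x, c) = 0" if "x \<notin> Ix E" for x c using assms(3)[of "(x, c)"] that by auto
  have "(\<Sum>a\<in>Ix (T I). T_mat P E I A (x, c') a * g a) = (\<Sum>a\<in>Ix E \<times> Ix I. T_mat P E I A (x, c') a * g a)"
    by (rule sum.mono_neutral_left) (use assms finite_E Ix_tensor_subset in auto)
  also have "\<dots> = (\<Sum>c\<in>Ix I. \<Sum>x'\<in>Ix E. of_bool (x' = x) * (A c c' * g (x, c)))"
    by (subst sum.swap, unfold sum.cartesian_product, rule sum.cong)
      (use assms(3) in \<open>auto simp: T_mat_def tensor_mat_def\<close>)
  also have "\<dots> = (\<Sum>c\<in>Ix I. A c c' * g (x, c))"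
    using finite_E by (intro sum.cong) (auto simp: of_bool_def if_distrib[of "\<lambda>x. x * _"] o cong: if_cong)
  finally show ?thesis .
qed

lemma T_mat_mone: "T_mat P E I (mone I) = mone (T I)"
  by (intro ext) (auto simp: T_mat_def tensor_mat_def mone_def)

lemma T_mat_mmul:
  assumes "finite (Ix I)" "finite (Ix J)" "A \<in> mats P I J 0" "B \<in> mats P J K 0"
  shows "T_mat P E I (mmul J B A) = mmul (T J) (T_mat P E I A) (T_mat P E J B)"
proof (intro ext, clarify)
  fix x c'' x' c
  have "mmul (T J) (T_mat P E I A) (T_mat P E J B) (x, c'') (x', c) =
    of_bool ((x', c) \<in> Ix (W I)) * (\<Sum>c'\<in>Ix J. T_mat P E J B (x, c'') (x', c') * A c c')"
    unfolding mmul_def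
    by (rule T_mat_sum_left[OF assms(2,3)]) (use mats_out(2)[OF T_mat_mats[OF assms(4)]] in auto)
  also have "\<dots> = T_mat P E I (mmul J B A) (x, c'') (x', c)"
  proof (cases "(x', c) \<in> Ix (W I)")
    case True
    have *: "T_mat P E J B (x, c'') (x', c') * A c c' = of_bool (x' = x) * (A c c' * B c' c'')" for c'
      using matsD[OF assms(3), of c c'] True transD[OF trans_P, of "Ps J c'" "Ps I c" "Ps E x'"]
      by (cases "A c c' = 0") (auto simp: T_mat_def tensor_mat_def)
    have "(\<Sum>c'\<in>Ix J. T_mat P E J B (x, c'') (x', c') * A c c') = of_bool (x' = x) * mmul J B A c c''"
      unfolding mmul_def sum_distrib_left * ..
    with True show ?thesis by (simp add: T_mat_def tensor_mat_def del: index_simps)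
  qed (simp add: T_mat_def tensor_mat_def del: index_simps)
  finally show "T_mat P E I (mmul J B A) (x, c'') (x', c) = mmul (T J) (T_mat P E I A) (T_mat P E J B) (x, c'') (x', c)" ..
qed

lemma T_mat_add: "T_mat P E I (\<lambda>v w. A v w + B v w) = (\<lambda>v w. T_mat P E I A v w + T_mat P E I B v w)"
  by (intro ext) (auto simp: T_mat_def tensor_mat_def distrib_left)

lemma tau_mat_natural:
  assumes fin: "finite (Ix I)" "finite (Ix J)" "finite (Ix I')" "finite (Ix J')"
    and A: "A \<in> mats P I I' 0" and B: "B \<in> mats P J J' 0" and F: "F \<in> mats P (T I) J n"
  shows "tau_mat E I' J' (mmul J B (mmul (T I) F (T_mat P E I A))) =
    mmul I A (mmul (T J) (tau_mat E I J F) (T_mat P E J B))"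
proof (intro ext, clarify)
  fix x d' c'
  note F' = tau_mat_mats[OF F]
  have 1: "mmul (T I) F (T_mat P E I A) (x, c') d = (\<Sum>c\<in>Ix I. A c c' * F (x, c) d)" for d
    unfolding mmul_def by (rule T_mat_sum_right[OF fin(1) A]) (use mats_out(1)[OF F] in auto)
  have 2: "mmul (T J) (tau_mat E I J F) (T_mat P E J B) (x, d') c = (\<Sum>d\<in>Ix J. B d d' * tau_mat E I J F (x, d) c)" for c
    unfolding mmul_def by (rule T_mat_sum_right[OF fin(2) B]) (use mats_out(1)[OF F'] in auto)
  have s: "tau_sign (Dg E x) (Dg I' c') (Dg J' d') * (A c c' * F (x, c) d * B d d') = B d d' * tau_mat E I J F (x, d) c * A c c'" for c d
    using matsD[OF A, of c c'] matsD[OF B, of d d']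
    by (cases "A c c' = 0 \<or> B d d' = 0") (auto simp: tau_mat_def)
  have "tau_mat E I' J' (mmul J B (mmul (T I) F (T_mat P E I A))) (x, d') c' =
    tau_sign (Dg E x) (Dg I' c') (Dg J' d') * (\<Sum>d\<in>Ix J. (\<Sum>c\<in>Ix I. A c c' * F (x, c) d) * B d d')"
    by (simp add: tau_mat_def mmul_def[of J] 1)
  also have "\<dots> = (\<Sum>d\<in>Ix J. \<Sum>c\<in>Ix I. B d d' * tau_mat E I J F (x, d) c * A c c')"
    by (simp add: sum_distrib_left sum_distrib_right s)
  also have "\<dots> = mmul I A (mmul (T J) (tau_mat E I J F) (T_mat P E J B)) (x, d') c'"
    unfolding mmul_def[of I] 2 sum_distrib_right by (rule sum.swap)
  finally show "tau_mat E I' J' (mmul J B (mmul (T I) F (T_mat P E I A))) (x, d') c' = \<dots>" .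
qed

lemma T_mat_chain:
  assumes fin: "finite (Ix I)" "finite (Ix J)" and dI: "dI \<in> mats P I I (-1)" and dJ: "dJ \<in> mats P J J (-1)"
    and A: "A \<in> mats P I J 0" and ch: "mbd I J 0 dI dJ A = (\<lambda>_ _. 0)"
  shows "mbd (T J) (T I) 0 (bdT J dJ) (bdT I dI) (T_mat P E I A) = (\<lambda>_ _. 0)"
proof (intro ext, clarify)
  fix x c' x' c
  note TA = T_mat_mats[OF A]
  have 1: "mmul (T I) (bdT I dI) (T_mat P E I A) (x, c') (x', c) = (\<Sum>b\<in>Ix I. A b c' * bdT I dI (x, b) (x', c))"
    unfolding mmul_def by (rule T_mat_sum_right[OF fin(1) A]) (rule mats_out(1)[OF T_bd_mats[OF dI]], simp)
  have 2: "mmul (T J) (T_mat P E I A) (bdT J dJ) (x, c') (x', c) =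
      of_bool ((x', c) \<in> Ix (W I)) * (\<Sum>b'\<in>Ix J. bdT J dJ (x, c') (x', b') * A c b')"
    unfolding mmul_def by (rule T_mat_sum_left[OF fin(2) A]) (rule mats_out(2)[OF T_bd_mats[OF dJ]], simp)
  show "mbd (T J) (T I) 0 (bdT J dJ) (bdT I dI) (T_mat P E I A) (x, c') (x', c) = 0"
  proof (cases "(x', c) \<in> Ix (W I)")
    case False
    then show ?thesis unfolding mbd_def 1 2 by (simp add: T_bd_def tensor_bd_def del: index_simps)
  next
    case True
    let ?K = "parity_sign (Dg E x + Dg J c' + 1)" and ?s = "parity_sign (Dg E x)"
    have c: "c \<in> Ix I" using True by simp
    have a: "A b c' * bdT I dI (x, b) (x', c) = ?K * (of_bool (b = c) * (A c c' * dE x' x)) +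
        ?K * (of_bool (x = x') * ?s) * (dI c b * A b c')" for b
      using True matsD[OF A, of b c']
      by (cases "A b c' = 0") (auto simp: T_bd_def tensor_bd_def parity_sign_def algebra_simps)
    have b: "bdT J dJ (x, c') (x', b') * A c b' = ?K * (of_bool (b' = c') * (A c c' * dE x' x)) +
        ?K * (of_bool (x = x') * ?s) * (A c b' * dJ b' c')" for b'
      using True matsD[OF A, of c b'] transD[OF trans_P, of "Ps J b'" "Ps I c" "Ps E x'"]
      by (cases "A c b' = 0") (auto simp: T_bd_def tensor_bd_def parity_sign_def algebra_simps)
    have "(\<Sum>b\<in>Ix I. ?K * (of_bool (b = c) * (A c c' * dE x' x))) = ?K * (A c c' * dE x' x)"
      using fin(1) c by (simp add: of_bool_def if_distrib[of "\<lambda>x. x * _"] if_distrib[of "\<lambda>x. _ * x"] cong: if_cong)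
    moreover have "(\<Sum>b\<in>Ix J. ?K * (of_bool (b = c') * (A c c' * dE x' x))) = ?K * (A c c' * dE x' x)"
      using fin(2) mats_out(2)[OF A, of c' c]
      by (auto simp add: of_bool_def if_distrib[of "\<lambda>x. x * _"] if_distrib[of "\<lambda>x. _ * x"] cong: if_cong)
    moreover have "(\<Sum>b\<in>Ix I. dI c b * A b c') = (\<Sum>b'\<in>Ix J. A c b' * dJ b' c')"
      using fun_cong[OF fun_cong[OF ch, of c], of c'] by (simp add: mbd_def mmul_def parity_sign_def)
    ultimately show ?thesis using True
      by (simp add: mbd_def 1 2 a b sum.distrib sum_distrib_left[symmetric] parity_sign_def[of 1] del: index_simps) metis
  qed
qed

end

section \<open>Homological perturbation\<close>

text \<open>Think of \<open>q\<close> as a projection onto the image of a section of \<open>e\<close> that need not be a chain map, of \<open>\<iota>\<close> as the identity, and of \<open>h\<close>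
  as a contraction of the complement up to the invertible error \<open>U = d h + h d (\<iota> - q) + q\<close>. The
  hypothesis \<open>q d q = q d\<close> says that the kernel of \<open>q\<close> is a subcomplex. There \<open>U\<close> equals \<open>d h + h d\<close>, so it
  commutes with \<open>d\<close>, and so does its inverse \<open>V\<close>. Therefore \<open>h V\<close> is an exact contraction of the kernel,
  and \<open>g\<close> is the projection that replaces \<open>q\<close> and commutes with \<open>d\<close>.\<close>

lemma (in ring) perturbed_contraction:
  assumes u: "\<iota> * \<iota> = \<iota>" "\<iota> * d = d" "d * \<iota> = d" "\<iota> * q = q" "q * \<iota> = q" "\<iota> * h = h" "h * \<iota> = h" "\<iota> * V = V" "V * \<iota> = V"
    and dd: "d * d = 0" and qq: "q * q = q" and qdq: "q * d * q = q * d" and qh: "q * h = 0" and hq: "h * q = 0"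
    and UV: "(d * h + h * d * (\<iota> - q) + q) * V = \<iota>" and VU: "V * (d * h + h * d * (\<iota> - q) + q) = \<iota>"
  defines "k \<equiv> h * V" and "g \<equiv> q - h * V * d * q"
  shows "d * k + k * d = \<iota> - g" and "d * g = g * d" and "g * q = g" and "q * g = q"
proof -
  define p where "p = \<iota> - q"
  define U where "U = d * h + h * d * p + q"
  have UV: "U * V = \<iota>" and VU: "V * U = \<iota>" using UV VU by (simp_all add: U_def p_def)
  have pp: "p * q = 0" "q * p = 0" "p * h = h" "h * p = h" "p * p = p"
    using u qq qh hq by (simp_all add: p_def algebra_simps)
  have qdp: "q * (d * p) = 0" using qdq u by (simp add: p_def algebra_simps mult.assoc)
  have pdp: "p * (d * p) = d * p"
  proof -
    have "p * (d * p) = \<iota> * (d * p) - q * (d * p)" by (simp add: p_def algebra_simps)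
    then show ?thesis using qdp u by (simp add: mult.assoc[symmetric])
  qed
  have dpdp: "d * p * (d * p) = 0"
    using pdp dd by (simp add: mult.assoc) (simp add: mult.assoc[symmetric])
  have dph: "d * p * d * h = 0"
  proof -
    have "d * p * d * h = d * p * (d * p) * h" using pp(3) by (simp add: mult.assoc)
    then show ?thesis using dpdp by simp
  qed
  have "U * (d * p) = d * h * d * p + h * (d * p * (d * p)) + q * (d * p)"
    by (simp add: U_def algebra_simps mult.assoc)
  also have "\<dots> = d * h * d * p" using dpdp qdp by simp
  also have "\<dots> = d * p * d * h + d * p * h * d * p + d * p * q"
    using dph pp by (simp add: mult.assoc)
  also have "\<dots> = (d * p) * U" by (simp add: U_def algebra_simps mult.assoc)
  finally have Ud: "U * (d * p) = (d * p) * U" .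
  have ud: "\<iota> * (d * p) = d * p" "d * p * \<iota> = d * p"
    using u by (simp_all add: p_def algebra_simps mult.assoc[symmetric])
  have Vd: "V * (d * p) = (d * p) * V"
  proof -
    have "V * (d * p) = V * ((d * p) * (U * V))" using UV ud by (simp add: mult.assoc)
    also have "\<dots> = V * (((d * p) * U) * V)" by (simp add: mult.assoc)
    also have "\<dots> = (V * U) * (d * p) * V" unfolding Ud[symmetric] by (simp add: mult.assoc)
    also have "\<dots> = (d * p) * V" using VU ud by (simp add: mult.assoc[symmetric])
    finally show ?thesis .
  qed
  have pdh: "p * d * h = d * h"
  proof -
    have "p * d * h = p * (d * p) * h" using pp(3) by (simp add: mult.assoc)
    also have "\<dots> = d * (p * h)" using pdp by (simp add: mult.assoc)
    finally show ?thesis using pp(3) by simp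
  qed
  have pU: "U - q = d * h + h * d * p" by (simp add: U_def)
  have qU: "q * U = q"
  proof -
    have "q * U = q * d * h + (q * h) * (d * p) + q * q" by (simp add: U_def algebra_simps mult.assoc)
    also have "q * d * h = q * (p * d * h)" using pdh by (simp add: mult.assoc)
    also have "\<dots> = 0" using pp(2) by (simp add: mult.assoc[symmetric])
    finally show ?thesis using qh qq by simp
  qed
  have qV: "q * V = q"
  proof -
    have "q * V = (q * U) * V" using qU by simp
    then show ?thesis using UV u by (simp add: mult.assoc)
  qed
  have Uq: "U * q = q" using qq hq pp by (simp add: U_def algebra_simps mult.assoc)
  have Vq: "V * q = q"
  proof -
    have "V * q = V * U * q" using Uq by (simp add: mult.assoc)
    then show ?thesis using VU u by simp
  qed
  have dk: "d * k = p - k * d * p"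
  proof -
    have "d * k + k * d * p = d * h * V + h * (V * (d * p))" by (simp add: k_def mult.assoc)
    also have "\<dots> = (U - q) * V" unfolding Vd pU by (simp add: algebra_simps mult.assoc)
    also have "\<dots> = p" using UV qV by (simp add: left_diff_distrib p_def)
    finally show ?thesis by (simp add: algebra_simps)
  qed
  have g: "g = q - k * d * q" by (simp add: g_def k_def mult.assoc)
  have kdp: "k * d * p = k * d - k * d * q"
    using u by (simp add: p_def right_diff_distrib mult.assoc)
  show "d * k + k * d = \<iota> - g"
    unfolding dk unfolding kdp g unfolding p_def by (simp add: algebra_simps)
  show "g * q = g" using qq by (simp add: g left_diff_distrib mult.assoc)
  have qk: "q * k = 0" using qh by (simp add: k_def mult.assoc[symmetric])
  show "q * g = q" using qk qq by (simp add: g right_diff_distrib mult.assoc[symmetric])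
  show "d * g = g * d"
  proof -
    have pdq: "p * d * q = d * q - q * d" using u qdq by (simp add: p_def left_diff_distrib)
    have "d * g = d * q - (d * k) * d * q" by (simp add: g right_diff_distrib mult.assoc)
    also have "\<dots> = d * q - p * d * q + k * (d * (p * d * q))" unfolding dk by (simp add: algebra_simps mult.assoc)
    also have "\<dots> = q * d + k * ((d * d) * q - d * (q * d))" unfolding pdq by (simp add: algebra_simps)
    also have "\<dots> = g * d" using dd by (simp add: g left_diff_distrib mult.assoc)
    finally show ?thesis .
  qed
qed

lemma ring_matrices: "class.ring (+) 0 (-) uminus (mmul X)"
  for X :: "('w, 's) index"
  by unfold_locales
   (simp_all add: mmul_assoc, simp_all add: mmul_def fun_eq_iff algebra_simps sum.distrib)

text \<open>The entries of \<open>\<nu>\<^sup>n\<close> lower the rank by at least \<open>n\<close>, so \<open>\<nu>\<close> is nilpotent and a partial sum of the geometric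
  series is an inverse of \<open>1 + \<nu>\<close>.\<close>

lemma unipotent_inverse:
  fixes X :: "('w, 's) index" and r :: "'w \<Rightarrow> int"
  assumes tr: "trans P" and refl: "\<And>v. v \<in> Ix X \<Longrightarrow> (Ps X v, Ps X v) \<in> P" and fin: "finite (Ix X)"
    and \<nu>: "\<nu> \<in> mats P X X 0" and r: "\<And>a b. \<nu> a b \<noteq> 0 \<Longrightarrow> r b < r a"
  shows "\<exists>V\<in>mats P X X 0. mmul X (mone X + \<nu>) V = mone X \<and> mmul X V (mone X + \<nu>) = mone X"
proof -
  interpret ring "(+)" 0 "(-)" uminus "mmul X" by (rule ring_matrices)
  let ?\<iota> = "mone X"
  have \<iota>: "?\<iota> \<in> mats P X X 0" by (rule mats_mone[OF refl])
  define V where "V = rec_nat ?\<iota> (\<lambda>_ v. ?\<iota> - mmul X \<nu> v)"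
  have V0: "V 0 = ?\<iota>" and VS: "V (Suc n) = ?\<iota> - mmul X \<nu> (V n)" for n by (simp_all add: V_def)
  have Vm: "V n \<in> mats P X X 0" for n
  proof (induction n)
    case (Suc n)
    have "mmul X \<nu> (V n) \<in> mats P X X 0" using mats_mmul[OF tr Suc \<nu>] by simp
    then have "(\<lambda>v w. ?\<iota> v w + (-1) * mmul X \<nu> (V n) v w) \<in> mats P X X 0"
      using \<iota> by (intro mats_add mats_scale) auto
    moreover have "V (Suc n) = (\<lambda>v w. ?\<iota> v w + (-1) * mmul X \<nu> (V n) v w)" by (simp add: VS fun_eq_iff)
    ultimately show ?case by simp
  qed (use \<iota> in \<open>simp add: V0\<close>)
  have u: "mmul X ?\<iota> A = A" "mmul X A ?\<iota> = A" if "A \<in> mats P X X 0" for A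
    using mmul_mone_left[OF that fin] mmul_mone_right[OF that fin] .
  have comm: "mmul X \<nu> (V n) = mmul X (V n) \<nu>" for n
  proof (induction n)
    case (Suc n)
    then show ?case unfolding VS right_diff_distrib left_diff_distrib u[OF \<nu>] mult.assoc by simp
  qed (simp add: V0 u \<nu>)
  \<comment> \<open>the error of the \<open>n\<close>-th partial sum; it is \<open>\<plusminus> \<nu>\<close> to the power \<open>n + 1\<close>\<close>
  define e where "e n = mmul X (?\<iota> + \<nu>) (V n) - ?\<iota>" for n
  have e0: "e 0 = \<nu>" by (simp add: e_def V0 distrib_right u \<nu> \<iota>)
  have eS: "e (Suc n) = - mmul X \<nu> (e n)" for n
  proof -
    have "mmul X \<nu> (V n) \<in> mats P X X 0" using mats_mmul[OF tr Vm \<nu>] by simp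
    from u(1)[OF this] show ?thesis
      by (simp add: e_def VS distrib_right distrib_left right_diff_distrib u[OF \<nu>] u[OF \<iota>] u[OF Vm])
  qed
  have low: "e n a b \<noteq> 0 \<Longrightarrow> r b + int n + 1 \<le> r a" for n a b
  proof (induction n arbitrary: a b)
    case 0
    then show ?case using r[of a b] by (simp add: e0)
  next
    case (Suc n)
    then have "mmul X \<nu> (e n) a b \<noteq> 0" by (simp add: eS)
    then obtain w where "e n a w * \<nu> w b \<noteq> 0" unfolding mmul_def by (meson sum.neutral)
    then have "e n a w \<noteq> 0" "\<nu> w b \<noteq> 0" by auto
    from Suc.IH[OF this(1)] r[OF this(2)] show ?case by simp
  qed
  have em: "e n a b \<noteq> 0 \<Longrightarrow> a \<in> Ix X \<and> b \<in> Ix X" for n a b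
  proof (induction n arbitrary: a b)
    case 0
    then show ?case using matsD[OF \<nu>, of a b] by (simp add: e0)
  next
    case (Suc n)
    then have "mmul X \<nu> (e n) a b \<noteq> 0" by (simp add: eS)
    then obtain w where "e n a w * \<nu> w b \<noteq> 0" unfolding mmul_def by (meson sum.neutral)
    then have "e n a w \<noteq> 0" "\<nu> w b \<noteq> 0" by auto
    from Suc.IH[OF this(1)] matsD[OF \<nu> this(2)] show ?case by simp
  qed
  \<comment> \<open>the range of the rank bounds the number of nonzero powers\<close>
  define N where "N = nat (Max (insert 0 (r ` Ix X)) - Min (insert 0 (r ` Ix X)))"
  have "e N a b = 0" for a b
  proof (rule ccontr)
    assume ne: "e N a b \<noteq> 0"
    have "r a \<le> Max (insert 0 (r ` Ix X))" "Min (insert 0 (r ` Ix X)) \<le> r b"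
      using em[OF ne] fin by auto
    with low[OF ne] show False by (auto simp: N_def split: if_splits)
  qed
  then have UV: "mmul X (?\<iota> + \<nu>) (V N) = ?\<iota>" by (metis (no_types) e_def ext eq_iff_diff_eq_0 zero_fun_def)
  moreover have "mmul X (V N) (?\<iota> + \<nu>) = ?\<iota>"
    using UV by (simp add: distrib_right distrib_left u Vm comm)
  ultimately show ?thesis using Vm by blast
qed

text \<open>Apply \<open>perturbed_contraction\<close> with \<open>q = s e\<close>, whose kernel is that of the chain map \<open>e\<close> and hence a
  subcomplex. The resulting projection \<open>G\<close> has the same kernel and commutes with \<open>d\<close>, so \<open>G s\<close> is a section
  of \<open>e\<close> that is a chain map.\<close>

lemma equivalence_of_unipotent:
  fixes X :: "('w, 's) index" and C :: "('v, 's) index" and r :: "'w \<Rightarrow> int"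
  assumes tr: "trans P" and reflX: "\<And>v. v \<in> Ix X \<Longrightarrow> (Ps X v, Ps X v) \<in> P" and reflC: "\<And>v. v \<in> Ix C \<Longrightarrow> (Ps C v, Ps C v) \<in> P"
    and fin: "finite (Ix X)" "finite (Ix C)"
    and d: "d \<in> mats P X X (-1)" and dC: "dC \<in> mats P C C (-1)" and dd: "mmul X d d = (\<lambda>_ _. 0)"
    and e: "e \<in> mats P X C 0" and chain: "mbd X C 0 d dC e = (\<lambda>_ _. 0)"
    and s: "s \<in> mats P C X 0" and es: "mmul X e s = mone C"
    and h: "h \<in> mats P X X 1" and eh: "mmul X e h = (\<lambda>_ _. 0)" and hs: "mmul X h s = (\<lambda>_ _. 0)"
    and rank: "\<And>a b. (mmul X d h + mmul X h d - mmul X (mmul X h d) (mmul C s e) + mmul C s e - mone X) a b \<noteq> 0 \<Longrightarrow> r b < r a"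
  shows "\<exists>g\<in>mats P C X 0. \<exists>k\<in>mats P X X 1. mbd C X 0 dC d g = (\<lambda>_ _. 0) \<and> mmul X e g = mone C \<and>
     mmul C g e = (\<lambda>a b. mbd X X 1 d d k a b + mone X a b)"
proof -
  interpret ring "(+)" 0 "(-)" uminus "mmul X" by (rule ring_matrices)
  let ?\<iota> = "mone X" and ?q = "mmul C s e"
  have z: "0 = (\<lambda>_ _. 0 :: int)" by (simp add: fun_eq_iff)
  define \<nu> where "\<nu> = mmul X d h + mmul X h d - mmul X (mmul X h d) ?q + ?q - ?\<iota>"
  have \<iota>: "?\<iota> \<in> mats P X X 0" by (rule mats_mone[OF reflX])
  have q: "?q \<in> mats P X X 0" using mats_mmul[OF tr e s] by simp
  have hd: "mmul X h d \<in> mats P X X 0" "mmul X d h \<in> mats P X X 0"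
    using mats_mmul[OF tr d h] mats_mmul[OF tr h d] by simp_all
  have hdq: "mmul X (mmul X h d) ?q \<in> mats P X X 0" using mats_mmul[OF tr q hd(1)] by simp
  have \<nu>m: "\<nu> \<in> mats P X X 0"
  proof -
    have "\<nu> = (\<lambda>a b. mmul X d h a b + mmul X h d a b + (-1) * mmul X (mmul X h d) ?q a b + ?q a b + (-1) * ?\<iota> a b)"
      by (simp add: \<nu>_def fun_eq_iff)
    also have "\<dots> \<in> mats P X X 0" by (intro mats_add mats_scale q hd hdq \<iota>)
    finally show ?thesis .
  qed
  obtain V where V: "V \<in> mats P X X 0" "mmul X (?\<iota> + \<nu>) V = ?\<iota>" "mmul X V (?\<iota> + \<nu>) = ?\<iota>"
    using unipotent_inverse[OF tr reflX fin(1) \<nu>m, of r] rank unfolding \<nu>_def by blast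
  have u: "mmul X ?\<iota> A = A" "mmul X A ?\<iota> = A" if "A \<in> mats P X X n" for A n
    using mmul_mone_left[OF that fin(1)] mmul_mone_right[OF that fin(1)] .
  have ce: "mmul C dC e = mmul X e d"
    using chain by (simp add: mbd_def parity_sign_def fun_eq_iff)
  have eq: "mmul X e ?q = e"
    by (simp add: mmul_assoc[symmetric] es) (rule mmul_mone_left[OF e fin(2)])
  have sq: "mmul X ?q s = s"
    by (simp add: mmul_assoc es) (rule mmul_mone_right[OF s fin(2)])
  have qA: "mmul X ?q A = mmul C s (mmul X e A)" for A :: "'w \<Rightarrow> 'w \<Rightarrow> int" by (simp add: mmul_assoc)
  have z1: "mmul C s (\<lambda>_ _. 0) = 0" for s :: "'v \<Rightarrow> 'w \<Rightarrow> int" by (simp add: mmul_def fun_eq_iff)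
  have z2: "mmul C (\<lambda>_ _. 0) e = 0" by (simp add: mmul_def fun_eq_iff)
  have U: "mmul X d h + mmul X (mmul X h d) (?\<iota> - ?q) + ?q = ?\<iota> + \<nu>"
    using u(2)[OF hd(1)] by (simp add: \<nu>_def right_diff_distrib)
  define G where "G = ?q - mmul X (mmul X (mmul X h V) d) ?q"
  define k where "k = mmul X h V"
  have hyps: "mmul X ?q ?q = ?q" "mmul X (mmul X ?q d) ?q = mmul X ?q d" "mmul X ?q h = 0" "mmul X h ?q = 0"
    "mmul X (mmul X d h + mmul X (mmul X h d) (?\<iota> - ?q) + ?q) V = ?\<iota>"
    "mmul X V (mmul X d h + mmul X (mmul X h d) (?\<iota> - ?q) + ?q) = ?\<iota>"
  proof -
    show "mmul X ?q ?q = ?q" by (simp add: qA eq)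
    show "mmul X (mmul X ?q d) ?q = mmul X ?q d"
      using eq by (simp add: qA mmul_assoc ce[symmetric])
    show "mmul X ?q h = 0" by (simp add: qA eh z1)
    show "mmul X h ?q = 0" using hs by (simp add: mmul_assoc[symmetric] z2)
  qed (simp_all only: U V(2,3))
  have dd': "mmul X d d = 0" using dd z by simp
  note pc = perturbed_contraction[OF u(1)[OF \<iota>] u[OF d] u[OF q] u[OF h] u[OF V(1)] dd' hyps, folded G_def k_def]
  have km: "k \<in> mats P X X 1" unfolding k_def using mats_mmul[OF tr V(1) h] by simp
  have Gm: "G \<in> mats P X X 0"
  proof -
    have "mmul X (mmul X k d) ?q \<in> mats P X X 0"
      using mats_mmul[OF tr q mats_mmul[OF tr d km]] by simp
    then have "(\<lambda>a b. ?q a b + (-1) * mmul X (mmul X k d) ?q a b) \<in> mats P X X 0"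
      using q by (intro mats_add mats_scale)
    moreover have "G = (\<lambda>a b. ?q a b + (-1) * mmul X (mmul X k d) ?q a b)" by (simp add: G_def k_def fun_eq_iff)
    ultimately show ?thesis by simp
  qed
  define g where "g = mmul X G s"
  have gm: "g \<in> mats P C X 0" unfolding g_def using mats_mmul[OF tr s Gm] by simp
  have ge: "mmul C g e = G" unfolding g_def by (simp add: mmul_assoc pc(3))
  have eg: "mmul X e g = mone C"
  proof -
    have "mmul X e g = mmul X (mmul X e ?q) (mmul X G s)" by (simp add: g_def eq)
    also have "\<dots> = mmul X e (mmul X (mmul X ?q G) s)" by (simp add: mmul_assoc)
    also have "\<dots> = mone C" by (simp add: pc(4) sq es)
    finally show ?thesis .
  qed
  have dg: "mmul X d g = mmul C g dC"
  proof -
    have "mmul C g dC = mmul C g (mmul C dC (mone C))" by (simp add: mmul_mone_right[OF dC fin(2)])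
    also have "\<dots> = mmul C g (mmul X (mmul C dC e) s)" by (simp add: es[symmetric] mmul_assoc)
    also have "\<dots> = mmul X (mmul X (mmul C g e) d) s" by (simp add: ce mmul_assoc)
    also have "\<dots> = mmul X (mmul X d G) s" by (simp only: ge pc(2))
    also have "\<dots> = mmul X d g" by (simp only: g_def mmul_assoc)
    finally show ?thesis ..
  qed
  have "mbd C X 0 dC d g = (\<lambda>_ _. 0)" by (simp add: mbd_def parity_sign_def dg fun_eq_iff)
  moreover have "mmul C g e = (\<lambda>a b. mbd X X 1 d d (- k) a b + ?\<iota> a b)"
  proof -
    have "mbd X X 1 d d (- k) = - (mmul X d k + mmul X k d)"
      by (simp add: mbd_def parity_sign_def fun_eq_iff mmul_def sum_negf)
    then show ?thesis by (simp add: pc(1) ge fun_eq_iff)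
  qed
  moreover have "- k \<in> mats P X X 1"
  proof -
    have "- k = (\<lambda>a b. (-1) * k a b)" by (simp add: fun_eq_iff)
    then show ?thesis using mats_scale[OF km, of "\<lambda>_ _. -1"] by simp
  qed
  ultimately show ?thesis using gm eg by blast
qed

section \<open>The evaluation map in coordinates\<close>

text \<open>The combinatorial input. Every interval from \<open>\<pi>\<close> to \<open>x\<close> with \<open>\<pi> \<noteq> x\<close> is divided into low and raised elements such
  that the block of the differential from the low to the raised ones is an orthogonal matrix, hence
  invertible with the transpose as inverse. This makes the part of \<open>E\<close> in the interval contractible. For simplices
  the block is a signed permutation matrix.\<close>

locale acyclic_intervals = tensor_matrices P E dE
  for P :: "'s rel" and E :: "('s, 's) index" and dE +
  fixes raised :: "'s \<Rightarrow> 's \<Rightarrow> 's \<Rightarrow> bool"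
  assumes Ix_E: "Ix E = Field P" and Ps_E: "Ps E = (\<lambda>x. x)"
    and antisym_P: "antisym P"
    and low_orthogonal: "\<lbrakk>(\<pi>, x) \<in> P; \<pi> \<noteq> x; (\<pi>, y) \<in> P; (y, x) \<in> P; (\<pi>, y') \<in> P; (y', x) \<in> P;
        \<not> raised \<pi> x y; \<not> raised \<pi> x y'\<rbrakk> \<Longrightarrow>
      (\<Sum>z\<in>{z \<in> Field P. (\<pi>, z) \<in> P \<and> (z, x) \<in> P \<and> raised \<pi> x z}. dE y z * dE y' z) = of_bool (y = y')"
    and raised_orthogonal: "\<lbrakk>(\<pi>, x) \<in> P; \<pi> \<noteq> x; (\<pi>, z) \<in> P; (z, x) \<in> P; (\<pi>, z') \<in> P; (z', x) \<in> P;
        raised \<pi> x z; raised \<pi> x z'\<rbrakk> \<Longrightarrow>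
      (\<Sum>y\<in>{y \<in> Field P. (\<pi>, y) \<in> P \<and> (y, x) \<in> P \<and> \<not> raised \<pi> x y}. dE y z * dE y z') = of_bool (z = z')"

text \<open>The matrix of \<open>e\<close> on \<open>T\<^sup>2C\<close>, whose basis elements are the triples \<open>(x, y, c)\<close> with \<open>c \<le> y \<le> x\<close>.\<close>

locale double_dual = acyclic_intervals P E dE raised
  for P :: "'s rel" and E :: "('s, 's) index" and dE and raised +
  fixes C :: "('w, 's) index" and dC
  assumes finite_C: "finite (Ix C)" and dC: "dC \<in> mats P C C (-1)" and dC_dC: "mmul C dC dC = (\<lambda>_ _. 0)"
    and pos_C: "c \<in> Ix C \<Longrightarrow> Ps C c \<in> Field P"
begin

lemma reflP: "x \<in> Field P \<Longrightarrow> (x, x) \<in> P" using refl_E by (simp add: Ix_E Ps_E)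
lemma transP: "(x, y) \<in> P \<Longrightarrow> (y, z) \<in> P \<Longrightarrow> (x, z) \<in> P" using trans_P by (rule transD)
lemma antisymP: "(x, y) \<in> P \<Longrightarrow> (y, x) \<in> P \<Longrightarrow> x = y" using antisym_P by (rule antisymD)
lemma fieldP: "(x, y) \<in> P \<Longrightarrow> x \<in> Field P" "(x, y) \<in> P \<Longrightarrow> y \<in> Field P" by (auto simp: Field_def)

abbreviation X where "X \<equiv> T (T C)"
abbreviation d where "d \<equiv> bdT (T C) (bdT C dC)"

lemma Ix_X: "(x, y, c) \<in> Ix X \<longleftrightarrow> c \<in> Ix C \<and> (Ps C c, y) \<in> P \<and> (y, x) \<in> P"
  using fieldP by (auto simp: Ix_E Ps_E)

lemma Dg_X: "Dg X (x, y, c) = Dg E y + Dg C c - Dg E x" and Ps_X: "Ps X (x, y, c) = x"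
  by (simp_all add: Ps_E)

lemma finite_X: "finite (Ix X)" by (simp add: finite_tensor_index finite_E finite_C)

definition sg :: "'w \<Rightarrow> 's \<Rightarrow> int" where
  "sg c x = tau_sign (Dg E x) (Dg C c) (- Dg E x - Dg C c)"

lemma sg_sq: "sg c x * sg c x = 1" by (simp add: sg_def tau_sign_def)

definition e_mat where "e_mat = tau_mat E C (T C) (mone (T C))"

lemma e_mat: "e_mat (x, y, c) c' = of_bool ((x, y, c) \<in> Ix X \<and> x = y \<and> c = c') * sg c x"
  by (auto simp: e_mat_def tau_mat_def mone_def Ix_E Ps_E sg_def fieldP reflP split: if_splits)

text \<open>The section \<open>c \<mapsto> \<plusminus> (p, p, c)\<close> with \<open>p\<close> the position of \<open>c\<close>. In general it is not a chain map.\<close>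

definition s_mat :: "'w \<Rightarrow> 's \<times> 's \<times> 'w \<Rightarrow> int" where
  "s_mat c = (\<lambda>(x, y, c'). of_bool (c \<in> Ix C \<and> c' = c \<and> x = Ps C c \<and> y = Ps C c) * sg c x)"

text \<open>The contraction: the transpose of the orthogonal block from low to raised elements of each
  interval. The minus sign is that of \<open>- dE\<close> in \<open>dy\<close>.\<close>

definition h_mat :: "'s \<times> 's \<times> 'w \<Rightarrow> 's \<times> 's \<times> 'w \<Rightarrow> int" where
  "h_mat = (\<lambda>(x, z, c) (x', y, c'). of_bool ((x, z, c) \<in> Ix X \<and> x' = x \<and> c' = c \<and> Ps C c \<noteq> x
     \<and> raised (Ps C c) x z \<and> \<not> raised (Ps C c) x y \<and> (Ps C c, y) \<in> P) * - dE y z)"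

lemma dED: "dE y z \<noteq> 0 \<Longrightarrow> Dg E z = Dg E y - 1 \<and> (y, z) \<in> P \<and> y \<noteq> z"
  using matsD[OF dE, of y z] by (auto simp: Ps_E)

lemma h_mats: "h_mat \<in> mats P X X 1"
proof (rule matsI)
  fix a b assume ne: "h_mat a b \<noteq> 0"
  obtain x z c x' y c' where ab: "a = (x, z, c)" "b = (x', y, c')" by (metis prod_cases3)
  have *: "(x, z, c) \<in> Ix X" "x' = x" "c' = c" "(Ps C c, y) \<in> P" "dE y z \<noteq> 0"
    using ne by (auto simp: ab h_mat_def split: if_splits simp del: index_simps)
  then show "a \<in> Ix X \<and> b \<in> Ix X \<and> Dg X b = Dg X a + 1 \<and> (Ps X b, Ps X a) \<in> P"
    using dED[OF *(5)] transP[of y z x] fieldP[of z x] reflP[of x] unfolding ab Ix_X Dg_X Ps_X by auto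
qed

lemma s_mats: "s_mat \<in> mats P C X 0"
proof (rule matsI)
  fix c b assume ne: "s_mat c b \<noteq> 0"
  obtain x y c' where b: "b = (x, y, c')" by (metis prod_cases3)
  have "c \<in> Ix C" "c' = c" "x = Ps C c" "y = Ps C c"
    using ne by (auto simp: b s_mat_def split: if_splits)
  then show "c \<in> Ix C \<and> b \<in> Ix X \<and> Dg X b = Dg C c + 0 \<and> (Ps X b, Ps C c) \<in> P"
    unfolding b Ix_X Dg_X Ps_X using pos_C reflP by auto
qed

lemma mone_T_mats: "mone (T C) \<in> mats P (T C) (T C) 0"
  by (rule mats_mone) (auto simp: Ps_E Ix_E reflP)

lemma e_mats: "e_mat \<in> mats P X C 0"
  unfolding e_mat_def by (rule tau_mat_mats[OF mone_T_mats])

lemma dT_mats: "bdT C dC \<in> mats P (T C) (T C) (-1)" and d_mats: "d \<in> mats P X X (-1)"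
  by (rule T_bd_mats[OF dC], rule T_bd_mats[OF T_bd_mats[OF dC]])

lemma d_d: "mmul X d d = (\<lambda>_ _. 0)"
  by (intro T_bd_squared dT_mats finite_C finite_tensor_index finite_E dC dC_dC) (simp add: finite_tensor_index finite_E finite_C)

lemma e_chain: "mbd X C 0 d dC e_mat = (\<lambda>_ _. 0)"
proof -
  have fT: "finite (Ix (T C))" by (simp add: finite_tensor_index finite_E finite_C)
  have "mbd (T C) (T C) 0 (bdT C dC) (bdT C dC) (mone (T C)) = (\<lambda>_ _. 0)"
    by (simp add: mbd_def mmul_mone_left[OF dT_mats fT] mmul_mone_right[OF dT_mats fT] parity_sign_def)
  then show ?thesis
    unfolding e_mat_def tau_mat_chain[OF finite_C fT dC dT_mats mone_T_mats, symmetric]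
    by (simp add: tau_mat_def fun_eq_iff)
qed

lemma e_s: "mmul X e_mat s_mat = mone C"
proof (intro ext)
  fix c c'
  show "mmul X e_mat s_mat c c' = mone C c c'"
  proof (cases "c \<in> Ix C")
    case True
    let ?w = "(Ps C c, Ps C c, c)"
    have w: "?w \<in> Ix X" unfolding Ix_X using True pos_C reflP by auto
    have "mmul X e_mat s_mat c c' = (\<Sum>w\<in>Ix X. if w = ?w then sg c (Ps C c) * e_mat w c' else 0)"
      unfolding mmul_def by (rule sum.cong) (auto simp: s_mat_def True)
    also have "\<dots> = sg c (Ps C c) * e_mat ?w c'" using w finite_X by simp
    also have "\<dots> = mone C c c'" using w True sg_sq by (simp add: e_mat mone_def del: index_simps)
    finally show ?thesis .
  qed (simp add: mmul_def s_mat_def mone_def split_beta)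
qed

lemma e_h: "mmul X e_mat h_mat = (\<lambda>_ _. 0)"
proof (intro ext)
  fix a c
  have "h_mat a w * e_mat w c = 0" for w
  proof (rule ccontr)
    assume ne: "h_mat a w * e_mat w c \<noteq> 0"
    obtain x z c1 x' y c2 where aw: "a = (x, z, c1)" "w = (x', y, c2)" by (metis prod_cases3)
    have "(x, z, c1) \<in> Ix X" "x' = x" "x' = y" "dE y z \<noteq> 0"
      using ne by (auto simp: aw h_mat_def e_mat split: if_splits simp del: index_simps)
    then show False using dED[of y z] antisymP unfolding Ix_X by auto
  qed
  then show "mmul X e_mat h_mat a c = 0" unfolding mmul_def by (intro sum.neutral ballI)
qed

lemma h_s: "mmul X h_mat s_mat = (\<lambda>_ _. 0)"
proof (intro ext)
  fix c b
  have "s_mat c w * h_mat w b = 0" for w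
    by (cases w; cases b) (auto simp: s_mat_def h_mat_def)
  then show "mmul X h_mat s_mat c b = 0" unfolding mmul_def by (intro sum.neutral ballI)
qed

text \<open>None of the maps involved raises the level. The maps that preserve it fix \<open>x\<close> and \<open>c\<close>, so they live
  on a single interval.\<close>

definition lev :: "'s \<times> 's \<times> 'w \<Rightarrow> int" where
  "lev = (\<lambda>(x, y, c). int (card {z. (z, x) \<in> P}) + Dg C c)"

text \<open>Where the level is preserved, the deviation of \<open>d h + h d\<close> from the identity leads from raised to low
  elements, which is recorded by the last bit of the rank.\<close>

definition rank :: "'s \<times> 's \<times> 'w \<Rightarrow> int" where
  "rank = (\<lambda>(x, y, c). 2 * lev (x, y, c) + of_bool (raised (Ps C c) x y))"

lemma card_less: "(x', x) \<in> P \<Longrightarrow> x' \<noteq> x \<Longrightarrow> card {z. (z, x') \<in> P} < card {z. (z, x) \<in> P}"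
proof (rule psubset_card_mono)
  have "{z. (z, x) \<in> P} \<subseteq> Field P" by (auto simp: Field_def)
  then show "finite {z. (z, x) \<in> P}" using finite_E finite_subset by (metis Ix_E)
  assume *: "(x', x) \<in> P" "x' \<noteq> x"
  then have "x \<in> {z. (z, x) \<in> P}" "x \<notin> {z. (z, x') \<in> P}" using reflP fieldP antisymP by auto
  moreover have "{z. (z, x') \<in> P} \<subseteq> {z. (z, x) \<in> P}" using * transP by auto
  ultimately show "{z. (z, x') \<in> P} \<subset> {z. (z, x) \<in> P}" by blast
qed

text \<open>The part of the differential that moves the middle element only.\<close>

definition dy :: "'s \<times> 's \<times> 'w \<Rightarrow> 's \<times> 's \<times> 'w \<Rightarrow> int" where
  "dy = (\<lambda>(x, y, c) (x', y', c'). of_bool ((x, y, c) \<in> Ix X \<and> (x', y', c') \<in> Ix X \<and> x' = x \<and> c' = c) * - dE y y')"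

text \<open>The other terms of \<open>d\<close> lower \<open>x\<close> by the differential of the outer copy of \<open>E\<close>, or lower the degree of
  \<open>c\<close>.\<close>

lemma d_cases:
  assumes "d (x, y, c) (x', y', c') \<noteq> dy (x, y, c) (x', y', c')"
  shows "lev (x', y', c') < lev (x, y, c)"
proof -
  let ?a = "(x, y, c)" and ?b = "(x', y', c')"
  have mem: "?a \<in> Ix X \<and> ?b \<in> Ix X"
  proof (rule ccontr)
    assume n: "\<not> ?thesis"
    then have "d ?a ?b = 0" using matsD[OF d_mats, of ?a ?b] by blast
    moreover have "dy ?a ?b = 0" using n by (auto simp: dy_def simp del: index_simps)
    ultimately show False using assms by simp
  qed
  have cs: "(y, c) \<in> Ix (W C)" "(x', (y', c')) \<in> Ix (W (T C))" using mem by (auto simp: Ps_E)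
  have D: "d ?a ?b = parity_sign (Dg X ?a + 1) * (of_bool (y' = y \<and> c' = c) * dE x' x
     + of_bool (x' = x) * (parity_sign (Dg E x') * (parity_sign (1 - Dg E y' - Dg C c') *
        (of_bool (c = c') * dE y y' + of_bool (y = y') * (parity_sign (Dg E y) * dC c c')))))"
    using cs by (simp add: T_bd_def tensor_bd_def algebra_simps)
  show ?thesis
  proof (cases "x' = x")
    case False
    then have "dE x' x \<noteq> 0" "y' = y" "c' = c" using assms D by (auto simp: dy_def simp del: index_simps)
    then show ?thesis using dED[of x' x] card_less[of x' x] by (simp add: lev_def)
  next
    case True
    have z: "dE x x = 0" "dC c c = 0" using dED[of x x] matsD[OF dC, of c c] by auto
    show ?thesis
    proof (cases "c' = c")
      case True
      have "d ?a ?b = dy ?a ?b"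
        using mem z \<open>x' = x\<close> True dED[of y y'] unfolding D
        by (cases "dE y y' = 0") (auto simp: dy_def Dg_X parity_sign_def simp del: index_simps)
      with assms show ?thesis by simp
    next
      case False
      then have "dC c c' \<noteq> 0" using assms D z \<open>x' = x\<close> by (auto simp: dy_def)
      then show ?thesis using matsD[OF dC, of c c'] \<open>x' = x\<close> by (simp add: lev_def)
    qed
  qed
qed

text \<open>Equality of the induced maps on the graded pieces of the filtration by level.\<close>

definition filtered where "filtered A \<longleftrightarrow> (\<forall>a b. A a b \<noteq> (0::int) \<longrightarrow> lev b \<le> lev a)"
definition eq_top where "eq_top A B \<longleftrightarrow> filtered A \<and> filtered B \<and> (\<forall>a b. lev a \<le> lev b \<longrightarrow> A a b = B a b)"

lemma eq_top_mmul:
  assumes "eq_top A A'" "eq_top B B'" shows "eq_top (mmul X B A) (mmul X B' A')"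
proof -
  have f: "filtered (mmul X B A)" if "filtered A" "filtered B" for A B
    unfolding filtered_def
  proof (intro allI impI)
    fix a b assume "mmul X B A a b \<noteq> 0"
    then obtain w where "A a w * B w b \<noteq> 0" unfolding mmul_def by (meson sum.neutral)
    then show "lev b \<le> lev a" using that unfolding filtered_def by (metis mult_eq_0_iff order_trans)
  qed
  have "mmul X B A a b = mmul X B' A' a b" if l: "lev a \<le> lev b" for a b
    unfolding mmul_def
  proof (rule sum.cong)
    fix w
    show "A a w * B w b = A' a w * B' w b"
    proof (cases "lev w \<le> lev a \<and> lev b \<le> lev w")
      case True
      then have "lev a \<le> lev w" "lev w \<le> lev b" using l by auto
      then have "A a w = A' a w" "B w b = B' w b" using assms unfolding eq_top_def by blast+
      then show ?thesis by simp
    next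
      case False
      then have z: "A a w * B w b = 0" "A' a w * B' w b = 0"
        using assms unfolding eq_top_def filtered_def by (metis mult_eq_0_iff)+
      show ?thesis unfolding z ..
    qed
  qed simp
  then show ?thesis using assms f unfolding eq_top_def by blast
qed

text \<open>The level-preserving part of \<open>s e\<close>: the identity on the triples of the one-point intervals, and zero
  on the other intervals.\<close>

definition q0 :: "'s \<times> 's \<times> 'w \<Rightarrow> 's \<times> 's \<times> 'w \<Rightarrow> int" where
  "q0 = (\<lambda>(x, y, c) b. of_bool ((x, y, c) \<in> Ix X \<and> b = (x, y, c) \<and> x = Ps C c))"

lemma lev_simp: "lev (x, y, c) = lev (x, y', c)" by (simp add: lev_def)

lemma dy_filtered: "filtered dy" and h_filtered: "filtered h_mat" and q0_filtered: "filtered q0"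
  unfolding filtered_def
  by (auto simp: dy_def h_mat_def q0_def lev_def split: if_splits simp del: index_simps)

lemma eq_top_refl: "filtered A \<Longrightarrow> eq_top A A" by (simp add: eq_top_def)

lemma eq_top_d: "eq_top d dy"
  unfolding eq_top_def
proof (intro conjI allI impI dy_filtered)
  show "filtered d"
    unfolding filtered_def
  proof (intro allI impI)
    fix a b assume ne: "d a b \<noteq> 0"
    obtain x y c x' y' c' where ab: "a = (x, y, c)" "b = (x', y', c')" by (metis prod_cases3)
    show "lev b \<le> lev a"
      using d_cases[of x y c x' y' c'] ne dy_filtered unfolding ab filtered_def by fastforce
  qed
  fix a b assume l: "lev a \<le> lev b"
  obtain x y c x' y' c' where ab: "a = (x, y, c)" "b = (x', y', c')" by (metis prod_cases3)
  show "d a b = dy a b" using d_cases[of x y c x' y' c'] l unfolding ab by fastforce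
qed

abbreviation q where "q \<equiv> mmul C s_mat e_mat"

lemma q_entry: "q (x, y, c) (x', y', c') = of_bool ((x, y, c) \<in> Ix X \<and> x = y \<and> c' = c \<and> x' = Ps C c \<and> y' = Ps C c) * (sg c x * sg c (Ps C c))"
proof -
  have "q (x, y, c) (x', y', c') = (\<Sum>w\<in>Ix C. if w = c then e_mat (x, y, c) c * s_mat c (x', y', c') else 0)"
    unfolding mmul_def by (rule sum.cong) (auto simp: e_mat simp del: index_simps)
  also have "\<dots> = (if c \<in> Ix C then e_mat (x, y, c) c * s_mat c (x', y', c') else 0)" using finite_C by simp
  also have "\<dots> = of_bool ((x, y, c) \<in> Ix X \<and> x = y \<and> c' = c \<and> x' = Ps C c \<and> y' = Ps C c) * (sg c x * sg c (Ps C c))"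
    by (auto simp: e_mat s_mat_def Ix_X simp del: index_simps)
  finally show ?thesis .
qed

lemma eq_top_q: "eq_top q q0"
  unfolding eq_top_def
proof (intro conjI allI impI q0_filtered)
  have less: "lev (Ps C c, Ps C c, c) < lev (x, x, c)" if "(x, x, c) \<in> Ix X" "x \<noteq> Ps C c" for x c
    using card_less[of "Ps C c" x] that unfolding Ix_X by (simp add: lev_def)
  show "filtered q"
    unfolding filtered_def
  proof (intro allI impI)
    fix a b assume ne: "q a b \<noteq> 0"
    obtain x y c x' y' c' where ab: "a = (x, y, c)" "b = (x', y', c')" by (metis prod_cases3)
    have "(x, x, c) \<in> Ix X" "x = y" "c' = c" "x' = Ps C c" "y' = Ps C c"
      using ne by (auto simp: ab q_entry split: if_splits simp del: index_simps)
    then show "lev b \<le> lev a" using less[of x c] unfolding ab by (cases "x = Ps C c") auto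
  qed
  fix a b assume l: "lev a \<le> lev b"
  obtain x y c x' y' c' where ab: "a = (x, y, c)" "b = (x', y', c')" by (metis prod_cases3)
  show "q a b = q0 a b"
  proof (cases "x = Ps C c \<and> (x, y, c) \<in> Ix X")
    case True
    then have "y = x" using antisymP unfolding Ix_X by auto
    with True show ?thesis using sg_sq by (auto simp: ab q_entry q0_def simp del: index_simps)
  next
    case False
    have "q a b = 0"
    proof (rule ccontr)
      assume "q a b \<noteq> 0"
      then have "(x, x, c) \<in> Ix X" "x = y" "c' = c" "x' = Ps C c" "y' = Ps C c"
        by (auto simp: ab q_entry split: if_splits simp del: index_simps)
      then show False using less[of x c] l False unfolding ab by auto
    qed
    moreover have "q0 a b = 0" using False by (auto simp: ab q0_def simp del: index_simps)
    ultimately show ?thesis by simp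
  qed
qed

lemma sum_X:
  assumes "\<And>w. w \<in> Ix X \<Longrightarrow> f w \<noteq> 0 \<Longrightarrow> \<exists>y. w = (x, y, c)" "c \<in> Ix C"
  shows "(\<Sum>w\<in>Ix X. f w) = (\<Sum>y\<in>{y \<in> Field P. (Ps C c, y) \<in> P \<and> (y, x) \<in> P}. f (x, y, c) :: int)"
proof -
  let ?S = "{y \<in> Field P. (Ps C c, y) \<in> P \<and> (y, x) \<in> P}"
  have "(\<Sum>w\<in>Ix X. f w) = (\<Sum>w\<in>(\<lambda>y. (x, y, c)) ` ?S. f w)"
  proof (rule sum.mono_neutral_right[OF finite_X])
    show "(\<lambda>y. (x, y, c)) ` ?S \<subseteq> Ix X" using assms(2) by (auto simp: Ix_X simp del: index_simps)
    show "\<forall>w\<in>Ix X - (\<lambda>y. (x, y, c)) ` ?S. f w = 0"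
    proof (rule ballI, rule ccontr)
      fix w assume w: "w \<in> Ix X - (\<lambda>y. (x, y, c)) ` ?S" "f w \<noteq> 0"
      then obtain y where "w = (x, y, c)" using assms(1) by blast
      with w show False using fieldP by (auto simp: Ix_X simp del: index_simps)
    qed
  qed
  also have "\<dots> = (\<Sum>y\<in>?S. f (x, y, c))" by (subst sum.reindex) (auto simp: inj_on_def)
  finally show ?thesis .
qed

text \<open>On a one-point interval \<open>q0\<close> is already the identity and \<open>h\<close> vanishes. On the other intervals orthogonality of the
  block gives the identity from low to low and from raised to raised elements, \<open>d h + h d\<close> has no entries
  from low to raised ones, and the remaining entries lower the rank.\<close>

lemma homotopy_top:
  assumes "(mmul X dy h_mat + mmul X h_mat dy - mmul X (mmul X h_mat dy) q0 + q0 - mone X) a b \<noteq> 0"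
  shows "rank b < rank a \<and> lev b = lev a"
proof -
  obtain x y c x' y' c' where ab: "a = (x, y, c)" "b = (x', y', c')" by (metis prod_cases3)
  have dy0: "dy (x, x, c) w = 0" for x c w
  proof (cases w)
    case (fields x1 y1 c1)
    show ?thesis using dED[of x y1] antisymP by (auto simp: fields dy_def Ix_X simp del: index_simps)
  qed
  have "mmul X (mmul X h_mat dy) q0 a b = 0"
  proof -
    have "q0 a w * mmul X h_mat dy w b = 0" for w
    proof (cases "q0 a w = 0")
      case False
      then have "(x, y, c) \<in> Ix X" "w = (x, y, c)" "x = Ps C c" by (auto simp: ab q0_def split: if_splits simp del: index_simps)
      moreover from this have "y = x" using antisymP unfolding Ix_X by auto
      ultimately have "mmul X h_mat dy w b = 0" by (simp add: mmul_def dy0)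
      then show ?thesis by simp
    qed simp
    then show ?thesis unfolding mmul_def[of X "mmul X h_mat dy"] by (intro sum.neutral ballI)
  qed
  then have ne: "mmul X dy h_mat a b + mmul X h_mat dy a b + q0 a b - mone X a b \<noteq> 0"
    using assms by simp
  have hd: "h_mat a w * dy w b \<noteq> 0 \<Longrightarrow> (\<exists>y. w = (x, y, c)) \<and> a \<in> Ix X \<and> b \<in> Ix X \<and> x' = x \<and> c' = c \<and> x \<noteq> Ps C c" for w
    by (cases w) (auto simp: ab h_mat_def dy_def split: if_splits simp del: index_simps)
  have dh: "dy a w * h_mat w b \<noteq> 0 \<Longrightarrow> (\<exists>y. w = (x, y, c)) \<and> a \<in> Ix X \<and> b \<in> Ix X \<and> x' = x \<and> c' = c \<and> x \<noteq> Ps C c" for w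
    using matsD[OF h_mats, of w b]
    by (cases w) (auto simp: ab h_mat_def dy_def split: if_splits simp del: index_simps)
  have mem: "a \<in> Ix X \<and> b \<in> Ix X \<and> x' = x \<and> c' = c"
  proof (rule ccontr)
    assume n: "\<not> ?thesis"
    then have z: "h_mat a w * dy w b = 0" "dy a w * h_mat w b = 0" for w using hd[of w] dh[of w] by blast+
    have "mmul X dy h_mat a b = 0" "mmul X h_mat dy a b = 0"
      unfolding mmul_def by (intro sum.neutral ballI z)+
    moreover have "q0 a b = 0" "mone X a b = 0" using n by (auto simp: q0_def mone_def ab simp del: index_simps)
    ultimately show False using ne by simp
  qed
  have xc: "x \<noteq> Ps C c"
  proof
    assume x: "x = Ps C c"
    then have z: "h_mat a w * dy w b = 0" "dy a w * h_mat w b = 0" for w using hd[of w] dh[of w] by blast+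
    have "mmul X dy h_mat a b = 0" "mmul X h_mat dy a b = 0"
      unfolding mmul_def by (intro sum.neutral ballI z)+
    moreover have "q0 a b = mone X a b" using mem x by (auto simp: q0_def mone_def ab simp del: index_simps)
    ultimately show False using ne by simp
  qed
  have m: "c \<in> Ix C" "(Ps C c, y) \<in> P" "(y, x) \<in> P" "(Ps C c, y') \<in> P" "(y', x) \<in> P"
    using mem unfolding ab Ix_X by auto
  have px: "(Ps C c, x) \<in> P" using m transP by blast
  let ?R = "raised (Ps C c) x"
  let ?S = "{y \<in> Field P. (Ps C c, y) \<in> P \<and> (y, x) \<in> P}"
  have S: "finite ?S" using finite_E by (simp add: Ix_E)
  have 1: "mmul X dy h_mat a b = of_bool (?R y) * (\<Sum>y1\<in>{y \<in> Field P. (Ps C c, y) \<in> P \<and> (y, x) \<in> P \<and> \<not> ?R y}. dE y1 y * dE y1 y')"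
  proof -
    have "mmul X dy h_mat a b = (\<Sum>y1\<in>?S. h_mat a (x, y1, c) * dy (x, y1, c) b)"
      unfolding mmul_def by (rule sum_X) (use hd m in \<open>auto simp del: index_simps\<close>)
    also have "\<dots> = (\<Sum>y1\<in>?S. if \<not> ?R y1 then of_bool (?R y) * (dE y1 y * dE y1 y') else 0)"
      by (rule sum.cong) (use mem m xc in \<open>auto simp: ab h_mat_def dy_def Ix_X simp del: index_simps\<close>)
    also have "\<dots> = (\<Sum>y1\<in>{y \<in> ?S. \<not> ?R y}. of_bool (?R y) * (dE y1 y * dE y1 y'))"
      by (rule sum.inter_filter[symmetric, OF S])
    finally show ?thesis by (simp add: sum_distrib_left conj_assoc)
  qed
  have 2: "mmul X h_mat dy a b = of_bool (\<not> ?R y') * (\<Sum>y1\<in>{y \<in> Field P. (Ps C c, y) \<in> P \<and> (y, x) \<in> P \<and> ?R y}. dE y y1 * dE y' y1)"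
  proof -
    have "mmul X h_mat dy a b = (\<Sum>y1\<in>?S. dy a (x, y1, c) * h_mat (x, y1, c) b)"
      unfolding mmul_def by (rule sum_X) (use dh m in \<open>auto simp del: index_simps\<close>)
    also have "\<dots> = (\<Sum>y1\<in>?S. if ?R y1 then of_bool (\<not> ?R y') * (dE y y1 * dE y' y1) else 0)"
      by (rule sum.cong) (use mem m xc in \<open>auto simp: ab h_mat_def dy_def Ix_X simp del: index_simps\<close>)
    also have "\<dots> = (\<Sum>y1\<in>{y \<in> ?S. ?R y}. of_bool (\<not> ?R y') * (dE y y1 * dE y' y1))"
      by (rule sum.inter_filter[symmetric, OF S])
    finally show ?thesis by (simp add: sum_distrib_left conj_assoc)
  qed
  have 3: "q0 a b = 0" "mone X a b = of_bool (y = y')"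
    using xc mem by (auto simp: q0_def mone_def ab simp del: index_simps)
  have low: "\<not> ?R y \<Longrightarrow> \<not> ?R y' \<Longrightarrow> mmul X h_mat dy a b = of_bool (y = y')"
    unfolding 2 using low_orthogonal[OF px, of y y'] xc m by simp
  have high: "?R y \<Longrightarrow> ?R y' \<Longrightarrow> mmul X dy h_mat a b = of_bool (y = y')"
    unfolding 1 using raised_orthogonal[OF px, of y y'] xc m by simp
  have "?R y \<and> \<not> ?R y'"
  proof (rule ccontr)
    assume "\<not> ?thesis"
    then consider "\<not> ?R y" "\<not> ?R y'" | "\<not> ?R y" "?R y'" | "?R y" "?R y'" by blast
    then show False
    proof cases
      case 1 then show ?thesis using ne low \<open>mmul X dy h_mat a b = _\<close> by (simp add: 3)
    next
      case 2 then show ?thesis using ne 1 \<open>mmul X h_mat dy a b = _\<close> by (auto simp: 3)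
    next
      case 3 then show ?thesis using ne high \<open>mmul X h_mat dy a b = _\<close> \<open>q0 a b = 0\<close> \<open>mone X a b = _\<close> by simp
    qed
  qed
  then show ?thesis using mem lev_simp[of x y' c y] by (simp add: ab rank_def)
qed

text \<open>The total deviation from the identity: entries that lower the level lower the rank because the level counts
  twice, and entries that preserve the level are those of \<open>homotopy_top\<close>.\<close>

lemma rank_drops:
  assumes "(mmul X d h_mat + mmul X h_mat d - mmul X (mmul X h_mat d) q + q - mone X) a b \<noteq> 0"
  shows "rank b < rank a"
proof -
  note top = eq_top_mmul[OF eq_top_refl[OF h_filtered] eq_top_d] eq_top_mmul[OF eq_top_d eq_top_refl[OF h_filtered]]
  note top' = eq_top_mmul[OF eq_top_q top(2)]
  have one: "mone X a b \<noteq> 0 \<Longrightarrow> a = b" by (auto simp: mone_def split: if_splits)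
  show ?thesis
  proof (cases "lev a \<le> lev b")
    case True
    then have "(mmul X dy h_mat + mmul X h_mat dy - mmul X (mmul X h_mat dy) q0 + q0 - mone X) a b \<noteq> 0"
      using assms top top' eq_top_q unfolding eq_top_def by simp
    then show ?thesis using homotopy_top by blast
  next
    case False
    obtain x y c x' y' c' where ab: "a = (x, y, c)" "b = (x', y', c')" by (metis prod_cases3)
    show ?thesis using False by (simp add: ab rank_def)
  qed
qed

lemma e_equivalence:
  shows "\<exists>g\<in>mats P C X 0. \<exists>k\<in>mats P X X 1. mbd C X 0 dC d g = (\<lambda>_ _. 0) \<and> mmul X e_mat g = mone C \<and>
     mmul C g e_mat = (\<lambda>a b. mbd X X 1 d d k a b + mone X a b)"
proof (rule equivalence_of_unipotent[OF trans_P _ _ finite_X finite_C d_mats dC d_d e_mats e_chain s_mats e_s h_mats e_h h_s rank_drops])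
  show "(Ps X v, Ps X v) \<in> P" if "v \<in> Ix X" for v
    using that reflP by (cases v) (auto simp: Ps_E Ix_E)
  show "(Ps C v, Ps C v) \<in> P" if "v \<in> Ix C" for v using that pos_C reflP by blast
qed

end

section \<open>Framed complexes\<close>

text \<open>The coordinates \<open>Crd X n \<sigma>\<close> concern the summand at \<open>\<sigma>\<close> in degree \<open>n\<close>. One index set serves all degrees and positions,
  so that a map of complexes has a single matrix.\<close>

record ('s, 'a, 'w) framed_cx =
  Cpx :: "('s, 'a) based_complex"
  Idx :: "('w, 's) index"
  Crd :: "int \<Rightarrow> 's \<Rightarrow> 'a \<Rightarrow> 'w \<Rightarrow> int"

definition at_deg :: "('w, 's) index \<Rightarrow> int \<Rightarrow> 'w set" where
  "at_deg I n = {w \<in> Ix I. Dg I w = n}"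

abbreviation (input) cgr where "cgr X \<equiv> Gr (Cpx X)"
abbreviation (input) ctot where "ctot P X n \<equiv> total P (Gr (Cpx X) n)"
abbreviation crd where "crd X n \<equiv> sum_coord (at_deg (Idx X) n) (Ps (Idx X)) (Crd X n)"

locale framed_complex = finite_poset P for P :: "'s rel" +
  fixes X :: "('s, 'a, 'w) framed_cx"
  assumes finite_Ix: "finite (Ix (Idx X))" and Ps_Field: "w \<in> Ix (Idx X) \<Longrightarrow> Ps (Idx X) w \<in> Field P"
    and framed_Gr: "\<sigma> \<in> Field P \<Longrightarrow> framed (Gr (Cpx X) n \<sigma>) {w \<in> at_deg (Idx X) n. Ps (Idx X) w = \<sigma>} (Crd X n \<sigma>)"
begin

sublocale deg: framed_based P "Gr (Cpx X) n" "at_deg (Idx X) n" "Ps (Idx X)" "Crd X n" for n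
proof unfold_locales
  show "framed (Gr (Cpx X) n \<sigma>) {w \<in> at_deg (Idx X) n. Ps (Idx X) w = \<sigma>} (Crd X n \<sigma>)" if "\<sigma> \<in> Field P" for n \<sigma>
    using that by (rule framed_Gr)
qed (auto simp: at_deg_def finite_Ix Ps_Field)

lemma framed_converse: "framed_complex (P\<inverse>) X"
proof -
  interpret C: finite_poset "P\<inverse>" by (rule finite_poset_converse)
  show ?thesis by unfold_locales (auto simp: framed_Gr finite_Ix Ps_Field)
qed

sublocale tot: framed_group "total P (Gr (Cpx X) n)" "at_deg (Idx X) n" "crd X n" for n
  by (rule deg.total_frame)

abbreviation bas where "bas n w \<equiv> basis_elt (total P (Gr (Cpx X) n)) (crd X n) w"

end

locale framed_complex_pair = X: framed_complex P X + Y: framed_complex P Y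
  for P :: "'s rel" and X :: "('s, 'a, 'v) framed_cx" and Y :: "('s, 'b, 'w) framed_cx"
begin

sublocale pair: framed_based_pair P "Gr (Cpx X) p" "at_deg (Idx X) p" "Ps (Idx X)" "Crd X p"
    "Gr (Cpx Y) q" "at_deg (Idx Y) q" "Ps (Idx Y)" "Crd Y q" for p q
  by unfold_locales

end

text \<open>Only the entries of \<open>A\<close> from elements of degree \<open>p\<close> to elements of degree \<open>q\<close> matter. Extensionality makes \<open>f\<close>
  unique.\<close>

definition has_matrix :: "'s rel \<Rightarrow> ('s, 'a, 'v) framed_cx \<Rightarrow> int \<Rightarrow> ('s, 'b, 'w) framed_cx \<Rightarrow> int
    \<Rightarrow> (('s \<Rightarrow> 'a) \<Rightarrow> ('s \<Rightarrow> 'b)) \<Rightarrow> ('v \<Rightarrow> 'w \<Rightarrow> int) \<Rightarrow> bool" where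
  "has_matrix P X p Y q f A \<longleftrightarrow>
     f \<in> carrier (ctot P X p) \<rightarrow> carrier (ctot P Y q) \<and> f \<in> extensional (carrier (ctot P X p)) \<and>
     (\<forall>x\<in>carrier (ctot P X p). \<forall>w'\<in>at_deg (Idx Y) q.
        crd Y q (f x) w' = (\<Sum>w\<in>at_deg (Idx X) p. crd X p x w * A w w'))"

lemma has_matrixD:
  assumes "has_matrix P X p Y q f A"
  shows "x \<in> carrier (ctot P X p) \<Longrightarrow> f x \<in> carrier (ctot P Y q)"
    and "f \<in> extensional (carrier (ctot P X p))"
    and "x \<in> carrier (ctot P X p) \<Longrightarrow> w' \<in> at_deg (Idx Y) q \<Longrightarrow>
      crd Y q (f x) w' = (\<Sum>w\<in>at_deg (Idx X) p. crd X p x w * A w w')"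
  using assms by (auto simp: has_matrix_def)

context framed_complex_pair
begin

lemma has_matrix_based_hom:
  assumes "has_matrix P X p Y q f A" "A \<in> mats P (Idx X) (Idx Y) n"
  shows "f \<in> carrier (based_hom P (cgr X p) (cgr Y q))"
  by (rule pair.based_homI[where A = A])
    (use assms matsD[OF assms(2)] in \<open>auto simp: has_matrix_def\<close>)

lemma has_matrix_basis:
  assumes "has_matrix P X p Y q f A" "w \<in> at_deg (Idx X) p" "w' \<in> at_deg (Idx Y) q"
  shows "crd Y q (f (X.bas p w)) w' = A w w'"
proof -
  have "crd Y q (f (X.bas p w)) w' = (\<Sum>v\<in>at_deg (Idx X) p. crd X p (X.bas p w) v * A v w')"
    using assms X.tot.basis_closed[OF assms(2)] by (simp add: has_matrix_def)
  also have "\<dots> = (\<Sum>v\<in>at_deg (Idx X) p. if v = w then A v w' else 0)"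
    by (rule sum.cong) (auto simp: X.tot.coord_basis[OF assms(2)])
  also have "\<dots> = A w w'" using assms(2) X.tot.fin by simp
  finally show ?thesis .
qed

lemma has_matrix_ex:
  assumes "f \<in> carrier (based_hom P (cgr X p) (cgr Y q))"
  shows "has_matrix P X p Y q f (\<lambda>w w'. crd Y q (f (X.bas p w)) w')"
  unfolding has_matrix_def
  using pair.based_hom_in[OF assms] pair.based_hom_ext[OF assms] pair.based_hom_matrix[OF assms] by auto

lemma has_matrix_eq:
  assumes "has_matrix P X p Y q f A" "has_matrix P X p Y q g A"
  shows "f = g"
proof (rule extensionalityI[of _ "carrier (ctot P X p)"])
  fix x assume x: "x \<in> carrier (ctot P X p)"
  show "f x = g x"
    by (rule Y.tot.coord_eq[where n = q]) (use assms x in \<open>auto simp: has_matrix_def\<close>)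
qed (use assms in \<open>auto simp: has_matrix_def\<close>)

lemma has_matrix_hom:
  assumes "has_matrix P X p Y q f A"
  shows "f \<in> hom (ctot P X p) (ctot P Y q)"
proof (rule homI)
  fix x y assume xy: "x \<in> carrier (ctot P X p)" "y \<in> carrier (ctot P X p)"
  show "f (x \<otimes>\<^bsub>ctot P X p\<^esub> y) = f x \<otimes>\<^bsub>ctot P Y q\<^esub> f y"
    by (rule Y.tot.coord_eq[where n = q])
      (use has_matrixD[OF assms] xy in \<open>simp_all add: Y.tot.coord_mult X.tot.coord_mult sum.distrib distrib_right\<close>)
qed (rule has_matrixD(1)[OF assms])

end

lemma has_matrix_cong:
  assumes "has_matrix P X p Y q f A"
    "\<And>w w'. w \<in> at_deg (Idx X) p \<Longrightarrow> w' \<in> at_deg (Idx Y) q \<Longrightarrow> A w w' = B w w'"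
  shows "has_matrix P X p Y q f B"
  using assms by (auto simp: has_matrix_def intro!: sum.cong)

section \<open>Framings of tensor products, of duals and of \<open>TC\<close>\<close>

definition tensor_cx :: "'s rel \<Rightarrow> ('s, 'e, 'x) framed_cx \<Rightarrow> ('s, 'a, 'w) framed_cx
    \<Rightarrow> ('s, int \<Rightarrow> ('e, 's \<Rightarrow> 'a) tensor, 'x \<times> 'w) framed_cx" where
  "tensor_cx P E X = \<lparr>Cpx = tensor_complex P (Cpx E) (bracket_complex P (Cpx X)),
     Idx = tensor_index P (Idx E) (Idx X),
     Crd = (\<lambda>n \<sigma>. sum_coord {w \<in> at_deg (tensor_index P (Idx E) (Idx X)) n. Ps (tensor_index P (Idx E) (Idx X)) w = \<sigma>}
       (\<lambda>w. Dg (Idx E) (fst w))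
       (\<lambda>p. tensor_coord (Gr (Cpx E) p \<sigma>) (below P (Gr (Cpx X) (n - p)) \<sigma>) (Crd E p \<sigma>) (crd X (n - p))))\<rparr>"

text \<open>The coordinates of a dual are the values on the basis. The argument \<open>P\<close> only affects the differential
  through the field of the relation, so the dual over \<open>P\<inverse>\<close> can be regarded as a complex over \<open>P\<close>.\<close>

definition dual_cx :: "'s rel \<Rightarrow> ('s, 'a, 'w) framed_cx \<Rightarrow> ('s, 'a \<Rightarrow> int, 'w) framed_cx" where
  "dual_cx P X = \<lparr>Cpx = dual_complex P (Cpx X), Idx = dual_index (Idx X),
     Crd = (\<lambda>n \<sigma> \<phi> w. if w \<in> {w \<in> at_deg (Idx X) (- n). Ps (Idx X) w = \<sigma>}
        then \<phi> (basis_elt (Gr (Cpx X) (- n) \<sigma>) (Crd X (- n) \<sigma>) w) else 0)\<rparr>"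

definition T_cx :: "'s rel \<Rightarrow> ('s, 'e, 'x) framed_cx \<Rightarrow> ('s, 'u::infinite, 'w) framed_cx
    \<Rightarrow> ('s, 'u, 'x \<times> 'w) framed_cx" where
  "T_cx P E X = \<lparr>Cpx = T_obj P (Cpx E) (Cpx X), Idx = T_index P (Idx E) (Idx X),
     Crd = (\<lambda>n \<sigma> y. Crd (dual_cx (P\<inverse>) (tensor_cx P E X)) n \<sigma> (uncopy_map (Gr (T_dual P (Cpx E) (Cpx X)) n \<sigma>) y))\<rparr>"

lemma at_deg_dual: "at_deg (dual_index I) n = at_deg I (- n)"
  by (auto simp: at_deg_def)

lemma at_deg_tensor: "(x, c) \<in> at_deg (tensor_index P E I) n \<longleftrightarrow>
    x \<in> Ix E \<and> c \<in> Ix I \<and> (Ps I c, Ps E x) \<in> P \<and> Dg E x + Dg I c = n"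
  by (auto simp: at_deg_def)

context framed_complex
begin

lemma framed_dual: "framed_complex P (dual_cx Q X)"
proof unfold_locales
  fix \<sigma> n assume \<sigma>: "\<sigma> \<in> Field P"
  have "framed (hom_group (Gr (Cpx X) (- n) \<sigma>) integer_group) {w \<in> at_deg (Idx X) (- n). Ps (Idx X) w = \<sigma>} (Crd (dual_cx Q X) n \<sigma>)"
    using framed_hom_group[OF framed_Gr[OF \<sigma>]] by (simp add: dual_cx_def)
  then show "framed (Gr (Cpx (dual_cx Q X)) n \<sigma>) {w \<in> at_deg (Idx (dual_cx Q X)) n. Ps (Idx (dual_cx Q X)) w = \<sigma>} (Crd (dual_cx Q X) n \<sigma>)"
    by (simp add: dual_cx_def dual_complex_def dual_obj_def at_deg_dual)
qed (auto simp: dual_cx_def finite_Ix Ps_Field)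

end

locale framed_tensor_cx = E: framed_complex P E + X: framed_complex P X
  for P :: "'s rel" and E :: "('s, 'e, 'x) framed_cx" and X :: "('s, 'a, 'w) framed_cx"
begin

lemma tensor_frame:
  assumes "\<sigma> \<in> Field P"
  shows "framed_tensor (Gr (Cpx E) p \<sigma>) {x \<in> at_deg (Idx E) p. Ps (Idx E) x = \<sigma>} (Crd E p \<sigma>)
    (below P (Gr (Cpx X) q) \<sigma>) {c \<in> at_deg (Idx X) q. (Ps (Idx X) c, \<sigma>) \<in> P} (crd X q)"
proof -
  interpret G: framed_group "Gr (Cpx E) p \<sigma>" "{x \<in> at_deg (Idx E) p. Ps (Idx E) x = \<sigma>}" "Crd E p \<sigma>"
    by unfold_locales (rule E.framed_Gr[OF assms])
  interpret H: framed_group "below P (Gr (Cpx X) q) \<sigma>" "{c \<in> at_deg (Idx X) q. (Ps (Idx X) c, \<sigma>) \<in> P}" "crd X q"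
    by unfold_locales (rule X.deg.framed_below)
  show ?thesis by unfold_locales
qed

abbreviation WI where "WI \<equiv> tensor_index P (Idx E) (Idx X)"

lemma degree_frame:
  assumes "\<sigma> \<in> Field P"
  shows "framed_sum UNIV (\<lambda>p. tensor_group (Gr (Cpx E) p \<sigma>) (below P (Gr (Cpx X) (n - p)) \<sigma>))
    {w \<in> at_deg WI n. Ps WI w = \<sigma>} (\<lambda>w. Dg (Idx E) (fst w))
    (\<lambda>p. tensor_coord (Gr (Cpx E) p \<sigma>) (below P (Gr (Cpx X) (n - p)) \<sigma>) (Crd E p \<sigma>) (crd X (n - p)))"
proof unfold_locales
  show "finite {w \<in> at_deg WI n. Ps WI w = \<sigma>}"
    by (rule finite_subset[OF _ finite_tensor_index[OF E.finite_Ix X.finite_Ix, of P]]) (auto simp: at_deg_def)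
  fix p
  interpret framed_tensor "Gr (Cpx E) p \<sigma>" "{x \<in> at_deg (Idx E) p. Ps (Idx E) x = \<sigma>}" "Crd E p \<sigma>"
    "below P (Gr (Cpx X) (n - p)) \<sigma>" "{c \<in> at_deg (Idx X) (n - p). (Ps (Idx X) c, \<sigma>) \<in> P}" "crd X (n - p)"
    by (rule tensor_frame[OF assms])
  have "{w \<in> {w \<in> at_deg WI n. Ps WI w = \<sigma>}. Dg (Idx E) (fst w) = p} =
     {x \<in> at_deg (Idx E) p. Ps (Idx E) x = \<sigma>} \<times> {c \<in> at_deg (Idx X) (n - p). (Ps (Idx X) c, \<sigma>) \<in> P}"
    by (auto simp: at_deg_tensor) (auto simp: at_deg_def)
  then show "framed (tensor_group (Gr (Cpx E) p \<sigma>) (below P (Gr (Cpx X) (n - p)) \<sigma>))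
     {w \<in> {w \<in> at_deg WI n. Ps WI w = \<sigma>}. Dg (Idx E) (fst w) = p}
     (tensor_coord (Gr (Cpx E) p \<sigma>) (below P (Gr (Cpx X) (n - p)) \<sigma>) (Crd E p \<sigma>) (crd X (n - p)))"
    using framed_T by simp
qed auto

lemma Gr_tensor_cx: "Gr (Cpx (tensor_cx P E X)) n \<sigma> =
    sum_group UNIV (\<lambda>p. tensor_group (Gr (Cpx E) p \<sigma>) (below P (Gr (Cpx X) (n - p)) \<sigma>))"
  by (simp add: tensor_cx_def tensor_complex_def tensor_gr_def tensor_obj_def bracket_complex_def bracket_def)

lemma framed_tensor_cx: "framed_complex P (tensor_cx P E X)"
proof unfold_locales
  fix \<sigma> n assume "\<sigma> \<in> Field P"
  then interpret framed_sum UNIV "\<lambda>p. tensor_group (Gr (Cpx E) p \<sigma>) (below P (Gr (Cpx X) (n - p)) \<sigma>)"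
    "{w \<in> at_deg WI n. Ps WI w = \<sigma>}" "\<lambda>w. Dg (Idx E) (fst w)"
    "\<lambda>p. tensor_coord (Gr (Cpx E) p \<sigma>) (below P (Gr (Cpx X) (n - p)) \<sigma>) (Crd E p \<sigma>) (crd X (n - p))"
    by (rule degree_frame)
  show "framed (Gr (Cpx (tensor_cx P E X)) n \<sigma>) {w \<in> at_deg (Idx (tensor_cx P E X)) n. Ps (Idx (tensor_cx P E X)) w = \<sigma>} (Crd (tensor_cx P E X) n \<sigma>)"
    unfolding Gr_tensor_cx using framed_sum_group by (simp add: tensor_cx_def)
qed (auto simp: tensor_cx_def finite_tensor_index E.finite_Ix X.finite_Ix E.Ps_Field split: prod.splits)

sublocale W: framed_complex P "tensor_cx P E X" by (rule framed_tensor_cx)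

sublocale Wop: framed_complex "P\<inverse>" "tensor_cx P E X" by (rule W.framed_converse)

lemma Idx_tensor_cx: "Idx (tensor_cx P E X) = WI" by (simp add: tensor_cx_def)

lemma crd_tensor_cx:
  assumes "(x, c) \<in> at_deg WI n"
  shows "crd (tensor_cx P E X) n u (x, c) = tensor_coord (Gr (Cpx E) (Dg (Idx E) x) (Ps (Idx E) x))
     (below P (Gr (Cpx X) (n - Dg (Idx E) x)) (Ps (Idx E) x)) (Crd E (Dg (Idx E) x) (Ps (Idx E) x)) (crd X (n - Dg (Idx E) x))
     (u (Ps (Idx E) x) (Dg (Idx E) x)) (x, c)"
  using assms by (simp add: sum_coord_def tensor_cx_def)

lemma tensor_total_component:
  assumes "u \<in> carrier (ctot P (tensor_cx P E X) n)" "\<sigma> \<in> Field P"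
  shows "u \<sigma> p \<in> carrier (tensor_group (Gr (Cpx E) p \<sigma>) (below P (Gr (Cpx X) (n - p)) \<sigma>))"
proof -
  have "u \<sigma> \<in> carrier (Gr (Cpx (tensor_cx P E X)) n \<sigma>)" using assms by (auto simp: W.deg.carrier_total)
  then show ?thesis unfolding Gr_tensor_cx framed_sum.carrier_sum[OF degree_frame[OF assms(2)]] by auto
qed

end

locale framed_T_cx = framed_tensor_cx P E X
  for P :: "'s rel" and E :: "('s, 'e, 'x) framed_cx" and X :: "('s, 'u::infinite, 'w) framed_cx"
begin

lemma framed_dual_tensor: "framed_complex P (dual_cx (P\<inverse>) (tensor_cx P E X))"
  by (rule W.framed_dual)

lemma Gr_T_dual: "Gr (Cpx (dual_cx (P\<inverse>) (tensor_cx P E X))) n = Gr (T_dual P (Cpx E) (Cpx X)) n"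
  by (simp add: dual_cx_def T_dual_def T_tensor_def tensor_cx_def)

lemma framed_T: "framed_complex P (T_cx P E X)"
proof unfold_locales
  interpret D: framed_complex P "dual_cx (P\<inverse>) (tensor_cx P E X)" by (rule framed_dual_tensor)
  fix \<sigma> n assume \<sigma>: "\<sigma> \<in> Field P"
  show "framed (Gr (Cpx (T_cx P E X)) n \<sigma>) {w \<in> at_deg (Idx (T_cx P E X)) n. Ps (Idx (T_cx P E X)) w = \<sigma>} (Crd (T_cx P E X) n \<sigma>)"
    using framed_copy[OF D.framed_Gr[OF \<sigma>, of n], where 'u = 'u] unfolding Gr_T_dual
    by (simp add: T_cx_def T_obj_def copy_obj_def) (simp add: dual_cx_def tensor_cx_def)
qed (auto simp: T_cx_def finite_tensor_index E.finite_Ix X.finite_Ix E.Ps_Field split: prod.splits)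

sublocale T: framed_complex P "T_cx P E X" by (rule framed_T)

end

section \<open>The matrices of the maps between tensor products\<close>

lemma bilinear_tens_comp:
  assumes "tensor_product G' H'" "f \<in> hom G G'" "g \<in> hom H H'"
  shows "bilinear G H (tensor_group G' H') (\<lambda>x y. tens G' H' (f x) (g y))"
proof -
  interpret tensor_product G' H' by fact
  show ?thesis
    unfolding bilinear_def
    by (intro conjI ballI homI)
      (use assms(2,3) in \<open>auto simp: tens_closed hom_in_carrier hom_mult[OF assms(2)] hom_mult[OF assms(3)] tens_mult_left tens_mult_right\<close>)
qed

lemma
  assumes "framed_tensor G V \<kappa> H W \<mu>" "framed_tensor G' V' \<kappa>' H' W' \<mu>'"
    and f: "f \<in> hom G G'" and g: "g \<in> hom H H'"
  shows tensor_map_hom: "tensor_map G H G' H' f g \<in> hom (tensor_group G H) (tensor_group G' H')"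
    and tensor_map_coord: "X \<in> carrier (tensor_group G H) \<Longrightarrow>
    tensor_coord G' H' \<kappa>' \<mu>' (tensor_map G H G' H' f g X) (v', w') =
    (\<Sum>(v, w)\<in>V \<times> W. tensor_coord G H \<kappa> \<mu> X (v, w) *
       (\<kappa>' (f (basis_elt G \<kappa> v)) v' * \<mu>' (g (basis_elt H \<mu> w)) w'))"
proof -
  interpret A: framed_tensor G V \<kappa> H W \<mu> by fact
  interpret B: framed_tensor G' V' \<kappa>' H' W' \<mu>' by fact
  have bi: "bilinear G H (tensor_group G' H') (\<lambda>x y. tens G' H' (f x) (g y))"
    by (rule bilinear_tens_comp[OF B.tensor_product_axioms f g])
  show "tensor_map G H G' H' f g \<in> hom (tensor_group G H) (tensor_group G' H')"
    unfolding tensor_map_def by (rule A.tensor_lift_hom[OF B.T.comm bi])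
  assume X: "X \<in> carrier (tensor_group G H)"
  show "tensor_coord G' H' \<kappa>' \<mu>' (tensor_map G H G' H' f g X) (v', w') =
    (\<Sum>(v, w)\<in>V \<times> W. tensor_coord G H \<kappa> \<mu> X (v, w) *
       (\<kappa>' (f (basis_elt G \<kappa> v)) v' * \<mu>' (g (basis_elt H \<mu> w)) w'))"
    unfolding tensor_map_def A.int_hom_tensor_lift[OF B.T.comm bi B.tensor_coord_hom X]
    by (rule sum.cong)
      (use f g in \<open>auto simp: B.tensor_coord_tens hom_in_carrier A.G.basis_closed A.H.basis_closed\<close>)
qed

lemma (in finite_poset) carrier_total_groups:
  "(\<And>\<sigma>. \<sigma> \<in> Field P \<Longrightarrow> group (M \<sigma>)) \<Longrightarrow> carrier (total P M) = (\<Pi>\<^sub>E \<sigma>\<in>Field P. carrier (M \<sigma>))"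
  using finite_poset by (auto simp: total_def carrier_sum_group)

lemma total_converse [simp]: "total (P\<inverse>) M = total P M"
  and component_converse [simp]: "component (P\<inverse>) M = component P M"
  by (simp_all add: total_def component_def fun_eq_iff)

lemma has_matrix_converse [simp]: "has_matrix (P\<inverse>) X p Y q f A = has_matrix P X p Y q f A"
  by (simp add: has_matrix_def)

context framed_complex_pair
begin

lemma component_hom:
  assumes "f \<in> hom (ctot P X p) (ctot P Y q)" "\<sigma> \<in> Field P" "\<tau> \<in> Field P"
  shows "component P (cgr X p) f \<sigma> \<tau> \<in> hom (cgr X p \<sigma>) (cgr Y q \<tau>)"
proof (rule homI)
  fix a b assume ab: "a \<in> carrier (cgr X p \<sigma>)" "b \<in> carrier (cgr X p \<sigma>)"
  have i: "sum_incl (Field P) (cgr X p) \<sigma> x \<in> carrier (ctot P X p)" if "x \<in> carrier (cgr X p \<sigma>)" for x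
    by (rule X.deg.sum_incl_total[OF assms(2) that])
  have "f (sum_incl (Field P) (cgr X p) \<sigma> (a \<otimes>\<^bsub>cgr X p \<sigma>\<^esub> b)) =
    f (sum_incl (Field P) (cgr X p) \<sigma> a) \<otimes>\<^bsub>ctot P Y q\<^esub> f (sum_incl (Field P) (cgr X p) \<sigma> b)"
    using hom_mult[OF X.deg.sum_incl_hom[OF assms(2)] ab] hom_mult[OF assms(1) i[OF ab(1)] i[OF ab(2)]]
    by (simp add: total_def)
  then show "component P (cgr X p) f \<sigma> \<tau> (a \<otimes>\<^bsub>cgr X p \<sigma>\<^esub> b) =
      component P (cgr X p) f \<sigma> \<tau> a \<otimes>\<^bsub>cgr Y q \<tau>\<^esub> component P (cgr X p) f \<sigma> \<tau> b"
    using assms(3) by (simp add: component_def Y.deg.mult_total)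
next
  fix a assume "a \<in> carrier (cgr X p \<sigma>)"
  then show "component P (cgr X p) f \<sigma> \<tau> a \<in> carrier (cgr Y q \<tau>)"
    using hom_in_carrier[OF assms(1) X.deg.sum_incl_total[OF assms(2)]] assms(3)
    by (auto simp: component_def Y.deg.carrier_total)
qed

lemma component_basis:
  assumes "has_matrix P X p Y q f A" "w \<in> at_deg (Idx X) p" "w' \<in> at_deg (Idx Y) q"
  shows "Crd Y q (Ps (Idx Y) w') (component P (cgr X p) f (Ps (Idx X) w) (Ps (Idx Y) w')
    (basis_elt (cgr X p (Ps (Idx X) w)) (Crd X p (Ps (Idx X) w)) w)) w' = A w w'"
  using has_matrix_basis[OF assms] assms(3)
  by (simp add: X.deg.basis_total[OF assms(2)] component_def sum_coord_def)

lemma has_matrix_below: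
  assumes "has_matrix P X p Y q f A" "A \<in> mats P (Idx X) (Idx Y) n" "x \<in> carrier (below P (cgr X p) \<sigma>)"
  shows "f x \<in> carrier (below P (cgr Y q) \<sigma>)"
  unfolding Y.deg.carrier_below
proof (intro conjI ballI impI)
  have x: "x \<in> carrier (ctot P X p)" using assms(3) by (simp add: X.deg.carrier_below)
  show "f x \<in> carrier (ctot P Y q)" by (rule has_matrixD(1)[OF assms(1) x])
  fix w' assume w': "w' \<in> at_deg (Idx Y) q" and "crd Y q (f x) w' \<noteq> 0"
  then have "(\<Sum>w\<in>at_deg (Idx X) p. crd X p x w * A w w') \<noteq> 0" using has_matrixD(3)[OF assms(1) x w'] by simp
  then obtain w where w: "w \<in> at_deg (Idx X) p" "crd X p x w * A w w' \<noteq> 0" by (meson sum.neutral)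
  then have "(Ps (Idx X) w, \<sigma>) \<in> P" using assms(3) by (auto simp: X.deg.carrier_below)
  moreover have "(Ps (Idx Y) w', Ps (Idx X) w) \<in> P" using w matsD[OF assms(2), of w w'] by auto
  ultimately show "(Ps (Idx Y) w', \<sigma>) \<in> P" using X.poset_trans by blast
qed

end

context framed_complex
begin

lemma has_matrix_id: "has_matrix P X n X n (based_id P (cgr X n)) (mone (Idx X))"
  unfolding has_matrix_def based_id_def mone_def
  using tot.fin by (auto simp: of_bool_def if_distrib at_deg_def cong: if_cong)

lemma mone_mats: "mone (Idx X) \<in> mats P (Idx X) (Idx X) 0"
  by (rule mats_mone) (simp add: poset_refl Ps_Field)

end

text \<open>Maps \<open>f \<otimes> g\<close> with \<open>f\<close> from \<open>E\<close> to itself. This covers both terms of the differential of \<open>E \<otimes> [X]\<close>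
  as well as \<open>Id \<otimes> [g]\<close>.\<close>

locale framed_tensor_pair = EX: framed_tensor_cx P E X + EY: framed_tensor_cx P E Y
  for P :: "'s rel" and E :: "('s, 'e, 'x) framed_cx" and X :: "('s, 'a, 'v) framed_cx"
    and Y :: "('s, 'b, 'w) framed_cx"
begin

sublocale EE: framed_complex_pair P E E by unfold_locales
sublocale XY: framed_complex_pair P X Y by unfold_locales

definition tcrd where
  "tcrd p q u = (\<lambda>(x, c). tensor_coord (cgr E p (Ps (Idx E) x)) (below P (cgr X q) (Ps (Idx E) x))
      (Crd E p (Ps (Idx E) x)) (crd X q) (u (Ps (Idx E) x)) (x, c))"

text \<open>The Kronecker product: entries of \<open>f \<otimes> g\<close> are products of entries. The sum over the positions below
  \<open>\<tau>\<close> in the definition of \<open>tensor_mor\<close> is absorbed in the sum over all basis elements, because entries of \<open>A\<close> from other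
  positions vanish.\<close>

lemma
  assumes f: "has_matrix P E p E p' f A" and A: "A \<in> mats (P\<inverse>) (Idx E) (Idx E) m"
    and h: "has_matrix P X q Y q' h B" and B: "B \<in> mats P (Idx X) (Idx Y) n"
    and g: "\<And>\<sigma> z. \<lbrakk>\<sigma> \<in> Field P; z \<in> carrier (below P (cgr X q) \<sigma>)\<rbrakk> \<Longrightarrow> g \<sigma> z = h z"
    and u: "\<And>\<sigma>. \<sigma> \<in> Field P \<Longrightarrow> u \<sigma> \<in> carrier (tensor_group (cgr E p \<sigma>) (below P (cgr X q) \<sigma>))"
      "u \<in> extensional (Field P)"
    and \<tau>: "\<tau> \<in> Field P"
  defines "v \<equiv> tensor_mor P (cgr E p) (bracket P (cgr X q)) (cgr E p') (bracket P (cgr Y q')) f g u \<tau>"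
  shows tensor_mor_closed: "v \<in> carrier (tensor_group (cgr E p' \<tau>) (below P (cgr Y q') \<tau>))"
    and tensor_mor_coord: "\<lbrakk>x' \<in> at_deg (Idx E) p'; Ps (Idx E) x' = \<tau>; c' \<in> at_deg (Idx Y) q'\<rbrakk> \<Longrightarrow>
     tensor_coord (cgr E p' \<tau>) (below P (cgr Y q') \<tau>) (Crd E p' \<tau>) (crd Y q') v (x', c') =
     (\<Sum>(x, c)\<in>{(x, c) \<in> Ix EX.WI. Dg (Idx E) x = p \<and> Dg (Idx X) c = q}.
        tcrd p q u (x, c) * (A x x' * B c c'))"
proof -
  let ?V = "\<lambda>\<sigma>. {x \<in> at_deg (Idx E) p. Ps (Idx E) x = \<sigma>}"
    and ?W = "\<lambda>\<sigma>. {c \<in> at_deg (Idx X) q. (Ps (Idx X) c, \<sigma>) \<in> P}"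
  let ?t = "\<lambda>\<sigma>. tensor_map (cgr E p \<sigma>) (below P (cgr X q) \<sigma>) (cgr E p' \<tau>) (below P (cgr Y q') \<tau>)
              (component P (cgr E p) f \<sigma> \<tau>) (Fun (bracket P (cgr Y q')) \<sigma> \<tau> \<circ> g \<sigma>)"
  interpret T': framed_tensor "cgr E p' \<tau>" "{x \<in> at_deg (Idx E) p'. Ps (Idx E) x = \<tau>}" "Crd E p' \<tau>"
    "below P (cgr Y q') \<tau>" "{c \<in> at_deg (Idx Y) q'. (Ps (Idx Y) c, \<tau>) \<in> P}" "crd Y q'"
    by (rule EY.tensor_frame[OF \<tau>])
  have below: "finite {\<sigma>. (\<sigma>, \<tau>) \<in> P}" "\<And>\<sigma>. (\<sigma>, \<tau>) \<in> P \<Longrightarrow> \<sigma> \<in> Field P"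
  proof -
    show "\<And>\<sigma>. (\<sigma>, \<tau>) \<in> P \<Longrightarrow> \<sigma> \<in> Field P" by (auto simp: Field_def)
    then show "finite {\<sigma>. (\<sigma>, \<tau>) \<in> P}" by (intro finite_subset[OF _ EX.E.finite_poset]) auto
  qed
  have fh: "component P (cgr E p) f \<sigma> \<tau> \<in> hom (cgr E p \<sigma>) (cgr E p' \<tau>)" if "\<sigma> \<in> Field P" for \<sigma>
    by (rule EE.component_hom[OF EE.has_matrix_hom[OF f] that \<tau>])
  have g_eq: "(Fun (bracket P (cgr Y q')) \<sigma> \<tau> \<circ> g \<sigma>) z = h z" if "\<sigma> \<in> Field P" "z \<in> carrier (below P (cgr X q) \<sigma>)" for \<sigma> z
    using g[OF that] XY.has_matrix_below[OF h B that(2)] by (simp add: bracket_def)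
  have gh: "(Fun (bracket P (cgr Y q')) \<sigma> \<tau> \<circ> g \<sigma>) \<in> hom (below P (cgr X q) \<sigma>) (below P (cgr Y q') \<tau>)"
    if \<sigma>: "(\<sigma>, \<tau>) \<in> P" for \<sigma>
  proof -
    interpret H: framed_group "below P (cgr X q) \<sigma>" "?W \<sigma>" "crd X q"
      by unfold_locales (rule EX.X.deg.framed_below)
    have mono: "x \<in> carrier (below P (cgr Y q') \<tau>)" if "x \<in> carrier (below P (cgr Y q') \<sigma>)" for x
      using that \<sigma> EX.E.poset_trans unfolding EY.X.deg.carrier_below by blast
    show ?thesis
    proof (rule homI)
      fix z assume z: "z \<in> carrier (below P (cgr X q) \<sigma>)"
      show "(Fun (bracket P (cgr Y q')) \<sigma> \<tau> \<circ> g \<sigma>) z \<in> carrier (below P (cgr Y q') \<tau>)"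
        unfolding g_eq[OF below(2)[OF \<sigma>] z] by (rule mono[OF XY.has_matrix_below[OF h B z]])
      fix z' assume z': "z' \<in> carrier (below P (cgr X q) \<sigma>)"
      have "h (z \<otimes>\<^bsub>below P (cgr X q) \<sigma>\<^esub> z') = h z \<otimes>\<^bsub>below P (cgr Y q') \<tau>\<^esub> h z'"
        unfolding EX.X.deg.mult_below EY.X.deg.mult_below
        by (rule hom_mult[OF XY.has_matrix_hom[OF h]]) (use z z' in \<open>auto simp: EX.X.deg.carrier_below\<close>)
      then show "(Fun (bracket P (cgr Y q')) \<sigma> \<tau> \<circ> g \<sigma>) (z \<otimes>\<^bsub>below P (cgr X q) \<sigma>\<^esub> z') =
         (Fun (bracket P (cgr Y q')) \<sigma> \<tau> \<circ> g \<sigma>) z \<otimes>\<^bsub>below P (cgr Y q') \<tau>\<^esub> (Fun (bracket P (cgr Y q')) \<sigma> \<tau> \<circ> g \<sigma>) z'"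
        by (simp only: g_eq[OF below(2)[OF \<sigma>]] z z' H.m_closed)
    qed
  qed
  have th: "?t \<sigma> (u \<sigma>) \<in> carrier (tensor_group (cgr E p' \<tau>) (below P (cgr Y q') \<tau>))" if \<sigma>: "(\<sigma>, \<tau>) \<in> P" for \<sigma>
    using hom_in_carrier[OF tensor_map_hom[OF EX.tensor_frame[OF below(2)[OF \<sigma>]] T'.framed_tensor_axioms fh[OF below(2)[OF \<sigma>]] gh[OF \<sigma>]] u(1)[OF below(2)[OF \<sigma>]]] .
  have "u \<in> carrier (total P (tensor_obj (cgr E p) (bracket P (cgr X q))))"
  proof -
    have "group (tensor_obj (cgr E p) (bracket P (cgr X q)) \<sigma>)" if "\<sigma> \<in> Field P" for \<sigma>
    proof -
      interpret framed_tensor "cgr E p \<sigma>" "?V \<sigma>" "Crd E p \<sigma>" "below P (cgr X q) \<sigma>" "?W \<sigma>" "crd X q"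
        by (rule EX.tensor_frame[OF that])
      show ?thesis unfolding tensor_obj_def bracket_def by simp
    qed
    then show ?thesis using u
      by (auto simp: EX.E.carrier_total_groups tensor_obj_def bracket_def PiE_def)
  qed
  then have v: "v = finprod (tensor_group (cgr E p' \<tau>) (below P (cgr Y q') \<tau>)) (\<lambda>\<sigma>. ?t \<sigma> (u \<sigma>)) {\<sigma>. (\<sigma>, \<tau>) \<in> P}"
    unfolding v_def tensor_mor_def using \<tau> by (simp add: tensor_obj_def bracket_def)
  have Pi: "(\<lambda>\<sigma>. ?t \<sigma> (u \<sigma>)) \<in> {\<sigma>. (\<sigma>, \<tau>) \<in> P} \<rightarrow> carrier (tensor_group (cgr E p' \<tau>) (below P (cgr Y q') \<tau>))"
    using th by auto
  show "v \<in> carrier (tensor_group (cgr E p' \<tau>) (below P (cgr Y q') \<tau>))"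
    unfolding v using Pi by simp
  assume x': "x' \<in> at_deg (Idx E) p'" "Ps (Idx E) x' = \<tau>" and c': "c' \<in> at_deg (Idx Y) q'"
  let ?S = "{(x, c) \<in> Ix EX.WI. Dg (Idx E) x = p \<and> Dg (Idx X) c = q}"
  let ?F = "\<lambda>(x, c). tcrd p q u (x, c) * (A x x' * B c c')"
  have finS: "finite ?S"
    by (rule finite_subset[OF _ finite_tensor_index[OF EX.E.finite_Ix EX.X.finite_Ix, of P]]) auto
  have "T'.tc v (x', c') = (\<Sum>\<sigma>\<in>{\<sigma>. (\<sigma>, \<tau>) \<in> P}. T'.tc (?t \<sigma> (u \<sigma>)) (x', c'))"
    unfolding v by (rule T'.T.coord_finprod[OF Pi])
  also have "\<dots> = (\<Sum>\<sigma>\<in>{\<sigma>. (\<sigma>, \<tau>) \<in> P}. \<Sum>p\<in>{p \<in> {p \<in> ?S. (Ps (Idx E) (fst p), \<tau>) \<in> P}. Ps (Idx E) (fst p) = \<sigma>}. ?F p)"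
  proof (rule sum.cong[OF refl])
    fix \<sigma> assume "\<sigma> \<in> {\<sigma>. (\<sigma>, \<tau>) \<in> P}"
    then have \<sigma>: "(\<sigma>, \<tau>) \<in> P" "\<sigma> \<in> Field P" using below(2) by auto
    interpret S: framed_tensor "cgr E p \<sigma>" "?V \<sigma>" "Crd E p \<sigma>" "below P (cgr X q) \<sigma>" "?W \<sigma>" "crd X q"
      by (rule EX.tensor_frame[OF \<sigma>(2)])
    have "T'.tc (?t \<sigma> (u \<sigma>)) (x', c') = (\<Sum>(x, c)\<in>?V \<sigma> \<times> ?W \<sigma>. S.tc (u \<sigma>) (x, c) *
       (Crd E p' \<tau> (component P (cgr E p) f \<sigma> \<tau> (basis_elt (cgr E p \<sigma>) (Crd E p \<sigma>) x)) x' *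
         crd Y q' ((Fun (bracket P (cgr Y q')) \<sigma> \<tau> \<circ> g \<sigma>) (basis_elt (below P (cgr X q) \<sigma>) (crd X q) c)) c'))"
      by (rule tensor_map_coord[OF S.framed_tensor_axioms T'.framed_tensor_axioms fh[OF \<sigma>(2)] gh[OF \<sigma>(1)] u(1)[OF \<sigma>(2)]])
    also have "\<dots> = (\<Sum>p\<in>?V \<sigma> \<times> ?W \<sigma>. ?F p)"
    proof (rule sum.cong[OF refl], clarify, rule arg_cong2[where f = "(*)"])
      fix x c assume x: "x \<in> at_deg (Idx E) p" "\<sigma> = Ps (Idx E) x" and c: "c \<in> at_deg (Idx X) q" "(Ps (Idx X) c, Ps (Idx E) x) \<in> P"
      show "tensor_coord (cgr E p (Ps (Idx E) x)) (below P (cgr X q) (Ps (Idx E) x)) (Crd E p (Ps (Idx E) x)) (crd X q) (u (Ps (Idx E) x)) (x, c) = tcrd p q u (x, c)"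
        by (simp add: tcrd_def)
      have "Crd E p' (Ps (Idx E) x') (component P (cgr E p) f (Ps (Idx E) x) (Ps (Idx E) x') (basis_elt (cgr E p (Ps (Idx E) x)) (Crd E p (Ps (Idx E) x)) x)) x' = A x x'"
        by (rule EE.component_basis[OF f x(1) x'(1)])
      moreover have "crd Y q' ((Fun (bracket P (cgr Y q')) (Ps (Idx E) x) \<tau> \<circ> g (Ps (Idx E) x)) (basis_elt (below P (cgr X q) (Ps (Idx E) x)) (crd X q) c)) c' = B c c'"
      proof -
        have b: "basis_elt (below P (cgr X q) (Ps (Idx E) x)) (crd X q) c \<in> carrier (below P (cgr X q) (Ps (Idx E) x))"
          using S.H.basis_closed[of c] c unfolding x(2) by simp
        show ?thesis
          unfolding g_eq[OF \<sigma>(2)[unfolded x(2)] b]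
          unfolding EX.X.deg.basis_below[OF c] by (rule XY.has_matrix_basis[OF h c(1) c'])
      qed
      ultimately show "Crd E p' \<tau> (component P (cgr E p) f (Ps (Idx E) x) \<tau> (basis_elt (cgr E p (Ps (Idx E) x)) (Crd E p (Ps (Idx E) x)) x)) x' *
         crd Y q' ((Fun (bracket P (cgr Y q')) (Ps (Idx E) x) \<tau> \<circ> g (Ps (Idx E) x)) (basis_elt (below P (cgr X q) (Ps (Idx E) x)) (crd X q) c)) c' = A x x' * B c c'"
        unfolding x'(2) by simp
    qed
    also have "?V \<sigma> \<times> ?W \<sigma> = {p \<in> {p \<in> ?S. (Ps (Idx E) (fst p), \<tau>) \<in> P}. Ps (Idx E) (fst p) = \<sigma>}"
      using \<sigma> by (auto simp: at_deg_def)
    finally show "T'.tc (?t \<sigma> (u \<sigma>)) (x', c') = (\<Sum>p\<in>{p \<in> {p \<in> ?S. (Ps (Idx E) (fst p), \<tau>) \<in> P}. Ps (Idx E) (fst p) = \<sigma>}. ?F p)" .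
  qed
  also have "\<dots> = (\<Sum>p\<in>{p \<in> ?S. (Ps (Idx E) (fst p), \<tau>) \<in> P}. ?F p)"
    by (rule sum.group) (use finS below(1) in auto)
  also have "\<dots> = (\<Sum>p\<in>?S. ?F p)"
  proof (rule sum.mono_neutral_left[OF finS])
    show "\<forall>p\<in>?S - {p \<in> ?S. (Ps (Idx E) (fst p), \<tau>) \<in> P}. ?F p = 0"
    proof
      fix p assume p: "p \<in> ?S - {p \<in> ?S. (Ps (Idx E) (fst p), \<tau>) \<in> P}"
      then have "A (fst p) x' = 0" using matsD[OF A, of "fst p" x'] x'(2) by auto
      then show "?F p = 0" by (simp add: split_beta)
    qed
  qed auto
  finally show "T'.tc v (x', c') = (\<Sum>(x, c)\<in>?S. tcrd p q u (x, c) * (A x x' * B c c'))" .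
qed

end

definition bd_matrix :: "'s rel \<Rightarrow> ('s, 'a, 'w) framed_cx \<Rightarrow> ('w \<Rightarrow> 'w \<Rightarrow> int) \<Rightarrow> bool" where
  "bd_matrix P X A \<longleftrightarrow> (\<forall>n. has_matrix P X n X (n - 1) (Bd (Cpx X) n) A)"

context framed_tensor_pair
begin

lemma component_in:
  assumes "u \<in> carrier (ctot P (tensor_cx P E X) n)" "p + q = n"
  shows "\<sigma> \<in> Field P \<Longrightarrow> slice P u p \<sigma> \<in> carrier (tensor_group (cgr E p \<sigma>) (below P (cgr X q) \<sigma>))"
    and "slice P u p \<in> extensional (Field P)"
  using EX.tensor_total_component[OF assms(1), of \<sigma> p] assms(2) by (auto simp: slice_def algebra_simps)

lemma tcrd_slice:
  assumes "(x, c) \<in> Ix EX.WI" "Dg (Idx E) x = p" "Dg (Idx X) c = q" "p + q = n"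
  shows "tcrd p q (slice P u p) (x, c) = crd (tensor_cx P E X) n u (x, c)"
proof -
  have "(x, c) \<in> at_deg EX.WI n" using assms by (auto simp: at_deg_def)
  from EX.crd_tensor_cx[OF this, of u] show ?thesis
    using assms EX.E.Ps_Field by (auto simp: tcrd_def slice_def algebra_simps)
qed

lemma
  assumes f: "has_matrix P E p E p' f A" and A: "A \<in> mats (P\<inverse>) (Idx E) (Idx E) m"
    and h: "has_matrix P X q Y q' h B" and B: "B \<in> mats P (Idx X) (Idx Y) n'"
    and g: "\<And>\<sigma> z. z \<in> carrier (below P (cgr X q) \<sigma>) \<Longrightarrow> g \<sigma> z = h z"
    and u: "u \<in> carrier (ctot P (tensor_cx P E X) n)" and n: "p + q = n" and \<tau>: "\<tau> \<in> Field P"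
  defines "v \<equiv> tensor_mor P (cgr E p) (bracket P (cgr X q)) (cgr E p') (bracket P (cgr Y q')) f g (slice P u p) \<tau>"
  shows tensor_mor_slice_closed: "v \<in> carrier (tensor_group (cgr E p' \<tau>) (below P (cgr Y q') \<tau>))"
    and tensor_mor_slice_coord: "\<lbrakk>x' \<in> at_deg (Idx E) p'; Ps (Idx E) x' = \<tau>; c' \<in> at_deg (Idx Y) q'\<rbrakk> \<Longrightarrow>
     tensor_coord (cgr E p' \<tau>) (below P (cgr Y q') \<tau>) (Crd E p' \<tau>) (crd Y q') v (x', c') =
     (\<Sum>a\<in>{(x, c) \<in> Ix EX.WI. Dg (Idx E) x = p \<and> Dg (Idx X) c = q}.
        crd (tensor_cx P E X) n u a * (A (fst a) x' * B (snd a) c'))"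
proof -
  note c = component_in[OF u n]
  show "v \<in> carrier (tensor_group (cgr E p' \<tau>) (below P (cgr Y q') \<tau>))"
    unfolding v_def by (rule tensor_mor_closed[OF f A h B _ c \<tau>]) (erule g)
  assume x': "x' \<in> at_deg (Idx E) p'" "Ps (Idx E) x' = \<tau>" "c' \<in> at_deg (Idx Y) q'"
  show "tensor_coord (cgr E p' \<tau>) (below P (cgr Y q') \<tau>) (Crd E p' \<tau>) (crd Y q') v (x', c') =
     (\<Sum>a\<in>{(x, c) \<in> Ix EX.WI. Dg (Idx E) x = p \<and> Dg (Idx X) c = q}.
        crd (tensor_cx P E X) n u a * (A (fst a) x' * B (snd a) c'))"
  proof -
    have "tensor_coord (cgr E p' \<tau>) (below P (cgr Y q') \<tau>) (Crd E p' \<tau>) (crd Y q') v (x', c') =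
      (\<Sum>(x, c)\<in>{(x, c) \<in> Ix EX.WI. Dg (Idx E) x = p \<and> Dg (Idx X) c = q}.
        tcrd p q (slice P u p) (x, c) * (A x x' * B c c'))"
      unfolding v_def
    proof (rule tensor_mor_coord[OF f A h B])
      show "g \<sigma> z = h z" if "z \<in> carrier (below P (cgr X q) \<sigma>)" for \<sigma> z using that by (rule g)
    qed (use c \<tau> x' in auto)
    also have "\<dots> = (\<Sum>a\<in>{(x, c) \<in> Ix EX.WI. Dg (Idx E) x = p \<and> Dg (Idx X) c = q}.
        crd (tensor_cx P E X) n u a * (A (fst a) x' * B (snd a) c'))"
  proof (rule sum.cong[OF refl])
    fix a assume "a \<in> {(x, c) \<in> Ix EX.WI. Dg (Idx E) x = p \<and> Dg (Idx X) c = q}"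
    moreover obtain x c where a: "a = (x, c)" by (cases a)
    ultimately have h: "(x, c) \<in> Ix EX.WI" "Dg (Idx E) x = p" "Dg (Idx X) c = q" by auto
    show "(case a of (x, c) \<Rightarrow> tcrd p q (slice P u p) (x, c) * (A x x' * B c c')) =
        crd (tensor_cx P E X) n u a * (A (fst a) x' * B (snd a) c')"
      by (simp add: a tcrd_slice[OF h n])
  qed
    finally show ?thesis .
  qed
qed

end

locale framed_tensor_map = framed_tensor_pair P E X Y
  for P :: "'s rel" and E :: "('s, 'e, 'x) framed_cx" and X :: "('s, 'a, 'v) framed_cx"
    and Y :: "('s, 'a, 'w) framed_cx"
begin

interpretation WY: framed_complex_pair P "tensor_cx P E X" "tensor_cx P E Y"
  by unfold_locales

lemma tensor_chain_map_matrix: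
  assumes f: "\<And>q. has_matrix P X q Y q (f q) A" and A: "A \<in> mats P (Idx X) (Idx Y) 0"
  shows "has_matrix P (tensor_cx P E X) n (tensor_cx P E Y) n
    (tensor_chain_map P (Cpx E) (bracket_complex P (Cpx X)) (bracket_complex P (Cpx Y))
       (\<lambda>q. bracket_mor P (cgr X q) (f q)) n)
    (tensor_mat P (Idx E) (Idx X) A)"
proof -
  let ?F = "tensor_chain_map P (Cpx E) (bracket_complex P (Cpx X)) (bracket_complex P (Cpx Y))
       (\<lambda>q. bracket_mor P (cgr X q) (f q)) n"
  let ?m = "\<lambda>u p \<tau>. tensor_mor P (cgr E p) (bracket P (cgr X (n - p))) (cgr E p) (bracket P (cgr Y (n - p)))
            (based_id P (cgr E p)) (bracket_mor P (cgr X (n - p)) (f (n - p))) (slice P u p) \<tau>"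
  have tot: "total P (tensor_gr (Cpx E) (bracket_complex P (Cpx X)) n) = ctot P (tensor_cx P E X) n"
    by (simp add: tensor_cx_def tensor_complex_def)
  have F: "?F u \<tau> p = ?m u p \<tau>" if "u \<in> carrier (ctot P (tensor_cx P E X) n)" "\<tau> \<in> Field P" for u \<tau> p
    using that by (simp add: tensor_chain_map_def tot) (simp add: bracket_complex_def)
  have E1: "mone (Idx E) \<in> mats (P\<inverse>) (Idx E) (Idx E) 0"
    using framed_complex.mone_mats[OF EX.E.framed_converse] .
  have g: "bracket_mor P (cgr X q) h \<sigma> z = h z" if "z \<in> carrier (below P (cgr X q) \<sigma>)" for \<sigma> z q and h :: "('s \<Rightarrow> 'a) \<Rightarrow> ('s \<Rightarrow> 'a)"
    using that by (simp add: bracket_mor_def)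
  have d: "p + (n - p) = n" for p by simp
  have closed: "?m u p \<tau> \<in> carrier (tensor_group (cgr E p \<tau>) (below P (cgr Y (n - p)) \<tau>))"
    if "u \<in> carrier (ctot P (tensor_cx P E X) n)" "\<tau> \<in> Field P" for u p \<tau>
    by (rule tensor_mor_slice_closed[OF EX.E.has_matrix_id E1 f A _ that(1) d that(2)]) (rule g)
  show ?thesis
    unfolding has_matrix_def
  proof (intro conjI ballI)
    show "?F \<in> carrier (ctot P (tensor_cx P E X) n) \<rightarrow> carrier (ctot P (tensor_cx P E Y) n)"
    proof
      fix u assume u: "u \<in> carrier (ctot P (tensor_cx P E X) n)"
      have "?F u \<tau> \<in> carrier (cgr (tensor_cx P E Y) n \<tau>)" if \<tau>: "\<tau> \<in> Field P" for \<tau>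
        unfolding EY.Gr_tensor_cx framed_sum.carrier_sum[OF EY.degree_frame[OF \<tau>]]
        by (auto simp: F[OF u \<tau>] intro!: closed[OF u \<tau>])
      moreover have "?F u \<in> extensional (Field P)" using u by (simp add: tensor_chain_map_def tot)
      ultimately show "?F u \<in> carrier (ctot P (tensor_cx P E Y) n)"
        by (simp add: EY.W.deg.carrier_total PiE_def)
    qed
    show "?F \<in> extensional (carrier (ctot P (tensor_cx P E X) n))"
      by (simp add: tensor_chain_map_def tot)
    fix u b assume u: "u \<in> carrier (ctot P (tensor_cx P E X) n)" and b: "b \<in> at_deg (Idx (tensor_cx P E Y)) n"
    obtain x' c' where b': "b = (x', c')" by (cases b)
    have b'': "(x', c') \<in> at_deg EY.WI n" using b by (simp add: b' EY.Idx_tensor_cx)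
    then have x': "x' \<in> Ix (Idx E)" "c' \<in> Ix (Idx Y)" "Dg (Idx Y) c' = n - Dg (Idx E) x'" by (auto simp: at_deg_def)
    let ?p = "Dg (Idx E) x'" and ?\<tau> = "Ps (Idx E) x'"
    have \<tau>: "?\<tau> \<in> Field P" by (rule EX.E.Ps_Field[OF x'(1)])
    have "crd (tensor_cx P E Y) n (?F u) b = (\<Sum>a\<in>{(x, c) \<in> Ix EX.WI. Dg (Idx E) x = ?p \<and> Dg (Idx X) c = n - ?p}.
        crd (tensor_cx P E X) n u a * (mone (Idx E) (fst a) x' * A (snd a) c'))"
      unfolding b' EY.crd_tensor_cx[OF b''] F[OF u \<tau>]
      by (rule tensor_mor_slice_coord[OF EX.E.has_matrix_id E1 f A _ u d \<tau> _ refl])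
        (use x' in \<open>auto simp: at_deg_def intro: g\<close>)
    also have "\<dots> = (\<Sum>a\<in>{(x, c) \<in> Ix EX.WI. Dg (Idx E) x = ?p \<and> Dg (Idx X) c = n - ?p}.
        crd (tensor_cx P E X) n u a * tensor_mat P (Idx E) (Idx X) A a b)"
      by (rule sum.cong) (auto simp: tensor_mat_def b' mone_def)
    also have "\<dots> = (\<Sum>a\<in>at_deg EX.WI n. crd (tensor_cx P E X) n u a * tensor_mat P (Idx E) (Idx X) A a b)"
    proof (rule sum.mono_neutral_left)
      show "finite (at_deg EX.WI n)"
        by (rule finite_subset[OF _ finite_tensor_index[OF EX.E.finite_Ix EX.X.finite_Ix, of P]]) (auto simp: at_deg_def)
    qed (auto simp: at_deg_def tensor_mat_def b')
    finally show "crd (tensor_cx P E Y) n (?F u) b = (\<Sum>a\<in>at_deg (Idx (tensor_cx P E X)) n. crd (tensor_cx P E X) n u a * tensor_mat P (Idx E) (Idx X) A a b)"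
      by (simp add: EX.Idx_tensor_cx)
  qed
qed

end

context framed_tensor_cx
begin

interpretation XX: framed_tensor_pair P E X X by unfold_locales

text \<open>The two terms of the differential are Kronecker products with an identity matrix.\<close>

lemma tensor_bd_matrix:
  assumes dE: "bd_matrix P E A" "A \<in> mats (P\<inverse>) (Idx E) (Idx E) (-1)"
    and dX: "bd_matrix P X B" "B \<in> mats P (Idx X) (Idx X) (-1)"
  shows "bd_matrix P (tensor_cx P E X) (tensor_bd P (Idx E) (Idx X) A B)"
  unfolding bd_matrix_def
proof
  fix n
  let ?F = "Bd (Cpx (tensor_cx P E X)) n"
  let ?m1 = "\<lambda>u p \<tau>. tensor_mor P (cgr E (p + 1)) (bracket P (cgr X (n - 1 - p))) (cgr E p) (bracket P (cgr X (n - 1 - p)))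
            (Bd (Cpx E) (p + 1)) (\<lambda>\<sigma> y. y) (slice P u (p + 1)) \<tau>"
  let ?m2 = "\<lambda>u p \<tau>. tensor_mor P (cgr E p) (bracket P (cgr X (n - p))) (cgr E p) (bracket P (cgr X (n - 1 - p)))
            (based_id P (cgr E p)) (bracket_mor P (cgr X (n - p)) (Bd (Cpx X) (n - p))) (slice P u p) \<tau>"
  let ?G = "\<lambda>p \<tau>. tensor_group (cgr E p \<tau>) (below P (cgr X (n - 1 - p)) \<tau>)"
  have tot: "total P (tensor_gr (Cpx E) (bracket_complex P (Cpx X)) n) = ctot P (tensor_cx P E X) n"
    by (simp add: tensor_cx_def tensor_complex_def)
  have F: "?F u \<tau> p = ?m1 u p \<tau> \<otimes>\<^bsub>?G p \<tau>\<^esub> ?m2 u p \<tau> [^]\<^bsub>?G p \<tau>\<^esub> parity_sign p"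
    if "u \<in> carrier (ctot P (tensor_cx P E X) n)" "\<tau> \<in> Field P" for u \<tau> p
  proof -
    have n1: "n - (p + 1) = n - 1 - p" by simp
    have "?F = Bd (tensor_complex P (Cpx E) (bracket_complex P (Cpx X))) n" by (simp add: tensor_cx_def)
    then show ?thesis
      using that by (simp add: tensor_complex_def tot Let_def n1) (simp add: tensor_obj_def bracket_complex_def bracket_def n1)
  qed
  have E1: "mone (Idx E) \<in> mats (P\<inverse>) (Idx E) (Idx E) 0"
    using framed_complex.mone_mats[OF E.framed_converse] .
  have hE: "has_matrix P E (p + 1) E p (Bd (Cpx E) (p + 1)) A" for p
    using dE(1)[unfolded bd_matrix_def, rule_format, of "p + 1"] by simp
  have hX: "has_matrix P X (n - p) X (n - 1 - p) (Bd (Cpx X) (n - p)) B" for p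
    using dX(1)[unfolded bd_matrix_def, rule_format, of "n - p"] by (simp add: algebra_simps)
  have g1: "(\<lambda>\<sigma> y. y) \<sigma> z = based_id P (cgr X q) z" if "z \<in> carrier (below P (cgr X q) \<sigma>)" for \<sigma> z q
    using that by (simp add: based_id_def X.deg.carrier_below)
  have g2: "bracket_mor P (cgr X q) h \<sigma> z = h z" if "z \<in> carrier (below P (cgr X q) \<sigma>)" for \<sigma> z q and h :: "('s \<Rightarrow> 'a) \<Rightarrow> ('s \<Rightarrow> 'a)"
    using that by (simp add: bracket_mor_def)
  have d1: "p + 1 + (n - 1 - p) = n" and d2: "p + (n - p) = n" for p by simp_all
  have closed1: "?m1 u p \<tau> \<in> carrier (?G p \<tau>)"
    if "u \<in> carrier (ctot P (tensor_cx P E X) n)" "\<tau> \<in> Field P" for u p \<tau>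
    by (rule XX.tensor_mor_slice_closed[OF hE dE(2) X.has_matrix_id X.mone_mats _ that(1) d1 that(2)]) (rule g1)
  have closed2: "?m2 u p \<tau> \<in> carrier (?G p \<tau>)"
    if "u \<in> carrier (ctot P (tensor_cx P E X) n)" "\<tau> \<in> Field P" for u p \<tau>
    by (rule XX.tensor_mor_slice_closed[OF E.has_matrix_id E1 hX dX(2) _ that(1) d2 that(2)]) (rule g2)
  show "has_matrix P (tensor_cx P E X) n (tensor_cx P E X) (n - 1) ?F (tensor_bd P (Idx E) (Idx X) A B)"
    unfolding has_matrix_def
  proof (intro conjI ballI)
    show "?F \<in> carrier (ctot P (tensor_cx P E X) n) \<rightarrow> carrier (ctot P (tensor_cx P E X) (n - 1))"
    proof
      fix u assume u: "u \<in> carrier (ctot P (tensor_cx P E X) n)"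
      have "?F u \<tau> \<in> carrier (cgr (tensor_cx P E X) (n - 1) \<tau>)" if \<tau>: "\<tau> \<in> Field P" for \<tau>
        unfolding Gr_tensor_cx framed_sum.carrier_sum[OF degree_frame[OF \<tau>]]
      proof (rule PiE_I)
        fix p
        interpret t: framed_tensor "cgr E p \<tau>" "{x \<in> at_deg (Idx E) p. Ps (Idx E) x = \<tau>}" "Crd E p \<tau>"
          "below P (cgr X (n - 1 - p)) \<tau>" "{c \<in> at_deg (Idx X) (n - 1 - p). (Ps (Idx X) c, \<tau>) \<in> P}" "crd X (n - 1 - p)"
          by (rule tensor_frame[OF \<tau>])
        show "?F u \<tau> p \<in> carrier (?G p \<tau>)"
          unfolding F[OF u \<tau>]
          by (intro t.T.m_closed t.T.int_pow_closed closed1 closed2 u \<tau>)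
      qed simp
      moreover have "?F u \<in> extensional (Field P)" using u
        by (simp add: tensor_cx_def tensor_complex_def)
      ultimately show "?F u \<in> carrier (ctot P (tensor_cx P E X) (n - 1))"
        by (simp add: W.deg.carrier_total PiE_def)
    qed
    show "?F \<in> extensional (carrier (ctot P (tensor_cx P E X) n))"
      by (simp add: tensor_cx_def tensor_complex_def)
    fix u b assume u: "u \<in> carrier (ctot P (tensor_cx P E X) n)" and b: "b \<in> at_deg (Idx (tensor_cx P E X)) (n - 1)"
    obtain x' c' where b': "b = (x', c')" by (cases b)
    have b'': "(x', c') \<in> at_deg WI (n - 1)" using b by (simp add: b' Idx_tensor_cx)
    then have x': "x' \<in> Ix (Idx E)" "c' \<in> Ix (Idx X)" "Dg (Idx X) c' = n - 1 - Dg (Idx E) x'" by (auto simp: at_deg_def)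
    let ?p = "Dg (Idx E) x'" and ?\<tau> = "Ps (Idx E) x'"
    have \<tau>: "?\<tau> \<in> Field P" by (rule E.Ps_Field[OF x'(1)])
    have xd: "x' \<in> at_deg (Idx E) ?p" "c' \<in> at_deg (Idx X) (n - 1 - ?p)" using x' by (auto simp: at_deg_def)
    let ?S1 = "{(x, c) \<in> Ix WI. Dg (Idx E) x = ?p + 1 \<and> Dg (Idx X) c = n - 1 - ?p}"
    let ?S2 = "{(x, c) \<in> Ix WI. Dg (Idx E) x = ?p \<and> Dg (Idx X) c = n - ?p}"
    let ?u = "crd (tensor_cx P E X) n u"
    interpret t: framed_tensor "cgr E ?p ?\<tau>" "{x \<in> at_deg (Idx E) ?p. Ps (Idx E) x = ?\<tau>}" "Crd E ?p ?\<tau>"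
      "below P (cgr X (n - 1 - ?p)) ?\<tau>" "{c \<in> at_deg (Idx X) (n - 1 - ?p). (Ps (Idx X) c, ?\<tau>) \<in> P}" "crd X (n - 1 - ?p)"
      by (rule tensor_frame[OF \<tau>])
    have fin: "finite (at_deg WI n)"
      by (rule finite_subset[OF _ finite_tensor_index[OF E.finite_Ix X.finite_Ix, of P]]) (auto simp: at_deg_def)
    have "t.tc (?m1 u ?p ?\<tau>) (x', c') = (\<Sum>a\<in>?S1. ?u a * (A (fst a) x' * mone (Idx X) (snd a) c'))"
      by (rule XX.tensor_mor_slice_coord[OF hE dE(2) X.has_matrix_id X.mone_mats _ u d1 \<tau> xd(1) refl xd(2)]) (rule g1)
    also have "\<dots> = (\<Sum>a\<in>?S1. ?u a * (of_bool (snd a = c') * A (fst a) x'))"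
      by (rule sum.cong) (auto simp: mone_def)
    also have "\<dots> = (\<Sum>a\<in>at_deg WI n. ?u a * (of_bool (snd a = c') * A (fst a) x'))"
    proof (rule sum.mono_neutral_left[OF fin])
      show "\<forall>a\<in>at_deg WI n - ?S1. ?u a * (of_bool (snd a = c') * A (fst a) x') = 0"
      proof
        fix a assume "a \<in> at_deg WI n - ?S1"
        then show "?u a * (of_bool (snd a = c') * A (fst a) x') = 0"
          using matsD[OF dE(2), of "fst a" x'] by (cases a; cases "A (fst a) x' = 0") (auto simp: at_deg_def)
      qed
    qed (auto simp: at_deg_def)
    finally have 1: "t.tc (?m1 u ?p ?\<tau>) (x', c') = (\<Sum>a\<in>at_deg WI n. ?u a * (of_bool (snd a = c') * A (fst a) x'))" .
    have "t.tc (?m2 u ?p ?\<tau>) (x', c') = (\<Sum>a\<in>?S2. ?u a * (mone (Idx E) (fst a) x' * B (snd a) c'))"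
      by (rule XX.tensor_mor_slice_coord[OF E.has_matrix_id E1 hX dX(2) _ u d2 \<tau> xd(1) refl xd(2)]) (rule g2)
    also have "\<dots> = (\<Sum>a\<in>?S2. ?u a * (of_bool (fst a = x') * B (snd a) c'))"
      by (rule sum.cong) (auto simp: mone_def)
    also have "\<dots> = (\<Sum>a\<in>at_deg WI n. ?u a * (of_bool (fst a = x') * B (snd a) c'))"
      by (rule sum.mono_neutral_left[OF fin]) (auto simp: at_deg_def)
    finally have 2: "t.tc (?m2 u ?p ?\<tau>) (x', c') = (\<Sum>a\<in>at_deg WI n. ?u a * (of_bool (fst a = x') * B (snd a) c'))" .
    have c1: "?m1 u ?p ?\<tau> \<in> carrier (?G ?p ?\<tau>)" by (rule closed1[OF u \<tau>])
    have c2: "?m2 u ?p ?\<tau> \<in> carrier (?G ?p ?\<tau>)" by (rule closed2[OF u \<tau>])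
    have "crd (tensor_cx P E X) (n - 1) (?F u) b = t.tc (?m1 u ?p ?\<tau>) (x', c') + parity_sign ?p * t.tc (?m2 u ?p ?\<tau>) (x', c')"
      unfolding b' crd_tensor_cx[OF b''] F[OF u \<tau>] using c1 c2 by (simp add: t.T.coord_mult t.T.coord_int_pow)
    also have "\<dots> = (\<Sum>a\<in>at_deg WI n. ?u a * tensor_bd P (Idx E) (Idx X) A B a b)"
      unfolding 1 2 sum_distrib_left sum.distrib[symmetric]
      by (rule sum.cong) (auto simp: tensor_bd_def b' algebra_simps at_deg_def)
    finally show "crd (tensor_cx P E X) (n - 1) (?F u) b = (\<Sum>a\<in>at_deg (Idx (tensor_cx P E X)) n. ?u a * tensor_bd P (Idx E) (Idx X) A B a b)"
      by (simp add: Idx_tensor_cx)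
  qed
qed

end

section \<open>The matrices of dual maps and of copied maps\<close>

context framed_complex_pair
begin

text \<open>Precomposition with \<open>f\<close> is given by the transposed matrix in the dual bases.\<close>

lemma dual_mor_matrix:
  assumes f: "has_matrix P X (- n) Y (- m) f A"
  shows "has_matrix P (dual_cx Q Y) m (dual_cx Q X) n (dual_mor P (cgr X (- n)) (cgr Y (- m)) f) (\<lambda>a b. A b a)"
proof -
  interpret DX: framed_complex P "dual_cx Q X" by (rule X.framed_dual)
  interpret DY: framed_complex P "dual_cx Q Y" by (rule Y.framed_dual)
  have gX: "cgr (dual_cx Q X) n = dual_obj (cgr X (- n))" and gY: "cgr (dual_cx Q Y) m = dual_obj (cgr Y (- m))"
    by (simp_all add: dual_cx_def dual_complex_def)
  let ?F = "dual_mor P (cgr X (- n)) (cgr Y (- m)) f"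
  have fh: "f \<in> hom (ctot P X (- n)) (ctot P Y (- m))" by (rule has_matrix_hom[OF f])
  have \<phi>h: "\<phi> \<sigma> \<in> hom (cgr Y (- m) \<sigma>) integer_group" if "\<phi> \<in> carrier (ctot P (dual_cx Q Y) m)" "\<sigma> \<in> Field P" for \<phi> \<sigma>
    using that DY.deg.carrier_total[of m] by (auto simp: gY dual_obj_def carrier_hom_group)
  have F: "?F \<phi> \<tau> = (\<lambda>x\<in>carrier (cgr X (- n) \<tau>). \<Sum>\<sigma>\<in>Field P. \<phi> \<sigma> (component P (cgr X (- n)) f \<tau> \<sigma> x))"
    if "\<phi> \<in> carrier (ctot P (dual_cx Q Y) m)" "\<tau> \<in> Field P" for \<phi> \<tau>
    using that by (simp add: dual_mor_def gY)
  show ?thesis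
    unfolding has_matrix_def
  proof (intro conjI ballI)
    show "?F \<in> carrier (ctot P (dual_cx Q Y) m) \<rightarrow> carrier (ctot P (dual_cx Q X) n)"
    proof
      fix \<phi> assume \<phi>: "\<phi> \<in> carrier (ctot P (dual_cx Q Y) m)"
      have "?F \<phi> \<tau> \<in> carrier (cgr (dual_cx Q X) n \<tau>)" if \<tau>: "\<tau> \<in> Field P" for \<tau>
      proof -
        have g: "group (cgr X (- n) \<tau>)" by (rule X.deg.group_summand[OF \<tau>])
        have "(\<lambda>x. \<Sum>\<sigma>\<in>Field P. \<phi> \<sigma> (component P (cgr X (- n)) f \<tau> \<sigma> x)) \<in> hom (cgr X (- n) \<tau>) integer_group"
        proof (rule homI)
          fix x y assume xy: "x \<in> carrier (cgr X (- n) \<tau>)" "y \<in> carrier (cgr X (- n) \<tau>)"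
          have "\<phi> \<sigma> (component P (cgr X (- n)) f \<tau> \<sigma> (x \<otimes>\<^bsub>cgr X (- n) \<tau>\<^esub> y)) =
              \<phi> \<sigma> (component P (cgr X (- n)) f \<tau> \<sigma> x) + \<phi> \<sigma> (component P (cgr X (- n)) f \<tau> \<sigma> y)" if \<sigma>: "\<sigma> \<in> Field P" for \<sigma>
            using hom_mult[OF component_hom[OF fh \<tau> \<sigma>] xy]
              hom_mult[OF \<phi>h[OF \<phi> \<sigma>] hom_in_carrier[OF component_hom[OF fh \<tau> \<sigma>] xy(1)] hom_in_carrier[OF component_hom[OF fh \<tau> \<sigma>] xy(2)]]
            by simp
          then show "(\<Sum>\<sigma>\<in>Field P. \<phi> \<sigma> (component P (cgr X (- n)) f \<tau> \<sigma> (x \<otimes>\<^bsub>cgr X (- n) \<tau>\<^esub> y))) =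
             (\<Sum>\<sigma>\<in>Field P. \<phi> \<sigma> (component P (cgr X (- n)) f \<tau> \<sigma> x)) \<otimes>\<^bsub>integer_group\<^esub> (\<Sum>\<sigma>\<in>Field P. \<phi> \<sigma> (component P (cgr X (- n)) f \<tau> \<sigma> y))"
            by (simp add: sum.distrib)
        qed simp
        from restrict_hom_group[OF g this] show ?thesis unfolding F[OF \<phi> \<tau>] by (simp add: gX dual_obj_def)
      qed
      moreover have "?F \<phi> \<in> extensional (Field P)" using \<phi> by (simp add: dual_mor_def gY)
      ultimately show "?F \<phi> \<in> carrier (ctot P (dual_cx Q X) n)" by (simp add: DX.deg.carrier_total PiE_def)
    qed
    show "?F \<in> extensional (carrier (ctot P (dual_cx Q Y) m))" by (simp add: dual_mor_def gY)
    fix \<phi> w assume \<phi>: "\<phi> \<in> carrier (ctot P (dual_cx Q Y) m)" and w: "w \<in> at_deg (Idx (dual_cx Q X)) n"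
    have w: "w \<in> at_deg (Idx X) (- n)" using w by (simp add: dual_cx_def at_deg_dual)
    let ?\<tau> = "Ps (Idx X) w"
    let ?b = "basis_elt (cgr X (- n) ?\<tau>) (Crd X (- n) ?\<tau>) w"
    have \<tau>: "?\<tau> \<in> Field P" by (rule X.deg.index_in[OF w])
    have bc: "?b \<in> carrier (cgr X (- n) ?\<tau>)" by (rule X.deg.basis_summand[OF w])
    have "crd (dual_cx Q X) n (?F \<phi>) w = ?F \<phi> ?\<tau> ?b"
      using w by (simp add: sum_coord_def dual_cx_def at_deg_dual)
    also have "\<dots> = (\<Sum>\<sigma>\<in>Field P. \<phi> \<sigma> (component P (cgr X (- n)) f ?\<tau> \<sigma> ?b))"
      unfolding F[OF \<phi> \<tau>] using bc by simp
    also have "\<dots> = (\<Sum>\<sigma>\<in>Field P. \<Sum>v\<in>{v \<in> at_deg (Idx Y) (- m). Ps (Idx Y) v = \<sigma>}. crd (dual_cx Q Y) m \<phi> v * A w v)"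
    proof (rule sum.cong[OF refl])
      fix \<sigma> assume \<sigma>: "\<sigma> \<in> Field P"
      interpret s: framed_group "cgr Y (- m) \<sigma>" "{v \<in> at_deg (Idx Y) (- m). Ps (Idx Y) v = \<sigma>}" "Crd Y (- m) \<sigma>"
        by (rule Y.deg.fr[OF \<sigma>])
      have "\<phi> \<sigma> (component P (cgr X (- n)) f ?\<tau> \<sigma> ?b) = (\<Sum>v\<in>{v \<in> at_deg (Idx Y) (- m). Ps (Idx Y) v = \<sigma>}.
         Crd Y (- m) \<sigma> (component P (cgr X (- n)) f ?\<tau> \<sigma> ?b) v * \<phi> \<sigma> (basis_elt (cgr Y (- m) \<sigma>) (Crd Y (- m) \<sigma>) v))"
        by (rule s.int_hom_expansion[OF \<phi>h[OF \<phi> \<sigma>] hom_in_carrier[OF component_hom[OF fh \<tau> \<sigma>] bc]])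
      also have "\<dots> = (\<Sum>v\<in>{v \<in> at_deg (Idx Y) (- m). Ps (Idx Y) v = \<sigma>}. crd (dual_cx Q Y) m \<phi> v * A w v)"
        by (rule sum.cong) (use component_basis[OF f w] in \<open>auto simp: sum_coord_def dual_cx_def at_deg_dual\<close>)
      finally show "\<phi> \<sigma> (component P (cgr X (- n)) f ?\<tau> \<sigma> ?b) = \<dots>" .
    qed
    also have "\<dots> = (\<Sum>v\<in>at_deg (Idx Y) (- m). crd (dual_cx Q Y) m \<phi> v * A w v)"
      by (rule sum.group) (use Y.tot.fin Y.deg.index_in X.finite_poset in auto)
    finally show "crd (dual_cx Q X) n (?F \<phi>) w = (\<Sum>v\<in>at_deg (Idx (dual_cx Q Y)) m. crd (dual_cx Q Y) m \<phi> v * A w v)"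
      by (simp add: dual_cx_def at_deg_dual)
  qed
qed

end

lemma dual_cx_converse: "dual_mor (Q\<inverse>) M N f = dual_mor Q M N f"
  by (simp add: dual_mor_def)

context framed_complex
begin

interpretation XX: framed_complex_pair P X X by unfold_locales

lemma dual_bd_matrix:
  assumes "bd_matrix P X A" "Q = P \<or> Q = P\<inverse>"
  shows "bd_matrix P (dual_cx Q X) (\<lambda>a b. parity_sign (Dg (dual_index (Idx X)) a + 1) * A b a)"
  unfolding bd_matrix_def
proof
  fix n
  interpret D: framed_complex P "dual_cx Q X" by (rule framed_dual)
  have dQ: "dual_mor Q M N f = dual_mor P M N f" "total Q M' = total P M'" for M N f and M' :: "('s, 'b) based"
    using assms(2) dual_cx_converse by auto
  have "has_matrix P X (- (n - 1)) X (- n) (Bd (Cpx X) (1 - n)) A"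
    using assms(1)[unfolded bd_matrix_def, rule_format, of "1 - n"] by simp
  from XX.dual_mor_matrix[OF this]
  have h: "has_matrix P (dual_cx Q X) n (dual_cx Q X) (n - 1) (dual_mor P (cgr X (1 - n)) (cgr X (- n)) (Bd (Cpx X) (1 - n))) (\<lambda>a b. A b a)"
    by simp
  have g: "cgr (dual_cx Q X) n = dual_obj (cgr X (- n))" "cgr (dual_cx Q X) (n - 1) = dual_obj (cgr X (1 - n))"
    by (simp_all add: dual_cx_def dual_complex_def)
  have B: "Bd (Cpx (dual_cx Q X)) n = (\<lambda>\<phi>\<in>carrier (ctot P (dual_cx Q X) n).
       dual_mor P (cgr X (1 - n)) (cgr X (- n)) (Bd (Cpx X) (1 - n)) \<phi> [^]\<^bsub>ctot P (dual_cx Q X) (n - 1)\<^esub> parity_sign (n + 1))"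
    unfolding g by (simp add: dual_cx_def dual_complex_def dQ)
  show "has_matrix P (dual_cx Q X) n (dual_cx Q X) (n - 1) (Bd (Cpx (dual_cx Q X)) n) (\<lambda>a b. parity_sign (Dg (dual_index (Idx X)) a + 1) * A b a)"
    unfolding has_matrix_def B
  proof (intro conjI ballI)
    fix \<phi> w assume \<phi>: "\<phi> \<in> carrier (ctot P (dual_cx Q X) n)" and w: "w \<in> at_deg (Idx (dual_cx Q X)) (n - 1)"
    let ?y = "dual_mor P (cgr X (1 - n)) (cgr X (- n)) (Bd (Cpx X) (1 - n)) \<phi>"
    have "crd (dual_cx Q X) (n - 1) (?y [^]\<^bsub>ctot P (dual_cx Q X) (n - 1)\<^esub> parity_sign (n + 1)) w =
        parity_sign (n + 1) * (\<Sum>v\<in>at_deg (Idx (dual_cx Q X)) n. crd (dual_cx Q X) n \<phi> v * A w v)"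
      using D.tot.coord_int_pow[OF has_matrixD(1)[OF h \<phi>]] has_matrixD(3)[OF h \<phi> w] by simp
    also have "\<dots> = (\<Sum>v\<in>at_deg (Idx (dual_cx Q X)) n. crd (dual_cx Q X) n \<phi> v * (parity_sign (Dg (dual_index (Idx X)) v + 1) * A w v))"
      unfolding sum_distrib_left by (rule sum.cong) (auto simp: at_deg_def dual_cx_def)
    finally show "crd (dual_cx Q X) (n - 1) ((\<lambda>\<phi>\<in>carrier (ctot P (dual_cx Q X) n). dual_mor P (cgr X (1 - n)) (cgr X (- n)) (Bd (Cpx X) (1 - n)) \<phi> [^]\<^bsub>ctot P (dual_cx Q X) (n - 1)\<^esub> parity_sign (n + 1)) \<phi>) w =
      (\<Sum>v\<in>at_deg (Idx (dual_cx Q X)) n. crd (dual_cx Q X) n \<phi> v * (parity_sign (Dg (dual_index (Idx X)) v + 1) * A w v))"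
      using \<phi> by simp
  qed (use has_matrixD(1)[OF h] in auto)
qed

end

definition copy_of :: "('s, 'a, 'w) framed_cx \<Rightarrow> ('s, 'u::infinite, 'w) framed_cx \<Rightarrow> bool" where
  "copy_of X Z \<longleftrightarrow> Idx Z = Idx X \<and> (\<forall>n. Gr (Cpx Z) n = copy_obj (Gr (Cpx X) n)) \<and>
     (\<forall>n \<sigma> y. Crd Z n \<sigma> y = Crd X n \<sigma> (uncopy_map (Gr (Cpx X) n \<sigma>) y))"

lemma copy_mor_matrix:
  fixes Z :: "('s, 'u::infinite, 'v) framed_cx" and Z' :: "('s, 'u, 'w) framed_cx"
  assumes "framed_complex_pair P X Y" "framed_complex_pair P Z Z'" "copy_of X Z" "copy_of Y Z'"
    and f: "has_matrix P X p Y q f A"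
  shows "has_matrix P Z p Z' q (copy_mor P (Gr (Cpx X) p) (Gr (Cpx Y) q) f) A"
proof -
  interpret XY: framed_complex_pair P X Y by fact
  interpret ZZ: framed_complex_pair P Z Z' by fact
  have Z: "Idx Z = Idx X" "\<And>n. cgr Z n = copy_obj (cgr X n)" "\<And>n \<sigma> y. Crd Z n \<sigma> y = Crd X n \<sigma> (uncopy_map (cgr X n \<sigma>) y)"
    using assms(3) by (auto simp: copy_of_def)
  have Z': "Idx Z' = Idx Y" "\<And>n. cgr Z' n = copy_obj (cgr Y n)" "\<And>n \<sigma> y. Crd Z' n \<sigma> y = Crd Y n \<sigma> (uncopy_map (cgr Y n \<sigma>) y)"
    using assms(4) by (auto simp: copy_of_def)
  let ?F = "copy_mor P (cgr X p) (cgr Y q) f" and ?u = "\<lambda>x. \<lambda>\<sigma>\<in>Field P. uncopy_map (cgr X p \<sigma>) (x \<sigma>)"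
  have u: "?u x \<in> carrier (ctot P X p)" if "x \<in> carrier (ctot P Z p)" for x
    using that unfolding XY.X.deg.carrier_total ZZ.X.deg.carrier_total by (auto simp: Z(2) copy_obj_def intro!: uncopy_closed)
  have F: "?F x \<tau> = copy_map (cgr Y q \<tau>) (f (?u x) \<tau>)" if "x \<in> carrier (ctot P Z p)" "\<tau> \<in> Field P" for x \<tau>
    using that by (simp add: copy_mor_def Z(2))
  have fu: "f (?u x) \<tau> \<in> carrier (cgr Y q \<tau>)" if "x \<in> carrier (ctot P Z p)" "\<tau> \<in> Field P" for x \<tau>
    using has_matrixD(1)[OF f u[OF that(1)]] that(2) by (auto simp: XY.Y.deg.carrier_total)
  show ?thesis
    unfolding has_matrix_def
  proof (intro conjI ballI)
    show "?F \<in> carrier (ctot P Z p) \<rightarrow> carrier (ctot P Z' q)"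
    proof
      fix x assume x: "x \<in> carrier (ctot P Z p)"
      have "?F x \<tau> \<in> carrier (cgr Z' q \<tau>)" if "\<tau> \<in> Field P" for \<tau>
        unfolding F[OF x that] using copy_closed[OF fu[OF x that]] by (simp add: Z'(2) copy_obj_def)
      moreover have "?F x \<in> extensional (Field P)" using x by (simp add: copy_mor_def Z(2))
      ultimately show "?F x \<in> carrier (ctot P Z' q)" by (simp add: ZZ.Y.deg.carrier_total PiE_def)
    qed
    show "?F \<in> extensional (carrier (ctot P Z p))" by (simp add: copy_mor_def Z(2))
    fix x w' assume x: "x \<in> carrier (ctot P Z p)" and w': "w' \<in> at_deg (Idx Z') q"
    have w'Y: "w' \<in> at_deg (Idx Y) q" using w' by (simp add: Z')
    have \<tau>: "Ps (Idx Y) w' \<in> Field P" by (rule XY.Y.deg.index_in[OF w'Y])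
    have c: "countable (carrier (cgr Y q (Ps (Idx Y) w')))" by (rule framed_countable[OF XY.Y.framed_Gr[OF \<tau>]])
    have "crd Z' q (?F x) w' = crd Y q (f (?u x)) w'"
      using w'Y by (simp add: sum_coord_def Z' F[OF x \<tau>] uncopy_copy[OF c fu[OF x \<tau>]])
    also have "\<dots> = (\<Sum>w\<in>at_deg (Idx X) p. crd X p (?u x) w * A w w')" by (rule has_matrixD(3)[OF f u[OF x] w'Y])
    also have "\<dots> = (\<Sum>w\<in>at_deg (Idx Z) p. crd Z p x w * A w w')"
      by (rule sum.cong) (auto simp: Z sum_coord_def XY.X.deg.index_in)
    finally show "crd Z' q (?F x) w' = (\<Sum>w\<in>at_deg (Idx Z) p. crd Z p x w * A w w')" .
  qed
qed

context framed_T_cx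
begin

lemma copy_of_T: "copy_of (dual_cx (P\<inverse>) (tensor_cx P E X)) (T_cx P E X)"
  unfolding copy_of_def by (simp add: T_cx_def T_obj_def Gr_T_dual) (simp add: dual_cx_def tensor_cx_def)

lemma T_bd_matrix:
  assumes "bd_matrix P E A" "A \<in> mats (P\<inverse>) (Idx E) (Idx E) (-1)"
    and "bd_matrix P X B" "B \<in> mats P (Idx X) (Idx X) (-1)"
  shows "bd_matrix P (T_cx P E X) (T_bd P (Idx E) (Idx X) A B)"
proof -
  interpret D: framed_complex P "dual_cx (P\<inverse>) (tensor_cx P E X)" by (rule framed_dual_tensor)
  interpret DD: framed_complex_pair P "dual_cx (P\<inverse>) (tensor_cx P E X)" "dual_cx (P\<inverse>) (tensor_cx P E X)" by unfold_locales
  interpret TT: framed_complex_pair P "T_cx P E X" "T_cx P E X" by unfold_locales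
  have "bd_matrix P (dual_cx (P\<inverse>) (tensor_cx P E X)) (T_bd P (Idx E) (Idx X) A B)"
    using W.dual_bd_matrix[OF tensor_bd_matrix[OF assms], of "P\<inverse>"] by (simp add: T_bd_def Idx_tensor_cx)
  then have "has_matrix P (T_cx P E X) n (T_cx P E X) (n - 1)
     (copy_mor P (cgr (dual_cx (P\<inverse>) (tensor_cx P E X)) n) (cgr (dual_cx (P\<inverse>) (tensor_cx P E X)) (n - 1))
        (Bd (Cpx (dual_cx (P\<inverse>) (tensor_cx P E X))) n)) (T_bd P (Idx E) (Idx X) A B)" for n
    unfolding bd_matrix_def
    by (intro copy_mor_matrix[OF DD.framed_complex_pair_axioms TT.framed_complex_pair_axioms copy_of_T copy_of_T]) simp
  moreover have "Bd (Cpx (T_cx P E X)) n = copy_mor P (cgr (dual_cx (P\<inverse>) (tensor_cx P E X)) n) (cgr (dual_cx (P\<inverse>) (tensor_cx P E X)) (n - 1))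
        (Bd (Cpx (dual_cx (P\<inverse>) (tensor_cx P E X))) n)" for n
    unfolding Gr_T_dual by (simp add: T_cx_def T_obj_def) (simp add: dual_cx_def T_dual_def T_tensor_def tensor_cx_def)
  ultimately show ?thesis unfolding bd_matrix_def by simp
qed

end

locale framed_T_pair = framed_tensor_map P E X Y
  for P :: "'s rel" and E :: "('s, 'e, 'x) framed_cx" and X :: "('s, 'u::infinite, 'v) framed_cx"
    and Y :: "('s, 'u, 'w) framed_cx"
begin

sublocale TX: framed_T_cx P E X by unfold_locales
sublocale TY: framed_T_cx P E Y by unfold_locales

lemma T_mor_matrix:
  assumes f: "\<And>q. has_matrix P X q Y q (f q) A" and A: "A \<in> mats P (Idx X) (Idx Y) 0"
  shows "has_matrix P (T_cx P E Y) n (T_cx P E X) n (T_mor P (Cpx E) (Cpx X) (Cpx Y) f n) (T_mat P (Idx E) (Idx X) A)"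
proof -
  interpret DX: framed_complex P "dual_cx (P\<inverse>) (tensor_cx P E X)" by (rule TX.framed_dual_tensor)
  interpret DY: framed_complex P "dual_cx (P\<inverse>) (tensor_cx P E Y)" by (rule TY.framed_dual_tensor)
  interpret D: framed_complex_pair P "dual_cx (P\<inverse>) (tensor_cx P E Y)" "dual_cx (P\<inverse>) (tensor_cx P E X)" by unfold_locales
  interpret T: framed_complex_pair P "T_cx P E Y" "T_cx P E X" by unfold_locales
  interpret W: framed_complex_pair P "tensor_cx P E X" "tensor_cx P E Y" by unfold_locales
  let ?F = "\<lambda>n. tensor_chain_map P (Cpx E) (bracket_complex P (Cpx X)) (bracket_complex P (Cpx Y))
       (\<lambda>q. bracket_mor P (cgr X q) (f q)) n"
  have 1: "has_matrix P (dual_cx (P\<inverse>) (tensor_cx P E Y)) n (dual_cx (P\<inverse>) (tensor_cx P E X)) n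
     (dual_mor P (cgr (tensor_cx P E X) (- n)) (cgr (tensor_cx P E Y) (- n)) (?F (- n))) (T_mat P (Idx E) (Idx X) A)"
    unfolding T_mat_def by (rule W.dual_mor_matrix[OF tensor_chain_map_matrix[OF f A]])
  have eq: "T_mor P (Cpx E) (Cpx X) (Cpx Y) f n = copy_mor P (cgr (dual_cx (P\<inverse>) (tensor_cx P E Y)) n) (cgr (dual_cx (P\<inverse>) (tensor_cx P E X)) n)
     (dual_mor P (cgr (tensor_cx P E X) (- n)) (cgr (tensor_cx P E Y) (- n)) (?F (- n)))"
    unfolding TX.Gr_T_dual TY.Gr_T_dual
    by (simp add: T_mor_def dual_chain_map_def dual_cx_converse) (simp add: T_tensor_def tensor_cx_def)
  show ?thesis
    unfolding eq
    by (rule copy_mor_matrix[OF D.framed_complex_pair_axioms T.framed_complex_pair_axioms TY.copy_of_T TX.copy_of_T 1])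
qed

end

section \<open>The matrix of \<open>S\<close>\<close>

lemma (in comm_group) int_hom_gfinprod:
  assumes "\<chi> \<in> hom G integer_group" "f \<in> I \<rightarrow> carrier G" "finite S" "S \<subseteq> I" "\<And>i. i \<in> I - S \<Longrightarrow> f i = \<one>"
  shows "\<chi> (gfinprod G f I) = (\<Sum>i\<in>S. \<chi> (f i))"
proof -
  have "gfinprod G f I = gfinprod G f S"
    by (rule gfinprod_mono_neutral_cong_right) (use assms in auto)
  also have "\<dots> = finprod G f S" by (rule gfinprod_eq_finprod) (use assms in auto)
  finally show ?thesis using int_hom_finprod[OF comm_group_axioms assms(1), of f S] assms(2,4) by auto
qed

text \<open>As \<open>mats\<close> fixes the degree of the entries, the components of \<open>f\<close> in all degrees share the matrix \<open>A\<close>.\<close>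

definition represents :: "'s rel \<Rightarrow> ('s, 'a, 'v) framed_cx \<Rightarrow> ('s, 'b, 'w) framed_cx \<Rightarrow> int
    \<Rightarrow> (int \<Rightarrow> ('s \<Rightarrow> 'a) \<Rightarrow> ('s \<Rightarrow> 'b)) \<Rightarrow> ('v \<Rightarrow> 'w \<Rightarrow> int) \<Rightarrow> bool" where
  "represents P X Y n f A \<longleftrightarrow> A \<in> mats P (Idx X) (Idx Y) n \<and> (\<forall>p. has_matrix P X p Y (p + n) (f p) A)"

locale framed_triple = framed_T_pair P E X Y
  for P :: "'s rel" and E :: "('s, 'e, 'x) framed_cx" and X :: "('s, 'u::infinite, 'v) framed_cx"
    and Y :: "('s, 'u, 'w) framed_cx"
begin

abbreviation WX where "WX \<equiv> tensor_cx P E X"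
abbreviation WY where "WY \<equiv> tensor_cx P E Y"
abbreviation TX where "TX \<equiv> T_cx P E X"

sublocale WXY: framed_tensor_cx P WX Y by unfold_locales
sublocale WYX: framed_tensor_cx P WY X by unfold_locales

abbreviation XY where "XY \<equiv> tensor_cx P WX Y"
abbreviation YX where "YX \<equiv> tensor_cx P WY X"

lemma Cpx_WX: "Cpx WX = T_tensor P (Cpx E) (Cpx X)" and Cpx_WY: "Cpx WY = T_tensor P (Cpx E) (Cpx Y)"
  and Cpx_XY: "Cpx XY = T_tensor2 P (Cpx E) (Cpx X) (Cpx Y)" and Cpx_YX: "Cpx YX = T_tensor2 P (Cpx E) (Cpx Y) (Cpx X)"
  and Cpx_TX: "Cpx TX = T_obj P (Cpx E) (Cpx X)"
  by (simp_all add: tensor_cx_def T_tensor_def T_tensor2_def T_cx_def)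

text \<open>Up to sign, \<open>S\<close> only reinterprets a vector indexed by pairs \<open>(w, d)\<close> as a matrix.\<close>

definition S_matrix where
  "S_matrix n u = (\<lambda>w d. parity_sign (Dg (Idx WX) w * Dg (Idx Y) d + Dg (Idx WX) w) * crd XY n u (w, d))"

text \<open>The functional \<open>\<phi>\<close> dual to the basis element \<open>w\<close> is sent to the sum of the elements \<open>z\<close> that occur together with \<open>w\<close>.
  Evaluating \<open>finprod\<close> and \<open>tensor_lift\<close> under a coordinate functional of \<open>D\<close> turns them into sums.\<close>

lemma S_map_represents:
  assumes u: "u \<in> carrier (ctot P XY n)"
  shows "represents P TX Y n (S_map P (Cpx E) (Cpx X) (Cpx Y) n u) (S_matrix n u)"
  unfolding represents_def
proof (intro conjI allI)
  have out: "crd XY n u (w, d) = 0" if "(w, d) \<notin> at_deg WXY.WI n" for w d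
    using that by (simp add: sum_coord_def WXY.Idx_tensor_cx)
  show "S_matrix n u \<in> mats P (Idx TX) (Idx Y) n"
  proof (rule matsI)
    fix w d assume "S_matrix n u w d \<noteq> 0"
    then have "(w, d) \<in> at_deg WXY.WI n" using out unfolding S_matrix_def by fastforce
    then show "w \<in> Ix (Idx TX) \<and> d \<in> Ix (Idx Y) \<and> Dg (Idx Y) d = Dg (Idx TX) w + n \<and> (Ps (Idx Y) d, Ps (Idx TX) w) \<in> P"
      by (cases w) (auto simp: at_deg_def T_cx_def EX.Idx_tensor_cx)
  qed
  fix q
  let ?G = "ctot P Y (q + n)"
  let ?S = "S_map P (Cpx E) (Cpx X) (Cpx Y) n u q"
  let ?s = "parity_sign ((- q) * (q + n) + (- q))"
  let ?\<psi> = "\<lambda>\<phi> \<sigma>. uncopy_map (Gr (T_dual P (Cpx E) (Cpx X)) q \<sigma>) (\<phi> \<sigma>)"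
  let ?\<beta> = "\<lambda>\<phi> \<sigma> w z. z [^]\<^bsub>?G\<^esub> (?s * ?\<psi> \<phi> \<sigma> w)"
  let ?t = "\<lambda>\<phi> \<sigma>. tensor_lift (cgr WX (- q) \<sigma>) (below P (cgr Y (q + n)) \<sigma>) ?G (?\<beta> \<phi> \<sigma>) (u \<sigma> (- q))"
  have nq: "n - - q = q + n" by simp
  have S: "?S \<phi> = finprod ?G (?t \<phi>) (Field P)" if "\<phi> \<in> carrier (ctot P TX q)" for \<phi>
    using that unfolding S_map_def Cpx_TX Cpx_WX by (simp add: Let_def)
  have fr: "framed_tensor (cgr WX (- q) \<sigma>) {w \<in> at_deg (Idx WX) (- q). Ps (Idx WX) w = \<sigma>} (Crd WX (- q) \<sigma>)
      (below P (cgr Y (q + n)) \<sigma>) {d \<in> at_deg (Idx Y) (q + n). (Ps (Idx Y) d, \<sigma>) \<in> P} (crd Y (q + n))"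
    if "\<sigma> \<in> Field P" for \<sigma>
    by (rule WXY.tensor_frame[OF that])
  have us: "u \<sigma> (- q) \<in> carrier (tensor_group (cgr WX (- q) \<sigma>) (below P (cgr Y (q + n)) \<sigma>))" if "\<sigma> \<in> Field P" for \<sigma>
    using WXY.tensor_total_component[OF u that, of "- q"] unfolding nq .
  have \<psi>: "?\<psi> \<phi> \<sigma> \<in> hom (cgr WX (- q) \<sigma>) integer_group" if "\<phi> \<in> carrier (ctot P TX q)" "\<sigma> \<in> Field P" for \<phi> \<sigma>
  proof -
    have "\<phi> \<sigma> \<in> carrier (cgr TX q \<sigma>)" using that by (auto simp: TX.T.deg.carrier_total)
    then have "?\<psi> \<phi> \<sigma> \<in> carrier (Gr (T_dual P (Cpx E) (Cpx X)) q \<sigma>)"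
      by (intro uncopy_closed) (simp add: T_cx_def T_obj_def copy_obj_def)
    then show ?thesis by (simp add: T_dual_def dual_complex_def dual_obj_def carrier_hom_group Cpx_WX)
  qed
  have bi: "bilinear (cgr WX (- q) \<sigma>) (below P (cgr Y (q + n)) \<sigma>) ?G (?\<beta> \<phi> \<sigma>)"
    if \<phi>: "\<phi> \<in> carrier (ctot P TX q)" and \<sigma>: "\<sigma> \<in> Field P" for \<phi> \<sigma>
  proof -
    have sub: "z \<in> carrier ?G" if "z \<in> carrier (below P (cgr Y (q + n)) \<sigma>)" for z
      using that by (simp add: EY.X.deg.carrier_below)
    show ?thesis
      unfolding bilinear_def
    proof (intro conjI ballI homI)
      fix w w' z assume w: "w \<in> carrier (cgr WX (- q) \<sigma>)" "w' \<in> carrier (cgr WX (- q) \<sigma>)" and z: "z \<in> carrier (below P (cgr Y (q + n)) \<sigma>)"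
      show "?\<beta> \<phi> \<sigma> (w \<otimes>\<^bsub>cgr WX (- q) \<sigma>\<^esub> w') z = ?\<beta> \<phi> \<sigma> w z \<otimes>\<^bsub>?G\<^esub> ?\<beta> \<phi> \<sigma> w' z"
        using hom_mult[OF \<psi>[OF \<phi> \<sigma>] w] sub[OF z] by (simp add: distrib_left EY.X.tot.int_pow_mult)
    next
      fix w z z' assume z: "z \<in> carrier (below P (cgr Y (q + n)) \<sigma>)" "z' \<in> carrier (below P (cgr Y (q + n)) \<sigma>)"
      show "?\<beta> \<phi> \<sigma> w (z \<otimes>\<^bsub>below P (cgr Y (q + n)) \<sigma>\<^esub> z') = ?\<beta> \<phi> \<sigma> w z \<otimes>\<^bsub>?G\<^esub> ?\<beta> \<phi> \<sigma> w z'"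
        using sub z by (simp add: EY.X.deg.mult_below EY.X.tot.int_pow_distrib)
    qed (use sub in auto)
  qed
  have tc: "?t \<phi> \<sigma> \<in> carrier ?G" if \<phi>: "\<phi> \<in> carrier (ctot P TX q)" and \<sigma>: "\<sigma> \<in> Field P" for \<phi> \<sigma>
  proof -
    interpret t: framed_tensor "cgr WX (- q) \<sigma>" "{w \<in> at_deg (Idx WX) (- q). Ps (Idx WX) w = \<sigma>}" "Crd WX (- q) \<sigma>"
      "below P (cgr Y (q + n)) \<sigma>" "{d \<in> at_deg (Idx Y) (q + n). (Ps (Idx Y) d, \<sigma>) \<in> P}" "crd Y (q + n)"
      by (rule fr[OF \<sigma>])
    show ?thesis by (rule hom_in_carrier[OF t.tensor_lift_hom[OF EY.X.tot.comm bi[OF \<phi> \<sigma>]] us[OF \<sigma>]])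
  qed
  show "has_matrix P TX q Y (q + n) ?S (S_matrix n u)"
    unfolding has_matrix_def
  proof (intro conjI ballI)
    show "?S \<in> carrier (ctot P TX q) \<rightarrow> carrier ?G"
      using tc by (auto simp: S intro!: EY.X.tot.finprod_closed)
    show "?S \<in> extensional (carrier (ctot P TX q))" unfolding S_map_def Cpx_TX by simp
    fix \<phi> d assume \<phi>: "\<phi> \<in> carrier (ctot P TX q)" and d: "d \<in> at_deg (Idx Y) (q + n)"
    have "crd Y (q + n) (?S \<phi>) d = (\<Sum>\<sigma>\<in>Field P. crd Y (q + n) (?t \<phi> \<sigma>) d)"
      unfolding S[OF \<phi>] by (rule EY.X.tot.coord_finprod) (use tc[OF \<phi>] in auto)
    also have "\<dots> = (\<Sum>\<sigma>\<in>Field P. \<Sum>w\<in>{w \<in> at_deg (Idx TX) q. Ps (Idx TX) w = \<sigma>}. crd TX q \<phi> w * S_matrix n u w d)"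
    proof (rule sum.cong[OF refl])
      fix \<sigma> assume \<sigma>: "\<sigma> \<in> Field P"
      let ?V = "{w \<in> at_deg (Idx WX) (- q). Ps (Idx WX) w = \<sigma>}"
      let ?D = "{d \<in> at_deg (Idx Y) (q + n). (Ps (Idx Y) d, \<sigma>) \<in> P}"
      interpret t: framed_tensor "cgr WX (- q) \<sigma>" ?V "Crd WX (- q) \<sigma>" "below P (cgr Y (q + n)) \<sigma>" ?D "crd Y (q + n)"
        by (rule fr[OF \<sigma>])
      have "crd Y (q + n) (?t \<phi> \<sigma>) d = (\<Sum>(w, d')\<in>?V \<times> ?D. t.tc (u \<sigma> (- q)) (w, d') *
          crd Y (q + n) (?\<beta> \<phi> \<sigma> (basis_elt (cgr WX (- q) \<sigma>) (Crd WX (- q) \<sigma>) w) (basis_elt (below P (cgr Y (q + n)) \<sigma>) (crd Y (q + n)) d')) d)"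
        by (rule t.int_hom_tensor_lift[OF EY.X.tot.comm bi[OF \<phi> \<sigma>] EY.X.tot.coord_hom us[OF \<sigma>]])
      also have "\<dots> = (\<Sum>w\<in>?V. \<Sum>d'\<in>?D. if d' = d then t.tc (u \<sigma> (- q)) (w, d) * (?s * ?\<psi> \<phi> \<sigma> (basis_elt (cgr WX (- q) \<sigma>) (Crd WX (- q) \<sigma>) w)) else 0)"
        unfolding sum.cartesian_product[symmetric]
        by (intro sum.cong) (auto simp: EY.X.deg.basis_below EY.X.tot.coord_int_pow EY.X.tot.basis_closed EY.X.tot.coord_basis)
      also have "\<dots> = (\<Sum>w\<in>?V. of_bool (d \<in> ?D) * (t.tc (u \<sigma> (- q)) (w, d) * (?s * ?\<psi> \<phi> \<sigma> (basis_elt (cgr WX (- q) \<sigma>) (Crd WX (- q) \<sigma>) w))))"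
        using t.H.fin by (intro sum.cong) auto
      also have "\<dots> = (\<Sum>w\<in>?V. crd TX q \<phi> w * S_matrix n u w d)"
      proof (rule sum.cong[OF refl])
        fix w assume w: "w \<in> ?V"
        have "crd TX q \<phi> w = ?\<psi> \<phi> \<sigma> (basis_elt (cgr WX (- q) \<sigma>) (Crd WX (- q) \<sigma>) w)"
          using w by (auto simp: sum_coord_def T_cx_def dual_cx_def at_deg_dual EX.Idx_tensor_cx)
        moreover have "S_matrix n u w d = of_bool (d \<in> ?D) * (?s * t.tc (u \<sigma> (- q)) (w, d))"
        proof (cases "d \<in> ?D")
          case True
          have wd: "Dg (Idx WX) w = - q" "Ps (Idx WX) w = \<sigma>" "Dg (Idx Y) d = q + n" using w d by (auto simp: at_deg_def)
          have "(w, d) \<in> at_deg WXY.WI n" using w d True by (auto simp: at_deg_def)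
          from WXY.crd_tensor_cx[OF this, of u] show ?thesis
            using True unfolding S_matrix_def wd nq by simp
        next
          case False
          then have "(w, d) \<notin> at_deg WXY.WI n" using w d by (auto simp: at_deg_def)
          with False show ?thesis using out by (simp add: S_matrix_def)
        qed
        ultimately show "of_bool (d \<in> ?D) * (t.tc (u \<sigma> (- q)) (w, d) * (?s * ?\<psi> \<phi> \<sigma> (basis_elt (cgr WX (- q) \<sigma>) (Crd WX (- q) \<sigma>) w))) = crd TX q \<phi> w * S_matrix n u w d"
          by (simp only: mult_ac)
      qed
      also have "?V = {w \<in> at_deg (Idx TX) q. Ps (Idx TX) w = \<sigma>}"
        by (auto simp: T_cx_def EX.Idx_tensor_cx at_deg_def)
      finally show "crd Y (q + n) (?t \<phi> \<sigma>) d = (\<Sum>w\<in>{w \<in> at_deg (Idx TX) q. Ps (Idx TX) w = \<sigma>}. crd TX q \<phi> w * S_matrix n u w d)" .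
    qed
    also have "\<dots> = (\<Sum>w\<in>at_deg (Idx TX) q. crd TX q \<phi> w * S_matrix n u w d)"
      by (rule sum.group) (use TX.T.tot.fin TX.T.deg.index_in EX.E.finite_poset in auto)
    finally show "crd Y (q + n) (?S \<phi>) d = (\<Sum>w\<in>at_deg (Idx TX) q. crd TX q \<phi> w * S_matrix n u w d)" .
  qed
qed

end

section \<open>The exchange of the last two tensor factors\<close>

lemma hom_comp: "\<lbrakk>f \<in> hom G H; g \<in> hom H K\<rbrakk> \<Longrightarrow> (\<lambda>x. g (f x)) \<in> hom G K"
  using hom_compose[of f G H g K] by (simp add: o_def)

context framed_tensor_cx
begin

lemma trivial_summand:
  assumes "\<sigma> \<in> Field P" "X' \<in> carrier (tensor_group (cgr E p \<sigma>) (below P (cgr X q) \<sigma>))"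
    "p \<notin> Dg (Idx E) ` Ix (Idx E)"
  shows "X' = \<one>\<^bsub>tensor_group (cgr E p \<sigma>) (below P (cgr X q) \<sigma>)\<^esub>"
proof -
  interpret t: framed_tensor "cgr E p \<sigma>" "{x \<in> at_deg (Idx E) p. Ps (Idx E) x = \<sigma>}" "Crd E p \<sigma>"
    "below P (cgr X q) \<sigma>" "{c \<in> at_deg (Idx X) q. (Ps (Idx X) c, \<sigma>) \<in> P}" "crd X q"
    by (rule tensor_frame[OF assms(1)])
  show ?thesis
    by (rule t.T.coord_eq) (use assms in \<open>auto simp: at_deg_def\<close>)
qed

lemma summand_component:
  assumes "\<sigma> \<in> Field P" "w \<in> carrier (cgr (tensor_cx P E X) n \<sigma>)"
  shows "w p \<in> carrier (tensor_group (cgr E p \<sigma>) (below P (cgr X (n - p)) \<sigma>))"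
  using assms(2) unfolding Gr_tensor_cx framed_sum.carrier_sum[OF degree_frame[OF assms(1)]] by auto

lemma Crd_tensor_cx:
  assumes "\<sigma> \<in> Field P"
  shows "Crd (tensor_cx P E X) n \<sigma> w (x, c) = (if (x, c) \<in> at_deg WI n \<and> Ps (Idx E) x = \<sigma>
     then tensor_coord (cgr E (Dg (Idx E) x) \<sigma>) (below P (cgr X (n - Dg (Idx E) x)) \<sigma>) (Crd E (Dg (Idx E) x) \<sigma>)
        (crd X (n - Dg (Idx E) x)) (w (Dg (Idx E) x)) (x, c) else 0)"
  by (auto simp: tensor_cx_def sum_coord_def)

text \<open>\<open>swap_map\<close> is assembled twice in this manner from bilinear maps on the summands of a graded piece of
  \<open>E \<otimes> [X]\<close>. It is evaluated by applying homomorphisms \<open>\<chi>\<close> to the integers.\<close>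

lemma
  assumes \<sigma>: "\<sigma> \<in> Field P" and A: "comm_group A"
    and \<beta>: "\<And>p. bilinear (cgr E p \<sigma>) (below P (cgr X (n - p)) \<sigma>) A (\<beta> p)"
  defines "L \<equiv> \<lambda>w. gfinprod A (\<lambda>p. tensor_lift (cgr E p \<sigma>) (below P (cgr X (n - p)) \<sigma>) A (\<beta> p) (w p)) UNIV"
  shows assembled_hom: "L \<in> hom (cgr (tensor_cx P E X) n \<sigma>) A"
    and int_hom_assembled: "\<lbrakk>\<chi> \<in> hom A integer_group; w \<in> carrier (cgr (tensor_cx P E X) n \<sigma>)\<rbrakk> \<Longrightarrow>
      \<chi> (L w) = (\<Sum>(x, c)\<in>{(x, c) \<in> at_deg WI n. Ps (Idx E) x = \<sigma>}. Crd (tensor_cx P E X) n \<sigma> w (x, c) *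
        \<chi> (\<beta> (Dg (Idx E) x) (basis_elt (cgr E (Dg (Idx E) x) \<sigma>) (Crd E (Dg (Idx E) x) \<sigma>) x)
              (basis_elt (ctot P X (Dg (Idx X) c)) (crd X (Dg (Idx X) c)) c)))"
proof -
  interpret A: comm_group A by fact
  let ?G = "\<lambda>p. tensor_group (cgr E p \<sigma>) (below P (cgr X (n - p)) \<sigma>)"
  let ?l = "\<lambda>p. tensor_lift (cgr E p \<sigma>) (below P (cgr X (n - p)) \<sigma>) A (\<beta> p)"
  let ?V = "\<lambda>p. {x \<in> at_deg (Idx E) p. Ps (Idx E) x = \<sigma>}"
    and ?W = "\<lambda>p. {c \<in> at_deg (Idx X) (n - p). (Ps (Idx X) c, \<sigma>) \<in> P}"
  have fr: "framed_tensor (cgr E p \<sigma>) (?V p) (Crd E p \<sigma>) (below P (cgr X (n - p)) \<sigma>) (?W p) (crd X (n - p))" for p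
    by (rule tensor_frame[OF \<sigma>])
  have l: "?l p \<in> hom (?G p) A" for p
  proof -
    interpret t: framed_tensor "cgr E p \<sigma>" "?V p" "Crd E p \<sigma>" "below P (cgr X (n - p)) \<sigma>" "?W p" "crd X (n - p)" by (rule fr)
    show ?thesis by (rule t.tensor_lift_hom[OF A \<beta>])
  qed
  have gr: "group (?G p)" for p
  proof -
    interpret t: framed_tensor "cgr E p \<sigma>" "?V p" "Crd E p \<sigma>" "below P (cgr X (n - p)) \<sigma>" "?W p" "crd X (n - p)" by (rule fr)
    show ?thesis by (rule t.T.group_axioms)
  qed
  show "L \<in> hom (cgr (tensor_cx P E X) n \<sigma>) A"
    unfolding L_def Gr_tensor_cx by (rule A.hom_group_sum[OF l gr])
  assume \<chi>: "\<chi> \<in> hom A integer_group" and w: "w \<in> carrier (cgr (tensor_cx P E X) n \<sigma>)"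
  note wp = summand_component[OF \<sigma> w]
  let ?S = "Dg (Idx E) ` Ix (Idx E)"
  let ?T = "{a \<in> at_deg WI n. Ps (Idx E) (fst a) = \<sigma>}"
  let ?f = "\<lambda>a. Crd (tensor_cx P E X) n \<sigma> w a *
        \<chi> (\<beta> (Dg (Idx E) (fst a)) (basis_elt (cgr E (Dg (Idx E) (fst a)) \<sigma>) (Crd E (Dg (Idx E) (fst a)) \<sigma>) (fst a))
              (basis_elt (ctot P X (Dg (Idx X) (snd a))) (crd X (Dg (Idx X) (snd a))) (snd a)))"
  have finT: "finite ?T"
    by (rule finite_subset[OF _ finite_tensor_index[OF E.finite_Ix X.finite_Ix, of P]]) (auto simp: at_deg_def)
  have "\<chi> (L w) = (\<Sum>p\<in>?S. \<chi> (?l p (w p)))"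
    unfolding L_def
  proof (rule A.int_hom_gfinprod[OF \<chi>])
    show "(\<lambda>p. ?l p (w p)) \<in> UNIV \<rightarrow> carrier A" using hom_in_carrier[OF l wp] by auto
    show "?l p (w p) = \<one>\<^bsub>A\<^esub>" if "p \<in> UNIV - ?S" for p
      using trivial_summand[OF \<sigma> wp] that hom_one[OF l gr A.group_axioms] by auto
  qed (use E.finite_Ix in auto)
  also have "\<dots> = (\<Sum>p\<in>?S. \<Sum>a\<in>{a \<in> ?T. Dg (Idx E) (fst a) = p}. ?f a)"
  proof (rule sum.cong[OF refl])
    fix p
    interpret t: framed_tensor "cgr E p \<sigma>" "?V p" "Crd E p \<sigma>" "below P (cgr X (n - p)) \<sigma>" "?W p" "crd X (n - p)" by (rule fr)
    have "\<chi> (?l p (w p)) = (\<Sum>(x, c)\<in>?V p \<times> ?W p. t.tc (w p) (x, c) * \<chi> (\<beta> p (basis_elt (cgr E p \<sigma>) (Crd E p \<sigma>) x) (basis_elt (below P (cgr X (n - p)) \<sigma>) (crd X (n - p)) c)))"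
      by (rule t.int_hom_tensor_lift[OF A \<beta> \<chi> wp])
    also have "\<dots> = (\<Sum>a\<in>?V p \<times> ?W p. ?f a)"
    proof (rule sum.cong[OF refl], clarify)
      fix x c assume x: "x \<in> at_deg (Idx E) p" "\<sigma> = Ps (Idx E) x" and c: "c \<in> at_deg (Idx X) (n - p)" "(Ps (Idx X) c, Ps (Idx E) x) \<in> P"
      have d: "Dg (Idx E) x = p" "Dg (Idx X) c = n - p" "(x, c) \<in> at_deg WI n" using x c by (auto simp: at_deg_def)
      show "tensor_coord (cgr E p (Ps (Idx E) x)) (below P (cgr X (n - p)) (Ps (Idx E) x)) (Crd E p (Ps (Idx E) x)) (crd X (n - p)) (w p) (x, c) *
         \<chi> (\<beta> p (basis_elt (cgr E p (Ps (Idx E) x)) (Crd E p (Ps (Idx E) x)) x) (basis_elt (below P (cgr X (n - p)) (Ps (Idx E) x)) (crd X (n - p)) c)) =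
         Crd (tensor_cx P E X) n (Ps (Idx E) x) w (x, c) *
        \<chi> (\<beta> (Dg (Idx E) (fst (x, c))) (basis_elt (cgr E (Dg (Idx E) (fst (x, c))) (Ps (Idx E) x)) (Crd E (Dg (Idx E) (fst (x, c))) (Ps (Idx E) x)) (fst (x, c)))
              (basis_elt (ctot P X (Dg (Idx X) (snd (x, c)))) (crd X (Dg (Idx X) (snd (x, c)))) (snd (x, c))))"
        using d Crd_tensor_cx[OF \<sigma>[unfolded x(2)], of n w x c] by (simp add: X.deg.basis_below[OF c])
    qed
    also have "?V p \<times> ?W p = {a \<in> ?T. Dg (Idx E) (fst a) = p}" by (auto simp: at_deg_def)
    finally show "\<chi> (?l p (w p)) = (\<Sum>a\<in>{a \<in> ?T. Dg (Idx E) (fst a) = p}. ?f a)" .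
  qed
  also have "\<dots> = (\<Sum>a\<in>?T. ?f a)"
    by (rule sum.group) (use finT E.finite_Ix in \<open>auto simp: at_deg_def\<close>)
  also have "\<dots> = (\<Sum>(x, c)\<in>{(x, c) \<in> at_deg WI n. Ps (Idx E) x = \<sigma>}. ?f (x, c))"
    by (rule sum.cong) auto
  finally show "\<chi> (L w) = (\<Sum>(x, c)\<in>{(x, c) \<in> at_deg WI n. Ps (Idx E) x = \<sigma>}. Crd (tensor_cx P E X) n \<sigma> w (x, c) *
        \<chi> (\<beta> (Dg (Idx E) x) (basis_elt (cgr E (Dg (Idx E) x) \<sigma>) (Crd E (Dg (Idx E) x) \<sigma>) x)
              (basis_elt (ctot P X (Dg (Idx X) c)) (crd X (Dg (Idx X) c)) c)))" by simp
qed

definition elem :: "int \<Rightarrow> 's \<Rightarrow> int \<Rightarrow> 'e \<Rightarrow> ('s \<Rightarrow> 'a) \<Rightarrow> (int \<Rightarrow> ('e, 's \<Rightarrow> 'a) tensor)" where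
  "elem n \<sigma> p x y = sum_incl UNIV (\<lambda>k. tensor_group (cgr E k \<sigma>) (below P (cgr X (n - k)) \<sigma>)) p
     (tens (cgr E p \<sigma>) (below P (cgr X (n - p)) \<sigma>) x y)"

lemma
  assumes \<sigma>: "\<sigma> \<in> Field P"
  shows elem_hom_left: "y \<in> carrier (below P (cgr X (n - p)) \<sigma>) \<Longrightarrow> (\<lambda>x. elem n \<sigma> p x y) \<in> hom (cgr E p \<sigma>) (cgr (tensor_cx P E X) n \<sigma>)"
    and elem_hom_right: "x \<in> carrier (cgr E p \<sigma>) \<Longrightarrow> elem n \<sigma> p x \<in> hom (below P (cgr X (n - p)) \<sigma>) (cgr (tensor_cx P E X) n \<sigma>)"
    and Crd_elem: "\<lbrakk>x \<in> carrier (cgr E p \<sigma>); y \<in> carrier (below P (cgr X (n - p)) \<sigma>); (x', c') \<in> at_deg WI n; Ps (Idx E) x' = \<sigma>\<rbrakk> \<Longrightarrow>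
      Crd (tensor_cx P E X) n \<sigma> (elem n \<sigma> p x y) (x', c') = of_bool (Dg (Idx E) x' = p) * (Crd E p \<sigma> x x' * crd X (n - p) y c')"
proof -
  interpret t: framed_tensor "cgr E p \<sigma>" "{x \<in> at_deg (Idx E) p. Ps (Idx E) x = \<sigma>}" "Crd E p \<sigma>"
    "below P (cgr X (n - p)) \<sigma>" "{c \<in> at_deg (Idx X) (n - p). (Ps (Idx X) c, \<sigma>) \<in> P}" "crd X (n - p)"
    by (rule tensor_frame[OF \<sigma>])
  interpret S: framed_sum UNIV "\<lambda>p. tensor_group (cgr E p \<sigma>) (below P (cgr X (n - p)) \<sigma>)"
    "{w \<in> at_deg WI n. Ps WI w = \<sigma>}" "\<lambda>w. Dg (Idx E) (fst w)"
    "\<lambda>p. tensor_coord (cgr E p \<sigma>) (below P (cgr X (n - p)) \<sigma>) (Crd E p \<sigma>) (crd X (n - p))"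
    by (rule degree_frame[OF \<sigma>])
  note si = S.sum_incl_hom[of p, folded Gr_tensor_cx, simplified]
  show "(\<lambda>x. elem n \<sigma> p x y) \<in> hom (cgr E p \<sigma>) (cgr (tensor_cx P E X) n \<sigma>)" if "y \<in> carrier (below P (cgr X (n - p)) \<sigma>)"
    unfolding elem_def by (rule hom_comp[OF t.tens_hom_left[OF that] si])
  show "elem n \<sigma> p x \<in> hom (below P (cgr X (n - p)) \<sigma>) (cgr (tensor_cx P E X) n \<sigma>)" if "x \<in> carrier (cgr E p \<sigma>)"
    using hom_comp[OF t.tens_hom_right[OF that] si] unfolding elem_def by (simp add: elem_def[abs_def])
  assume x: "x \<in> carrier (cgr E p \<sigma>)" and y: "y \<in> carrier (below P (cgr X (n - p)) \<sigma>)" and w: "(x', c') \<in> at_deg WI n" "Ps (Idx E) x' = \<sigma>"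
  have "Crd (tensor_cx P E X) n \<sigma> (elem n \<sigma> p x y) (x', c') =
    sum_coord {w \<in> at_deg WI n. Ps WI w = \<sigma>} (\<lambda>w. Dg (Idx E) (fst w)) (\<lambda>p. tensor_coord (cgr E p \<sigma>) (below P (cgr X (n - p)) \<sigma>) (Crd E p \<sigma>) (crd X (n - p)))
      (elem n \<sigma> p x y) (x', c')"
    by (simp add: tensor_cx_def)
  also have "\<dots> = of_bool (Dg (Idx E) x' = p) * (Crd E p \<sigma> x x' * crd X (n - p) y c')"
    unfolding elem_def by (subst S.coord_sum_incl) (use w x y in \<open>auto simp: t.tens_closed t.tensor_coord_tens\<close>)
  finally show "Crd (tensor_cx P E X) n \<sigma> (elem n \<sigma> p x y) (x', c') = \<dots>" .
qed

end

context framed_triple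
begin

text \<open>The inner map \<open>(x \<otimes> y) \<otimes> z \<mapsto> \<plusminus> (x \<otimes> z) \<otimes> y\<close> of \<open>swap_map\<close>, for fixed \<open>z\<close>.\<close>

definition swap_inner where
  "swap_inner n m \<sigma> p x y z = WYX.elem n \<sigma> (p + (n - m)) (EY.elem (p + (n - m)) \<sigma> p x z) y
     [^]\<^bsub>cgr YX n \<sigma>\<^esub> parity_sign ((m - p) * (n - m))"

definition swap_outer where
  "swap_outer n m \<sigma> w z = gfinprod (cgr YX n \<sigma>) (\<lambda>p. tensor_lift (cgr E p \<sigma>) (below P (cgr X (m - p)) \<sigma>) (cgr YX n \<sigma>)
      (\<lambda>x y. swap_inner n m \<sigma> p x y z) (w p)) UNIV"

lemma swap_map_eq:
  "swap_map P (Cpx E) (Cpx X) (Cpx Y) n u = (\<lambda>\<sigma>\<in>Field P. gfinprod (cgr YX n \<sigma>)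
     (\<lambda>m. tensor_lift (cgr WX m \<sigma>) (below P (cgr Y (n - m)) \<sigma>) (cgr YX n \<sigma>) (swap_outer n m \<sigma>) (u \<sigma> m)) UNIV)"
proof -
  have 1: "n - (p + (n - m)) = m - p" and 2: "p + (n - m) - p = n - m" for p m :: int by simp_all
  show ?thesis
    unfolding swap_map_def Let_def swap_outer_def swap_inner_def WYX.elem_def EY.elem_def Cpx_WX Cpx_WY Cpx_YX 1 2
    by simp
qed

context
  fixes \<sigma> assumes \<sigma>: "\<sigma> \<in> Field P"
begin

lemma frame_YX: "framed_group (cgr YX n \<sigma>) {w \<in> at_deg (Idx YX) n. Ps (Idx YX) w = \<sigma>} (Crd YX n \<sigma>)"
  by unfold_locales (rule WYX.W.framed_Gr[OF \<sigma>])

lemma swap_inner_bilinear: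
  assumes z: "z \<in> carrier (below P (cgr Y (n - m)) \<sigma>)"
  shows "bilinear (cgr E p \<sigma>) (below P (cgr X (m - p)) \<sigma>) (cgr YX n \<sigma>) (\<lambda>x y. swap_inner n m \<sigma> p x y z)"
proof -
  interpret G: framed_group "cgr YX n \<sigma>" "{w \<in> at_deg (Idx YX) n. Ps (Idx YX) w = \<sigma>}" "Crd YX n \<sigma>" by (rule frame_YX)
  have 1: "n - (p + (n - m)) = m - p" and 2: "p + (n - m) - p = n - m" by simp_all
  have pw: "(\<lambda>v. v [^]\<^bsub>cgr YX n \<sigma>\<^esub> k) \<in> hom (cgr YX n \<sigma>) (cgr YX n \<sigma>)" for k :: int
    by (rule homI) (auto simp: G.int_pow_distrib)
  have in1: "(\<lambda>x. EY.elem (p + (n - m)) \<sigma> p x z) \<in> hom (cgr E p \<sigma>) (cgr WY (p + (n - m)) \<sigma>)"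
    by (rule EY.elem_hom_left[OF \<sigma>]) (simp only: 2 z)
  show ?thesis
    unfolding bilinear_def swap_inner_def
  proof (intro conjI ballI)
    fix y assume y: "y \<in> carrier (below P (cgr X (m - p)) \<sigma>)"
    have "(\<lambda>v. WYX.elem n \<sigma> (p + (n - m)) v y) \<in> hom (cgr WY (p + (n - m)) \<sigma>) (cgr YX n \<sigma>)"
      by (rule WYX.elem_hom_left[OF \<sigma>]) (simp only: 1 y)
    from hom_comp[OF hom_comp[OF in1 this] pw]
    show "(\<lambda>x. WYX.elem n \<sigma> (p + (n - m)) (EY.elem (p + (n - m)) \<sigma> p x z) y [^]\<^bsub>cgr YX n \<sigma>\<^esub> parity_sign ((m - p) * (n - m))) \<in> hom (cgr E p \<sigma>) (cgr YX n \<sigma>)" .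
  next
    fix x assume x: "x \<in> carrier (cgr E p \<sigma>)"
    have "WYX.elem n \<sigma> (p + (n - m)) (EY.elem (p + (n - m)) \<sigma> p x z) \<in> hom (below P (cgr X (n - (p + (n - m)))) \<sigma>) (cgr YX n \<sigma>)"
      by (rule WYX.elem_hom_right[OF \<sigma> hom_in_carrier[OF in1 x]])
    from hom_comp[OF this[unfolded 1] pw]
    show "(\<lambda>y. WYX.elem n \<sigma> (p + (n - m)) (EY.elem (p + (n - m)) \<sigma> p x z) y [^]\<^bsub>cgr YX n \<sigma>\<^esub> parity_sign ((m - p) * (n - m))) \<in> hom (below P (cgr X (m - p)) \<sigma>) (cgr YX n \<sigma>)" .
  qed
qed

lemma swap_inner_coord:
  assumes x: "x \<in> carrier (cgr E p \<sigma>)" and y: "y \<in> carrier (below P (cgr X (m - p)) \<sigma>)" and z: "z \<in> carrier (below P (cgr Y (n - m)) \<sigma>)"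
    and b: "((x', d'), c') \<in> at_deg WYX.WI n" "Ps (Idx E) x' = \<sigma>"
  shows "Crd YX n \<sigma> (swap_inner n m \<sigma> p x y z) ((x', d'), c') = of_bool (Dg (Idx Y) d' = n - m \<and> Dg (Idx E) x' = p) *
     (parity_sign ((m - p) * (n - m)) * (Crd E p \<sigma> x x' * crd X (m - p) y c' * crd Y (n - m) z d'))"
proof -
  interpret G: framed_group "cgr YX n \<sigma>" "{w \<in> at_deg (Idx YX) n. Ps (Idx YX) w = \<sigma>}" "Crd YX n \<sigma>" by (rule frame_YX)
  have 1: "n - (p + (n - m)) = m - p" and 2: "p + (n - m) - p = n - m" by simp_all
  have in1: "EY.elem (p + (n - m)) \<sigma> p x z \<in> carrier (cgr WY (p + (n - m)) \<sigma>)"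
    by (rule hom_in_carrier[OF EY.elem_hom_left[OF \<sigma>] x]) (simp only: 2 z)
  have in2: "WYX.elem n \<sigma> (p + (n - m)) (EY.elem (p + (n - m)) \<sigma> p x z) y \<in> carrier (cgr YX n \<sigma>)"
    by (rule hom_in_carrier[OF WYX.elem_hom_right[OF \<sigma> in1]]) (simp only: 1 y)
  have mem: "(x', d') \<in> Ix (Idx WY)" using b by (auto simp: at_deg_def)
  have c1: "Crd YX n \<sigma> (WYX.elem n \<sigma> (p + (n - m)) (EY.elem (p + (n - m)) \<sigma> p x z) y) ((x', d'), c') =
     of_bool (Dg (Idx WY) (x', d') = p + (n - m)) * (Crd WY (p + (n - m)) \<sigma> (EY.elem (p + (n - m)) \<sigma> p x z) (x', d') * crd X (m - p) y c')"
    using WYX.Crd_elem[OF \<sigma> in1, of y n "(x', d')" c'] y b unfolding 1 by (simp add: EY.Idx_tensor_cx)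
  have c2: "Crd WY (p + (n - m)) \<sigma> (EY.elem (p + (n - m)) \<sigma> p x z) (x', d') = of_bool (Dg (Idx E) x' = p) * (Crd E p \<sigma> x x' * crd Y (n - m) z d')"
    if "Dg (Idx WY) (x', d') = p + (n - m)"
    using EY.Crd_elem[OF \<sigma> x, of z "p + (n - m)" x' d'] z b that mem unfolding 2 by (simp add: EY.Idx_tensor_cx at_deg_def)
  show ?thesis
    unfolding swap_inner_def G.coord_int_pow[OF in2] c1
    using c2 by (auto simp: EY.Idx_tensor_cx)
qed

lemma swap_outer_coord:
  assumes w: "w \<in> carrier (cgr WX m \<sigma>)" and z: "z \<in> carrier (below P (cgr Y (n - m)) \<sigma>)"
    and b: "((x', d'), c') \<in> at_deg WYX.WI n" "Ps (Idx E) x' = \<sigma>"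
  shows "Crd YX n \<sigma> (swap_outer n m \<sigma> w z) ((x', d'), c') =
     parity_sign (Dg (Idx X) c' * Dg (Idx Y) d') * (Crd WX m \<sigma> w (x', c') * crd Y (n - m) z d')"
proof -
  interpret G: framed_group "cgr YX n \<sigma>" "{w \<in> at_deg (Idx YX) n. Ps (Idx YX) w = \<sigma>}" "Crd YX n \<sigma>" by (rule frame_YX)
  let ?S = "{(x, c) \<in> at_deg EX.WI m. Ps (Idx E) x = \<sigma>}"
  let ?be = "\<lambda>x. basis_elt (cgr E (Dg (Idx E) x) \<sigma>) (Crd E (Dg (Idx E) x) \<sigma>) x"
    and ?bx = "\<lambda>c. basis_elt (ctot P X (Dg (Idx X) c)) (crd X (Dg (Idx X) c)) c"
  have finS: "finite ?S"
    by (rule finite_subset[OF _ finite_tensor_index[OF EX.E.finite_Ix EX.X.finite_Ix, of P]]) (auto simp: at_deg_def)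
  have mem: "x' \<in> Ix (Idx E)" "d' \<in> Ix (Idx Y)" "c' \<in> Ix (Idx X)" "(Ps (Idx Y) d', \<sigma>) \<in> P" "(Ps (Idx X) c', \<sigma>) \<in> P"
    "Dg (Idx E) x' + Dg (Idx Y) d' + Dg (Idx X) c' = n" using b by (auto simp: at_deg_def EY.Idx_tensor_cx)
  have "Crd YX n \<sigma> (swap_outer n m \<sigma> w z) ((x', d'), c') =
    (\<Sum>(x, c)\<in>?S. Crd WX m \<sigma> w (x, c) * Crd YX n \<sigma> (swap_inner n m \<sigma> (Dg (Idx E) x) (?be x) (?bx c) z) ((x', d'), c'))"
    unfolding swap_outer_def
    by (rule EX.int_hom_assembled[OF \<sigma> G.comm swap_inner_bilinear[OF z] G.coord_hom w])
  also have "\<dots> = (\<Sum>a\<in>?S. if a = (x', c') then parity_sign (Dg (Idx X) c' * Dg (Idx Y) d') * (Crd WX m \<sigma> w (x', c') * crd Y (n - m) z d') else 0)"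
  proof (rule sum.cong[OF refl], clarify)
    fix x c assume xc: "(x, c) \<in> at_deg EX.WI m" "\<sigma> = Ps (Idx E) x"
    then have m: "x \<in> Ix (Idx E)" "c \<in> Ix (Idx X)" "(Ps (Idx X) c, Ps (Idx E) x) \<in> P" "Dg (Idx X) c = m - Dg (Idx E) x" by (auto simp: at_deg_def)
    have xd: "x \<in> at_deg (Idx E) (Dg (Idx E) x)" "c \<in> at_deg (Idx X) (m - Dg (Idx E) x)" using m by (auto simp: at_deg_def)
    interpret e: framed_group "cgr E (Dg (Idx E) x) (Ps (Idx E) x)" "{y \<in> at_deg (Idx E) (Dg (Idx E) x). Ps (Idx E) y = Ps (Idx E) x}" "Crd E (Dg (Idx E) x) (Ps (Idx E) x)"
      by unfold_locales (rule EX.E.framed_Gr[OF EX.E.Ps_Field[OF m(1)]])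
    have be: "basis_elt (cgr E (Dg (Idx E) x) (Ps (Idx E) x)) (Crd E (Dg (Idx E) x) (Ps (Idx E) x)) x \<in> carrier (cgr E (Dg (Idx E) x) (Ps (Idx E) x))"
      by (rule EX.E.deg.basis_summand[OF xd(1)])
    have bx: "basis_elt (ctot P X (Dg (Idx X) c)) (crd X (Dg (Idx X) c)) c \<in> carrier (below P (cgr X (m - Dg (Idx E) x)) (Ps (Idx E) x))"
      unfolding m(4) EX.X.deg.carrier_below using xd(2) m(3) by (auto simp: EX.X.tot.basis_closed EX.X.tot.coord_basis)
    have ce: "Crd E (Dg (Idx E) x) (Ps (Idx E) x) (basis_elt (cgr E (Dg (Idx E) x) (Ps (Idx E) x)) (Crd E (Dg (Idx E) x) (Ps (Idx E) x)) x) x' = of_bool (x' = x)"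
      by (rule e.coord_basis) (use xd in simp)
    have cx: "crd X (m - Dg (Idx E) x) (basis_elt (ctot P X (Dg (Idx X) c)) (crd X (Dg (Idx X) c)) c) c' = of_bool (c' = c)"
      unfolding m(4) by (rule EX.X.tot.coord_basis[OF xd(2)])
    have b2: "Ps (Idx E) x' = Ps (Idx E) x" using b(2) xc(2) by simp
    show "Crd WX m (Ps (Idx E) x) w (x, c) * Crd YX n (Ps (Idx E) x) (swap_inner n m (Ps (Idx E) x) (Dg (Idx E) x)
        (basis_elt (cgr E (Dg (Idx E) x) (Ps (Idx E) x)) (Crd E (Dg (Idx E) x) (Ps (Idx E) x)) x) (?bx c) z) ((x', d'), c') =
      (if (x, c) = (x', c') then parity_sign (Dg (Idx X) c' * Dg (Idx Y) d') * (Crd WX m (Ps (Idx E) x) w (x', c') * crd Y (n - m) z d') else 0)"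
      unfolding swap_inner_coord[unfolded xc(2), OF be bx z[unfolded xc(2)] b(1) b2] ce cx
      using m(4) mem(6) by (auto simp: mult.commute algebra_simps)
  qed
  also have "\<dots> = of_bool ((x', c') \<in> ?S) * (parity_sign (Dg (Idx X) c' * Dg (Idx Y) d') * (Crd WX m \<sigma> w (x', c') * crd Y (n - m) z d'))"
    using finS by (subst sum.delta) auto
  also have "\<dots> = parity_sign (Dg (Idx X) c' * Dg (Idx Y) d') * (Crd WX m \<sigma> w (x', c') * crd Y (n - m) z d')"
    using EX.Crd_tensor_cx[OF \<sigma>, of m w x' c'] by auto
  finally show ?thesis .
qed

lemma swap_outer_bilinear: "bilinear (cgr WX m \<sigma>) (below P (cgr Y (n - m)) \<sigma>) (cgr YX n \<sigma>) (swap_outer n m \<sigma>)"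
proof -
  interpret G: framed_group "cgr YX n \<sigma>" "{w \<in> at_deg (Idx YX) n. Ps (Idx YX) w = \<sigma>}" "Crd YX n \<sigma>" by (rule frame_YX)
  interpret Yb: framed_group "below P (cgr Y (n - m)) \<sigma>" "{d \<in> at_deg (Idx Y) (n - m). (Ps (Idx Y) d, \<sigma>) \<in> P}" "crd Y (n - m)"
    by unfold_locales (rule EY.X.deg.framed_below)
  have l: "(\<lambda>w. swap_outer n m \<sigma> w z) \<in> hom (cgr WX m \<sigma>) (cgr YX n \<sigma>)" if z: "z \<in> carrier (below P (cgr Y (n - m)) \<sigma>)" for z
    unfolding swap_outer_def by (rule EX.assembled_hom[OF \<sigma> G.comm swap_inner_bilinear[OF z]])
  show ?thesis
    unfolding bilinear_def
  proof (intro conjI ballI l homI)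
    fix w z assume w: "w \<in> carrier (cgr WX m \<sigma>)" and z: "z \<in> carrier (below P (cgr Y (n - m)) \<sigma>)"
    show "swap_outer n m \<sigma> w z \<in> carrier (cgr YX n \<sigma>)" by (rule hom_in_carrier[OF l[OF z] w])
    fix z' assume z': "z' \<in> carrier (below P (cgr Y (n - m)) \<sigma>)"
    note zz = Yb.m_closed[OF z z']
    show "swap_outer n m \<sigma> w (z \<otimes>\<^bsub>below P (cgr Y (n - m)) \<sigma>\<^esub> z') = swap_outer n m \<sigma> w z \<otimes>\<^bsub>cgr YX n \<sigma>\<^esub> swap_outer n m \<sigma> w z'"
    proof (rule G.coord_eq)
      fix b assume b: "b \<in> {w \<in> at_deg (Idx YX) n. Ps (Idx YX) w = \<sigma>}"
      obtain x' d' c' where b': "b = ((x', d'), c')" by (metis prod.exhaust)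
      have m: "((x', d'), c') \<in> at_deg WYX.WI n" "Ps (Idx E) x' = \<sigma>"
        using b by (auto simp: b' WYX.Idx_tensor_cx EY.Idx_tensor_cx)
      note s = hom_in_carrier[OF l[OF z] w] hom_in_carrier[OF l[OF z'] w]
      show "Crd YX n \<sigma> (swap_outer n m \<sigma> w (z \<otimes>\<^bsub>below P (cgr Y (n - m)) \<sigma>\<^esub> z')) b =
          Crd YX n \<sigma> (swap_outer n m \<sigma> w z \<otimes>\<^bsub>cgr YX n \<sigma>\<^esub> swap_outer n m \<sigma> w z') b"
        unfolding b' G.coord_mult[OF s] swap_outer_coord[OF w z m] swap_outer_coord[OF w z' m] swap_outer_coord[OF w zz m] Yb.coord_mult[OF z z']
        by (simp add: distrib_left)
    qed (use hom_in_carrier[OF l[OF z] w] hom_in_carrier[OF l[OF z'] w] hom_in_carrier[OF l[OF zz] w] in auto)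
  qed
qed

end

lemma swap_map_closed:
  assumes u: "u \<in> carrier (ctot P XY n)"
  shows "swap_map P (Cpx E) (Cpx X) (Cpx Y) n u \<in> carrier (ctot P YX n)"
proof -
  have "gfinprod (cgr YX n \<sigma>)
     (\<lambda>m. tensor_lift (cgr WX m \<sigma>) (below P (cgr Y (n - m)) \<sigma>) (cgr YX n \<sigma>) (swap_outer n m \<sigma>) (u \<sigma> m)) UNIV \<in> carrier (cgr YX n \<sigma>)"
    if \<sigma>: "\<sigma> \<in> Field P" for \<sigma>
  proof -
    have "u \<sigma> \<in> carrier (cgr XY n \<sigma>)" using u \<sigma> by (auto simp: WXY.W.deg.carrier_total)
    then show ?thesis
      by (rule hom_in_carrier[OF WXY.assembled_hom[OF \<sigma> framed_group.comm[OF frame_YX[OF \<sigma>]] swap_outer_bilinear[OF \<sigma>]]])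
  qed
  then show ?thesis unfolding swap_map_eq WYX.W.deg.carrier_total by auto
qed

text \<open>On basis elements the exchange map is \<open>(x \<otimes> c) \<otimes> d \<mapsto> \<plusminus> (x \<otimes> d) \<otimes> c\<close>, so in coordinates it permutes the indices.\<close>

lemma swap_map_coord:
  assumes u: "u \<in> carrier (ctot P XY n)" and b: "((x', d'), c') \<in> at_deg WYX.WI n"
  shows "crd YX n (swap_map P (Cpx E) (Cpx X) (Cpx Y) n u) ((x', d'), c') =
     parity_sign (Dg (Idx X) c' * Dg (Idx Y) d') * crd XY n u ((x', c'), d')"
proof -
  let ?\<sigma> = "Ps (Idx E) x'"
  have mem: "x' \<in> Ix (Idx E)" "d' \<in> Ix (Idx Y)" "c' \<in> Ix (Idx X)" "(Ps (Idx Y) d', ?\<sigma>) \<in> P" "(Ps (Idx X) c', ?\<sigma>) \<in> P"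
    "Dg (Idx E) x' + Dg (Idx Y) d' + Dg (Idx X) c' = n" using b by (auto simp: at_deg_def EY.Idx_tensor_cx)
  have \<sigma>: "?\<sigma> \<in> Field P" by (rule EX.E.Ps_Field[OF mem(1)])
  interpret G: framed_group "cgr YX n ?\<sigma>" "{w \<in> at_deg (Idx YX) n. Ps (Idx YX) w = ?\<sigma>}" "Crd YX n ?\<sigma>" by (rule frame_YX[OF \<sigma>])
  have us: "u ?\<sigma> \<in> carrier (cgr XY n ?\<sigma>)" using u \<sigma> by (auto simp: WXY.W.deg.carrier_total)
  have b': "((x', c'), d') \<in> at_deg WXY.WI n" using mem by (auto simp: at_deg_def EX.Idx_tensor_cx)
  let ?S = "{(w, d) \<in> at_deg WXY.WI n. Ps (Idx WX) w = ?\<sigma>}"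
  have finS: "finite ?S"
    by (rule finite_subset[OF _ finite_tensor_index[OF EX.W.finite_Ix EY.X.finite_Ix, of P]]) (auto simp: at_deg_def)
  have "crd YX n (swap_map P (Cpx E) (Cpx X) (Cpx Y) n u) ((x', d'), c') = Crd YX n ?\<sigma> (swap_map P (Cpx E) (Cpx X) (Cpx Y) n u ?\<sigma>) ((x', d'), c')"
    using b by (simp add: sum_coord_def WYX.Idx_tensor_cx EY.Idx_tensor_cx)
  also have "\<dots> = (\<Sum>(w, d)\<in>?S. Crd XY n ?\<sigma> (u ?\<sigma>) (w, d) * Crd YX n ?\<sigma> (swap_outer n (Dg (Idx WX) w) ?\<sigma>
       (basis_elt (cgr WX (Dg (Idx WX) w) ?\<sigma>) (Crd WX (Dg (Idx WX) w) ?\<sigma>) w) (basis_elt (ctot P Y (Dg (Idx Y) d)) (crd Y (Dg (Idx Y) d)) d)) ((x', d'), c'))"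
    unfolding swap_map_eq using \<sigma> WXY.int_hom_assembled[OF \<sigma> G.comm swap_outer_bilinear[OF \<sigma>] G.coord_hom us] by simp
  also have "\<dots> = (\<Sum>a\<in>?S. if a = ((x', c'), d') then parity_sign (Dg (Idx X) c' * Dg (Idx Y) d') * Crd XY n ?\<sigma> (u ?\<sigma>) ((x', c'), d') else 0)"
  proof (rule sum.cong[OF refl], clarify)
    fix x c d assume wd: "((x, c), d) \<in> at_deg WXY.WI n" "Ps (Idx WX) (x, c) = ?\<sigma>"
    let ?w = "(x, c)"
    have m: "?w \<in> Ix (Idx WX)" "d \<in> Ix (Idx Y)" "(Ps (Idx Y) d, ?\<sigma>) \<in> P" "Dg (Idx Y) d = n - Dg (Idx WX) ?w"
      using wd by (auto simp: at_deg_def)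
    have xd: "?w \<in> at_deg (Idx WX) (Dg (Idx WX) ?w)" "d \<in> at_deg (Idx Y) (n - Dg (Idx WX) ?w)" using m by (auto simp: at_deg_def)
    interpret e: framed_group "cgr WX (Dg (Idx WX) ?w) ?\<sigma>" "{y \<in> at_deg (Idx WX) (Dg (Idx WX) ?w). Ps (Idx WX) y = ?\<sigma>}" "Crd WX (Dg (Idx WX) ?w) ?\<sigma>"
      by unfold_locales (rule EX.W.framed_Gr[OF \<sigma>])
    have be: "basis_elt (cgr WX (Dg (Idx WX) ?w) ?\<sigma>) (Crd WX (Dg (Idx WX) ?w) ?\<sigma>) ?w \<in> carrier (cgr WX (Dg (Idx WX) ?w) ?\<sigma>)"
      by (rule e.basis_closed) (use xd wd in auto)
    have by': "basis_elt (ctot P Y (Dg (Idx Y) d)) (crd Y (Dg (Idx Y) d)) d \<in> carrier (below P (cgr Y (n - Dg (Idx WX) ?w)) ?\<sigma>)"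
      unfolding m(4) EY.X.deg.carrier_below using xd(2) m(3) by (auto simp: EY.X.tot.basis_closed EY.X.tot.coord_basis)
    have ce: "Crd WX (Dg (Idx WX) ?w) ?\<sigma> (basis_elt (cgr WX (Dg (Idx WX) ?w) ?\<sigma>) (Crd WX (Dg (Idx WX) ?w) ?\<sigma>) ?w) (x', c') = of_bool ((x', c') = ?w)"
      by (rule e.coord_basis) (use xd wd in simp)
    have cx: "crd Y (n - Dg (Idx WX) ?w) (basis_elt (ctot P Y (Dg (Idx Y) d)) (crd Y (Dg (Idx Y) d)) d) d' = of_bool (d' = d)"
      unfolding m(4) by (rule EY.X.tot.coord_basis[OF xd(2)])
    show "Crd XY n ?\<sigma> (u ?\<sigma>) (?w, d) * Crd YX n ?\<sigma> (swap_outer n (Dg (Idx WX) ?w) ?\<sigma>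
       (basis_elt (cgr WX (Dg (Idx WX) ?w) ?\<sigma>) (Crd WX (Dg (Idx WX) ?w) ?\<sigma>) ?w) (basis_elt (ctot P Y (Dg (Idx Y) d)) (crd Y (Dg (Idx Y) d)) d)) ((x', d'), c') =
      (if (?w, d) = ((x', c'), d') then parity_sign (Dg (Idx X) c' * Dg (Idx Y) d') * Crd XY n ?\<sigma> (u ?\<sigma>) ((x', c'), d') else 0)"
      unfolding swap_outer_coord[OF \<sigma> be by' b refl] ce cx by auto
  qed
  also have "\<dots> = parity_sign (Dg (Idx X) c' * Dg (Idx Y) d') * Crd XY n ?\<sigma> (u ?\<sigma>) ((x', c'), d')"
    using finS b' by (subst sum.delta) (auto simp: EX.Idx_tensor_cx)
  also have "Crd XY n ?\<sigma> (u ?\<sigma>) ((x', c'), d') = crd XY n u ((x', c'), d')"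
    using b' by (simp add: sum_coord_def WXY.Idx_tensor_cx EX.Idx_tensor_cx)
  finally show ?thesis .
qed

end

section \<open>Morphism complexes as complexes of matrices\<close>

lemma based_category_simps [simp]:
  "Obj (based_category P) = {M. \<forall>\<sigma>\<in>Field P. fg_free (M \<sigma>)}" "Mor (based_category P) = based_hom P"
  "Ident (based_category P) = based_id P"
  "Comp (based_category P) L M N g f = compose (carrier (total P L)) g f"
  by (simp_all add: based_category_def)

locale framed_hom_pair = framed_complex_pair P X Y
  for P :: "'s rel" and X :: "('s, 'a, 'v) framed_cx" and Y :: "('s, 'a, 'w) framed_cx"
begin

lemma trivial_based_hom:
  assumes "f \<in> carrier (based_hom P (cgr X p) (cgr Y q))" "p \<notin> Dg (Idx X) ` Ix (Idx X)"
  shows "f = \<one>\<^bsub>based_hom P (cgr X p) (cgr Y q)\<^esub>"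
proof (rule extensionalityI[of _ "carrier (ctot P X p)"])
  fix x assume x: "x \<in> carrier (ctot P X p)"
  have "x = \<one>\<^bsub>ctot P X p\<^esub>"
    by (rule X.tot.coord_eq[where n = p]) (use x assms(2) in \<open>auto simp: at_deg_def\<close>)
  then show "f x = \<one>\<^bsub>based_hom P (cgr X p) (cgr Y q)\<^esub> x"
    using hom_one[OF pair.based_hom_hom[OF assms(1)] X.tot.group_axioms Y.tot.group_axioms] x
    by (simp add: pair.one_based_hom)
qed (use pair.based_hom_ext[OF assms(1)] in \<open>auto simp: pair.one_based_hom\<close>)

text \<open>The finiteness condition in the direct sum is automatic: \<open>X\<close> vanishes in almost all degrees.\<close>

lemma Hom_gr_carrier:
  "f \<in> carrier (Hom_gr (based_category P) (Cpx X) (Cpx Y) n) \<longleftrightarrow>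
    (\<forall>p. f p \<in> carrier (based_hom P (cgr X p) (cgr Y (p + n))))"
proof -
  have g: "group (based_hom P (cgr X p) (cgr Y (p + n)))" for p
    using pair.comm_group_based_hom comm_group.axioms(2) by blast
  have "finite {p. f p \<noteq> \<one>\<^bsub>based_hom P (cgr X p) (cgr Y (p + n))\<^esub>}"
    if "\<forall>p. f p \<in> carrier (based_hom P (cgr X p) (cgr Y (p + n)))"
  proof (rule finite_subset)
    show "{p. f p \<noteq> \<one>\<^bsub>based_hom P (cgr X p) (cgr Y (p + n))\<^esub>} \<subseteq> Dg (Idx X) ` Ix (Idx X)"
      using trivial_based_hom[OF that[rule_format]] by blast
  qed (simp add: X.finite_Ix)
  then show ?thesis using g by (auto simp: Hom_gr_def carrier_sum_group)
qed

lemma Hom_gr_ops: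
  "(f \<otimes>\<^bsub>Hom_gr (based_category P) (Cpx X) (Cpx Y) n\<^esub> g) p = (\<lambda>x\<in>carrier (ctot P X p). f p x \<otimes>\<^bsub>ctot P Y (p + n)\<^esub> g p x)"
  "\<one>\<^bsub>Hom_gr (based_category P) (Cpx X) (Cpx Y) n\<^esub> p = (\<lambda>x\<in>carrier (ctot P X p). \<one>\<^bsub>ctot P Y (p + n)\<^esub>)"
  by (simp_all add: Hom_gr_def pair.mult_based_hom pair.one_based_hom)

lemma represents_carrier:
  assumes "represents P X Y n f A"
  shows "f \<in> carrier (Hom_gr (based_category P) (Cpx X) (Cpx Y) n)"
  using assms has_matrix_based_hom unfolding Hom_gr_carrier represents_def by blast

lemma represents_eq:
  assumes "represents P X Y n f A" "represents P X Y n g A" shows "f = g"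
proof
  fix p
  show "f p = g p" using assms has_matrix_eq[of p "p + n" "f p" A "g p"] by (auto simp: represents_def)
qed

text \<open>Entries of \<open>A\<close> are coordinates of the images of basis elements.\<close>

lemma represents_unique:
  assumes "represents P X Y n f A" "represents P X Y n f B" shows "A = B"
proof (intro ext)
  fix w w'
  show "A w w' = B w w'"
  proof (cases "w \<in> at_deg (Idx X) (Dg (Idx X) w) \<and> w' \<in> at_deg (Idx Y) (Dg (Idx X) w + n)")
    case True
    then show ?thesis
      using has_matrix_basis[of "Dg (Idx X) w" "Dg (Idx X) w + n" "f (Dg (Idx X) w)"] assms unfolding represents_def by metis
  next
    case False
    have "A w w' = 0" "B w w' = 0"
      using False assms matsD[of A P "Idx X" "Idx Y" n w w'] matsD[of B P "Idx X" "Idx Y" n w w']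
      by (auto simp: represents_def at_deg_def)
    then show ?thesis by simp
  qed
qed

lemma represents_ex:
  assumes "f \<in> carrier (Hom_gr (based_category P) (Cpx X) (Cpx Y) n)"
  shows "\<exists>A. represents P X Y n f A"
proof -
  let ?A = "\<lambda>w w'. if w \<in> Ix (Idx X) \<and> w' \<in> at_deg (Idx Y) (Dg (Idx X) w + n)
     then crd Y (Dg (Idx X) w + n) (f (Dg (Idx X) w) (X.bas (Dg (Idx X) w) w)) w' else 0"
  have f: "f p \<in> carrier (based_hom P (cgr X p) (cgr Y (p + n)))" for p using assms by (simp add: Hom_gr_carrier)
  have "?A \<in> mats P (Idx X) (Idx Y) n"
  proof (rule matsI)
    fix w w' assume ne: "?A w w' \<noteq> 0"
    then have w: "w \<in> Ix (Idx X)" "w' \<in> at_deg (Idx Y) (Dg (Idx X) w + n)" "w \<in> at_deg (Idx X) (Dg (Idx X) w)"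
      by (auto simp: at_deg_def split: if_splits)
    moreover have "(Ps (Idx Y) w', Ps (Idx X) w) \<in> P"
      using f[of "Dg (Idx X) w"] w ne unfolding pair.based_hom_iff by (auto split: if_splits)
    ultimately show "w \<in> Ix (Idx X) \<and> w' \<in> Ix (Idx Y) \<and> Dg (Idx Y) w' = Dg (Idx X) w + n \<and> (Ps (Idx Y) w', Ps (Idx X) w) \<in> P"
      by (auto simp: at_deg_def)
  qed
  moreover have "has_matrix P X p Y (p + n) (f p) ?A" for p
    by (rule has_matrix_cong[OF has_matrix_ex[OF f]]) (auto simp: at_deg_def)
  ultimately show ?thesis unfolding represents_def by blast
qed

lemma represents_lift:
  assumes "A \<in> mats P (Idx X) (Idx Y) n"
  shows "\<exists>f. represents P X Y n f A"
proof -
  have "\<exists>g. has_matrix P X p Y (p + n) g A" for p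
  proof -
    obtain g where "g \<in> carrier (based_hom P (cgr X p) (cgr Y (p + n)))"
      "\<And>x w'. \<lbrakk>x \<in> carrier (ctot P X p); w' \<in> at_deg (Idx Y) (p + n)\<rbrakk> \<Longrightarrow> crd Y (p + n) (g x) w' = (\<Sum>w\<in>at_deg (Idx X) p. crd X p x w * A w w')"
      using pair.based_hom_of_matrix[of p "p + n" A] matsD[OF assms] by blast
    then have "has_matrix P X p Y (p + n) g A"
      unfolding has_matrix_def using pair.based_hom_in pair.based_hom_ext by blast
    then show ?thesis by blast
  qed
  then obtain f where "\<And>p. has_matrix P X p Y (p + n) (f p) A" by metis
  then show ?thesis using assms unfolding represents_def by blast
qed

lemma has_matrix_add:
  assumes f: "has_matrix P X p Y q f A" and g: "has_matrix P X p Y q g B"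
  shows "has_matrix P X p Y q (\<lambda>x\<in>carrier (ctot P X p). f x \<otimes>\<^bsub>ctot P Y q\<^esub> g x) (\<lambda>w w'. A w w' + B w w')"
  unfolding has_matrix_def
  using has_matrixD(1,3)[OF f] has_matrixD(1,3)[OF g] by (auto simp: Y.tot.coord_mult distrib_left sum.distrib)

lemma has_matrix_scale:
  assumes f: "has_matrix P X p Y q f A" and A: "A \<in> mats P (Idx X) (Idx Y) n"
  shows "has_matrix P X p Y q (f [^]\<^bsub>based_hom P (cgr X p) (cgr Y q)\<^esub> (k::int)) (\<lambda>w w'. k * A w w')"
proof -
  note fh = has_matrix_based_hom[OF f A]
  interpret B: comm_group "based_hom P (cgr X p) (cgr Y q)" by (rule pair.comm_group_based_hom)
  have e: "(f [^]\<^bsub>based_hom P (cgr X p) (cgr Y q)\<^esub> k) x = f x [^]\<^bsub>ctot P Y q\<^esub> k" if "x \<in> carrier (ctot P X p)" for x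
    by (rule pair.based_hom_int_pow[OF fh that])
  show ?thesis
    unfolding has_matrix_def
    using has_matrixD(1,3)[OF f] pair.based_hom_ext[OF B.int_pow_closed[OF fh]]
    by (auto simp: e Y.tot.coord_int_pow sum_distrib_left mult.left_commute)
qed

lemma represents_add:
  assumes "represents P X Y n f A" "represents P X Y n g B"
  shows "represents P X Y n (f \<otimes>\<^bsub>Hom_gr (based_category P) (Cpx X) (Cpx Y) n\<^esub> g) (\<lambda>w w'. A w w' + B w w')"
  using assms has_matrix_add unfolding represents_def Hom_gr_ops by (auto intro: mats_add)

lemma represents_one: "represents P X Y n \<one>\<^bsub>Hom_gr (based_category P) (Cpx X) (Cpx Y) n\<^esub> (\<lambda>_ _. 0)"
  unfolding represents_def has_matrix_def Hom_gr_ops by (auto simp: mats_zero Y.tot.coord_one)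

end

context framed_complex
begin

lemma represents_id: "represents P X X 0 (chain_id (based_category P) (Cpx X)) (mone (Idx X))"
  unfolding represents_def chain_id_def using has_matrix_id mone_mats by simp

end

lemma has_matrix_compose:
  assumes "framed_complex_pair P X Y" "framed_complex_pair P Y Z"
    and f: "has_matrix P X p Y q f A" and g: "has_matrix P Y q Z r g B" and A: "A \<in> mats P (Idx X) (Idx Y) n" "q = p + n"
  shows "has_matrix P X p Z r (compose (carrier (ctot P X p)) g f) (mmul (Idx Y) B A)"
proof -
  interpret XY: framed_complex_pair P X Y by fact
  interpret YZ: framed_complex_pair P Y Z by fact
  show ?thesis
    unfolding has_matrix_def
  proof (intro conjI ballI)
    show "compose (carrier (ctot P X p)) g f \<in> carrier (ctot P X p) \<rightarrow> carrier (ctot P Z r)"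
      using has_matrixD(1)[OF f] has_matrixD(1)[OF g] by (auto simp: compose_def)
    fix x w' assume x: "x \<in> carrier (ctot P X p)" and w': "w' \<in> at_deg (Idx Z) r"
    have "crd Z r (compose (carrier (ctot P X p)) g f x) w' = (\<Sum>v\<in>at_deg (Idx Y) q. (\<Sum>w\<in>at_deg (Idx X) p. crd X p x w * A w v) * B v w')"
      using has_matrixD(3)[OF g has_matrixD(1)[OF f x] w'] has_matrixD(3)[OF f x] x by (simp add: compose_def)
    also have "\<dots> = (\<Sum>w\<in>at_deg (Idx X) p. \<Sum>v\<in>at_deg (Idx Y) q. crd X p x w * (A w v * B v w'))"
      unfolding sum_distrib_right by (subst sum.swap) (simp only: mult.assoc)
    also have "\<dots> = (\<Sum>w\<in>at_deg (Idx X) p. crd X p x w * mmul (Idx Y) B A w w')"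
    proof (rule sum.cong[OF refl])
      fix w assume w: "w \<in> at_deg (Idx X) p"
      have "(\<Sum>v\<in>at_deg (Idx Y) q. A w v * B v w') = (\<Sum>v\<in>Ix (Idx Y). A w v * B v w')"
      proof (rule sum.mono_neutral_left)
        show "\<forall>v\<in>Ix (Idx Y) - at_deg (Idx Y) q. A w v * B v w' = 0"
        proof
          fix v assume "v \<in> Ix (Idx Y) - at_deg (Idx Y) q"
          then show "A w v * B v w' = 0"
            using matsD[OF A(1), of w v] w A(2) by (cases "A w v = 0") (auto simp: at_deg_def)
        qed
      qed (auto simp: at_deg_def XY.Y.finite_Ix)
      then show "(\<Sum>v\<in>at_deg (Idx Y) q. crd X p x w * (A w v * B v w')) = crd X p x w * mmul (Idx Y) B A w w'"
        by (simp add: mmul_def sum_distrib_left[symmetric])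
    qed
    finally show "crd Z r (compose (carrier (ctot P X p)) g f x) w' = (\<Sum>w\<in>at_deg (Idx X) p. crd X p x w * mmul (Idx Y) B A w w')" .
  qed (simp add: compose_def)
qed

lemma (in finite_poset) trans_P: "trans P"
  by (rule transI) (rule poset_trans)

lemma represents_comp:
  assumes XY: "framed_complex_pair P X Y" and YZ: "framed_complex_pair P Y Z"
    and f: "represents P X Y m f A" and g: "represents P Y Z n g B"
  shows "represents P X Z (m + n) (Hom_comp (based_category P) (Cpx X) (Cpx Y) (Cpx Z) m n g f) (mmul (Idx Y) B A)"
proof -
  interpret XY: framed_complex_pair P X Y by fact
  show ?thesis
    unfolding represents_def
  proof (intro conjI allI)
    show "mmul (Idx Y) B A \<in> mats P (Idx X) (Idx Z) (m + n)"
      by (rule mats_mmul[OF XY.X.trans_P]) (use f g in \<open>auto simp: represents_def\<close>)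
    fix p
    have "has_matrix P X p Z (p + m + n) (compose (carrier (ctot P X p)) (g (p + m)) (f p)) (mmul (Idx Y) B A)"
      by (rule has_matrix_compose[OF XY YZ]) (use f g in \<open>auto simp: represents_def\<close>)
    then show "has_matrix P X p Z (p + (m + n)) (Hom_comp (based_category P) (Cpx X) (Cpx Y) (Cpx Z) m n g f p) (mmul (Idx Y) B A)"
      by (simp add: Hom_comp_def add.assoc)
  qed
qed

locale framed_chain_complex = framed_complex P X for P :: "'s rel" and X :: "('s, 'a, 'w) framed_cx" +
  fixes dX :: "'w \<Rightarrow> 'w \<Rightarrow> int"
  assumes bd: "bd_matrix P X dX" and bd_mats: "dX \<in> mats P (Idx X) (Idx X) (-1)"
    and bd_bd: "mmul (Idx X) dX dX = (\<lambda>_ _. 0)"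

locale framed_chain_pair = X: framed_chain_complex P X dX + Y: framed_chain_complex P Y dY
  for P :: "'s rel" and X :: "('s, 'a, 'v) framed_cx" and dX and Y :: "('s, 'a, 'w) framed_cx" and dY
begin

sublocale framed_hom_pair P X Y by unfold_locales
sublocale XX: framed_hom_pair P X X by unfold_locales
sublocale YY: framed_hom_pair P Y Y by unfold_locales

lemma represents_bd:
  assumes f: "represents P X Y n f A"
  shows "represents P X Y (n - 1) (Hom_bd (based_category P) (Cpx X) (Cpx Y) n f) (mbd (Idx X) (Idx Y) n dX dY A)"
  unfolding represents_def
proof (intro conjI allI)
  have A: "A \<in> mats P (Idx X) (Idx Y) n" using f by (simp add: represents_def)
  show "mbd (Idx X) (Idx Y) n dX dY A \<in> mats P (Idx X) (Idx Y) (n - 1)"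
    by (rule mats_mbd[OF X.trans_P A X.bd_mats Y.bd_mats])
  fix p
  have n1: "p - 1 + n = p + n - 1" "p + (n - 1) = p + n - 1" by simp_all
  have f1: "has_matrix P X p Y (p + n) (f p) A" using f by (simp add: represents_def)
  have "has_matrix P X (p - 1) Y (p - 1 + n) (f (p - 1)) A" using f by (simp add: represents_def)
  then have f2: "has_matrix P X (p - 1) Y (p + n - 1) (f (p - 1)) A" unfolding n1 .
  have dX: "has_matrix P X p X (p - 1) (Bd (Cpx X) p) dX" and dY: "has_matrix P Y (p + n) Y (p + n - 1) (Bd (Cpx Y) (p + n)) dY"
    using X.bd Y.bd by (auto simp: bd_matrix_def)
  have 1: "has_matrix P X p Y (p + n - 1) (compose (carrier (ctot P X p)) (Bd (Cpx Y) (p + n)) (f p)) (mmul (Idx Y) dY A)"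
    by (rule has_matrix_compose[OF framed_complex_pair_axioms YY.framed_complex_pair_axioms f1 dY A refl])
  have 2: "has_matrix P X p Y (p + n - 1) (compose (carrier (ctot P X p)) (f (p - 1)) (Bd (Cpx X) p)) (mmul (Idx X) A dX)"
    by (rule has_matrix_compose[OF XX.framed_complex_pair_axioms framed_complex_pair_axioms dX f2 X.bd_mats]) simp
  have m2: "mmul (Idx X) A dX \<in> mats P (Idx X) (Idx Y) (n - 1)"
    using mats_mmul[OF X.trans_P X.bd_mats A] by (simp add: add.commute)
  show "has_matrix P X p Y (p + (n - 1)) (Hom_bd (based_category P) (Cpx X) (Cpx Y) n f p) (mbd (Idx X) (Idx Y) n dX dY A)"
    using has_matrix_add[OF 1 has_matrix_scale[OF 2 m2, of "parity_sign (n + 1)"]]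
    unfolding n1 mbd_def by (simp add: Hom_bd_def Let_def pair.mult_based_hom)
qed

text \<open>Cycles correspond to cycles, because the zero matrix represents only the zero map.\<close>

lemma represents_chain_map:
  assumes f: "represents P X Y 0 f A"
  shows "f \<in> chain_maps (based_category P) (Cpx X) (Cpx Y) \<longleftrightarrow> mbd (Idx X) (Idx Y) 0 dX dY A = (\<lambda>_ _. 0)"
proof -
  have d: "represents P X Y (-1) (Hom_bd (based_category P) (Cpx X) (Cpx Y) 0 f) (mbd (Idx X) (Idx Y) 0 dX dY A)"
    using represents_bd[OF f] by simp
  have "Hom_bd (based_category P) (Cpx X) (Cpx Y) 0 f = \<one>\<^bsub>Hom_gr (based_category P) (Cpx X) (Cpx Y) (-1)\<^esub> \<longleftrightarrow>
     mbd (Idx X) (Idx Y) 0 dX dY A = (\<lambda>_ _. 0)"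
  proof
    assume "Hom_bd (based_category P) (Cpx X) (Cpx Y) 0 f = \<one>\<^bsub>Hom_gr (based_category P) (Cpx X) (Cpx Y) (-1)\<^esub>"
    with d show "mbd (Idx X) (Idx Y) 0 dX dY A = (\<lambda>_ _. 0)" using represents_unique[OF _ represents_one] by simp
  next
    assume "mbd (Idx X) (Idx Y) 0 dX dY A = (\<lambda>_ _. 0)"
    with d show "Hom_bd (based_category P) (Cpx X) (Cpx Y) 0 f = \<one>\<^bsub>Hom_gr (based_category P) (Cpx X) (Cpx Y) (-1)\<^esub>"
      by (intro represents_eq[OF _ represents_one]) simp
  qed
  then show ?thesis using represents_carrier[OF f] by (simp add: chain_maps_def)
qed

end

lemma sum_of_bool_eq:
  "finite A \<Longrightarrow> (\<Sum>w\<in>A. k w * of_bool (w = v)) = (if v \<in> A then k v else (0::int))"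
proof -
  assume "finite A"
  moreover have "(\<Sum>w\<in>A. k w * of_bool (w = v)) = (\<Sum>w\<in>A. if w = v then k w else 0)" by (rule sum.cong) auto
  ultimately show ?thesis by simp
qed

context framed_based
begin

lemma based_id_hom: "based_id P M \<in> carrier (based_hom P M M)"
proof -
  interpret MM: framed_based_pair P M W ps \<kappa> M W ps \<kappa> by unfold_locales
  show ?thesis
  proof (rule MM.based_homI[where A = "\<lambda>v w. of_bool (v = w)"])
    fix x w' assume x: "x \<in> carrier (total P M)" and w': "w' \<in> W"
    show "crd (based_id P M x) w' = (\<Sum>w\<in>W. crd x w * of_bool (w = w'))"
      unfolding sum_of_bool_eq[OF MM.TM.fin] using x w' by (simp add: based_id_def)
  next
    fix w w' assume "w \<in> W" "of_bool (w = w') \<noteq> (0::int)"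
    then show "(ps w', ps w) \<in> P" using poset_refl[OF index_in] by (cases "w = w'") auto
  qed (auto simp: based_id_def)
qed

end

context finite_poset
begin

text \<open>A zero object has only one endomorphism, so the identity of \<open>M\<close> is zero.\<close>

lemma zero_object_trivial:
  assumes "zero_object (based_category P) M" "\<sigma> \<in> Field P"
  shows "carrier (M \<sigma>) = {\<one>\<^bsub>M \<sigma>\<^esub>}"
proof -
  have M: "\<forall>\<sigma>\<in>Field P. fg_free (M \<sigma>)" and t: "carrier (based_hom P M M) = {\<one>\<^bsub>based_hom P M M\<^esub>}"
    using assms by (auto simp: zero_object_def)
  obtain W \<kappa> where "framed_based P M (W :: ('s \<times> nat) set) fst \<kappa>" using based_frame_ex[OF M] by blast
  then interpret M: framed_based P M W fst \<kappa> .
  interpret MM: framed_based_pair P M W fst \<kappa> M W fst \<kappa> by unfold_locales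
  have id: "based_id P M = \<one>\<^bsub>based_hom P M M\<^esub>" using M.based_id_hom t by simp
  have "x = \<one>\<^bsub>M \<sigma>\<^esub>" if x: "x \<in> carrier (M \<sigma>)" for x
  proof -
    have i: "sum_incl (Field P) M \<sigma> x \<in> carrier (total P M)" by (rule M.sum_incl_total[OF assms(2) x])
    then have "sum_incl (Field P) M \<sigma> x = \<one>\<^bsub>total P M\<^esub>"
      using fun_cong[OF id, of "sum_incl (Field P) M \<sigma> x"] by (simp add: based_id_def MM.one_based_hom)
    from fun_cong[OF this, of \<sigma>] show ?thesis using assms(2) by (simp add: sum_incl_def M.one_total)
  qed
  then show ?thesis using M.group_summand[OF assms(2)] by (auto simp: group.is_monoid)
qed

lemma zero_objectI:
  assumes "\<And>\<sigma>. \<sigma> \<in> Field P \<Longrightarrow> fg_free (M \<sigma>)" "\<And>\<sigma>. \<sigma> \<in> Field P \<Longrightarrow> carrier (M \<sigma>) = {\<one>\<^bsub>M \<sigma>\<^esub>}"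
  shows "zero_object (based_category P) M"
proof -
  obtain W \<kappa> where "framed_based P M (W :: ('s \<times> nat) set) fst \<kappa>" using based_frame_ex[of M] assms(1) by blast
  then interpret M: framed_based P M W fst \<kappa> .
  have W: "W = {}"
  proof (rule ccontr)
    assume "W \<noteq> {}"
    then obtain w where w: "w \<in> W" by blast
    interpret g: framed_group "M (fst w)" "{w' \<in> W. fst w' = fst w}" "\<kappa> (fst w)" by (rule M.fr[OF M.index_in[OF w]])
    have "basis_elt (M (fst w)) (\<kappa> (fst w)) w = \<one>\<^bsub>M (fst w)\<^esub>"
      using M.basis_summand[OF w] assms(2)[OF M.index_in[OF w]] by simp
    then show False using g.coord_basis[of w w] g.coord_one[of w] w by simp
  qed
  show ?thesis
    unfolding zero_object_def
  proof (intro conjI ballI)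
    show "M \<in> Obj (based_category P)" using assms(1) by simp
    fix N :: "('s, 'a) based" assume "N \<in> Obj (based_category P)"
    then obtain V \<mu> where "framed_based P N (V :: ('s \<times> nat) set) fst \<mu>" using based_frame_ex[of N] by auto
    then interpret N: framed_based P N V fst \<mu> .
    interpret MN: framed_based_pair P M W fst \<kappa> N V fst \<mu> by unfold_locales
    interpret NM: framed_based_pair P N V fst \<mu> M W fst \<kappa> by unfold_locales
    have one: "x = \<one>\<^bsub>total P M\<^esub>" if "x \<in> carrier (total P M)" for x
      by (rule MN.TM.coord_eq) (use that W in auto)
    have "f = \<one>\<^bsub>based_hom P M N\<^esub>" if f: "f \<in> carrier (based_hom P M N)" for f
    proof (rule extensionalityI[of _ "carrier (total P M)"])
      fix x assume x: "x \<in> carrier (total P M)"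
      have "f \<one>\<^bsub>total P M\<^esub> = \<one>\<^bsub>total P N\<^esub>"
        by (rule hom_one[OF MN.based_hom_hom[OF f] MN.TM.group_axioms MN.TN.group_axioms])
      then show "f x = \<one>\<^bsub>based_hom P M N\<^esub> x"
        unfolding one[OF x] by (simp add: MN.one_based_hom)
    qed (use MN.based_hom_ext[OF f] in \<open>auto simp: MN.one_based_hom\<close>)
    moreover have "f = \<one>\<^bsub>based_hom P N M\<^esub>" if f: "f \<in> carrier (based_hom P N M)" for f
    proof (rule extensionalityI[of _ "carrier (total P N)"])
      fix x assume x: "x \<in> carrier (total P N)"
      show "f x = \<one>\<^bsub>based_hom P N M\<^esub> x"
        unfolding one[OF NM.based_hom_in[OF f x]] using x by (simp add: NM.one_based_hom)
    qed (use NM.based_hom_ext[OF f] in \<open>auto simp: NM.one_based_hom\<close>)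
    moreover have "\<one>\<^bsub>based_hom P M N\<^esub> \<in> carrier (based_hom P M N)" "\<one>\<^bsub>based_hom P N M\<^esub> \<in> carrier (based_hom P N M)"
      using monoid.one_closed[OF group.is_monoid[OF comm_group.axioms(2)[OF MN.comm_group_based_hom]]]
        monoid.one_closed[OF group.is_monoid[OF comm_group.axioms(2)[OF NM.comm_group_based_hom]]] .
    ultimately show "carrier (Mor (based_category P) N M) = {\<one>\<^bsub>Mor (based_category P) N M\<^esub>}"
      "carrier (Mor (based_category P) M N) = {\<one>\<^bsub>Mor (based_category P) M N\<^esub>}"
      unfolding based_category_simps by blast+
  qed
qed

end

context framed_chain_complex
begin

lemma in_Ch: "Cpx X \<in> Ch (based_category P)"
proof -
  interpret XX: framed_chain_pair P X dX X dX by unfold_locales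
  have B: "has_matrix P X n X (n - 1) (Bd (Cpx X) n) dX" for n using bd by (simp add: bd_matrix_def)
  have 1: "cgr X n \<in> Obj (based_category P)" for n using deg.fg_free_summand by simp
  have 2: "Bd (Cpx X) n \<in> carrier (based_hom P (cgr X n) (cgr X (n - 1)))" for n
    by (rule XX.has_matrix_based_hom[OF B bd_mats])
  have 3: "compose (carrier (ctot P X n)) (Bd (Cpx X) (n - 1)) (Bd (Cpx X) n) = \<one>\<^bsub>based_hom P (cgr X n) (cgr X (n - 2))\<^esub>" for n
  proof -
    have "has_matrix P X n X (n - 1 - 1) (compose (carrier (ctot P X n)) (Bd (Cpx X) (n - 1)) (Bd (Cpx X) n)) (mmul (Idx X) dX dX)"
      by (rule has_matrix_compose[OF XX.framed_complex_pair_axioms XX.framed_complex_pair_axioms B B bd_mats]) simp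
    then have a: "has_matrix P X n X (n - 2) (compose (carrier (ctot P X n)) (Bd (Cpx X) (n - 1)) (Bd (Cpx X) n)) (\<lambda>_ _. 0)"
      by (simp add: bd_bd)
    have "has_matrix P X n X (n - 2) \<one>\<^bsub>based_hom P (cgr X n) (cgr X (n - 2))\<^esub> (\<lambda>_ _. 0)"
      unfolding has_matrix_def XX.pair.one_based_hom by (auto simp: tot.coord_one)
    from XX.has_matrix_eq[OF a this] show ?thesis .
  qed
  have "{n. \<not> zero_object (based_category P) (cgr X n)} \<subseteq> Dg (Idx X) ` Ix (Idx X)"
  proof (rule subsetI, rule ccontr)
    fix n assume n: "n \<in> {n. \<not> zero_object (based_category P) (cgr X n)}" "n \<notin> Dg (Idx X) ` Ix (Idx X)"
    have "zero_object (based_category P) (cgr X n)"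
    proof (rule zero_objectI)
      show "fg_free (cgr X n \<sigma>)" if "\<sigma> \<in> Field P" for \<sigma> by (rule deg.fg_free_summand[OF that])
      fix \<sigma> assume \<sigma>: "\<sigma> \<in> Field P"
      interpret g: framed_group "cgr X n \<sigma>" "{w \<in> at_deg (Idx X) n. Ps (Idx X) w = \<sigma>}" "Crd X n \<sigma>" by (rule deg.fr[OF \<sigma>])
      have "x = \<one>\<^bsub>cgr X n \<sigma>\<^esub>" if "x \<in> carrier (cgr X n \<sigma>)" for x
        by (rule g.coord_eq) (use that n(2) in \<open>auto simp: at_deg_def\<close>)
      then show "carrier (cgr X n \<sigma>) = {\<one>\<^bsub>cgr X n \<sigma>\<^esub>}" by auto
    qed
    with n(1) show False by simp
  qed
  then have 4: "finite {n. \<not> zero_object (based_category P) (cgr X n)}"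
    using finite_Ix finite_subset by blast
  show ?thesis unfolding Ch_def using 1 2 3 4 by simp
qed

end

text \<open>All but finitely many \<open>C\<^sub>n\<close> are zero objects, so the bases of the \<open>C\<^sub>n\<close>, tagged with the degree, form one finite
  index set.\<close>

lemma (in finite_poset) Ch_framed:
  fixes C :: "('s, 'a) based_complex"
  assumes C: "C \<in> Ch (based_category P)"
  shows "\<exists>(X :: ('s, 'a, int \<times> 's \<times> nat) framed_cx) dX. Cpx X = C \<and> framed_chain_complex P X dX"
proof -
  have obj: "\<forall>\<sigma>\<in>Field P. fg_free (Gr C n \<sigma>)" for n using C by (simp add: Ch_def)
  have mor: "Bd C n \<in> carrier (based_hom P (Gr C n) (Gr C (n - 1)))" for n using C by (simp add: Ch_def)
  have dd: "compose (carrier (total P (Gr C n))) (Bd C (n - 1)) (Bd C n) = \<one>\<^bsub>based_hom P (Gr C n) (Gr C (n - 2))\<^esub>" for n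
    using C by (simp add: Ch_def)
  define N where "N = {n. \<not> zero_object (based_category P) (Gr C n)}"
  have finN: "finite N" using C by (simp add: Ch_def N_def)
  have "\<exists>p. framed_based P (Gr C n) (fst p :: ('s \<times> nat) set) fst (snd p)" for n
    using based_frame_ex[OF obj, of n] by (metis fst_conv snd_conv)
  then obtain F where F: "\<And>n. framed_based P (Gr C n) (fst (F n) :: ('s \<times> nat) set) fst (snd (F n))" by metis
  have W0: "fst (F n) = {}" if "n \<notin> N" for n
  proof (rule ccontr)
    interpret M: framed_based P "Gr C n" "fst (F n)" fst "snd (F n)" by (rule F)
    assume "fst (F n) \<noteq> {}"
    then obtain w where w: "w \<in> fst (F n)" by blast
    interpret g: framed_group "Gr C n (fst w)" "{w' \<in> fst (F n). fst w' = fst w}" "snd (F n) (fst w)" by (rule M.fr[OF M.index_in[OF w]])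
    have "basis_elt (Gr C n (fst w)) (snd (F n) (fst w)) w = \<one>\<^bsub>Gr C n (fst w)\<^esub>"
      using M.basis_summand[OF w] zero_object_trivial[OF _ M.index_in[OF w], of "Gr C n"] that by (simp add: N_def)
    then show False using g.coord_basis[of w w] g.coord_one[of w] w by simp
  qed
  define I :: "(int \<times> 's \<times> nat, 's) index" where
    "I = \<lparr>Ix = (SIGMA n:N. fst (F n)), Dg = fst, Ps = (\<lambda>w. fst (snd w))\<rparr>"
  define X where "X = \<lparr>Cpx = C, Idx = I, Crd = (\<lambda>n \<sigma> x w. if fst w = n then snd (F n) \<sigma> x (snd w) else 0)\<rparr>"
  have "framed_complex P X"
  proof unfold_locales
    show "finite (Ix (Idx X))"
      using finN F by (auto simp: X_def I_def framed_based_def framed_sum_def)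
    show "Ps (Idx X) w \<in> Field P" if "w \<in> Ix (Idx X)" for w
      using that framed_sum.index_in[OF framed_based.axioms(2)[OF F]] by (auto simp: X_def I_def)
    fix \<sigma> n assume \<sigma>: "\<sigma> \<in> Field P"
    interpret M: framed_based P "Gr C n" "fst (F n)" fst "snd (F n)" by (rule F)
    interpret g: framed_group "Gr C n \<sigma>" "{w' \<in> fst (F n). fst w' = \<sigma>}" "snd (F n) \<sigma>" by (rule M.fr[OF \<sigma>])
    have at: "{w \<in> at_deg (Idx X) n. Ps (Idx X) w = \<sigma>} = Pair n ` {w' \<in> fst (F n). fst w' = \<sigma>}"
      using W0 by (auto simp: at_deg_def X_def I_def)
    show "framed (Gr (Cpx X) n \<sigma>) {w \<in> at_deg (Idx X) n. Ps (Idx X) w = \<sigma>} (Crd X n \<sigma>)"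
      unfolding at
    proof (rule framedI[where c = "\<lambda>w. basis_elt (Gr C n \<sigma>) (snd (F n) \<sigma>) (snd w)"])
      fix x assume x: "x \<in> carrier (Gr (Cpx X) n \<sigma>)" and z: "\<And>w. w \<in> Pair n ` {w' \<in> fst (F n). fst w' = \<sigma>} \<Longrightarrow> Crd X n \<sigma> x w = 0"
      show "x = \<one>\<^bsub>Gr (Cpx X) n \<sigma>\<^esub>"
      proof -
        have x': "x \<in> carrier (Gr C n \<sigma>)" using x by (simp add: X_def)
        have "x = \<one>\<^bsub>Gr C n \<sigma>\<^esub>"
        proof (rule g.coord_eq[OF x'])
          fix w assume "w \<in> {w' \<in> fst (F n). fst w' = \<sigma>}"
          then have "Crd X n \<sigma> x (n, w) = 0" by (intro z imageI)
          then show "snd (F n) \<sigma> x w = snd (F n) \<sigma> \<one>\<^bsub>Gr C n \<sigma>\<^esub> w" by (simp add: X_def g.coord_one)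
        qed simp
        then show ?thesis by (simp add: X_def)
      qed
    next
      fix x w assume x: "x \<in> carrier (Gr (Cpx X) n \<sigma>)" and w: "w \<notin> Pair n ` {w' \<in> fst (F n). fst w' = \<sigma>}"
      show "Crd X n \<sigma> x w = 0"
      proof (cases "fst w = n")
        case True
        then have "snd w \<notin> {w' \<in> fst (F n). fst w' = \<sigma>}" using w by (metis imageI prod.collapse)
        then have "snd (F n) \<sigma> x (snd w) = 0" using x by (intro g.coord_outside) (auto simp: X_def)
        then show ?thesis by (simp add: X_def)
      qed (simp add: X_def)
    qed (auto simp: X_def g.comm g.fin g.coord_mult g.basis_closed g.coord_basis)
  qed
  then interpret X: framed_complex P X .
  have CX: "Cpx X = C" by (simp add: X_def)
  interpret XX: framed_hom_pair P X X by unfold_locales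
  have "Bd C \<in> carrier (Hom_gr (based_category P) (Cpx X) (Cpx X) (-1))"
    unfolding XX.Hom_gr_carrier using mor by (simp add: CX)
  then obtain dX where dX: "represents P X X (-1) (Bd C) dX" using XX.represents_ex by blast
  have bd: "bd_matrix P X dX" using dX by (simp add: bd_matrix_def represents_def CX)
  have m: "dX \<in> mats P (Idx X) (Idx X) (-1)" using dX by (simp add: represents_def)
  have "represents P X X (-2) (Hom_comp (based_category P) (Cpx X) (Cpx X) (Cpx X) (-1) (-1) (Bd C) (Bd C)) (mmul (Idx X) dX dX)"
    using represents_comp[OF XX.framed_complex_pair_axioms XX.framed_complex_pair_axioms dX dX] by simp
  moreover have "Hom_comp (based_category P) (Cpx X) (Cpx X) (Cpx X) (-1) (-1) (Bd C) (Bd C) = \<one>\<^bsub>Hom_gr (based_category P) (Cpx X) (Cpx X) (-2)\<^esub>"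
    unfolding Hom_comp_def Hom_gr_def by (simp add: CX dd fun_eq_iff)
  ultimately have "represents P X X (-2) \<one>\<^bsub>Hom_gr (based_category P) (Cpx X) (Cpx X) (-2)\<^esub> (mmul (Idx X) dX dX)" by simp
  from XX.represents_unique[OF this XX.represents_one] have "mmul (Idx X) dX dX = (\<lambda>_ _. 0)" .
  with bd m have "framed_chain_complex P X dX" by unfold_locales
  with CX show ?thesis by blast
qed

section \<open>The matrix of \<open>\<tau>\<close>\<close>

context framed_triple
begin

interpretation YX: framed_triple P E Y X by unfold_locales
interpretation TXY: framed_hom_pair P TX Y by unfold_locales

text \<open>The inverse of \<open>S\<close> is taken by choosing a preimage; one exists because every matrix is the \<open>S_matrix\<close> of
  some element, and its coordinates are determined by \<open>f\<close>.\<close>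

lemma tau_represents:
  assumes f: "represents P (T_cx P E X) Y n f A"
  shows "represents P (T_cx P E Y) X n (tau P (Cpx E) (Cpx X) (Cpx Y) n f) (tau_mat (Idx E) (Idx X) (Idx Y) A)"
proof -
  have A: "A \<in> mats P (Idx TX) (Idx Y) n" using f by (simp add: represents_def)
  let ?sg = "\<lambda>w d. parity_sign (Dg (Idx WX) w * Dg (Idx Y) d + Dg (Idx WX) w)"
  have A0: "A w d \<noteq> 0 \<Longrightarrow> (w, d) \<in> at_deg WXY.WI n" for w d
    using matsD[OF A, of w d] by (cases w) (auto simp: at_deg_def T_cx_def EX.Idx_tensor_cx)
  have out: "crd XY n u (w, d) = 0" if "(w, d) \<notin> at_deg WXY.WI n" for u w d
    using that by (simp add: sum_coord_def WXY.Idx_tensor_cx)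
  obtain u0 where u0: "u0 \<in> carrier (ctot P XY n)" "\<forall>a\<in>at_deg (Idx XY) n. crd XY n u0 a = ?sg (fst a) (snd a) * A (fst a) (snd a)"
    using WXY.W.tot.coord_ex[of n "\<lambda>a. ?sg (fst a) (snd a) * A (fst a) (snd a)"] by blast
  have "S_matrix n u0 w d = A w d" for w d
  proof (cases "(w, d) \<in> at_deg WXY.WI n")
    case True
    then have "crd XY n u0 (w, d) = ?sg w d * A w d" using u0(2) by (auto simp: WXY.Idx_tensor_cx)
    then show ?thesis by (simp add: S_matrix_def)
  next
    case False
    then show ?thesis using A0[of w d] out by (auto simp: S_matrix_def)
  qed
  then have "S_matrix n u0 = A" by (intro ext)
  with S_map_represents[OF u0(1)] have "S_map P (Cpx E) (Cpx X) (Cpx Y) n u0 = f"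
    using TXY.represents_eq f by simp
  then have im: "f \<in> S_map P (Cpx E) (Cpx X) (Cpx Y) n ` carrier (ctot P XY n)" using u0(1) by blast
  define u where "u = inv_into (carrier (ctot P XY n)) (S_map P (Cpx E) (Cpx X) (Cpx Y) n) f"
  have u: "u \<in> carrier (ctot P XY n)" "S_map P (Cpx E) (Cpx X) (Cpx Y) n u = f"
    unfolding u_def by (rule inv_into_into[OF im], rule f_inv_into_f[OF im])
  have SA: "S_matrix n u = A"
    using TXY.represents_unique[OF S_map_represents[OF u(1)]] f u(2) by simp
  let ?v = "swap_map P (Cpx E) (Cpx X) (Cpx Y) n u"
  have v: "?v \<in> carrier (ctot P YX.XY n)" by (rule swap_map_closed[OF u(1)])
  have "represents P (T_cx P E Y) X n (S_map P (Cpx E) (Cpx Y) (Cpx X) n ?v) (YX.S_matrix n ?v)"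
    by (rule YX.S_map_represents[OF v])
  moreover have "S_map P (Cpx E) (Cpx Y) (Cpx X) n ?v = tau P (Cpx E) (Cpx X) (Cpx Y) n f"
    by (simp add: tau_def u_def Cpx_XY)
  moreover have "YX.S_matrix n ?v = tau_mat (Idx E) (Idx X) (Idx Y) A"
  proof (intro ext, clarify)
    fix x d c
    show "YX.S_matrix n ?v (x, d) c = tau_mat (Idx E) (Idx X) (Idx Y) A (x, d) c"
    proof (cases "((x, d), c) \<in> at_deg WYX.WI n")
      case True
      have "A (x, c) d = ?sg (x, c) d * crd XY n u ((x, c), d)" using SA by (auto simp: S_matrix_def)
      then show ?thesis
        unfolding YX.S_matrix_def swap_map_coord[OF u(1) True]
        by (simp add: tau_mat_def EX.Idx_tensor_cx EY.Idx_tensor_cx tau_sign_def) (auto simp: parity_sign_def)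
    next
      case False
      have "A (x, c) d = 0"
      proof (rule ccontr)
        assume "A (x, c) d \<noteq> 0"
        from A0[OF this] False show False by (auto simp: at_deg_def EX.Idx_tensor_cx EY.Idx_tensor_cx)
      qed
      moreover have "crd YX.XY n ?v ((x, d), c) = 0" using False by (simp add: sum_coord_def WYX.Idx_tensor_cx)
      ultimately show ?thesis by (simp add: YX.S_matrix_def tau_mat_def)
    qed
  qed
  ultimately show ?thesis by simp
qed

end

section \<open>The category of based modules is additive\<close>

lemma framed_free_Abelian_group:
  assumes "finite W" shows "framed (free_Abelian_group W) W Poly_Mapping.lookup"
proof (rule framedI[OF abelian_free_Abelian_group assms, where c = frag_of])
  show "x = \<one>\<^bsub>free_Abelian_group W\<^esub>" if "x \<in> carrier (free_Abelian_group W)" "\<And>w. w \<in> W \<Longrightarrow> Poly_Mapping.lookup x w = 0" for x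
    using that by (auto intro!: poly_mapping_eqI simp: in_keys_iff)
qed (auto simp: lookup_add in_keys_iff)

context framed_based
begin

text \<open>A free abelian group on the disjoint union of the bases, copied into the universe \<open>'u\<close>. Only its basis is
  used, so the inclusions and projections of the biproduct can be given by matrices.\<close>

lemma sum_frame_ex:
  assumes "framed_based P N (V :: 'v set) qs \<mu>"
  shows "\<exists>S \<nu>. framed_based P (S :: ('s, 'u::infinite) based) (W <+> V) (case_sum ps qs) \<nu>"
proof -
  interpret N: framed_based P N V qs \<mu> by fact
  let ?I = "\<lambda>\<sigma>. {w \<in> W <+> V. case_sum ps qs w = \<sigma>}"
  have fin: "finite (?I \<sigma>)" for \<sigma> using finite_index N.finite_index by auto
  have "framed_based P (\<lambda>\<sigma>. copy_group (free_Abelian_group (?I \<sigma>)) :: 'u monoid) (W <+> V) (case_sum ps qs)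
      (\<lambda>\<sigma> y. Poly_Mapping.lookup (uncopy_map (free_Abelian_group (?I \<sigma>)) y))"
  proof unfold_locales
    show "framed (copy_group (free_Abelian_group (?I \<sigma>)) :: 'u monoid) (?I \<sigma>) (\<lambda>y. Poly_Mapping.lookup (uncopy_map (free_Abelian_group (?I \<sigma>)) y))" for \<sigma>
      by (rule framed_copy[OF framed_free_Abelian_group[OF fin]])
  qed (use finite_index N.finite_index index_in N.index_in in auto)
  then show ?thesis by blast
qed

end

lemma compose_in_based_hom:
  assumes "framed_based_pair P L U os \<eta> M W ps \<kappa>" "framed_based_pair P M W ps \<kappa> N V qs \<mu>"
    and f: "f \<in> carrier (based_hom P L M)" and g: "g \<in> carrier (based_hom P M N)"
  shows "compose (carrier (total P L)) g f \<in> carrier (based_hom P L N)"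
proof -
  interpret LM: framed_based_pair P L U os \<eta> M W ps \<kappa> by fact
  interpret MN: framed_based_pair P M W ps \<kappa> N V qs \<mu> by fact
  have g1: "g ` sum_incl (Field P) M \<tau> ` carrier (M \<tau>) \<subseteq> carrier (below P N \<tau>)" if "\<tau> \<in> Field P" for \<tau>
    using g that by (simp add: based_hom_def)
  have gb: "g y \<in> carrier (below P N \<tau>)" if y: "y \<in> carrier (below P M \<tau>)" and \<tau>: "\<tau> \<in> Field P" for y \<tau>
    unfolding MN.N.carrier_below
  proof (intro conjI ballI impI)
    have yt: "y \<in> carrier (total P M)" using y by (simp add: LM.N.carrier_below)
    show "g y \<in> carrier (total P N)" by (rule MN.based_hom_in[OF g yt])
    fix w assume w: "w \<in> V" "MN.N.crd (g y) w \<noteq> 0"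
    then have "(\<Sum>v\<in>W. LM.N.crd y v * MN.N.crd (g (basis_elt (total P M) LM.N.crd v)) w) \<noteq> 0"
      using MN.based_hom_matrix[OF g yt] by simp
    then obtain v where v: "v \<in> W" "LM.N.crd y v * MN.N.crd (g (basis_elt (total P M) LM.N.crd v)) w \<noteq> 0"
      by (meson sum.neutral)
    then have "(ps v, \<tau>) \<in> P" using y by (auto simp: LM.N.carrier_below)
    moreover have "(qs w, ps v) \<in> P" using g v w unfolding MN.based_hom_iff by auto
    ultimately show "(qs w, \<tau>) \<in> P" using LM.M.poset_trans by blast
  qed
  show ?thesis
    unfolding based_hom_def
  proof (simp, intro conjI ballI subsetI)
    have "(\<lambda>x. g (f x)) \<in> hom (total P L) (total P N)"
      by (rule hom_comp[OF LM.based_hom_hom[OF f] MN.based_hom_hom[OF g]])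
    then show "compose (carrier (total P L)) g f \<in> carrier (hom_group (total P L) (total P N))"
      unfolding compose_def by (rule restrict_hom_group[OF LM.TM.group_axioms])
    fix \<tau> y assume \<tau>: "\<tau> \<in> Field P" and "y \<in> compose (carrier (total P L)) g f ` sum_incl (Field P) L \<tau> ` carrier (L \<tau>)"
    then obtain a where a: "a \<in> carrier (L \<tau>)" and y: "y = compose (carrier (total P L)) g f (sum_incl (Field P) L \<tau> a)" by auto
    have "sum_incl (Field P) L \<tau> a \<in> carrier (total P L)" by (rule LM.M.sum_incl_total[OF \<tau> a])
    moreover have "f (sum_incl (Field P) L \<tau> a) \<in> carrier (below P M \<tau>)" using f \<tau> a by (auto simp: based_hom_def)
    ultimately show "y \<in> carrier (below P N \<tau>)" using gb[OF _ \<tau>] by (simp add: y compose_def)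
  qed
qed

context finite_poset
begin

lemma additive_based_category:
  "additive_category (based_category P :: (('s, 'u::infinite) based, ('s \<Rightarrow> 'u) \<Rightarrow> ('s \<Rightarrow> 'u)) category_data)"
    (is "additive_category ?A")
proof -
  define fr where "fr = (\<lambda>M :: ('s, 'u) based. SOME p. framed_based P M (fst p :: ('s \<times> nat) set) fst (snd p))"
  have fr: "framed_based P M (fst (fr M)) fst (snd (fr M))" if "M \<in> Obj ?A" for M
  proof -
    have "\<exists>p. framed_based P M (fst p :: ('s \<times> nat) set) fst (snd p)"
      using based_frame_ex[of M] that by (metis (no_types, lifting) based_category_simps(1) fst_conv mem_Collect_eq snd_conv)
    then show ?thesis unfolding fr_def by (rule someI_ex)
  qed
  have pr: "framed_based_pair P M (fst (fr M)) fst (snd (fr M)) N (fst (fr N)) fst (snd (fr N))"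
    if "M \<in> Obj ?A" "N \<in> Obj ?A" for M N
    using fr[OF that(1)] fr[OF that(2)] by (simp add: framed_based_pair_def)
  note in_hom = framed_based_pair.based_hom_in[OF pr]
  note ext_hom = framed_based_pair.based_hom_ext[OF pr]
  note hom_hom = framed_based_pair.based_hom_hom[OF pr]
  note mult = framed_based_pair.mult_based_hom[OF pr]
  have comp: "compose (carrier (total P L)) g f \<in> carrier (based_hom P L N)"
    if "L \<in> Obj ?A" "M \<in> Obj ?A" "N \<in> Obj ?A" "f \<in> carrier (based_hom P L M)" "g \<in> carrier (based_hom P M N)" for L M N f g
    by (rule compose_in_based_hom[OF pr pr]) (use that in auto)
  show ?thesis
  proof (rule additive_category.intro, unfold based_category_simps(2-4))
    fix a b assume ab: "a \<in> Obj ?A" "b \<in> Obj ?A"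
    show "comm_group (based_hom P a b)" by (rule framed_based_pair.comm_group_based_hom[OF pr[OF ab]])
    fix f assume f: "f \<in> carrier (based_hom P a b)"
    show "compose (carrier (total P a)) (based_id P b) f = f"
      by (rule extensionalityI[of _ "carrier (total P a)"])
        (use in_hom[OF ab f] ext_hom[OF ab f] in \<open>auto simp: compose_def based_id_def\<close>)
    show "compose (carrier (total P a)) f (based_id P a) = f"
      by (rule extensionalityI[of _ "carrier (total P a)"])
        (use ext_hom[OF ab f] in \<open>auto simp: compose_def based_id_def\<close>)
    fix c g assume c: "c \<in> Obj ?A" and g: "g \<in> carrier (based_hom P b c)"
    show "compose (carrier (total P a)) g f \<in> carrier (based_hom P a c)" by (rule comp[OF ab c f g])
    show "compose (carrier (total P a)) (g \<otimes>\<^bsub>based_hom P b c\<^esub> g') f =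
        compose (carrier (total P a)) g f \<otimes>\<^bsub>based_hom P a c\<^esub> compose (carrier (total P a)) g' f"
      if "g' \<in> carrier (based_hom P b c)" for g'
      unfolding mult[OF ab(2) c] mult[OF ab(1) c] using in_hom[OF ab f]
      by (auto simp: compose_def fun_eq_iff)
    show "compose (carrier (total P a)) g (f \<otimes>\<^bsub>based_hom P a b\<^esub> f') =
        compose (carrier (total P a)) g f \<otimes>\<^bsub>based_hom P a c\<^esub> compose (carrier (total P a)) g f'"
      if "f' \<in> carrier (based_hom P a b)" for f'
      unfolding mult[OF ab] mult[OF ab(1) c] using in_hom[OF ab f] in_hom[OF ab that] hom_mult[OF hom_hom[OF ab(2) c g]]
      by (auto simp: compose_def fun_eq_iff)
    fix d h assume d: "d \<in> Obj ?A" and h: "h \<in> carrier (based_hom P c d)"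
    show "compose (carrier (total P a)) h (compose (carrier (total P a)) g f) =
        compose (carrier (total P a)) (compose (carrier (total P b)) h g) f"
      using in_hom[OF ab f] by (auto simp: compose_def fun_eq_iff)
  next
    fix a assume a: "a \<in> Obj ?A"
    show "based_id P a \<in> carrier (based_hom P a a)" by (rule framed_based.based_id_hom[OF fr[OF a]])
  next
    let ?Z = "\<lambda>\<sigma>::'s. copy_group (free_Abelian_group ({} :: nat set)) :: 'u monoid"
    have f: "framed (?Z \<sigma>) {} (\<lambda>y. Poly_Mapping.lookup (uncopy_map (free_Abelian_group ({} :: nat set)) y))" for \<sigma>
      by (rule framed_copy[OF framed_free_Abelian_group]) simp
    have "zero_object ?A ?Z"
    proof (rule zero_objectI)
      show "fg_free (?Z \<sigma>)" for \<sigma> by (rule framed_fg_free[OF f])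
      fix \<sigma>
      interpret g: framed_group "?Z \<sigma>" "{}" "\<lambda>y. Poly_Mapping.lookup (uncopy_map (free_Abelian_group ({} :: nat set)) y)"
        by unfold_locales (rule f)
      have "x = \<one>\<^bsub>?Z \<sigma>\<^esub>" if "x \<in> carrier (?Z \<sigma>)" for x by (rule g.coord_eq) (use that in auto)
      then show "carrier (?Z \<sigma>) = {\<one>\<^bsub>?Z \<sigma>\<^esub>}" by auto
    qed
    then show "\<exists>z. zero_object ?A z" by blast
  next
    fix M N :: "('s, 'u) based" assume M: "M \<in> Obj ?A" and N: "N \<in> Obj ?A"
    let ?W = "fst (fr M)" and ?V = "fst (fr N)"
    interpret M: framed_based P M ?W fst "snd (fr M)" by (rule fr[OF M])
    interpret N: framed_based P N ?V fst "snd (fr N)" by (rule fr[OF N])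
    obtain S \<nu> where "framed_based P (S :: ('s, 'u) based) (?W <+> ?V) (case_sum fst fst) \<nu>"
      using M.sum_frame_ex[OF fr[OF N]] by blast
    then interpret S: framed_based P S "?W <+> ?V" "case_sum fst fst" \<nu> .
    interpret MS: framed_based_pair P M ?W fst "snd (fr M)" S "?W <+> ?V" "case_sum fst fst" \<nu> by unfold_locales
    interpret NS: framed_based_pair P N ?V fst "snd (fr N)" S "?W <+> ?V" "case_sum fst fst" \<nu> by unfold_locales
    interpret SM: framed_based_pair P S "?W <+> ?V" "case_sum fst fst" \<nu> M ?W fst "snd (fr M)" by unfold_locales
    interpret SN: framed_based_pair P S "?W <+> ?V" "case_sum fst fst" \<nu> N ?V fst "snd (fr N)" by unfold_locales
    interpret SS: framed_based_pair P S "?W <+> ?V" "case_sum fst fst" \<nu> S "?W <+> ?V" "case_sum fst fst" \<nu> by unfold_locales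
    interpret MM: framed_based_pair P M ?W fst "snd (fr M)" M ?W fst "snd (fr M)" by unfold_locales
    interpret NN: framed_based_pair P N ?V fst "snd (fr N)" N ?V fst "snd (fr N)" by unfold_locales
    interpret MN: framed_based_pair P M ?W fst "snd (fr M)" N ?V fst "snd (fr N)" by unfold_locales
    interpret NM: framed_based_pair P N ?V fst "snd (fr N)" M ?W fst "snd (fr M)" by unfold_locales
    have rW: "w \<in> ?W \<Longrightarrow> (fst w, fst w) \<in> P" and rV: "v \<in> ?V \<Longrightarrow> (fst v, fst v) \<in> P" for w v
      using poset_refl M.index_in N.index_in by auto
    note fin = MS.TM.fin NS.TM.fin
    obtain i where i: "i \<in> carrier (based_hom P M S)"
      "\<And>x s. \<lbrakk>x \<in> carrier (total P M); s \<in> ?W <+> ?V\<rbrakk> \<Longrightarrow> S.crd (i x) s = (\<Sum>w\<in>?W. M.crd x w * of_bool (s = Inl w))"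
      using rW by (rule_tac A = "\<lambda>w s. of_bool (s = Inl w)" in MS.based_hom_of_matrix) (auto split: if_splits)
    obtain j where j: "j \<in> carrier (based_hom P N S)"
      "\<And>x s. \<lbrakk>x \<in> carrier (total P N); s \<in> ?W <+> ?V\<rbrakk> \<Longrightarrow> S.crd (j x) s = (\<Sum>w\<in>?V. N.crd x w * of_bool (s = Inr w))"
      using rV by (rule_tac A = "\<lambda>w s. of_bool (s = Inr w)" in NS.based_hom_of_matrix) (auto split: if_splits)
    obtain p where p: "p \<in> carrier (based_hom P S M)"
      "\<And>x w. \<lbrakk>x \<in> carrier (total P S); w \<in> ?W\<rbrakk> \<Longrightarrow> M.crd (p x) w = (\<Sum>s\<in>?W <+> ?V. S.crd x s * of_bool (s = Inl w))"
      using rW by (rule_tac A = "\<lambda>s w. of_bool (s = Inl w)" in SM.based_hom_of_matrix) (auto split: if_splits)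
    obtain q where q: "q \<in> carrier (based_hom P S N)"
      "\<And>x w. \<lbrakk>x \<in> carrier (total P S); w \<in> ?V\<rbrakk> \<Longrightarrow> N.crd (q x) w = (\<Sum>s\<in>?W <+> ?V. S.crd x s * of_bool (s = Inr w))"
      using rV by (rule_tac A = "\<lambda>s w. of_bool (s = Inr w)" in SN.based_hom_of_matrix) (auto split: if_splits)
    have iW: "S.crd (i x) (Inl w) = M.crd x w" if "x \<in> carrier (total P M)" "w \<in> ?W" for x w
      using i(2)[OF that(1), of "Inl w"] that(2) sum_of_bool_eq[OF fin(1)] by (simp add: eq_commute[of w] InlI InrI)
    have jV: "S.crd (j x) (Inr v) = N.crd x v" if "x \<in> carrier (total P N)" "v \<in> ?V" for x v
      using j(2)[OF that(1), of "Inr v"] that(2) sum_of_bool_eq[OF fin(2)] by (simp add: eq_commute[of v] InlI InrI)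
    have pW: "M.crd (p x) w = S.crd x (Inl w)" if "x \<in> carrier (total P S)" "w \<in> ?W" for x w
      using that unfolding p(2)[OF that] sum_of_bool_eq[OF finite_Plus[OF fin]] by auto
    have qV: "N.crd (q x) v = S.crd x (Inr v)" if "x \<in> carrier (total P S)" "v \<in> ?V" for x v
      using that unfolding q(2)[OF that] sum_of_bool_eq[OF finite_Plus[OF fin]] by auto
    show "\<exists>s\<in>Obj ?A. \<exists>i\<in>carrier (based_hom P M s). \<exists>j\<in>carrier (based_hom P N s).
        \<exists>p\<in>carrier (based_hom P s M). \<exists>q\<in>carrier (based_hom P s N).
          compose (carrier (total P M)) p i = based_id P M \<and> compose (carrier (total P N)) q j = based_id P N \<and>
          compose (carrier (total P M)) q i = \<one>\<^bsub>based_hom P M N\<^esub> \<and> compose (carrier (total P N)) p j = \<one>\<^bsub>based_hom P N M\<^esub> \<and>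
          compose (carrier (total P s)) i p \<otimes>\<^bsub>based_hom P s s\<^esub> compose (carrier (total P s)) j q = based_id P s"
    proof (intro bexI conjI)
      show "S \<in> Obj ?A" using S.fg_free_summand by simp
      show "compose (carrier (total P M)) p i = based_id P M"
        unfolding compose_def based_id_def
      proof (rule restrict_ext)
        fix x assume x: "x \<in> carrier (total P M)"
        note ix = MS.based_hom_in[OF i(1) x]
        show "p (i x) = x"
          by (rule MS.TM.coord_eq) (use x SM.based_hom_in[OF p(1) ix] in \<open>simp_all add: pW[OF ix] iW[OF x]\<close>)
      qed
      show "compose (carrier (total P N)) q j = based_id P N"
        unfolding compose_def based_id_def
      proof (rule restrict_ext)
        fix x assume x: "x \<in> carrier (total P N)"
        note jx = NS.based_hom_in[OF j(1) x]
        show "q (j x) = x"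
          by (rule NS.TM.coord_eq) (use x SN.based_hom_in[OF q(1) jx] in \<open>simp_all add: qV[OF jx] jV[OF x]\<close>)
      qed
      show "compose (carrier (total P M)) q i = \<one>\<^bsub>based_hom P M N\<^esub>"
        unfolding compose_def MN.one_based_hom
      proof (rule restrict_ext)
        fix x assume x: "x \<in> carrier (total P M)"
        note ix = MS.based_hom_in[OF i(1) x]
        show "q (i x) = \<one>\<^bsub>total P N\<^esub>"
          by (rule NS.TM.coord_eq) (use SN.based_hom_in[OF q(1) ix] in \<open>simp_all add: qV[OF ix] i(2)[OF x] InrI NS.TM.coord_one\<close>)
      qed
      show "compose (carrier (total P N)) p j = \<one>\<^bsub>based_hom P N M\<^esub>"
        unfolding compose_def NM.one_based_hom
      proof (rule restrict_ext)
        fix x assume x: "x \<in> carrier (total P N)"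
        note jx = NS.based_hom_in[OF j(1) x]
        show "p (j x) = \<one>\<^bsub>total P M\<^esub>"
          by (rule MS.TM.coord_eq) (use SM.based_hom_in[OF p(1) jx] in \<open>simp_all add: pW[OF jx] j(2)[OF x] InlI MS.TM.coord_one\<close>)
      qed
      show "compose (carrier (total P S)) i p \<otimes>\<^bsub>based_hom P S S\<^esub> compose (carrier (total P S)) j q = based_id P S"
        unfolding SS.mult_based_hom based_id_def
      proof (rule restrict_ext)
        fix x assume x: "x \<in> carrier (total P S)"
        note px = SM.based_hom_in[OF p(1) x] and qx = SN.based_hom_in[OF q(1) x]
        note ip = MS.based_hom_in[OF i(1) px] and jq = NS.based_hom_in[OF j(1) qx]
        have "i (p x) \<otimes>\<^bsub>total P S\<^esub> j (q x) = x"
        proof (rule MS.TN.coord_eq)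
          fix s assume s: "s \<in> ?W <+> ?V"
          then show "S.crd (i (p x) \<otimes>\<^bsub>total P S\<^esub> j (q x)) s = S.crd x s"
          proof (cases s)
            case (Inl w)
            have "(\<Sum>v\<in>?W. M.crd (p x) v * of_bool (Inl w = (Inl v :: _ + 's \<times> nat))) = M.crd (p x) w"
              using s Inl sum_of_bool_eq[OF fin(1)] by (auto simp: eq_commute[of w])
            with s show ?thesis unfolding MS.TN.coord_mult[OF ip jq] i(2)[OF px s] j(2)[OF qx s] using pW[OF x] by (auto simp: Inl)
          next
            case (Inr v)
            have "(\<Sum>w\<in>?V. N.crd (q x) w * of_bool (Inr v = (Inr w :: 's \<times> nat + _))) = N.crd (q x) v"
              using s Inr sum_of_bool_eq[OF fin(2)] by (auto simp: eq_commute[of v])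
            with s show ?thesis unfolding MS.TN.coord_mult[OF ip jq] i(2)[OF px s] j(2)[OF qx s] using qV[OF x] by (auto simp: Inr)
          qed
        qed (use x ip jq in auto)
        then show "compose (carrier (total P S)) i p x \<otimes>\<^bsub>total P S\<^esub> compose (carrier (total P S)) j q x = x"
          using x by (simp add: compose_def)
      qed
    qed (rule i(1) j(1) p(1) q(1))+
  qed
qed

end

section \<open>Chain duality functors\<close>

lemma Cpx_T_cx: "Cpx (T_cx P E X) = T_obj P (Cpx E) (Cpx X)" and Idx_T_cx: "Idx (T_cx P E X) = T_index P (Idx E) (Idx X)"
  by (simp_all add: T_cx_def)

text \<open>The data on \<open>E\<close> for which \<open>T\<close> and \<open>\<tau>\<close> form a chain duality functor: any complex over \<open>\<int>(P\<^sup>o\<^sup>p)\<close>-mod with a framing.\<close>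

locale duality_frame = E: framed_complex P E + tensor_matrices P "Idx E" dE
  for P :: "'s rel" and E :: "('s, 'e, 'x) framed_cx" and dE +
  assumes bd_E: "bd_matrix P E dE"
begin

lemma framed_chain_T:
  fixes X :: "('s, 'u::infinite, 'w) framed_cx"
  assumes "framed_chain_complex P X dX"
  shows "framed_chain_complex P (T_cx P E X) (bdT (Idx X) dX)"
proof -
  interpret X: framed_chain_complex P X dX by fact
  interpret EX: framed_T_cx P E X by unfold_locales
  show ?thesis
  proof unfold_locales
    show "bd_matrix P (T_cx P E X) (bdT (Idx X) dX)" by (rule EX.T_bd_matrix[OF bd_E dE X.bd X.bd_mats])
  qed (simp_all add: Idx_T_cx T_bd_mats[OF X.bd_mats] T_bd_squared[OF X.finite_Ix X.bd_mats X.bd_bd])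
qed

lemma T_mor_represents:
  fixes X :: "('s, 'u::infinite, 'v) framed_cx" and Y :: "('s, 'u, 'w) framed_cx"
  assumes "framed_complex P X" "framed_complex P Y" and f: "represents P X Y 0 f A"
  shows "represents P (T_cx P E Y) (T_cx P E X) 0 (T_mor P (Cpx E) (Cpx X) (Cpx Y) f) (T_mat P (Idx E) (Idx X) A)"
proof -
  interpret X: framed_complex P X by fact
  interpret Y: framed_complex P Y by fact
  interpret XY: framed_T_pair P E X Y by unfold_locales
  have A: "A \<in> mats P (Idx X) (Idx Y) 0" using f by (simp add: represents_def)
  have "has_matrix P X q Y q (f q) A" for q using f unfolding represents_def by (metis add.right_neutral)
  from XY.T_mor_matrix[OF this A] show ?thesis
    unfolding represents_def Idx_T_cx using T_mat_mats[OF A] by simp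
qed

lemma tau_represents:
  fixes X :: "('s, 'u::infinite, 'v) framed_cx" and Y :: "('s, 'u, 'w) framed_cx"
  assumes "framed_complex P X" "framed_complex P Y" and f: "represents P (T_cx P E X) Y n f A"
  shows "represents P (T_cx P E Y) X n (tau P (Cpx E) (Cpx X) (Cpx Y) n f) (tau_mat (Idx E) (Idx X) (Idx Y) A)"
proof -
  interpret X: framed_complex P X by fact
  interpret Y: framed_complex P Y by fact
  interpret XY: framed_triple P E X Y by unfold_locales
  show ?thesis by (rule XY.tau_represents[OF f])
qed

end

locale duality_pair = duality_frame P E dE + framed_chain_pair P X dX Y dY
  for P :: "'s rel" and E :: "('s, 'e, 'x) framed_cx" and dE and X :: "('s, 'u::infinite, 'v) framed_cx" and dX
    and Y :: "('s, 'u, 'w) framed_cx" and dY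
begin

abbreviation TX where "TX \<equiv> T_cx P E X"
abbreviation TY where "TY \<equiv> T_cx P E Y"

sublocale TX: framed_chain_complex P TX "bdT (Idx X) dX" by (rule framed_chain_T) unfold_locales
sublocale TY: framed_chain_complex P TY "bdT (Idx Y) dY" by (rule framed_chain_T) unfold_locales
sublocale TYX: framed_chain_pair P TY "bdT (Idx Y) dY" TX "bdT (Idx X) dX" by unfold_locales
sublocale XTY: framed_chain_pair P TX "bdT (Idx X) dX" Y dY by unfold_locales
sublocale YTX: framed_chain_pair P TY "bdT (Idx Y) dY" X dX by unfold_locales

lemmas T_mor_represents_XY = T_mor_represents[OF X.framed_complex_axioms Y.framed_complex_axioms]
lemmas tau_represents_XY = tau_represents[OF X.framed_complex_axioms Y.framed_complex_axioms]
lemmas tau_represents_YX = tau_represents[OF Y.framed_complex_axioms X.framed_complex_axioms]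

lemma T_mor_chain_map:
  assumes "f \<in> chain_maps (based_category P) (Cpx X) (Cpx Y)"
  shows "T_mor P (Cpx E) (Cpx X) (Cpx Y) f \<in> chain_maps (based_category P) (Cpx TY) (Cpx TX)"
proof -
  obtain A where A: "represents P X Y 0 f A" using assms represents_ex by (auto simp: chain_maps_def)
  then have m: "A \<in> mats P (Idx X) (Idx Y) 0" by (simp add: represents_def)
  have c: "mbd (Idx X) (Idx Y) 0 dX dY A = (\<lambda>_ _. 0)" using represents_chain_map[OF A] assms by simp
  show ?thesis
    using TYX.represents_chain_map[OF T_mor_represents_XY[OF A]]
      T_mat_chain[OF X.finite_Ix Y.finite_Ix X.bd_mats Y.bd_mats m c] by (simp add: Idx_T_cx)
qed

lemma T_mor_add:
  assumes "f \<in> chain_maps (based_category P) (Cpx X) (Cpx Y)" "g \<in> chain_maps (based_category P) (Cpx X) (Cpx Y)"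
  shows "T_mor P (Cpx E) (Cpx X) (Cpx Y) (f \<otimes>\<^bsub>Hom_gr (based_category P) (Cpx X) (Cpx Y) 0\<^esub> g) =
    T_mor P (Cpx E) (Cpx X) (Cpx Y) f \<otimes>\<^bsub>Hom_gr (based_category P) (Cpx TY) (Cpx TX) 0\<^esub> T_mor P (Cpx E) (Cpx X) (Cpx Y) g"
proof -
  obtain A where A: "represents P X Y 0 f A" using assms(1) represents_ex by (auto simp: chain_maps_def)
  obtain B where B: "represents P X Y 0 g B" using assms(2) represents_ex by (auto simp: chain_maps_def)
  show ?thesis
    by (rule TYX.represents_eq[OF T_mor_represents_XY[OF represents_add[OF A B], unfolded T_mat_add]
          TYX.represents_add[OF T_mor_represents_XY[OF A] T_mor_represents_XY[OF B]]])
qed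

lemma tau_hom:
  "tau P (Cpx E) (Cpx X) (Cpx Y) n \<in> hom (Hom_gr (based_category P) (Cpx TX) (Cpx Y) n) (Hom_gr (based_category P) (Cpx TY) (Cpx X) n)"
proof (rule homI)
  fix f assume "f \<in> carrier (Hom_gr (based_category P) (Cpx TX) (Cpx Y) n)"
  then obtain A where A: "represents P TX Y n f A" using XTY.represents_ex by blast
  show "tau P (Cpx E) (Cpx X) (Cpx Y) n f \<in> carrier (Hom_gr (based_category P) (Cpx TY) (Cpx X) n)"
    by (rule YTX.represents_carrier[OF tau_represents_XY[OF A]])
  fix g assume "g \<in> carrier (Hom_gr (based_category P) (Cpx TX) (Cpx Y) n)"
  then obtain B where B: "represents P TX Y n g B" using XTY.represents_ex by blast
  have s: "tau_mat (Idx E) (Idx X) (Idx Y) (\<lambda>a b. A a b + B a b) =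
      (\<lambda>a b. tau_mat (Idx E) (Idx X) (Idx Y) A a b + tau_mat (Idx E) (Idx X) (Idx Y) B a b)"
    by (intro ext) (auto simp: tau_mat_def distrib_left)
  show "tau P (Cpx E) (Cpx X) (Cpx Y) n (f \<otimes>\<^bsub>Hom_gr (based_category P) (Cpx TX) (Cpx Y) n\<^esub> g) =
      tau P (Cpx E) (Cpx X) (Cpx Y) n f \<otimes>\<^bsub>Hom_gr (based_category P) (Cpx TY) (Cpx X) n\<^esub> tau P (Cpx E) (Cpx X) (Cpx Y) n g"
    by (rule YTX.represents_eq[OF tau_represents_XY[OF XTY.represents_add[OF A B], unfolded s]
          YTX.represents_add[OF tau_represents_XY[OF A] tau_represents_XY[OF B]]])
qed

lemma tau_chain:
  assumes "f \<in> carrier (Hom_gr (based_category P) (Cpx TX) (Cpx Y) n)"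
  shows "tau P (Cpx E) (Cpx X) (Cpx Y) (n - 1) (Hom_bd (based_category P) (Cpx TX) (Cpx Y) n f) =
    Hom_bd (based_category P) (Cpx TY) (Cpx X) n (tau P (Cpx E) (Cpx X) (Cpx Y) n f)"
proof -
  obtain A where A: "represents P TX Y n f A" using XTY.represents_ex[OF assms] by blast
  then have m: "A \<in> mats P (T (Idx X)) (Idx Y) n" by (simp add: represents_def Idx_T_cx)
  show ?thesis
    by (rule YTX.represents_eq[OF tau_represents_XY[OF XTY.represents_bd[OF A], unfolded Idx_T_cx
            tau_mat_chain[OF X.finite_Ix Y.finite_Ix X.bd_mats Y.bd_mats m]]
          YTX.represents_bd[OF tau_represents_XY[OF A], unfolded Idx_T_cx]])
qed

lemma tau_involution:
  assumes "f \<in> carrier (Hom_gr (based_category P) (Cpx TX) (Cpx Y) n)"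
  shows "tau P (Cpx E) (Cpx Y) (Cpx X) n (tau P (Cpx E) (Cpx X) (Cpx Y) n f) = f"
proof -
  obtain A where A: "represents P TX Y n f A" using XTY.represents_ex[OF assms] by blast
  show ?thesis
    by (rule XTY.represents_eq[OF tau_represents_YX[OF tau_represents_XY[OF A], unfolded tau_mat_involution] A])
qed

end

context duality_frame
begin

lemma T_mor_id:
  fixes X :: "('s, 'u::infinite, 'v) framed_cx"
  assumes "framed_chain_complex P X dX"
  shows "T_mor P (Cpx E) (Cpx X) (Cpx X) (chain_id (based_category P) (Cpx X)) = chain_id (based_category P) (Cpx (T_cx P E X))"
proof -
  interpret X: framed_chain_complex P X dX by fact
  interpret XX: duality_pair P E dE X dX X dX by unfold_locales
  show ?thesis
    by (rule XX.TYX.represents_eq[OF XX.T_mor_represents_XY[OF X.represents_id, unfolded T_mat_mone]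
          XX.TX.represents_id[unfolded Idx_T_cx]])
qed

lemma T_mor_comp:
  fixes X :: "('s, 'u::infinite, 'v) framed_cx" and Y :: "('s, 'u, 'w) framed_cx" and Z :: "('s, 'u, 'z) framed_cx"
  assumes "framed_chain_complex P X dX" "framed_chain_complex P Y dY" "framed_chain_complex P Z dZ"
    and f: "f \<in> chain_maps (based_category P) (Cpx X) (Cpx Y)" and g: "g \<in> chain_maps (based_category P) (Cpx Y) (Cpx Z)"
  shows "T_mor P (Cpx E) (Cpx X) (Cpx Z) (Hom_comp (based_category P) (Cpx X) (Cpx Y) (Cpx Z) 0 0 g f) =
    Hom_comp (based_category P) (Cpx (T_cx P E Z)) (Cpx (T_cx P E Y)) (Cpx (T_cx P E X)) 0 0
      (T_mor P (Cpx E) (Cpx X) (Cpx Y) f) (T_mor P (Cpx E) (Cpx Y) (Cpx Z) g)"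
proof -
  interpret X: framed_chain_complex P X dX by fact
  interpret Y: framed_chain_complex P Y dY by fact
  interpret Z: framed_chain_complex P Z dZ by fact
  interpret XY: duality_pair P E dE X dX Y dY by unfold_locales
  interpret YZ: duality_pair P E dE Y dY Z dZ by unfold_locales
  interpret XZ: duality_pair P E dE X dX Z dZ by unfold_locales
  obtain A where A: "represents P X Y 0 f A" using f XY.represents_ex by (auto simp: chain_maps_def)
  obtain B where B: "represents P Y Z 0 g B" using g YZ.represents_ex by (auto simp: chain_maps_def)
  have m: "A \<in> mats P (Idx X) (Idx Y) 0" "B \<in> mats P (Idx Y) (Idx Z) 0" using A B by (simp_all add: represents_def)
  have "represents P X Z 0 (Hom_comp (based_category P) (Cpx X) (Cpx Y) (Cpx Z) 0 0 g f) (mmul (Idx Y) B A)"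
    using represents_comp[OF XY.framed_complex_pair_axioms YZ.framed_complex_pair_axioms A B] by simp
  note 1 = XZ.T_mor_represents_XY[OF this, unfolded T_mat_mmul[OF X.finite_Ix Y.finite_Ix m]]
  note 2 = represents_comp[OF YZ.TYX.framed_complex_pair_axioms XY.TYX.framed_complex_pair_axioms
      YZ.T_mor_represents_XY[OF B] XY.T_mor_represents_XY[OF A], unfolded Idx_T_cx add_0]
  show ?thesis by (rule XZ.TYX.represents_eq[OF 1 2])
qed

lemma tau_natural:
  fixes X :: "('s, 'u::infinite, 'v) framed_cx" and Y :: "('s, 'u, 'w) framed_cx"
    and X' :: "('s, 'u, 'v') framed_cx" and Y' :: "('s, 'u, 'w') framed_cx"
  assumes "framed_chain_complex P X dX" "framed_chain_complex P X' dX'"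
    and "framed_chain_complex P Y dY" "framed_chain_complex P Y' dY'"
    and f: "f \<in> chain_maps (based_category P) (Cpx X) (Cpx X')" and g: "g \<in> chain_maps (based_category P) (Cpx Y) (Cpx Y')"
    and h: "h \<in> carrier (Hom_gr (based_category P) (Cpx (T_cx P E X)) (Cpx Y) n)"
  shows "tau P (Cpx E) (Cpx X') (Cpx Y') n (Hom_comp (based_category P) (Cpx (T_cx P E X')) (Cpx Y) (Cpx Y') n 0 g
      (Hom_comp (based_category P) (Cpx (T_cx P E X')) (Cpx (T_cx P E X)) (Cpx Y) 0 n h (T_mor P (Cpx E) (Cpx X) (Cpx X') f))) =
    Hom_comp (based_category P) (Cpx (T_cx P E Y')) (Cpx X) (Cpx X') n 0 f
      (Hom_comp (based_category P) (Cpx (T_cx P E Y')) (Cpx (T_cx P E Y)) (Cpx X) 0 n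
        (tau P (Cpx E) (Cpx X) (Cpx Y) n h) (T_mor P (Cpx E) (Cpx Y) (Cpx Y') g))"
proof -
  interpret X: framed_chain_complex P X dX by fact
  interpret X': framed_chain_complex P X' dX' by fact
  interpret Y: framed_chain_complex P Y dY by fact
  interpret Y': framed_chain_complex P Y' dY' by fact
  interpret XX': duality_pair P E dE X dX X' dX' by unfold_locales
  interpret YY': duality_pair P E dE Y dY Y' dY' by unfold_locales
  interpret XY: duality_pair P E dE X dX Y dY by unfold_locales
  interpret X'Y: duality_pair P E dE X' dX' Y dY by unfold_locales
  interpret XY': duality_pair P E dE X dX Y' dY' by unfold_locales
  interpret X'Y': duality_pair P E dE X' dX' Y' dY' by unfold_locales
  obtain A where A: "represents P X X' 0 f A" using f XX'.represents_ex by (auto simp: chain_maps_def)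
  obtain B where B: "represents P Y Y' 0 g B" using g YY'.represents_ex by (auto simp: chain_maps_def)
  obtain H where H: "represents P (T_cx P E X) Y n h H" using XY.XTY.represents_ex[OF h] by blast
  have m: "A \<in> mats P (Idx X) (Idx X') 0" "B \<in> mats P (Idx Y) (Idx Y') 0" "H \<in> mats P (T (Idx X)) (Idx Y) n"
    using A B H by (simp_all add: represents_def Idx_T_cx)
  have 1: "represents P (T_cx P E X') Y n (Hom_comp (based_category P) (Cpx (T_cx P E X')) (Cpx (T_cx P E X)) (Cpx Y) 0 n h
      (T_mor P (Cpx E) (Cpx X) (Cpx X') f)) (mmul (T (Idx X)) H (T_mat P (Idx E) (Idx X) A))"
    using represents_comp[OF XX'.TYX.framed_complex_pair_axioms XY.XTY.framed_complex_pair_axioms XX'.T_mor_represents_XY[OF A] H]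
    by (simp add: Idx_T_cx)
  have 2: "represents P (T_cx P E Y') X n (Hom_comp (based_category P) (Cpx (T_cx P E Y')) (Cpx (T_cx P E Y)) (Cpx X) 0 n
      (tau P (Cpx E) (Cpx X) (Cpx Y) n h) (T_mor P (Cpx E) (Cpx Y) (Cpx Y') g))
      (mmul (T (Idx Y)) (tau_mat (Idx E) (Idx X) (Idx Y) H) (T_mat P (Idx E) (Idx Y) B))"
    using represents_comp[OF YY'.TYX.framed_complex_pair_axioms XY.YTX.framed_complex_pair_axioms YY'.T_mor_represents_XY[OF B]
        XY.tau_represents_XY[OF H]] by (simp add: Idx_T_cx)
  show ?thesis
    using X'Y'.tau_represents_XY[OF represents_comp[OF X'Y.XTY.framed_complex_pair_axioms YY'.framed_complex_pair_axioms 1 B, simplified]]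
      represents_comp[OF XY'.YTX.framed_complex_pair_axioms XX'.framed_complex_pair_axioms 2 A, simplified]
    unfolding tau_mat_natural[OF X.finite_Ix Y.finite_Ix X'.finite_Ix Y'.finite_Ix m]
    by (rule X'Y'.YTX.represents_eq)
qed

theorem T_chain_duality_functor:
  "chain_duality_functor (based_category P :: (('s, 'u::infinite) based, ('s \<Rightarrow> 'u) \<Rightarrow> ('s \<Rightarrow> 'u)) category_data)
     (T_obj P (Cpx E)) (T_mor P (Cpx E)) (tau P (Cpx E))"
proof -
  let ?A = "based_category P :: (('s, 'u) based, ('s \<Rightarrow> 'u) \<Rightarrow> ('s \<Rightarrow> 'u)) category_data"
  have "\<forall>C\<in>Ch ?A. \<exists>X :: ('s, 'u, int \<times> 's \<times> nat) framed_cx. \<exists>dX. Cpx X = C \<and> framed_chain_complex P X dX"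
    by (rule ballI, rule E.Ch_framed)
  from bchoice[OF this] obtain X :: "('s, 'u) based_complex \<Rightarrow> ('s, 'u, int \<times> 's \<times> nat) framed_cx"
    where "\<forall>C\<in>Ch ?A. \<exists>dX. Cpx (X C) = C \<and> framed_chain_complex P (X C) dX" ..
  from bchoice[OF this] obtain d where Xd: "\<forall>C\<in>Ch ?A. Cpx (X C) = C \<and> framed_chain_complex P (X C) (d C)" ..
  have X: "Cpx (X C) = C" and d: "framed_chain_complex P (X C) (d C)" if "C \<in> Ch ?A" for C
    using Xd[rule_format, OF that] by (rule conjunct1, rule conjunct2)
  have pr: "duality_pair P E dE (X C) (d C) (X D) (d D)" if "C \<in> Ch ?A" "D \<in> Ch ?A" for C D
    by (rule duality_pair.intro[OF duality_frame_axioms framed_chain_pair.intro[OF d[OF that(1)] d[OF that(2)]]])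
  show ?thesis
  proof (rule chain_duality_functor.intro[OF E.additive_based_category], rule chain_duality_functor_axioms.intro)
    fix C assume C: "C \<in> Ch ?A"
    show "T_obj P (Cpx E) C \<in> Ch ?A"
      by (rule framed_chain_complex.in_Ch[OF framed_chain_T[OF d[OF C]], unfolded Cpx_T_cx X[OF C]])
    show "T_mor P (Cpx E) C C (chain_id ?A C) = chain_id ?A (T_obj P (Cpx E) C)"
      by (rule T_mor_id[OF d[OF C], unfolded Cpx_T_cx X[OF C]])
    fix D assume D: "D \<in> Ch ?A"
    note p = duality_pair.T_mor_chain_map[OF pr[OF C D]] duality_pair.T_mor_add[OF pr[OF C D]]
      duality_pair.tau_hom[OF pr[OF C D]] duality_pair.tau_chain[OF pr[OF C D]] duality_pair.tau_involution[OF pr[OF C D]]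
    note p = p[unfolded Cpx_T_cx X[OF C] X[OF D]]
    show "T_mor P (Cpx E) C D f \<in> chain_maps ?A (T_obj P (Cpx E) D) (T_obj P (Cpx E) C)" if "f \<in> chain_maps ?A C D" for f
      by (rule p(1)[OF that])
    show "T_mor P (Cpx E) C D (f \<otimes>\<^bsub>Hom_gr ?A C D 0\<^esub> g) =
        T_mor P (Cpx E) C D f \<otimes>\<^bsub>Hom_gr ?A (T_obj P (Cpx E) D) (T_obj P (Cpx E) C) 0\<^esub> T_mor P (Cpx E) C D g"
      if "f \<in> chain_maps ?A C D" "g \<in> chain_maps ?A C D" for f g
      by (rule p(2)[OF that])
    show "tau P (Cpx E) C D n \<in> hom (Hom_gr ?A (T_obj P (Cpx E) C) D n) (Hom_gr ?A (T_obj P (Cpx E) D) C n)" for n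
      by (rule p(3))
    show "tau P (Cpx E) C D (n - 1) (Hom_bd ?A (T_obj P (Cpx E) C) D n f) =
        Hom_bd ?A (T_obj P (Cpx E) D) C n (tau P (Cpx E) C D n f)" if "f \<in> carrier (Hom_gr ?A (T_obj P (Cpx E) C) D n)" for f n
      by (rule p(4)[OF that])
    show "tau P (Cpx E) D C n (tau P (Cpx E) C D n f) = f" if "f \<in> carrier (Hom_gr ?A (T_obj P (Cpx E) C) D n)" for f n
      by (rule p(5)[OF that])
    fix D' assume D': "D' \<in> Ch ?A"
    show "T_mor P (Cpx E) C D' (Hom_comp ?A C D D' 0 0 g f) = Hom_comp ?A (T_obj P (Cpx E) D') (T_obj P (Cpx E) D) (T_obj P (Cpx E) C) 0 0
        (T_mor P (Cpx E) C D f) (T_mor P (Cpx E) D D' g)"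
      if "f \<in> chain_maps ?A C D" "g \<in> chain_maps ?A D D'" for f g
      using T_mor_comp[OF d[OF C] d[OF D] d[OF D'], unfolded Cpx_T_cx X[OF C] X[OF D] X[OF D'], OF that] .
    fix C' assume C': "C' \<in> Ch ?A"
    show "tau P (Cpx E) C' D' n (Hom_comp ?A (T_obj P (Cpx E) C') D D' n 0 g
          (Hom_comp ?A (T_obj P (Cpx E) C') (T_obj P (Cpx E) C) D 0 n h (T_mor P (Cpx E) C C' f))) =
        Hom_comp ?A (T_obj P (Cpx E) D') C C' n 0 f
          (Hom_comp ?A (T_obj P (Cpx E) D') (T_obj P (Cpx E) D) C 0 n (tau P (Cpx E) C D n h) (T_mor P (Cpx E) D D' g))"
      if "f \<in> chain_maps ?A C C'" "g \<in> chain_maps ?A D D'" "h \<in> carrier (Hom_gr ?A (T_obj P (Cpx E) C) D n)" for f g h n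
      using tau_natural[OF d[OF C] d[OF C'] d[OF D] d[OF D'], unfolded Cpx_T_cx X[OF C] X[OF C'] X[OF D] X[OF D'], OF that] .
  qed
qed

end

section \<open>Chain dualities\<close>

locale acyclic_frame = duality_frame P E dE + acyclic_intervals P "Idx E" dE raised
  for P :: "'s rel" and E :: "('s, 'e, 's) framed_cx" and dE and raised
begin

text \<open>The matrix of \<open>e\<close> is \<open>tau_mat\<close> of an identity matrix, so \<open>double_dual\<close> provides an inverse and a homotopy as
  matrices, which are lifted to maps. One of the two homotopies is zero, as \<open>e g\<close> equals the identity.\<close>

lemma e_homotopy_equivalence:
  fixes X :: "('s, 'u::infinite, 'v) framed_cx"
  assumes "framed_chain_complex P X dX"
  shows "chain_homotopy_equivalence (based_category P) (Cpx (T_cx P E (T_cx P E X))) (Cpx X)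
    (tau P (Cpx E) (Cpx X) (Cpx (T_cx P E X)) 0 (chain_id (based_category P) (Cpx (T_cx P E X))))"
proof -
  interpret X: framed_chain_complex P X dX by fact
  let ?A = "based_category P :: (('s, 'u) based, ('s \<Rightarrow> 'u) \<Rightarrow> ('s \<Rightarrow> 'u)) category_data"
  let ?T = "T_cx P E X" and ?TT = "T_cx P E (T_cx P E X)"
  interpret D: double_dual P "Idx E" dE raised "Idx X" dX
    by unfold_locales (use X.finite_Ix X.bd_mats X.bd_bd X.Ps_Field in auto)
  interpret T: framed_chain_complex P ?T "bdT (Idx X) dX" by (rule framed_chain_T) unfold_locales
  interpret XT: duality_pair P E dE X dX ?T "bdT (Idx X) dX" by unfold_locales
  interpret XX: framed_chain_pair P ?TT "bdT (Idx ?T) (bdT (Idx X) dX)" ?TT "bdT (Idx ?T) (bdT (Idx X) dX)" by unfold_locales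
  interpret XTT: framed_chain_pair P X dX ?TT "bdT (Idx ?T) (bdT (Idx X) dX)" by unfold_locales
  have hXX: "framed_hom_pair P ?TT ?TT" and hXTT: "framed_hom_pair P X ?TT" and hX: "framed_hom_pair P X X" by unfold_locales
  have I: "Idx ?TT = D.X" "bdT (Idx ?T) (bdT (Idx X) dX) = D.d" by (simp_all add: Idx_T_cx)
  let ?e = "tau P (Cpx E) (Cpx X) (Cpx ?T) 0 (chain_id ?A (Cpx ?T))"
  have e: "represents P ?TT X 0 ?e D.e_mat"
    using XT.tau_represents_XY[OF T.represents_id] by (simp add: D.e_mat_def Idx_T_cx)
  obtain g k where g: "g \<in> mats P (Idx X) D.X 0" and k: "k \<in> mats P D.X D.X 1"
    and g_chain: "mbd (Idx X) D.X 0 dX D.d g = (\<lambda>_ _. 0)" and e_g: "mmul D.X D.e_mat g = mone (Idx X)"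
    and g_e: "mmul (Idx X) g D.e_mat = (\<lambda>a b. mbd D.X D.X 1 D.d D.d k a b + mone D.X a b)"
    using D.e_equivalence by blast
  obtain g' where g': "represents P X ?TT 0 g' g" using framed_hom_pair.represents_lift[OF hXTT, of g 0] g by (auto simp: I)
  obtain k' where k': "represents P ?TT ?TT 1 k' k" using framed_hom_pair.represents_lift[OF hXX, of k 1] k by (auto simp: I)
  show ?thesis
    unfolding chain_homotopy_equivalence_def
  proof (intro conjI bexI[of _ g'])
    show "?e \<in> chain_maps ?A (Cpx ?TT) (Cpx X)"
      using XT.YTX.represents_chain_map[OF e] D.e_chain by (simp only: I)
    show "g' \<in> chain_maps ?A (Cpx X) (Cpx ?TT)"
      using XTT.represents_chain_map[OF g'] g_chain by (simp only: I)
    show "chain_homotopic ?A (Cpx ?TT) (Cpx ?TT) (Hom_comp ?A (Cpx ?TT) (Cpx X) (Cpx ?TT) 0 0 g' ?e) (chain_id ?A (Cpx ?TT))"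
      unfolding chain_homotopic_def
    proof (rule bexI[of _ k'])
      have "represents P ?TT ?TT 0 (Hom_comp ?A (Cpx ?TT) (Cpx X) (Cpx ?TT) 0 0 g' ?e)
          (\<lambda>a b. mbd D.X D.X 1 D.d D.d k a b + mone D.X a b)"
        using represents_comp[OF XT.YTX.framed_complex_pair_axioms framed_hom_pair.axioms[OF hXTT] e g'] unfolding g_e by simp
      moreover have "represents P ?TT ?TT 0 (Hom_bd ?A (Cpx ?TT) (Cpx ?TT) 1 k' \<otimes>\<^bsub>Hom_gr ?A (Cpx ?TT) (Cpx ?TT) 0\<^esub> chain_id ?A (Cpx ?TT))
          (\<lambda>a b. mbd D.X D.X 1 D.d D.d k a b + mone D.X a b)"
        using framed_hom_pair.represents_add[OF hXX _ XT.TY.represents_id] XX.represents_bd[OF k'] by (simp add: I)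
      ultimately show "Hom_comp ?A (Cpx ?TT) (Cpx X) (Cpx ?TT) 0 0 g' ?e =
          Hom_bd ?A (Cpx ?TT) (Cpx ?TT) 1 k' \<otimes>\<^bsub>Hom_gr ?A (Cpx ?TT) (Cpx ?TT) 0\<^esub> chain_id ?A (Cpx ?TT)"
        by (rule framed_hom_pair.represents_eq[OF hXX])
    qed (rule framed_hom_pair.represents_carrier[OF hXX k'])
    show "chain_homotopic ?A (Cpx X) (Cpx X) (Hom_comp ?A (Cpx X) (Cpx ?TT) (Cpx X) 0 0 ?e g') (chain_id ?A (Cpx X))"
      unfolding chain_homotopic_def
    proof (rule bexI[of _ "\<one>\<^bsub>Hom_gr ?A (Cpx X) (Cpx X) 1\<^esub>"])
      interpret X1: framed_chain_pair P X dX X dX by unfold_locales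
      note o = framed_hom_pair.represents_one[OF hX, of 1]
      have comp: "represents P X X 0 (Hom_comp ?A (Cpx X) (Cpx ?TT) (Cpx X) 0 0 ?e g') (mone (Idx X))"
        using represents_comp[OF framed_hom_pair.axioms[OF hXTT] XT.YTX.framed_complex_pair_axioms g' e] unfolding I e_g by simp
      have "represents P X X 0 (Hom_bd ?A (Cpx X) (Cpx X) 1 \<one>\<^bsub>Hom_gr ?A (Cpx X) (Cpx X) 1\<^esub>) (\<lambda>_ _. 0)"
        using X1.represents_bd[OF o] by (simp add: mbd_def mmul_def)
      from framed_hom_pair.represents_add[OF hX this X.represents_id]
      have "represents P X X 0 (Hom_bd ?A (Cpx X) (Cpx X) 1 \<one>\<^bsub>Hom_gr ?A (Cpx X) (Cpx X) 1\<^esub> \<otimes>\<^bsub>Hom_gr ?A (Cpx X) (Cpx X) 0\<^esub> chain_id ?A (Cpx X))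
          (mone (Idx X))"
        by simp
      with comp show "Hom_comp ?A (Cpx X) (Cpx ?TT) (Cpx X) 0 0 ?e g' =
          Hom_bd ?A (Cpx X) (Cpx X) 1 \<one>\<^bsub>Hom_gr ?A (Cpx X) (Cpx X) 1\<^esub> \<otimes>\<^bsub>Hom_gr ?A (Cpx X) (Cpx X) 0\<^esub> chain_id ?A (Cpx X)"
        by (rule framed_hom_pair.represents_eq[OF hX])
      show "\<one>\<^bsub>Hom_gr ?A (Cpx X) (Cpx X) 1\<^esub> \<in> carrier (Hom_gr ?A (Cpx X) (Cpx X) 1)"
        by (rule framed_hom_pair.represents_carrier[OF hX o])
    qed
  qed
qed

theorem T_chain_duality:
  "chain_duality (based_category P :: (('s, 'u::infinite) based, ('s \<Rightarrow> 'u) \<Rightarrow> ('s \<Rightarrow> 'u)) category_data)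
     (T_obj P (Cpx E)) (T_mor P (Cpx E)) (tau P (Cpx E))"
proof (rule chain_duality.intro[OF T_chain_duality_functor], rule chain_duality_axioms.intro)
  let ?A = "based_category P :: (('s, 'u) based, ('s \<Rightarrow> 'u) \<Rightarrow> ('s \<Rightarrow> 'u)) category_data"
  interpret F: chain_duality_functor ?A "T_obj P (Cpx E)" "T_mor P (Cpx E)" "tau P (Cpx E)"
    by (rule T_chain_duality_functor)
  fix C assume "C \<in> Ch ?A"
  from E.Ch_framed[OF this] obtain X :: "('s, 'u, int \<times> 's \<times> nat) framed_cx" and dX
    where C: "Cpx X = C" and X: "framed_chain_complex P X dX" by blast
  show "chain_homotopy_equivalence ?A (T_obj P (Cpx E) (T_obj P (Cpx E) C)) C (F.e C)"
    unfolding F.e_def by (rule e_homotopy_equivalence[OF X, unfolded Cpx_T_cx C])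
qed

end

section \<open>Incidence numbers\<close>

text \<open>The parity of the number of inversions of a list with respect to an auxiliary linear order of the
  vertices, given by an injection \<open>f\<close> into the natural numbers.\<close>

fun order_sign :: "('v \<Rightarrow> nat) \<Rightarrow> 'v list \<Rightarrow> int" where
  "order_sign f [] = 1"
| "order_sign f (x # xs) = (-1) ^ card {y \<in> set xs. f y < f x} * order_sign f xs"

lemma order_sign_square [simp]: "order_sign f xs * order_sign f xs = 1"
  by (induction xs) (simp_all add: mult.assoc mult.left_commute flip: power_add mult_2)

lemma order_sign_swap:
  assumes "f a \<noteq> f b" "a \<notin> set w" "b \<notin> set w"
  shows "order_sign f (u @ a # b # w) = - order_sign f (u @ b # a # w)"
proof (induction u)
  case Nil
  have c: "card {y. (y = c \<or> y \<in> set w) \<and> f y < k} = card {y \<in> set w. f y < k} + of_bool (f c < k)" if "c \<notin> set w" for c k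
  proof -
    have "{y. (y = c \<or> y \<in> set w) \<and> f y < k} = (if f c < k then insert c {y \<in> set w. f y < k} else {y \<in> set w. f y < k})" by auto
    then show ?thesis using that by simp
  qed
  show ?case using assms by (auto simp: c[OF assms(2)] c[OF assms(3)])
next
  case (Cons x u)
  have "set (u @ a # b # w) = set (u @ b # a # w)" by auto
  then show ?case using Cons.IH by (simp only: append_Cons order_sign.simps mult_minus_right)
qed

lemma order_sign_move:
  assumes "\<And>y. y \<in> set v \<Longrightarrow> f y \<noteq> f a" "a \<notin> set w" "set v \<inter> set w = {}" "distinct v"
  shows "order_sign f (u @ a # v @ w) = (-1) ^ length v * order_sign f (u @ v @ a # w)"
  using assms
proof (induction v arbitrary: u)
  case (Cons b v)
  have "order_sign f (u @ a # b # v @ w) = - order_sign f (u @ b # a # v @ w)"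
    using Cons.prems by (intro order_sign_swap) force+
  then show ?case using Cons.IH[of "u @ [b]"] Cons.prems by simp
qed simp

text \<open>Move \<open>x\<close> to the front, where it contributes the number of smaller elements.\<close>

lemma order_sign_delete:
  assumes "distinct (u @ x # w)" "inj_on f (set (u @ x # w))"
  shows "order_sign f (u @ x # w) = (-1) ^ length u * (-1) ^ card {y \<in> set (u @ x # w). f y < f x} * order_sign f (u @ w)"
proof -
  have "order_sign f ([] @ x # u @ w) = (-1) ^ length u * order_sign f ([] @ u @ x # w)"
    by (rule order_sign_move) (use assms in \<open>auto simp: inj_on_def\<close>)
  then have "order_sign f (u @ x # w) = (-1) ^ length u * order_sign f (x # u @ w)"
    by (simp flip: power_add mult_2)
  moreover have "{y \<in> set (u @ x # w). f y < f x} = {y \<in> set (u @ w). f y < f x}" by auto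
  ultimately show ?thesis by (simp add: mult.assoc)
qed

text \<open>Moving the first element next to the second, exchanging the two and moving back gives an odd number
  of adjacent exchanges.\<close>

lemma order_sign_transpose:
  assumes "distinct xs" "inj_on f (set xs)" "a \<in> set xs" "b \<in> set xs" "a \<noteq> b"
  shows "order_sign f (map (transpose a b) xs) = - order_sign f xs"
proof -
  have main: "order_sign f (map (transpose a b) (u @ a # v @ b # w)) = - order_sign f (u @ a # v @ b # w)"
    if d: "distinct (u @ a # v @ b # w)" and i: "inj_on f (set (u @ a # v @ b # w))" for a b u v w
  proof -
    have m: "map (transpose a b) zs = zs" if "a \<notin> set zs" "b \<notin> set zs" for zs
      by (rule map_idI) (use that in \<open>metis transpose_apply_other\<close>)
    have "map (transpose a b) (u @ a # v @ b # w) = u @ b # v @ a # w" using d by (auto simp: m)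
    moreover have "order_sign f (u @ a # v @ b # w) = (-1) ^ length v * order_sign f (u @ v @ a # b # w)"
      using order_sign_move[of v f a "b # w" u] d i by (auto simp: inj_on_def)
    moreover have "order_sign f (u @ b # v @ a # w) = (-1) ^ length v * order_sign f (u @ v @ b # a # w)"
      using order_sign_move[of v f b "a # w" u] d i by (auto simp: inj_on_def)
    moreover have "order_sign f ((u @ v) @ a # b # w) = - order_sign f ((u @ v) @ b # a # w)"
      by (rule order_sign_swap) (use d i in \<open>auto simp: inj_on_def\<close>)
    ultimately show ?thesis by simp
  qed
  obtain u r where xs: "xs = u @ a # r" using assms(3) by (meson split_list)
  show ?thesis
  proof (cases "b \<in> set r")
    case True
    then obtain v w where "r = v @ b # w" by (meson split_list)
    then show ?thesis using main[of u a v b w] assms by (simp add: xs)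
  next
    case False
    then have "b \<in> set u" using assms by (auto simp: xs)
    then obtain v w where "u = v @ b # w" by (meson split_list)
    then show ?thesis using main[of v b w a r] assms by (simp add: xs transpose_commute)
  qed
qed

lemma sign_eq_order_sign:
  assumes "p permutes set xs" "distinct xs" "inj_on f (set xs)"
  shows "sign p = order_sign f xs * order_sign f (map p xs)"
proof -
  have "sign p * order_sign f xs = order_sign f (map p xs)" using assms(1) finite_set
  proof (induction p rule: permutes_induct)
    case id
    then show ?case by simp
  next
    case (swap a b p)
    have "order_sign f (map (transpose a b \<circ> p) xs) = - order_sign f (map p xs)"
    proof -
      have s: "set (map p xs) = set xs" using permutes_image[OF swap.hyps(4)] by simp
      have d: "distinct (map p xs)" using assms(2) permutes_inj_on[OF swap.hyps(4)] by (simp add: distinct_map)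
      show ?thesis
        using order_sign_transpose[OF d, unfolded s, OF assms(3) swap.hyps(1,2,3)] by simp
    qed
    moreover have "sign (transpose a b \<circ> p) = - sign p"
      using sign_compose[OF permutation_swap_id permutes_imp_permutation[OF finite_set swap.hyps(4)]] swap.hyps(3)
      by (simp add: sign_swap_id)
    ultimately show ?case using swap.IH by (simp only: mult_minus_left)
  qed
  then show ?thesis by (metis mult.commute mult.left_commute mult.right_neutral order_sign_square)
qed

text \<open>Permutations are products of transpositions, each of which changes both \<open>sign\<close> and \<open>order_sign\<close>. Hence
  orientations can be compared through the order given by \<open>f\<close>, without reference to permutations.\<close>

lemma list_sign_eq:
  assumes "distinct xs" "distinct ys" "set xs = set ys" "inj_on f (set xs)"
  shows "list_sign xs ys = order_sign f xs * order_sign f ys"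
proof -
  have n: "length xs = length ys" using assms by (metis distinct_card)
  have bx: "bij_betw ((!) xs) {..<length xs} (set xs)" and b: "bij_betw ((!) ys) {..<length xs} (set xs)"
    using bij_betw_nth[OF assms(1) refl refl] bij_betw_nth[OF assms(2) refl refl] by (simp_all add: assms(3) n)
  define p where "p = (\<lambda>x. if x \<in> set xs then ys ! inv_into {..<length xs} ((!) xs) x else x)"
  have "bij_betw ((!) ys \<circ> inv_into {..<length xs} ((!) xs)) (set xs) (set xs)"
    by (rule bij_betw_trans[OF bij_betw_inv_into[OF bx] b])
  then have "bij_betw p (set xs) (set xs)"
    by (rule iffD1[OF bij_betw_cong, rotated]) (simp add: p_def)
  then have p: "p permutes set xs" by (rule bij_imp_permutes) (simp add: p_def)
  have pxs: "map p xs = ys"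
    by (rule nth_equalityI) (use n bx in \<open>simp_all add: p_def bij_betw_inv_into_left\<close>)
  have "(THE p. p permutes set xs \<and> map p xs = ys) = p"
  proof (rule the_equality)
    fix q assume q: "q permutes set xs \<and> map q xs = ys"
    show "q = p"
    proof
      fix x show "q x = p x"
      proof (cases "x \<in> set xs")
        case True
        then show ?thesis using q pxs by (metis map_eq_conv)
      next
        case False
        then show ?thesis using p q by (metis permutes_not_in)
      qed
    qed
  qed (use p pxs in simp)
  then show ?thesis using sign_eq_order_sign[OF p assms(1,4)] by (simp add: list_sign_def pxs)
qed

locale oriented_complex =
  fixes K :: "'v set set" and orient :: "'v set \<Rightarrow> 'v list" and f :: "'v \<Rightarrow> nat"
  assumes complex: "finite_simplicial_complex K" and orient: "orientation K orient" and inj: "inj_on f (\<Union>K)"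
begin

lemma simplex: "\<sigma> \<in> K \<Longrightarrow> finite \<sigma>" "\<sigma> \<in> K \<Longrightarrow> \<sigma> \<noteq> {}" "finite K"
  "\<lbrakk>\<sigma> \<in> K; \<rho> \<subseteq> \<sigma>; \<rho> \<noteq> {}\<rbrakk> \<Longrightarrow> \<rho> \<in> K"
  using complex unfolding finite_simplicial_complex_def by blast+

lemma ordering: "\<sigma> \<in> K \<Longrightarrow> distinct (orient \<sigma>)" "\<sigma> \<in> K \<Longrightarrow> set (orient \<sigma>) = \<sigma>"
  using orient by (simp_all add: orientation_def)

lemma inj_simplex: "\<sigma> \<in> K \<Longrightarrow> inj_on f \<sigma>"
  using inj by (rule inj_on_subset) auto

abbreviation osign where "osign \<sigma> \<equiv> order_sign f (orient \<sigma>)"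
abbreviation before where "before \<sigma> x \<equiv> card {y \<in> \<sigma>. f y < f x}"

lemma set_face:
  assumes "\<sigma> \<in> K" "i < length (orient \<sigma>)"
  shows "set (take i (orient \<sigma>) @ drop (Suc i) (orient \<sigma>)) = \<sigma> - {orient \<sigma> ! i}"
proof -
  have "set (take i (orient \<sigma>) @ orient \<sigma> ! i # drop (Suc i) (orient \<sigma>)) = \<sigma>"
    and "distinct (take i (orient \<sigma>) @ orient \<sigma> ! i # drop (Suc i) (orient \<sigma>))"
    unfolding id_take_nth_drop[OF assms(2), symmetric] using ordering[OF assms(1)] by simp_all
  then show ?thesis by auto
qed

text \<open>The sign of deleting the vertex at place \<open>i\<close> and the sign \<open>(-1) ^ i\<close> combine to a sign that depends only on the number of
  smaller vertices. So the incidence numbers for arbitrary orientations differ from those for the ordered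
  simplices by the signs \<open>osign\<close> of the two simplices.\<close>

lemma incidence_facet:
  assumes \<sigma>: "\<sigma> \<in> K" and x: "x \<in> \<sigma>" and \<rho>: "\<sigma> - {x} \<in> K"
  shows "incidence orient \<sigma> (\<sigma> - {x}) = osign \<sigma> * osign (\<sigma> - {x}) * (-1) ^ before \<sigma> x"
proof -
  obtain u w where s: "orient \<sigma> = u @ x # w" using x ordering(2)[OF \<sigma>] by (metis split_list)
  have d: "distinct (u @ x # w)" and su: "set (u @ x # w) = \<sigma>" using ordering[OF \<sigma>] s by simp_all
  have uw: "set (u @ w) = \<sigma> - {x}" "distinct (u @ w)" using d su by auto
  let ?t = "\<lambda>i. let face = take i (orient \<sigma>) @ drop (Suc i) (orient \<sigma>)
        in if set face = \<sigma> - {x} then (-1) ^ i * list_sign (orient (\<sigma> - {x})) face else 0"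
  have "?t i = 0" if "i \<in> {..<length (orient \<sigma>)} - {length u}" for i
  proof -
    have i: "i < length (orient \<sigma>)" "i \<noteq> length u" using that by auto
    have "orient \<sigma> ! length u = x" by (simp add: s)
    then have "orient \<sigma> ! i \<noteq> x"
      using nth_eq_iff_index_eq[OF ordering(1)[OF \<sigma>] i(1), of "length u"] i(2) by (simp add: s)
    moreover have "orient \<sigma> ! i \<in> \<sigma>" using nth_mem[OF i(1)] ordering(2)[OF \<sigma>] by simp
    ultimately show ?thesis using set_face[OF \<sigma> i(1)] x by (auto simp: Let_def)
  qed
  then have "incidence orient \<sigma> (\<sigma> - {x}) = (\<Sum>i\<in>{length u}. ?t i)"
    unfolding incidence_def by (intro sum.mono_neutral_right) (auto simp: s)
  also have "\<dots> = (-1) ^ length u * list_sign (orient (\<sigma> - {x})) (u @ w)"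
    using uw by (simp add: s Let_def)
  also have "list_sign (orient (\<sigma> - {x})) (u @ w) = osign (\<sigma> - {x}) * order_sign f (u @ w)"
    by (rule list_sign_eq) (use ordering[OF \<rho>] uw inj_simplex[OF \<rho>] in simp_all)
  also have "order_sign f (u @ w) = (-1) ^ length u * (-1) ^ before \<sigma> x * osign \<sigma>"
  proof -
    have "osign \<sigma> = (-1) ^ length u * (-1) ^ before \<sigma> x * order_sign f (u @ w)"
      using order_sign_delete[OF d, of f] inj_simplex[OF \<sigma>] unfolding su s by blast
    then show ?thesis by (simp flip: power_add mult_2)
  qed
  finally show ?thesis by (simp add: mult_ac)
qed

lemma incidence_nonfacet:
  assumes "\<sigma> \<in> K" "\<nexists>x. x \<in> \<sigma> \<and> \<rho> = \<sigma> - {x}"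
  shows "incidence orient \<sigma> \<rho> = 0"
  unfolding incidence_def
proof (rule sum.neutral, rule ballI)
  fix i assume "i \<in> {..<length (orient \<sigma>)}"
  then have i: "i < length (orient \<sigma>)" by simp
  have "orient \<sigma> ! i \<in> \<sigma>" using nth_mem[OF i] ordering(2)[OF assms(1)] by simp
  then show "(let face = take i (orient \<sigma>) @ drop (Suc i) (orient \<sigma>)
        in if set face = \<rho> then (-1) ^ i * list_sign (orient \<rho>) face else 0) = 0"
    using set_face[OF assms(1) i] assms(2) by (auto simp: Let_def)
qed

text \<open>Set to zero outside \<open>K\<close>, where \<open>orient\<close> is arbitrary.\<close>

definition inc :: "'v set \<Rightarrow> 'v set \<Rightarrow> int" where
  "inc \<sigma> \<rho> = (if \<sigma> \<in> K \<and> \<rho> \<in> K then incidence orient \<sigma> \<rho> else 0)"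

lemma inc_facet: "\<lbrakk>\<sigma> \<in> K; x \<in> \<sigma>; \<sigma> - {x} \<in> K\<rbrakk> \<Longrightarrow> inc \<sigma> (\<sigma> - {x}) = osign \<sigma> * osign (\<sigma> - {x}) * (-1) ^ before \<sigma> x"
  by (simp add: inc_def incidence_facet)

lemma inc_nonzero:
  assumes "inc \<sigma> \<rho> \<noteq> 0"
  obtains x where "\<sigma> \<in> K" "\<rho> \<in> K" "x \<in> \<sigma>" "\<rho> = \<sigma> - {x}" "int (card \<rho>) = int (card \<sigma>) - 1"
proof -
  have K: "\<sigma> \<in> K" "\<rho> \<in> K" using assms by (auto simp: inc_def split: if_splits)
  then have "incidence orient \<sigma> \<rho> \<noteq> 0" using assms by (simp add: inc_def)
  then obtain x where x: "x \<in> \<sigma>" "\<rho> = \<sigma> - {x}" using incidence_nonfacet[OF K(1), of \<rho>] by blast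
  have "card \<sigma> > 0" using simplex(1,2)[OF K(1)] by (simp add: card_gt_0_iff)
  then show ?thesis using x K that by (simp add: card_Diff_singleton of_nat_diff)
qed

lemma before_delete:
  assumes "\<sigma> \<in> K" "x \<in> \<sigma>"
  shows "before \<sigma> y = before (\<sigma> - {x}) y + of_bool (f x < f y)"
proof -
  have "{z \<in> \<sigma>. f z < f y} = (if f x < f y then insert x {z \<in> \<sigma> - {x}. f z < f y} else {z \<in> \<sigma> - {x}. f z < f y})"
    using assms(2) by auto
  then show ?thesis using simplex(1)[OF assms(1)] by simp
qed

text \<open>The two ways of removing \<open>x\<close> and \<open>y\<close> from \<open>\<sigma>\<close> have opposite signs, because removing the smaller vertex first
  decreases the number of predecessors of the larger one.\<close>

lemma inc_inc: "(\<Sum>\<tau>\<in>K. inc \<sigma> \<tau> * inc \<tau> \<rho>) = 0"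
proof (cases "\<exists>\<tau>. inc \<sigma> \<tau> * inc \<tau> \<rho> \<noteq> 0")
  case True
  then obtain \<tau> where "inc \<sigma> \<tau> \<noteq> 0" "inc \<tau> \<rho> \<noteq> 0" by (metis mult_eq_0_iff)
  obtain x where \<sigma>: "\<sigma> \<in> K" and x: "x \<in> \<sigma>" "\<tau> = \<sigma> - {x}" using \<open>inc \<sigma> \<tau> \<noteq> 0\<close> by (rule inc_nonzero)
  obtain y where \<rho>: "\<rho> \<in> K" and y: "y \<in> \<tau>" "\<rho> = \<tau> - {y}" using \<open>inc \<tau> \<rho> \<noteq> 0\<close> by (rule inc_nonzero)
  have xy: "x \<noteq> y" and r: "\<rho> = \<sigma> - {x} - {y}" and y: "y \<in> \<sigma>" using x y by auto
  note x = x(1)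
  have x': "\<sigma> - {x} \<in> K" by (rule simplex(4)[OF \<sigma>]) (use y xy in auto)
  have y': "\<sigma> - {y} \<in> K" by (rule simplex(4)[OF \<sigma>]) (use x xy in auto)
  have r': "\<rho> = \<sigma> - {y} - {x}" using r by auto
  have "(\<Sum>\<tau>\<in>K. inc \<sigma> \<tau> * inc \<tau> \<rho>) = (\<Sum>\<tau>\<in>{\<sigma> - {x}, \<sigma> - {y}}. inc \<sigma> \<tau> * inc \<tau> \<rho>)"
  proof (rule sum.mono_neutral_right[OF simplex(3)])
    show "\<forall>\<tau>\<in>K - {\<sigma> - {x}, \<sigma> - {y}}. inc \<sigma> \<tau> * inc \<tau> \<rho> = 0"
    proof (rule ballI, rule ccontr)
      fix \<tau> assume \<tau>: "\<tau> \<in> K - {\<sigma> - {x}, \<sigma> - {y}}" and "inc \<sigma> \<tau> * inc \<tau> \<rho> \<noteq> 0"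
      then have n: "inc \<sigma> \<tau> \<noteq> 0" "inc \<tau> \<rho> \<noteq> 0" by simp_all
      obtain a where a: "a \<in> \<sigma>" "\<tau> = \<sigma> - {a}" using n(1) by (rule inc_nonzero)
      obtain b where "\<rho> = \<tau> - {b}" using n(2) by (rule inc_nonzero)
      with a have "a \<notin> \<rho>" by auto
      then have "a = x \<or> a = y" using a(1) r by auto
      then show False using \<tau> a(2) by auto
    qed
  qed (use x' y' in auto)
  also have "\<dots> = inc \<sigma> (\<sigma> - {x}) * inc (\<sigma> - {x}) \<rho> + inc \<sigma> (\<sigma> - {y}) * inc (\<sigma> - {y}) \<rho>"
    using x y xy by (subst sum.insert) auto
  also have "\<dots> = osign \<sigma> * osign \<rho> * ((-1) ^ (before \<sigma> x + before (\<sigma> - {x}) y) + (-1) ^ (before \<sigma> y + before (\<sigma> - {y}) x))"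
  proof -
    have 1: "inc (\<sigma> - {x}) \<rho> = osign (\<sigma> - {x}) * osign \<rho> * (-1) ^ before (\<sigma> - {x}) y"
      unfolding r by (rule inc_facet[OF x']) (use y xy \<rho> r in auto)
    have 2: "inc (\<sigma> - {y}) \<rho> = osign (\<sigma> - {y}) * osign \<rho> * (-1) ^ before (\<sigma> - {y}) x"
      unfolding r' by (rule inc_facet[OF y']) (use x xy \<rho> r' in auto)
    have c: "(a * t * p) * (t * b * q) = a * b * (p * q)" if "t * t = 1" for a b t p q :: int
    proof -
      have "(a * t * p) * (t * b * q) = t * t * (a * b * (p * q))" by (simp only: mult_ac)
      then show ?thesis by (simp only: that mult_1)
    qed
    show ?thesis
      unfolding inc_facet[OF \<sigma> x x'] inc_facet[OF \<sigma> y y'] 1 2 c[OF order_sign_square] power_add distrib_left ..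
  qed
  also have "(-1) ^ (before \<sigma> x + before (\<sigma> - {x}) y) + (-1) ^ (before \<sigma> y + before (\<sigma> - {y}) x) = (0::int)"
  proof -
    have "f x \<noteq> f y" using inj_onD[OF inj_simplex[OF \<sigma>] _ x y] xy by blast
    then show ?thesis
      using before_delete[OF \<sigma> x, of y] before_delete[OF \<sigma> y, of x] by (cases "f x < f y") (auto simp: power_add)
  qed
  finally show ?thesis by simp
next
  case False
  then show ?thesis by (intro sum.neutral) blast
qed

end

text \<open>A signed permutation matrix is orthogonal.\<close>

lemma matching_orthogonal:
  fixes d :: "'a \<Rightarrow> 'b \<Rightarrow> int"
  assumes fin: "finite L" "finite R" and b: "bij_betw \<phi> L R"
    and d: "\<And>y z. \<lbrakk>y \<in> L; z \<in> R\<rbrakk> \<Longrightarrow> d y z = (if z = \<phi> y then \<epsilon> y else 0)" and \<epsilon>: "\<And>y. y \<in> L \<Longrightarrow> \<epsilon> y * \<epsilon> y = 1"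
  shows "\<lbrakk>y \<in> L; y' \<in> L\<rbrakk> \<Longrightarrow> (\<Sum>z\<in>R. d y z * d y' z) = of_bool (y = y')"
    and "\<lbrakk>z \<in> R; z' \<in> R\<rbrakk> \<Longrightarrow> (\<Sum>y\<in>L. d y z * d y z') = of_bool (z = z')"
proof -
  assume y: "y \<in> L" "y' \<in> L"
  have "(\<Sum>z\<in>R. d y z * d y' z) = (\<Sum>z\<in>R. if z = \<phi> y then of_bool (y = y') else 0)"
  proof (rule sum.cong[OF refl])
    fix z assume "z \<in> R"
    moreover have "\<phi> y = \<phi> y' \<longleftrightarrow> y = y'" using b y by (auto simp: bij_betw_def inj_on_def)
    ultimately show "d y z * d y' z = (if z = \<phi> y then of_bool (y = y') else 0)" using y by (auto simp: d \<epsilon>)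
  qed
  then show "(\<Sum>z\<in>R. d y z * d y' z) = of_bool (y = y')" using fin(2) bij_betwE[OF b] y by simp
next
  assume z: "z \<in> R" "z' \<in> R"
  then obtain y0 where y0: "y0 \<in> L" "z = \<phi> y0" using b by (auto simp: bij_betw_def)
  have "(\<Sum>y\<in>L. d y z * d y z') = (\<Sum>y\<in>L. if y = y0 then of_bool (z = z') else 0)"
  proof (rule sum.cong[OF refl])
    fix y assume y: "y \<in> L"
    have "\<phi> y = \<phi> y0 \<longleftrightarrow> y = y0" using b y y0 by (auto simp: bij_betw_def inj_on_def)
    then show "d y z * d y z' = (if y = y0 then of_bool (z = z') else 0)" using y y0 z by (auto simp: d \<epsilon>)
  qed
  then show "(\<Sum>y\<in>L. d y z * d y z') = of_bool (z = z')" using fin(1) y0 by simp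
qed

section \<open>The simplicial chain complex\<close>

definition simplicial_cx :: "'v set set \<Rightarrow> ('v set \<Rightarrow> 'v list) \<Rightarrow> ('v set, int, 'v set) framed_cx" where
  "simplicial_cx K orient = \<lparr>Cpx = simplicial_chains K orient,
     Idx = \<lparr>Ix = K, Dg = (\<lambda>\<sigma>. int (card \<sigma>) - 1), Ps = (\<lambda>\<sigma>. \<sigma>)\<rparr>,
     Crd = (\<lambda>n \<sigma> x w. if w = \<sigma> \<and> n = int (card \<sigma>) - 1 then x else 0)\<rparr>"

lemma face_poset_Field: "Field (face_poset K) = K"
  by (auto simp: Field_def face_poset_def)

context oriented_complex
begin

lemma finite_face_poset: "finite_poset (face_poset K)"
  by unfold_locales (auto simp: face_poset_Field simplex(3), auto simp: face_poset_def)

abbreviation S where "S \<equiv> simplicial_cx K orient"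

lemma S_simps [simp]: "Cpx S = simplicial_chains K orient" "Ix (Idx S) = K" "Dg (Idx S) \<sigma> = int (card \<sigma>) - 1" "Ps (Idx S) = (\<lambda>\<sigma>. \<sigma>)"
  by (simp_all add: simplicial_cx_def)

lemma framed_S: "framed_complex (face_poset K) S"
proof -
  interpret finite_poset "face_poset K" by (rule finite_face_poset)
  show ?thesis
  proof unfold_locales
    fix \<sigma> n assume "\<sigma> \<in> Field (face_poset K)"
    then have s: "{w \<in> at_deg (Idx S) n. Ps (Idx S) w = \<sigma>} = (if n = int (card \<sigma>) - 1 then {\<sigma>} else {})"
      by (auto simp: at_deg_def face_poset_Field)
    show "framed (Gr (Cpx S) n \<sigma>) {w \<in> at_deg (Idx S) n. Ps (Idx S) w = \<sigma>} (Crd S n \<sigma>)"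
      unfolding s
    proof (rule framedI[where c = "\<lambda>_. 1"])
      show "comm_group (Gr (Cpx S) n \<sigma>)"
        by (simp add: simplicial_chains_def simplicial_gr_def abelian_integer_group)
    qed (auto simp: simplicial_chains_def simplicial_gr_def simplicial_cx_def singleton_group_def split: if_splits)
  qed (auto simp: face_poset_Field simplex(3))
qed

lemma bd_S: "bd_matrix (face_poset K) S inc"
proof -
  interpret S: framed_complex "face_poset K" S by (rule framed_S)
  show ?thesis
    unfolding bd_matrix_def has_matrix_def
  proof (intro allI conjI ballI)
    fix n
    have car: "x \<in> carrier (ctot (face_poset K) S m) \<longleftrightarrow> x \<in> extensional K \<and> (\<forall>\<sigma>\<in>K. m \<noteq> int (card \<sigma>) - 1 \<longrightarrow> x \<sigma> = 0)" for x m
      unfolding S.deg.carrier_total by (auto simp: face_poset_Field simplicial_chains_def simplicial_gr_def PiE_iff split: if_splits)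
    have bd: "Bd (Cpx S) n x = (\<lambda>\<rho>\<in>K. \<Sum>\<sigma>\<in>K. x \<sigma> * inc \<sigma> \<rho>)" if "x \<in> carrier (ctot (face_poset K) S n)" for x
      using that by (auto simp: simplicial_chains_def inc_def intro!: restrict_ext sum.cong)
    show "Bd (Cpx S) n \<in> carrier (ctot (face_poset K) S n) \<rightarrow> carrier (ctot (face_poset K) S (n - 1))"
    proof
      fix x assume x: "x \<in> carrier (ctot (face_poset K) S n)"
      have "(\<Sum>\<sigma>\<in>K. x \<sigma> * inc \<sigma> \<rho>) = 0" if "\<rho> \<in> K" "n - 1 \<noteq> int (card \<rho>) - 1" for \<rho>
      proof (rule sum.neutral, rule ballI)
        fix \<sigma> assume \<sigma>: "\<sigma> \<in> K"
        show "x \<sigma> * inc \<sigma> \<rho> = 0"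
        proof (cases "inc \<sigma> \<rho> = 0")
          case False
          then have "n \<noteq> int (card \<sigma>) - 1" using that(2) by (elim inc_nonzero) simp
          then show ?thesis using x \<sigma> car by simp
        qed simp
      qed
      then show "Bd (Cpx S) n x \<in> carrier (ctot (face_poset K) S (n - 1))"
        unfolding car bd[OF x] by simp
    qed
    show "Bd (Cpx S) n \<in> extensional (carrier (ctot (face_poset K) S n))" by (simp add: simplicial_chains_def)
    fix x \<rho> assume x: "x \<in> carrier (ctot (face_poset K) S n)" and \<rho>: "\<rho> \<in> at_deg (Idx S) (n - 1)"
    have c: "crd S m y \<sigma> = y \<sigma>" if "\<sigma> \<in> at_deg (Idx S) m" for m \<sigma> and y :: "'v set \<Rightarrow> int"
      using that by (auto simp: sum_coord_def at_deg_def) (simp add: simplicial_cx_def)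
    have "crd S (n - 1) (Bd (Cpx S) n x) \<rho> = (\<Sum>\<sigma>\<in>K. x \<sigma> * inc \<sigma> \<rho>)"
      unfolding c[OF \<rho>] bd[OF x] using \<rho> by (simp add: at_deg_def)
    also have "\<dots> = (\<Sum>\<sigma>\<in>at_deg (Idx S) n. x \<sigma> * inc \<sigma> \<rho>)"
      by (rule sum.mono_neutral_right[OF simplex(3)]) (use x car in \<open>auto simp: at_deg_def\<close>)
    also have "\<dots> = (\<Sum>\<sigma>\<in>at_deg (Idx S) n. crd S n x \<sigma> * inc \<sigma> \<rho>)" by (rule sum.cong[OF refl]) (simp only: c)
    finally show "crd S (n - 1) (Bd (Cpx S) n x) \<rho> = (\<Sum>\<sigma>\<in>at_deg (Idx S) n. crd S n x \<sigma> * inc \<sigma> \<rho>)" .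
  qed
qed

text \<open>The vertex along which the interval from \<open>\<rho>\<close> to \<open>\<sigma>\<close> is collapsed.\<close>

definition apex :: "'v set \<Rightarrow> 'v set \<Rightarrow> 'v" where
  "apex \<rho> \<sigma> = (SOME v. v \<in> \<sigma> - \<rho>)"

lemma apex: "\<rho> \<subset> \<sigma> \<Longrightarrow> apex \<rho> \<sigma> \<in> \<sigma> - \<rho>"
  unfolding apex_def by (rule someI_ex) auto

text \<open>Removing \<open>v\<close> is a bijection from the simplices with \<open>v\<close> to those without; it stays in the interval because
  \<open>v\<close> does not belong to \<open>\<rho>\<close>, and its inverse does because \<open>v\<close> belongs to \<open>\<sigma>\<close>. A facet of \<open>\<tau>\<close> without \<open>v\<close> can only
  be the one opposite to \<open>v\<close>, so the block of the boundary is a signed permutation matrix.\<close>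

lemma interval_matching:
  assumes \<sigma>: "\<sigma> \<in> K" and \<rho>: "\<rho> \<in> K" and v: "v \<in> \<sigma> - \<rho>"
  defines "U \<equiv> {\<tau> \<in> K. \<rho> \<subseteq> \<tau> \<and> \<tau> \<subseteq> \<sigma> \<and> v \<in> \<tau>}" and "L \<equiv> {\<tau> \<in> K. \<rho> \<subseteq> \<tau> \<and> \<tau> \<subseteq> \<sigma> \<and> v \<notin> \<tau>}"
  shows "\<lbrakk>\<tau> \<in> U; \<tau>' \<in> U\<rbrakk> \<Longrightarrow> (\<Sum>\<kappa>\<in>L. inc \<tau> \<kappa> * inc \<tau>' \<kappa>) = of_bool (\<tau> = \<tau>')"
    and "\<lbrakk>\<kappa> \<in> L; \<kappa>' \<in> L\<rbrakk> \<Longrightarrow> (\<Sum>\<tau>\<in>U. inc \<tau> \<kappa> * inc \<tau> \<kappa>') = of_bool (\<kappa> = \<kappa>')"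
proof -
  have fin: "finite U" "finite L" using simplex(3) by (auto simp: U_def L_def)
  have ne: "\<rho> \<noteq> {}" by (rule simplex(2)[OF \<rho>])
  have del: "\<tau> - {v} \<in> L" if "\<tau> \<in> U" for \<tau>
  proof -
    have "\<rho> \<subseteq> \<tau> - {v}" using that v by (auto simp: U_def)
    then have "\<tau> - {v} \<in> K" using simplex(4)[of \<tau> "\<tau> - {v}"] that ne by (auto simp: U_def)
    then show ?thesis using that v by (auto simp: U_def L_def)
  qed
  have b: "bij_betw (\<lambda>\<tau>. \<tau> - {v}) U L"
  proof (rule bij_betw_byWitness[where f' = "insert v"])
    show "insert v ` L \<subseteq> U"
    proof
      fix \<tau> assume "\<tau> \<in> insert v ` L"
      then obtain \<kappa> where \<kappa>: "\<kappa> \<in> L" "\<tau> = insert v \<kappa>" by auto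
      then have "insert v \<kappa> \<in> K" using simplex(4)[OF \<sigma>, of "insert v \<kappa>"] v by (auto simp: L_def)
      then show "\<tau> \<in> U" using \<kappa> v by (auto simp: U_def L_def)
    qed
  qed (use del in \<open>auto simp: U_def L_def\<close>)
  let ?e = "\<lambda>\<tau>. inc \<tau> (\<tau> - {v})"
  have d: "inc \<tau> \<kappa> = (if \<kappa> = \<tau> - {v} then ?e \<tau> else 0)" if "\<tau> \<in> U" "\<kappa> \<in> L" for \<tau> \<kappa>
  proof (cases "inc \<tau> \<kappa> = 0")
    case False
    then obtain x where "\<kappa> = \<tau> - {x}" by (rule inc_nonzero)
    moreover have "v \<in> \<tau>" "v \<notin> \<kappa>" using that by (auto simp: U_def L_def)
    ultimately show ?thesis by auto
  qed auto
  have e: "?e \<tau> * ?e \<tau> = 1" if "\<tau> \<in> U" for \<tau>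
  proof -
    have 1: "\<tau> \<in> K" "v \<in> \<tau>" "\<tau> - {v} \<in> K" using that del[OF that] by (auto simp: U_def L_def)
    have c: "(a * b * p) * (a * b * p) = (a * a) * (b * b) * (p * p)" for a b p :: int by (simp only: mult_ac)
    show ?thesis unfolding inc_facet[OF 1] c order_sign_square by (simp flip: power_add mult_2)
  qed
  show "(\<Sum>\<kappa>\<in>L. inc \<tau> \<kappa> * inc \<tau>' \<kappa>) = of_bool (\<tau> = \<tau>')" if "\<tau> \<in> U" "\<tau>' \<in> U"
    by (rule matching_orthogonal(1)[OF fin b d e that])
  show "(\<Sum>\<tau>\<in>U. inc \<tau> \<kappa> * inc \<tau> \<kappa>') = of_bool (\<kappa> = \<kappa>')" if "\<kappa> \<in> L" "\<kappa>' \<in> L"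
    by (rule matching_orthogonal(2)[OF fin b d e that])
qed

lemma face_poset_iff: "(\<rho>, \<sigma>) \<in> face_poset K \<longleftrightarrow> \<rho> \<in> K \<and> \<sigma> \<in> K \<and> \<rho> \<subseteq> \<sigma>"
  by (simp add: face_poset_def)

text \<open>The boundary map removes vertices, so the low elements are those that contain the chosen vertex.\<close>

lemma acyclic_chains:
  "acyclic_frame ((face_poset K)\<inverse>) S inc (\<lambda>\<sigma> \<rho> \<tau>. apex \<rho> \<sigma> \<notin> \<tau>)"
proof -
  let ?P = "(face_poset K)\<inverse>"
  interpret S: framed_complex ?P S by (rule framed_complex.framed_converse[OF framed_S])
  have m: "inc \<in> mats (?P\<inverse>) (Idx S) (Idx S) (-1)"
    by (rule matsI) (auto simp: face_poset_iff elim!: inc_nonzero)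
  have d: "bd_matrix ?P S inc" using bd_S by (simp add: bd_matrix_def)
  show ?thesis
  proof unfold_locales
    show "trans ?P" by (rule S.trans_P)
    show "antisym ?P" by (rule antisymI) (rule S.poset_antisym)
    show "inc \<in> mats (?P\<inverse>) (Idx S) (Idx S) (-1)" by (rule m)
    show "mmul (Idx S) inc inc = (\<lambda>_ _. 0)" by (simp add: mmul_def inc_inc)
    show "bd_matrix ?P S inc" by (rule d)
    fix \<sigma> \<rho> assume r: "(\<sigma>, \<rho>) \<in> ?P" "\<sigma> \<noteq> \<rho>"
    then have K: "\<sigma> \<in> K" "\<rho> \<in> K" "apex \<rho> \<sigma> \<in> \<sigma> - \<rho>" using apex[of \<rho> \<sigma>] by (auto simp: face_poset_iff)
    note im = interval_matching[OF K]
    show "(\<Sum>\<kappa>\<in>{\<kappa> \<in> Field ?P. (\<sigma>, \<kappa>) \<in> ?P \<and> (\<kappa>, \<rho>) \<in> ?P \<and> apex \<rho> \<sigma> \<notin> \<kappa>}. inc \<tau> \<kappa> * inc \<tau>' \<kappa>) = of_bool (\<tau> = \<tau>')"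
      if "(\<sigma>, \<tau>) \<in> ?P" "(\<tau>, \<rho>) \<in> ?P" "(\<sigma>, \<tau>') \<in> ?P" "(\<tau>', \<rho>) \<in> ?P" "\<not> apex \<rho> \<sigma> \<notin> \<tau>" "\<not> apex \<rho> \<sigma> \<notin> \<tau>'" for \<tau> \<tau>'
    proof -
      have "{\<kappa> \<in> Field ?P. (\<sigma>, \<kappa>) \<in> ?P \<and> (\<kappa>, \<rho>) \<in> ?P \<and> apex \<rho> \<sigma> \<notin> \<kappa>} = {\<kappa> \<in> K. \<rho> \<subseteq> \<kappa> \<and> \<kappa> \<subseteq> \<sigma> \<and> apex \<rho> \<sigma> \<notin> \<kappa>}"
        using K by (auto simp: face_poset_iff face_poset_Field)
      then show ?thesis using im(1)[of \<tau> \<tau>'] that by (simp add: face_poset_iff)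
    qed
    show "(\<Sum>\<tau>\<in>{\<tau> \<in> Field ?P. (\<sigma>, \<tau>) \<in> ?P \<and> (\<tau>, \<rho>) \<in> ?P \<and> \<not> apex \<rho> \<sigma> \<notin> \<tau>}. inc \<tau> \<kappa> * inc \<tau> \<kappa>') = of_bool (\<kappa> = \<kappa>')"
      if "(\<sigma>, \<kappa>) \<in> ?P" "(\<kappa>, \<rho>) \<in> ?P" "(\<sigma>, \<kappa>') \<in> ?P" "(\<kappa>', \<rho>) \<in> ?P" "apex \<rho> \<sigma> \<notin> \<kappa>" "apex \<rho> \<sigma> \<notin> \<kappa>'" for \<kappa> \<kappa>'
    proof -
      have "{\<tau> \<in> Field ?P. (\<sigma>, \<tau>) \<in> ?P \<and> (\<tau>, \<rho>) \<in> ?P \<and> \<not> apex \<rho> \<sigma> \<notin> \<tau>} = {\<tau> \<in> K. \<rho> \<subseteq> \<tau> \<and> \<tau> \<subseteq> \<sigma> \<and> apex \<rho> \<sigma> \<in> \<tau>}"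
        using K by (auto simp: face_poset_iff face_poset_Field)
      then show ?thesis using im(2)[of \<kappa> \<kappa>'] that by (simp add: face_poset_iff)
    qed
  qed (auto simp: face_poset_Field face_poset_iff simplex(3))
qed

abbreviation D where "D \<equiv> dual_cx (face_poset K) S"

text \<open>The matrix of the differential of \<open>\<Delta>K\<^sup>-\<^sup>*\<close>; the sign is \<open>(-1)^(n + 1)\<close> in degree \<open>n = 1 - card \<rho>\<close>.\<close>

definition coinc :: "'v set \<Rightarrow> 'v set \<Rightarrow> int" where
  "coinc \<rho> \<sigma> = parity_sign (int (card \<rho>)) * inc \<sigma> \<rho>"

text \<open>The coboundary map adds vertices, so the roles of low and raised elements are interchanged. The additional
  signs cancel in products of entries, because the sign of an entry depends on its row only, and the nonzero entries of a
  column lie in rows of equal degree.\<close>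

lemma acyclic_cochains:
  "acyclic_frame (face_poset K) D coinc (\<lambda>\<rho> \<sigma> \<tau>. apex \<rho> \<sigma> \<in> \<tau>)"
proof -
  let ?P = "face_poset K"
  interpret S: framed_complex ?P S by (rule framed_S)
  interpret D: framed_complex ?P D by (rule S.framed_dual)
  have I: "Idx D = dual_index (Idx S)" by (simp add: dual_cx_def)
  have d: "bd_matrix ?P D coinc"
  proof -
    have "coinc = (\<lambda>a b. parity_sign (Dg (dual_index (Idx S)) a + 1) * inc b a)"
      by (intro ext) (simp add: coinc_def parity_sign_def)
    then show ?thesis using S.dual_bd_matrix[OF bd_S, of ?P] by simp
  qed
  have par: "coinc a w * coinc b w = inc w a * inc w b" for a b w
  proof (cases "inc w a = 0 \<or> inc w b = 0")
    case False
    then have "card a = card b" by (auto elim!: inc_nonzero)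
    then show ?thesis by (simp add: coinc_def mult_ac)
  qed (auto simp: coinc_def)
  have dd: "coinc a w * coinc w b = - (inc b w * inc w a)" for a b w
  proof (cases "inc w a = 0")
    case False
    then have "int (card a) = int (card w) - 1" by (auto elim!: inc_nonzero)
    then show ?thesis by (simp add: coinc_def parity_sign_def)
  qed (auto simp: coinc_def)
  show ?thesis
  proof unfold_locales
    show "trans ?P" by (rule S.trans_P)
    show "antisym ?P" by (rule antisymI) (rule S.poset_antisym)
    show "coinc \<in> mats (?P\<inverse>) (Idx D) (Idx D) (-1)"
    proof (rule matsI)
      fix \<rho> \<sigma> assume "coinc \<rho> \<sigma> \<noteq> 0"
      then have "inc \<sigma> \<rho> \<noteq> 0" by (simp add: coinc_def)
      then show "\<rho> \<in> Ix (Idx D) \<and> \<sigma> \<in> Ix (Idx D) \<and> Dg (Idx D) \<sigma> = Dg (Idx D) \<rho> + - 1 \<and> (Ps (Idx D) \<sigma>, Ps (Idx D) \<rho>) \<in> ?P\<inverse>"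
        by (elim inc_nonzero) (auto simp: I face_poset_iff)
    qed
    show "mmul (Idx D) coinc coinc = (\<lambda>_ _. 0)" by (simp add: mmul_def dd I sum_negf inc_inc)
    show "bd_matrix ?P D coinc" by (rule d)
    fix \<rho> \<sigma> assume r: "(\<rho>, \<sigma>) \<in> ?P" "\<rho> \<noteq> \<sigma>"
    then have K: "\<sigma> \<in> K" "\<rho> \<in> K" "apex \<rho> \<sigma> \<in> \<sigma> - \<rho>" using apex[of \<rho> \<sigma>] by (auto simp: face_poset_iff)
    note im = interval_matching[OF K]
    show "(\<Sum>\<tau>\<in>{\<tau> \<in> Field ?P. (\<rho>, \<tau>) \<in> ?P \<and> (\<tau>, \<sigma>) \<in> ?P \<and> apex \<rho> \<sigma> \<in> \<tau>}. coinc \<kappa> \<tau> * coinc \<kappa>' \<tau>) = of_bool (\<kappa> = \<kappa>')"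
      if "(\<rho>, \<kappa>) \<in> ?P" "(\<kappa>, \<sigma>) \<in> ?P" "(\<rho>, \<kappa>') \<in> ?P" "(\<kappa>', \<sigma>) \<in> ?P" "apex \<rho> \<sigma> \<notin> \<kappa>" "apex \<rho> \<sigma> \<notin> \<kappa>'" for \<kappa> \<kappa>'
    proof -
      have "{\<tau> \<in> Field ?P. (\<rho>, \<tau>) \<in> ?P \<and> (\<tau>, \<sigma>) \<in> ?P \<and> apex \<rho> \<sigma> \<in> \<tau>} = {\<tau> \<in> K. \<rho> \<subseteq> \<tau> \<and> \<tau> \<subseteq> \<sigma> \<and> apex \<rho> \<sigma> \<in> \<tau>}"
        using K by (auto simp: face_poset_iff face_poset_Field)
      then show ?thesis using im(2)[of \<kappa> \<kappa>'] that by (simp add: face_poset_iff par)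
    qed
    show "(\<Sum>\<kappa>\<in>{\<kappa> \<in> Field ?P. (\<rho>, \<kappa>) \<in> ?P \<and> (\<kappa>, \<sigma>) \<in> ?P \<and> apex \<rho> \<sigma> \<notin> \<kappa>}. coinc \<kappa> \<tau> * coinc \<kappa> \<tau>') = of_bool (\<tau> = \<tau>')"
      if "(\<rho>, \<tau>) \<in> ?P" "(\<tau>, \<sigma>) \<in> ?P" "(\<rho>, \<tau>') \<in> ?P" "(\<tau>', \<sigma>) \<in> ?P" "apex \<rho> \<sigma> \<in> \<tau>" "apex \<rho> \<sigma> \<in> \<tau>'" for \<tau> \<tau>'
    proof -
      have "{\<kappa> \<in> Field ?P. (\<rho>, \<kappa>) \<in> ?P \<and> (\<kappa>, \<sigma>) \<in> ?P \<and> apex \<rho> \<sigma> \<notin> \<kappa>} = {\<kappa> \<in> K. \<rho> \<subseteq> \<kappa> \<and> \<kappa> \<subseteq> \<sigma> \<and> apex \<rho> \<sigma> \<notin> \<kappa>}"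
        using K by (auto simp: face_poset_iff face_poset_Field)
      moreover have "coinc \<kappa> \<tau> * coinc \<kappa> \<tau>' = inc \<tau> \<kappa> * inc \<tau>' \<kappa>" for \<kappa> by (simp add: coinc_def mult_ac)
      ultimately show ?thesis using im(1)[of \<tau> \<tau>'] that by (simp add: face_poset_iff)
    qed
  qed (auto simp: I face_poset_Field face_poset_iff simplex(3))
qed

end

theorem theorem1:
  fixes K :: "'v set set" and orient :: "'v set \<Rightarrow> 'v list"
  assumes "finite_simplicial_complex K" and "orientation K orient"
  shows "chain_duality
           (based_category ((face_poset K)\<inverse>) ::
             (('v set, 'u::infinite) based, ('v set \<Rightarrow> 'u) \<Rightarrow> ('v set \<Rightarrow> 'u)) category_data)
           (T_obj ((face_poset K)\<inverse>) (simplicial_chains K orient))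
           (T_mor ((face_poset K)\<inverse>) (simplicial_chains K orient))
           (tau ((face_poset K)\<inverse>) (simplicial_chains K orient)) \<and>
         chain_duality
           (based_category (face_poset K) ::
             (('v set, 'u) based, ('v set \<Rightarrow> 'u) \<Rightarrow> ('v set \<Rightarrow> 'u)) category_data)
           (T_obj (face_poset K) (dual_complex (face_poset K) (simplicial_chains K orient)))
           (T_mor (face_poset K) (dual_complex (face_poset K) (simplicial_chains K orient)))
           (tau (face_poset K) (dual_complex (face_poset K) (simplicial_chains K orient)))"
proof -
  have "finite K" "\<And>\<sigma>. \<sigma> \<in> K \<Longrightarrow> finite \<sigma>"
    using assms(1) unfolding finite_simplicial_complex_def by blast+
  then have "finite (\<Union>K)" by (rule finite_Union)
  then have "\<exists>f :: 'v \<Rightarrow> nat. \<exists>n. f ` \<Union>K = {i. i < n} \<and> inj_on f (\<Union>K)"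
    by (rule finite_imp_inj_to_nat_seg)
  then obtain f :: "'v \<Rightarrow> nat" where f: "inj_on f (\<Union>K)" by (elim exE conjE)
  interpret oriented_complex K orient f by (rule oriented_complex.intro[OF assms f])
  have D: "Cpx D = dual_complex (face_poset K) (simplicial_chains K orient)" by (simp add: dual_cx_def)
  show ?thesis
    by (rule conjI[OF acyclic_frame.T_chain_duality[OF acyclic_chains, unfolded S_simps(1)]
          acyclic_frame.T_chain_duality[OF acyclic_cochains, unfolded D]])
qed

end
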